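(* Let $w$ be the solution of the long-term nonlinear Schrödinger equation $$\mathrm{i}w_\kappa=-\Delta w+\varepsilon\lambda|w|^2w,\quad(\kappa,x)\in[0,T/\varepsilon]\times[-\pi,\pi]^d,\qquad w(0,x)=w^0(x),$$ with periodic boundary conditions and $w^0\in H^\alpha$, and let $\Phi^{\delta\kappa}$ be the one-step map of the method EP1, EP2 or EP3 (defined in the context) with time step $\delta\kappa$; put $\kappa_n=n\,\delta\kappa$. There exists a constant $N_0>0$ independent of $\varepsilon$ such that for any time step $\delta\kappa=\frac{T_0}{N}$ with any integer $N\ge N_0$, the following error bounds hold for both regimes of $\varepsilon$ ($\varepsilon=1$ and $0<\varepsilon\ll1$), for all $n$ with $n\,\delta\kappa\le T/\varepsilon$: $$\begin{aligned}&\text{EP1: }\ \|(\Phi^{\delta\kappa})^n(w^0)-w(\kappa_n)\|_{H^{\alpha-4}}\lesssim\delta\kappa^2,&&\alpha>\max(d/2+2,4),\\ &\text{EP2: }\ \|(\Phi^{\delta\kappa})^n(w^0)-w(\kappa_n)\|_{H^{\alpha-6}}\lesssim\varepsilon\,\delta\kappa^2+\delta\kappa^3,&&\alpha>\max(d/2+2,6),\\ &\text{EP3: }\ \|(\Phi^{\delta\kappa})^n(w^0)-w(\kappa_n)\|_{H^{\alpha-8}}\lesssim\varepsilon\,\delta\kappa^3+\delta\kappa^4,&&\alpha>\max(d/2+2,8).\end{aligned}$$ When $\varepsilon=1$, the bounds for EP2 and EP3 also hold in the $H^{\alpha-4}$-norm and the $H^{\alpha-6}$-norm, respectively.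
   Context: $H^\beta$ denotes the Sobolev space of periodic functions on $[-\pi,\pi]^d$ (only $\beta\ge0$ is considered); $\lambda\in\mathbb{R}$ is a fixed parameter; $T_0$ is the period of $\kappa\mapsto e^{\mathrm{i}\kappa\Delta}$. The constant $T>0$ is such that for every $\varepsilon$ considered the equation has a unique solution $w\in C^0([0,T/\varepsilon];H^\alpha)\cap C^1([0,T/\varepsilon];H^{\alpha-2})$ with $\|w(\kappa)\|_{H^\alpha}\le K\|w^0\|_{H^\alpha}$ on $[0,T/\varepsilon]$ for some $K>1$ independent of $\varepsilon$. $A\lesssim B$ means $A\le CB$ with a constant $C>0$ independent of $n$, $\delta\kappa$ and $\varepsilon$ (it may depend on $T$, on $K$, on $\|w^0\|_{H^\alpha}$, and on the bounds and Lipschitz constants of $f$ and of the coefficient operators on the relevant Sobolev spaces). Methods. Let $f(w)=-\mathrm{i}\lambda|w|^2w$, $\mathcal{W}=\mathrm{i}\,\delta\kappa\,\Delta$, $\varphi_1(z)=\int_0^1e^{(1-\xi)z}d\xi$. Given coefficient functions $C_\tau$, $A_{\tau,\sigma}$, the integrator is the (implicit) scheme $$w^{n+\tau}=\Phi^{\tau\delta\kappa}(w^n):=C_\tau(\mathcal{W})w^n+\varepsilon\,\delta\kappa\int_0^1A_{\tau,\sigma}(\mathcal{W})f(w^{n+\sigma})\,d\sigma,\quad0\le\tau\le1,$$ and $w^{n+1}=\Phi^{\delta\kappa}(w^n)$ is the case $\tau=1$. EP1: $C_\tau(\mathcal{W})=(1-\tau)I+\tau e^{\mathcal{W}}$, $A_{\tau,\sigma}(\mathcal{W})=\tau\varphi_1(\mathcal{W})$.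 EP2: with $m=1/2$, $C_\tau(\mathcal{W})=\frac{(\tau-1)(\tau-m)}{m}I+\frac{\tau(\tau-1)}{m(m-1)}e^{m\mathcal{W}}+\frac{\tau(m-\tau)}{m-1}e^{\mathcal{W}}$, $A_{\tau,\sigma}(\mathcal{W})=\sum_{l=1}^2\sum_{n=1}^2a_{ln}(\mathcal{W})\tau^l\sigma^{n-1}$, where $a_{11}=\frac{1+m}{m(1-m)}\varphi_1(m\mathcal{W})+\frac{m+1}{m-1}\varphi_1(\mathcal{W})+\frac1{1-m}\varphi_1((1-m)\mathcal{W})$, $a_{22}=\frac2{m(1-m)}\big(\varphi_1(m\mathcal{W})-\varphi_1(\mathcal{W})+\varphi_1((1-m)\mathcal{W})\big)$, $a_{21}=(1+\frac1m)\varphi_1(\mathcal{W})-\frac1m\varphi_1((1-m)\mathcal{W})-a_{11}$, $a_{12}=-\frac2m(\varphi_1(\mathcal{W})-\varphi_1((1-m)\mathcal{W}))-a_{22}$. EP3: with nodes $c_0=0$, $c_1=\frac13$, $c_2=\frac1{18}\big(14+(71-9\sqrt{58})^{1/3}+(71+9\sqrt{58})^{1/3}\big)$, $c_3=1$, and $l_j(\tau)=\prod_{k\ne j}\frac{\tau-c_k}{c_j-c_k}$ ($j=0,\dots,3$), $C_\tau(\mathcal{W})=\sum_{k=0}^3l_k(\tau)e^{c_k\mathcal{W}}$ and $A_{\tau,\sigma}(\mathcal{W})=\sum_{l=1}^3\sum_{n=1}^3a_{ln}(\mathcal{W})\tau^l\sigma^{n-1}$, where $a_{ln}(\mathcal{W})=-\frac1l\sum_{0\le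 k<i\le3}(c_i-c_k)\,C_{l-1,i}\,C_{n-1,k}\,\varphi_1((c_i-c_k)\mathcal{W})$ and $C_{jk}$ is the coefficient of $\tau^j$ in the polynomial $l_k'(\tau)$. *)

theory Defs
  imports "HOL-Analysis.Analysis" "HOL-Computational_Algebra.Polynomial"
begin

text \<open>
  Elements of the Sobolev spaces are functions on the whole of \<open>\<real>\<^sup>d\<close>, \<open>d = CARD('d)\<close>, that are
  \<open>2\<pi>\<close>-periodic in each coordinate; two functions that agree almost everywhere represent the same
  element.  Requiring Borel representatives loses no class.
\<close>

type_synonym 'd field = "real ^ 'd \<Rightarrow> complex"

definition torus_box :: "(real ^ 'd::finite) set" where
  "torus_box = cbox (\<chi> i. - pi) (\<chi> i. pi)"

definition periodic_fun :: "'d::finite field \<Rightarrow> bool" where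
  "periodic_fun u \<longleftrightarrow> (\<forall>x i. u (x + axis i (2 * pi)) = u x)"

definition ae_eq :: "'d::finite field \<Rightarrow> 'd field \<Rightarrow> bool" where
  "ae_eq u v \<longleftrightarrow> (AE x in lborel. u x = v x)"

definition fourier_exp :: "int ^ 'd \<Rightarrow> 'd::finite field" where
  "fourier_exp k x = cis (\<Sum>i\<in>UNIV. real_of_int (k $ i) * x $ i)"

definition fourier_coeff :: "'d::finite field \<Rightarrow> int ^ 'd \<Rightarrow> complex" where
  "fourier_coeff u k =
     (LINT x:torus_box|lborel. u x * cnj (fourier_exp k x)) / of_real ((2 * pi) ^ CARD('d))"

definition freq_sq :: "int ^ 'd::finite \<Rightarrow> real" where
  "freq_sq k = (\<Sum>i\<in>UNIV. (real_of_int (k $ i))\<^sup>2)"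

definition sobolev_space :: "real \<Rightarrow> 'd::finite field set" where
  "sobolev_space \<beta> = {u. periodic_fun u \<and> u \<in> borel_measurable borel \<and>
     set_integrable lborel torus_box (\<lambda>x. (cmod (u x))\<^sup>2) \<and>
     (\<lambda>k. (1 + freq_sq k) powr \<beta> * (cmod (fourier_coeff u k))\<^sup>2) summable_on UNIV}"

definition sobolev_norm :: "real \<Rightarrow> 'd::finite field \<Rightarrow> real" where
  "sobolev_norm \<beta> u =
     sqrt (\<Sum>\<^sub>\<infinity>k. (1 + freq_sq k) powr \<beta> * (cmod (fourier_coeff u k))\<^sup>2)"

definition sobolev_continuous_on :: "real \<Rightarrow> real set \<Rightarrow> (real \<Rightarrow> 'd::finite field) \<Rightarrow> bool" where
  "sobolev_continuous_on \<beta> I u \<longleftrightarrow>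
     (\<forall>t\<in>I. u t \<in> sobolev_space \<beta>) \<and>
     (\<forall>t\<in>I. ((\<lambda>s. sobolev_norm \<beta> (\<lambda>x. u s x - u t x)) \<longlongrightarrow> 0) (at t within I))"

definition sobolev_has_derivative_on ::
    "real \<Rightarrow> real set \<Rightarrow> (real \<Rightarrow> 'd::finite field) \<Rightarrow> (real \<Rightarrow> 'd field) \<Rightarrow> bool" where
  "sobolev_has_derivative_on \<beta> I u u' \<longleftrightarrow>
     (\<forall>t\<in>I. ((\<lambda>s. sobolev_norm \<beta> (\<lambda>x. (u s x - u t x) / of_real (s - t) - u' t x)) \<longlongrightarrow> 0)
        (at t within I))"

text \<open>
  \<open>lap_fun g\<close> is the operator \<open>g(\<Delta>)\<close> on periodic functions: \<open>\<Delta>\<close> acts on the Fourier mode \<open>k\<close> by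
  \<open>-\<bar>k\<bar>\<^sup>2\<close>.  It is only used on arguments for which the series converges absolutely (bounded \<open>g\<close> on
  \<open>H\<^sup>\<beta>\<close> with \<open>\<beta> > d/2\<close>, or \<open>\<Delta>\<close> itself on \<open>H\<^sup>\<beta>\<close> with \<open>\<beta> > d/2 + 2\<close>); it then yields the continuous
  representative, so that integrals over time may be taken pointwise in space.
\<close>

definition lap_fun :: "(complex \<Rightarrow> complex) \<Rightarrow> 'd::finite field \<Rightarrow> 'd field" where
  "lap_fun g u = (\<lambda>x. \<Sum>\<^sub>\<infinity>k. g (- of_real (freq_sq k)) * fourier_coeff u k * fourier_exp k x)"

abbreviation laplacian :: "'d::finite field \<Rightarrow> 'd field" where
  "laplacian \<equiv> lap_fun (\<lambda>z. z)"

definition free_flow :: "real \<Rightarrow> 'd::finite field \<Rightarrow> 'd field" where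
  "free_flow \<kappa> = lap_fun (\<lambda>z. exp (\<i> * of_real \<kappa> * z))"

definition is_minimal_period :: "(real \<Rightarrow> 'a) \<Rightarrow> real \<Rightarrow> bool" where
  "is_minimal_period F p \<longleftrightarrow> 0 < p \<and> (\<forall>t. F (t + p) = F t) \<and>
     (\<forall>q. 0 < q \<and> q < p \<longrightarrow> (\<exists>t. F (t + q) \<noteq> F t))"

definition nls_f :: "real \<Rightarrow> 'd::finite field \<Rightarrow> 'd field" where
  "nls_f lam u = (\<lambda>x. - \<i> * of_real lam * of_real ((cmod (u x))\<^sup>2) * u x)"

definition nls_solution ::
    "real \<Rightarrow> real \<Rightarrow> real \<Rightarrow> real \<Rightarrow> 'd::finite field \<Rightarrow> (real \<Rightarrow> 'd field) \<Rightarrow> bool" where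
  "nls_solution lam \<alpha> T \<epsilon> w0 w \<longleftrightarrow>
     sobolev_continuous_on \<alpha> {0..T / \<epsilon>} w \<and>
     (\<exists>w'. sobolev_continuous_on (\<alpha> - 2) {0..T / \<epsilon>} w' \<and>
        sobolev_has_derivative_on (\<alpha> - 2) {0..T / \<epsilon>} w w' \<and>
        (\<forall>\<kappa>\<in>{0..T / \<epsilon>}. ae_eq (\<lambda>x. \<i> * w' \<kappa> x)
           (\<lambda>x. - laplacian (w \<kappa>) x
              + of_real (\<epsilon> * lam) * of_real ((cmod (w \<kappa> x))\<^sup>2) * w \<kappa> x))) \<and>
     ae_eq (w 0) w0"

text \<open>\<open>E\<close> is the set of values of \<open>\<epsilon>\<close> under consideration and \<open>w \<epsilon>\<close> is the solution for \<open>\<epsilon>\<close>.\<close>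

definition nls_family ::
    "real \<Rightarrow> real \<Rightarrow> real \<Rightarrow> real \<Rightarrow> real set \<Rightarrow> 'd::finite field \<Rightarrow>
     (real \<Rightarrow> real \<Rightarrow> 'd field) \<Rightarrow> bool" where
  "nls_family lam \<alpha> T K E w0 w \<longleftrightarrow>
     w0 \<in> sobolev_space \<alpha> \<and>
     (\<forall>\<epsilon>\<in>E. nls_solution lam \<alpha> T \<epsilon> w0 (w \<epsilon>) \<and>
        (\<forall>v. nls_solution lam \<alpha> T \<epsilon> w0 v \<longrightarrow> (\<forall>\<kappa>\<in>{0..T / \<epsilon>}. ae_eq (v \<kappa>) (w \<epsilon> \<kappa>))) \<and>
        (\<forall>\<kappa>\<in>{0..T / \<epsilon>}. sobolev_norm \<alpha> (w \<epsilon> \<kappa>) \<le> K * sobolev_norm \<alpha> w0))"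

text \<open>
  The coefficient functions are given as functions \<open>C \<tau> z\<close>, \<open>A \<tau> \<sigma> z\<close> of the complex variable \<open>z\<close>
  that stands for \<open>\<W> = \<i> \<delta>\<kappa> \<Delta>\<close>.

  The stage equations are cubic and may have further solutions of size about \<open>\<delta>\<kappa>\<^sup>-\<^sup>1\<^sup>/\<^sup>2\<close>; the
  scheme means the solution that stays bounded as \<open>\<delta>\<kappa> \<rightarrow> 0\<close>, so the stages are confined to a
  ball of \<open>H\<^sup>\<alpha>\<close> with radius \<open>R\<close>.
\<close>

type_synonym C_coeff = "real \<Rightarrow> complex \<Rightarrow> complex"
type_synonym A_coeff = "real \<Rightarrow> real \<Rightarrow> complex \<Rightarrow> complex"

definition stage_solution ::
    "C_coeff \<Rightarrow> A_coeff \<Rightarrow> real \<Rightarrow> real \<Rightarrow> real \<Rightarrow> real \<Rightarrow> real \<Rightarrow>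
     'd::finite field \<Rightarrow> (real \<Rightarrow> 'd field) \<Rightarrow> bool" where
  "stage_solution C A lam \<epsilon> dk \<alpha> R u W \<longleftrightarrow>
     sobolev_continuous_on \<alpha> {0..1} W \<and>
     (\<forall>\<tau>\<in>{0..1}. sobolev_norm \<alpha> (W \<tau>) \<le> R) \<and>
     (\<forall>\<tau>\<in>{0..1}. ae_eq (W \<tau>)
        (\<lambda>x. lap_fun (\<lambda>z. C \<tau> (\<i> * of_real dk * z)) u x
           + of_real (\<epsilon> * dk) * integral {0..1}
               (\<lambda>\<sigma>. lap_fun (\<lambda>z. A \<tau> \<sigma> (\<i> * of_real dk * z)) (nls_f lam (W \<sigma>)) x)))"

definition unique_stage_solution ::
    "C_coeff \<Rightarrow> A_coeff \<Rightarrow> real \<Rightarrow> real \<Rightarrow> real \<Rightarrow> real \<Rightarrow> real \<Rightarrow> 'd::finite field \<Rightarrow> bool" where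
  "unique_stage_solution C A lam \<epsilon> dk \<alpha> R u \<longleftrightarrow>
     (\<exists>W. stage_solution C A lam \<epsilon> dk \<alpha> R u W) \<and>
     (\<forall>V W. stage_solution C A lam \<epsilon> dk \<alpha> R u V \<and> stage_solution C A lam \<epsilon> dk \<alpha> R u W \<longrightarrow>
        (\<forall>\<tau>\<in>{0..1}. ae_eq (V \<tau>) (W \<tau>)))"

definition ep_step ::
    "C_coeff \<Rightarrow> A_coeff \<Rightarrow> real \<Rightarrow> real \<Rightarrow> real \<Rightarrow> real \<Rightarrow> real \<Rightarrow> 'd::finite field \<Rightarrow> 'd field" where
  "ep_step C A lam \<epsilon> dk \<alpha> R u = (SOME W. stage_solution C A lam \<epsilon> dk \<alpha> R u W) 1"

definition phi1 :: "complex \<Rightarrow> complex" where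
  "phi1 z = integral {0..1} (\<lambda>\<xi>::real. exp ((1 - of_real \<xi>) * z))"

definition EP1_C :: C_coeff where
  "EP1_C \<tau> z = of_real (1 - \<tau>) + of_real \<tau> * exp z"

definition EP1_A :: A_coeff where
  "EP1_A \<tau> \<sigma> z = of_real \<tau> * phi1 z"

definition EP2_m :: real where
  "EP2_m = 1 / 2"

definition EP2_C :: C_coeff where
  "EP2_C \<tau> z = (let m = EP2_m in
      of_real ((\<tau> - 1) * (\<tau> - m) / m)
    + of_real (\<tau> * (\<tau> - 1) / (m * (m - 1))) * exp (of_real m * z)
    + of_real (\<tau> * (m - \<tau>) / (m - 1)) * exp z)"

definition EP2_a11 :: "complex \<Rightarrow> complex" where
  "EP2_a11 z = (let m = EP2_m in
      of_real ((1 + m) / (m * (1 - m))) * phi1 (of_real m * z)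
    + of_real ((m + 1) / (m - 1)) * phi1 z
    + of_real (1 / (1 - m)) * phi1 (of_real (1 - m) * z))"

definition EP2_a22 :: "complex \<Rightarrow> complex" where
  "EP2_a22 z = (let m = EP2_m in
      of_real (2 / (m * (1 - m))) *
        (phi1 (of_real m * z) - phi1 z + phi1 (of_real (1 - m) * z)))"

definition EP2_a21 :: "complex \<Rightarrow> complex" where
  "EP2_a21 z = (let m = EP2_m in
      of_real (1 + 1 / m) * phi1 z - of_real (1 / m) * phi1 (of_real (1 - m) * z) - EP2_a11 z)"

definition EP2_a12 :: "complex \<Rightarrow> complex" where
  "EP2_a12 z = (let m = EP2_m in
      - of_real (2 / m) * (phi1 z - phi1 (of_real (1 - m) * z)) - EP2_a22 z)"

definition EP2_A :: A_coeff where
  "EP2_A \<tau> \<sigma> z =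
      EP2_a11 z * of_real \<tau> + EP2_a12 z * of_real (\<tau> * \<sigma>)
    + EP2_a21 z * of_real (\<tau>\<^sup>2) + EP2_a22 z * of_real (\<tau>\<^sup>2 * \<sigma>)"

definition EP3_c :: "nat \<Rightarrow> real" where
  "EP3_c j = (if j = 0 then 0
              else if j = 1 then 1 / 3
              else if j = 2 then
                (14 + root 3 (71 - 9 * sqrt 58) + root 3 (71 + 9 * sqrt 58)) / 18
              else 1)"

definition EP3_l :: "nat \<Rightarrow> real poly" where
  "EP3_l j = (\<Prod>k\<in>{0..3} - {j}. smult (1 / (EP3_c j - EP3_c k)) [:- EP3_c k, 1:])"

definition EP3_dcoeff :: "nat \<Rightarrow> nat \<Rightarrow> real" where
  "EP3_dcoeff j k = coeff (pderiv (EP3_l k)) j"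

definition EP3_C :: C_coeff where
  "EP3_C \<tau> z = (\<Sum>k=0..3. of_real (poly (EP3_l k) \<tau>) * exp (of_real (EP3_c k) * z))"

definition EP3_a :: "nat \<Rightarrow> nat \<Rightarrow> complex \<Rightarrow> complex" where
  "EP3_a l n z = - (1 / of_nat l) *
     (\<Sum>i=0..3. \<Sum>k<i. of_real ((EP3_c i - EP3_c k) * EP3_dcoeff (l - 1) i * EP3_dcoeff (n - 1) k)
        * phi1 (of_real (EP3_c i - EP3_c k) * z))"

definition EP3_A :: A_coeff where
  "EP3_A \<tau> \<sigma> z = (\<Sum>l=1..3. \<Sum>n=1..3. EP3_a l n z * of_real (\<tau> ^ l * \<sigma> ^ (n - 1)))"

text \<open>
  Besides the error bound in \<open>H\<^sup>s\<close>, this asserts that the iterates \<open>\<Phi>\<^sup>n(w0)\<close> are well defined: the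
  stage equations have exactly one solution in the ball of radius \<open>R\<close>.
\<close>

definition ep_error_bound ::
    "C_coeff \<Rightarrow> A_coeff \<Rightarrow> real \<Rightarrow> real \<Rightarrow> real \<Rightarrow> real \<Rightarrow> real \<Rightarrow> real set \<Rightarrow> real \<Rightarrow>
     (real \<Rightarrow> real \<Rightarrow> real) \<Rightarrow> 'd::finite field \<Rightarrow> (real \<Rightarrow> real \<Rightarrow> 'd field) \<Rightarrow> bool" where
  "ep_error_bound C A lam \<alpha> T T0 R E s bound w0 w \<longleftrightarrow>
     (\<exists>N0::nat. N0 > 0 \<and> (\<forall>\<epsilon>\<in>E. \<forall>N\<ge>N0. \<forall>n::nat.
        let dk = T0 / real N; \<Phi> = ep_step C A lam \<epsilon> dk \<alpha> R
        in real n * dk \<le> T / \<epsilon> \<longrightarrow>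
             (\<Phi> ^^ n) w0 \<in> sobolev_space \<alpha> \<and>
             unique_stage_solution C A lam \<epsilon> dk \<alpha> R ((\<Phi> ^^ n) w0) \<and>
             sobolev_norm s (\<lambda>x. (\<Phi> ^^ n) w0 x - w \<epsilon> (real n * dk) x) \<le> bound \<epsilon> dk))"

end

theory Submission
  imports Defs "HOL-Probability.Characteristic_Functions"
begin

text \<open>
  On the Fourier side the equation becomes a system with a cubic convolution, and each method
  interpolates the free flow at nodes \<open>0 = c\<^sub>0, \<dots>, c\<^sub>r = 1\<close>.  For small steps the stage
  equations are contractions in \<open>H\<^sup>\<alpha>\<close>.  Interpolation loses two derivatives for each power of the
  step, so the linear part of the stage defect is of size \<open>\<delta>\<kappa>\<^sup>q\<close> in the Sobolev space of
  exponent \<open>\<alpha> - 2q\<close>, for \<open>q \<le> r + 1\<close>;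
  the nonlinear part is of size \<open>\<epsilon> \<delta>\<kappa>\<^sup>2\<close>, and for EP3 it becomes \<open>\<epsilon> \<delta>\<kappa>\<^sup>3\<close>, because the node \<open>c\<^sub>2\<close> is chosen
  such that its leading term has mean zero over the stages.  The local error carries another factor
  \<open>\<epsilon> \<delta>\<kappa>\<close>, which is what the summation over \<open>T / (\<epsilon> \<delta>\<kappa>)\<close> steps consumes.  These estimates need the iterates
  bounded in \<open>H\<^sup>\<alpha>\<close>.  This is bootstrapped: the error bound for \<open>q = 1\<close> controls them one Sobolev
  level lower, at \<open>\<alpha> - 2\<close>, and a tame estimate, linear in the \<open>H\<^sup>\<alpha>\<close>-norm, then propagates that norm.
\<close>

section \<open>Weighted square-summable sequences\<close>

text \<open>One step may amplify errors by a factor 1 + O(\<epsilon> dk) only, or the long time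
  destroys every bound. The stages do lose a constant in front of the initial error; the update does
  not, because its linear part is the exact flow, an isometry of every Sobolev space. Hence each
  one-step estimate goes through the stages first and then uses them only inside the nonlinear term.
  The working level is \<alpha> - 2 because \<alpha> > d/2 + 2 makes that space an algebra, whereas
  the levels of the error may lie below d/2, so products need estimates with one factor of low
  regularity. For EP3 the exact solution is not close enough to the stages: they follow the solution
  shifted by \<epsilon> dk P(\<tau>) \<open>\<rho>'\<close>, where \<open>\<rho>'\<close> is the
  derivative of the nonlinear term along the solution. Comparison with the shifted curve is what
  makes the vanishing mean of P usable. In terms of the quadrature weights b_i of the nodes that
  condition says that the sum of (c_i - c_k) b_i b_k over k < i equals 1/6; with the nodes 0, 1/3, 1
  given, it is a cubic equation for c_2.\<close>

definition wt :: "real \<Rightarrow> int ^ 'd::finite \<Rightarrow> real" where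
  "wt s k = (1 + freq_sq k) powr (s / 2)"

lemma freq_sq_nonneg [simp]: "freq_sq k \<ge> 0"
  by (simp add: freq_sq_def sum_nonneg)

lemma freq_sq_minus [simp]: "freq_sq (- k) = freq_sq k"
  by (simp add: freq_sq_def)

lemma freq_sq_le: "freq_sq k \<le> 2 * freq_sq (k - l) + 2 * freq_sq l"
proof -
  have "(real_of_int (k $ i))\<^sup>2 \<le> 2 * (real_of_int ((k - l) $ i))\<^sup>2 + 2 * (real_of_int (l $ i))\<^sup>2" for i
    using zero_le_power2[of "real_of_int (k $ i) - 2 * real_of_int (l $ i)"]
    by (simp add: power2_eq_square algebra_simps)
  then show ?thesis
    unfolding freq_sq_def sum_distrib_left sum.distrib[symmetric] by (intro sum_mono)
qed

lemma one_plus_freq_sq_pos [simp]: "1 + freq_sq k > 0"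
  by (simp add: add_pos_nonneg)

lemma wt_pos [simp]: "wt s k > 0"
  using one_plus_freq_sq_pos[of k] unfolding wt_def by (simp del: one_plus_freq_sq_pos)

lemma wt_nonneg [simp]: "wt s k \<ge> 0"
  using wt_pos[of s k] by linarith

lemma wt_neq_0 [simp]: "wt s k \<noteq> 0"
  using wt_pos[of s k] by linarith

lemma wt_0 [simp]: "wt 0 k = 1"
  using one_plus_freq_sq_pos[of k] unfolding wt_def by (simp del: one_plus_freq_sq_pos)

lemma wt_add: "wt (s + t) k = wt s k * wt t k"
  by (simp add: wt_def add_divide_distrib powr_add)

lemma wt_mono: "s \<le> t \<Longrightarrow> wt s k \<le> wt t k"
  by (simp add: wt_def powr_mono)

lemma wt_minus [simp]: "wt s (- k) = wt s k"
  by (simp add: wt_def)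

lemma wt_ge_1: "s \<ge> 0 \<Longrightarrow> wt s k \<ge> 1"
  using wt_mono[of 0 s k] by simp

lemma wt_power2: "(wt s k)\<^sup>2 = (1 + freq_sq k) powr s"
  by (simp add: wt_def power2_eq_square powr_add[symmetric])

lemma freq_sq_le_wt: "freq_sq k \<le> wt 2 k"
  using one_plus_freq_sq_pos[of k] by (simp add: wt_def)

lemma freq_sq_power_le_wt: "freq_sq k ^ j \<le> wt (2 * real j) k"
proof -
  have "freq_sq k ^ j \<le> (1 + freq_sq k) ^ j" by (intro power_mono) auto
  then show ?thesis using one_plus_freq_sq_pos[of k] by (simp add: wt_def powr_realpow)
qed

text \<open>One of the frequencies k - l and l carries at least a quarter of
  \<open>1 + freq_sq k\<close>. A maximum is kept, rather than the product of both weights, because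
  it loads the weight on one factor only; this is the source of the tame estimates.\<close>

lemma wt_le_diff_max:
  assumes "s \<ge> 0"
  shows "wt s k \<le> 2 powr s * max (wt s (k - l)) (wt s l)"
proof -
  let ?m = "max (1 + freq_sq (k - l)) (1 + freq_sq l)"
  have "1 + freq_sq k \<le> 4 * ?m" using freq_sq_le[of k l] by (simp add: max_def)
  then have "wt s k \<le> (4 * ?m) powr (s / 2)"
    unfolding wt_def using assms by (intro powr_mono2) (auto intro: add_nonneg_nonneg)
  also have "\<dots> = 4 powr (s / 2) * ?m powr (s / 2)"
    by (rule powr_mult)
  also have "(4::real) powr (s / 2) = 2 powr s"
    using powr_powr[of "2::real" 2 "s / 2"] by simp
  also have "?m powr (s / 2) = max (wt s (k - l)) (wt s l)"
    proof -
    have "(1 + freq_sq (k - l)) powr (s / 2) \<le> (1 + freq_sq l) powr (s / 2)"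
      if "1 + freq_sq (k - l) \<le> 1 + freq_sq l" using assms that by (intro powr_mono2) auto
    moreover have "(1 + freq_sq l) powr (s / 2) \<le> (1 + freq_sq (k - l)) powr (s / 2)"
      if "1 + freq_sq l \<le> 1 + freq_sq (k - l)" using assms that by (intro powr_mono2) auto
    ultimately show ?thesis unfolding wt_def max_def by (auto intro: antisym)
  qed
  finally show ?thesis .
qed

text \<open>Quantifying over finite frequency sets makes membership in H^s and the norm bound one
  statement: no infinite sum has to be shown to exist, and bounds survive coordinatewise
  limits.\<close>

definition hs_le :: "real \<Rightarrow> (int ^ 'd::finite \<Rightarrow> complex) \<Rightarrow> real \<Rightarrow> bool" where
  "hs_le s a B \<longleftrightarrow> (\<forall>F. finite F \<longrightarrow> L2_set (\<lambda>k. wt s k * cmod (a k)) F \<le> B)"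

text \<open>The norm of the Wiener algebra, that is, of absolutely convergent Fourier
  series.\<close>

definition l1_le :: "(int ^ 'd::finite \<Rightarrow> complex) \<Rightarrow> real \<Rightarrow> bool" where
  "l1_le a B \<longleftrightarrow> (\<forall>F. finite F \<longrightarrow> (\<Sum>k\<in>F. cmod (a k)) \<le> B)"

lemma hs_leI: "(\<And>F. finite F \<Longrightarrow> L2_set (\<lambda>k. wt s k * cmod (a k)) F \<le> B) \<Longrightarrow> hs_le s a B"
  by (simp add: hs_le_def)

lemma hs_leD: "hs_le s a B \<Longrightarrow> finite F \<Longrightarrow> L2_set (\<lambda>k. wt s k * cmod (a k)) F \<le> B"
  by (simp add: hs_le_def)

lemma hs_le_nonneg: "hs_le s a B \<Longrightarrow> 0 \<le> B"
  using hs_leD[of s a B "{}"] by simp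

lemma hs_le_coord: "hs_le s a B \<Longrightarrow> wt s k * cmod (a k) \<le> B"
  using hs_leD[of s a B "{k}"] by simp

lemma hs_le_weaken: "hs_le s a B \<Longrightarrow> B \<le> B' \<Longrightarrow> hs_le s a B'"
  unfolding hs_le_def by (meson order_trans)

lemma hs_le_subst: "hs_le s a B \<Longrightarrow> (\<And>k. b k = a k) \<Longrightarrow> B \<le> B' \<Longrightarrow> hs_le s b B'"
  by (metis ext hs_le_weaken)

lemma hs_le_dominated:
  assumes "hs_le s b B" "\<And>k. wt s' k * cmod (a k) \<le> c * (wt s k * cmod (b k))" "c \<ge> 0"
  shows "hs_le s' a (c * B)"
proof (rule hs_leI, goal_cases)
  case (1 F)
  have "L2_set (\<lambda>k. wt s' k * cmod (a k)) F \<le> L2_set (\<lambda>k. c * (wt s k * cmod (b k))) F"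
    using assms by (intro L2_set_mono) auto
  also have "\<dots> = c * L2_set (\<lambda>k. wt s k * cmod (b k)) F"
    using assms by (simp add: L2_set_right_distrib)
  also have "\<dots> \<le> c * B" using assms hs_leD[OF assms(1) \<open>finite F\<close>] by (intro mult_left_mono)
  finally show "L2_set (\<lambda>k. wt s' k * cmod (a k)) F \<le> c * B" .
qed

lemma hs_le_mono:
  assumes "hs_le s a B" "s' \<le> s" "B \<le> B'"
  shows "hs_le s' a B'"
proof -
  have "hs_le s' a (1 * B)"
    by (intro hs_le_dominated[OF assms(1)]) (auto intro!: mult_right_mono wt_mono assms)
  then show ?thesis using assms(3) by (auto intro: hs_le_weaken)
qed

lemma hs_le_zero [simp]: "hs_le s (\<lambda>k. 0) B \<longleftrightarrow> 0 \<le> B"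
  by (auto simp: hs_le_def L2_set_def)

lemma hs_le_add:
  assumes "hs_le s a A" "hs_le s b B"
  shows "hs_le s (\<lambda>k. a k + b k) (A + B)"
proof (rule hs_leI, goal_cases)
  case (1 F)
  have "L2_set (\<lambda>k. wt s k * cmod (a k + b k)) F
      \<le> L2_set (\<lambda>k. wt s k * cmod (a k) + wt s k * cmod (b k)) F"
    by (intro L2_set_mono) (auto simp: distrib_left[symmetric] intro!: mult_left_mono norm_triangle_ineq)
  also have "\<dots> \<le> L2_set (\<lambda>k. wt s k * cmod (a k)) F + L2_set (\<lambda>k. wt s k * cmod (b k)) F"
    by (rule L2_set_triangle_ineq)
  also have "\<dots> \<le> A + B" using assms \<open>finite F\<close> by (intro add_mono hs_leD)
  finally show "L2_set (\<lambda>k. wt s k * cmod (a k + b k)) F \<le> A + B" .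
qed

lemma hs_le_uminus [simp]: "hs_le s (\<lambda>k. - a k) B = hs_le s a B"
  by (simp add: hs_le_def)

lemma hs_le_diff: "hs_le s a A \<Longrightarrow> hs_le s b B \<Longrightarrow> hs_le s (\<lambda>k. a k - b k) (A + B)"
  using hs_le_add[of s a A "\<lambda>k. - b k" B] by simp

lemma hs_le_minus_commute: "hs_le s (\<lambda>k. a k - b k) B \<longleftrightarrow> hs_le s (\<lambda>k. b k - a k) B"
  by (simp add: hs_le_def norm_minus_commute)

lemma hs_le_multiplier:
  assumes "hs_le s a B" "\<And>k. cmod (m k) \<le> c" "c \<ge> 0"
  shows "hs_le s (\<lambda>k. m k * a k) (c * B)"
  by (rule hs_le_dominated[OF assms(1)])
     (use assms in \<open>auto simp: norm_mult mult.assoc mult.left_commute intro!: mult_left_mono mult_right_mono\<close>)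

lemma hs_le_multiplier_wt:
  fixes a :: "int^'d::finite \<Rightarrow> complex"
  assumes "hs_le s a B" "\<And>k. cmod (m k) \<le> c * wt \<beta> k" "c \<ge> 0"
  shows "hs_le (s - \<beta>) (\<lambda>k. m k * a k) (c * B)"
proof (rule hs_le_dominated[OF assms(1)])
  fix k :: "int^'d"
  have "wt s k = wt (s - \<beta>) k * wt \<beta> k" by (simp flip: wt_add)
  then show "wt (s - \<beta>) k * cmod (m k * a k) \<le> c * (wt s k * cmod (a k))"
    using mult_left_mono[OF assms(2)[of k], of "wt (s - \<beta>) k * cmod (a k)"]
    by (simp add: norm_mult algebra_simps)
qed fact

lemma hs_le_scale: "hs_le s a B \<Longrightarrow> hs_le s (\<lambda>k. z * a k) (cmod z * B)"
  by (rule hs_le_multiplier) auto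

text \<open>A form of Fatou's lemma: a finite section depends continuously on finitely many
  coordinates, so coordinatewise convergence suffices.\<close>

lemma hs_le_lim:
  assumes "eventually (\<lambda>n. hs_le s (a n) B) F" "\<And>k. ((\<lambda>n. a n k) \<longlongrightarrow> b k) F" "F \<noteq> bot"
  shows "hs_le s b B"
proof (rule hs_leI, goal_cases)
  case (1 G)
  have "((\<lambda>n. L2_set (\<lambda>k. wt s k * cmod (a n k)) G) \<longlongrightarrow> L2_set (\<lambda>k. wt s k * cmod (b k)) G) F"
    unfolding L2_set_def by (intro tendsto_intros assms)
  then show "L2_set (\<lambda>k. wt s k * cmod (b k)) G \<le> B"
    by (rule tendsto_upperbound) (use assms \<open>finite G\<close> in \<open>auto elim!: eventually_mono intro: hs_leD\<close>)
qed

lemma hs_le_const_lim: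
  assumes "eventually (\<lambda>n. hs_le s a (B n)) F" "(B \<longlongrightarrow> B') F" "F \<noteq> bot"
  shows "hs_le s a B'"
proof (rule hs_leI, goal_cases)
  case (1 G)
  show "L2_set (\<lambda>k. wt s k * cmod (a k)) G \<le> B'"
    by (rule tendsto_lowerbound[OF assms(2)])
       (use assms \<open>finite G\<close> in \<open>auto elim!: eventually_mono intro: hs_leD\<close>)
qed

lemma hs_le_0D: "hs_le s a 0 \<Longrightarrow> a k = 0"
proof -
  assume "hs_le s a 0"
  then have "wt s k * cmod (a k) \<le> wt s k * 0" using hs_le_coord by force
  then have "cmod (a k) \<le> 0" by (rule mult_left_le_imp_le) simp
  then show "a k = 0" by simp
qed

text \<open>Minkowski's integral inequality, by duality. The square of the norm N of a finite
  section is the pairing of the integral with itself; taking the integral out of this pairing and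
  applying Cauchy-Schwarz under it gives N^2 \<le> N (b - a) B, and N is cancelled.\<close>

lemma hs_le_integral:
  assumes ab: "a \<le> b" and h: "\<And>\<sigma>. \<sigma> \<in> {a..b} \<Longrightarrow> hs_le s (h \<sigma>) B"
    and cont: "\<And>k. continuous_on {a..b} (\<lambda>\<sigma>. h \<sigma> k)"
  shows "hs_le s (\<lambda>k. integral {a..b} (\<lambda>\<sigma>. h \<sigma> k)) ((b - a) * B)"
proof (rule hs_leI, goal_cases)
  case (1 F)
  define I where "I k = integral {a..b} (\<lambda>\<sigma>. h \<sigma> k)" for k
  define N where "N = L2_set (\<lambda>k. wt s k * cmod (I k)) F"
  have int: "(\<lambda>\<sigma>. h \<sigma> k) integrable_on {a..b}" for k
    by (intro integrable_continuous_interval cont)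
  have N0: "N \<ge> 0" by (simp add: N_def)
  have B0: "B \<ge> 0" using h[of a] ab by (auto dest: hs_le_nonneg)
  define G where "G \<sigma> = (\<Sum>k\<in>F. cnj ((wt s k)\<^sup>2 *\<^sub>R I k) * h \<sigma> k)" for \<sigma>
  have "of_real (N\<^sup>2) = (\<Sum>k\<in>F. cnj ((wt s k)\<^sup>2 *\<^sub>R I k) * I k)"
    unfolding N_def L2_set_def
    by (auto simp: sum_nonneg power_mult_distrib complex_norm_square scaleR_conv_of_real mult.commute mult.left_commute
        intro!: sum.cong simp flip: of_real_power)
  also have "\<dots> = integral {a..b} G"
    unfolding G_def I_def using int \<open>finite F\<close>
    by (subst integral_sum) (auto intro!: integrable_on_mult_right sum.cong)
  finally have eq: "complex_of_real (N\<^sup>2) = integral {a..b} G" .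
  have "N\<^sup>2 = norm (integral {a..b} G)" by (simp add: eq[symmetric] norm_power)
  also have "\<dots> \<le> (N * B) * (b - a)"
  proof (rule integral_bound)
    show "a \<le> b" by fact
    show "continuous_on {a..b} G" unfolding G_def by (intro continuous_intros cont)
    fix \<sigma> assume \<sigma>: "\<sigma> \<in> {a..b}"
    have "norm (G \<sigma>) \<le> (\<Sum>k\<in>F. \<bar>wt s k * cmod (I k)\<bar> * \<bar>wt s k * cmod (h \<sigma> k)\<bar>)"
      unfolding G_def by (rule order_trans[OF norm_sum])
        (auto intro!: sum_mono simp: norm_mult power2_eq_square)
    also have "\<dots> \<le> N * L2_set (\<lambda>k. wt s k * cmod (h \<sigma> k)) F"
      unfolding N_def by (rule L2_set_mult_ineq)
    also have "\<dots> \<le> N * B" using h[OF \<sigma>] \<open>finite F\<close> N0 by (intro mult_left_mono hs_leD)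
    finally show "norm (G \<sigma>) \<le> N * B" .
  qed
  finally have "N * N \<le> N * ((b - a) * B)" by (simp add: power2_eq_square mult_ac)
  then have "N \<le> (b - a) * B \<or> N = 0" using N0 by (cases "N = 0") auto
  then show "L2_set (\<lambda>k. wt s k * cmod (integral {a..b} (\<lambda>\<sigma>. h \<sigma> k))) F \<le> (b - a) * B"
    using ab B0 by (auto simp: N_def I_def)
qed

lemma l1_leD: "l1_le a B \<Longrightarrow> finite F \<Longrightarrow> (\<Sum>k\<in>F. cmod (a k)) \<le> B"
  by (simp add: l1_le_def)

lemma l1_le_nonneg: "l1_le a B \<Longrightarrow> 0 \<le> B"
  using l1_leD[of a B "{}"] by simp

lemma l1_le_abs_summable:
  assumes "l1_le a B" shows "(\<lambda>k. cmod (a k)) summable_on UNIV"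
  by (rule nonneg_bdd_above_summable_on) (use assms in \<open>auto simp: l1_le_def intro!: bdd_aboveI2[where M=B]\<close>)

lemma l1_le_summable: "l1_le a B \<Longrightarrow> a summable_on UNIV"
  by (rule abs_summable_summable[OF l1_le_abs_summable])

lemma l1_le_infsum: "l1_le a B \<Longrightarrow> (\<Sum>\<^sub>\<infinity>k. cmod (a k)) \<le> B"
  by (rule infsum_le_finite_sums[OF l1_le_abs_summable]) (auto intro: l1_leD)

lemma l1_le_norm_infsum: "l1_le a B \<Longrightarrow> cmod (\<Sum>\<^sub>\<infinity>k. a k) \<le> B"
  by (rule order_trans[OF norm_infsum_bound[OF l1_le_abs_summable] l1_le_infsum])

lemma l1_le_coord: "l1_le a B \<Longrightarrow> cmod (a k) \<le> B"
  using l1_leD[of a B "{k}"] by simp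

lemma l1_le_multiplier:
  assumes "l1_le a B" "\<And>k. cmod (m k) \<le> c" "c \<ge> 0"
  shows "l1_le (\<lambda>k. m k * a k) (c * B)"
  unfolding l1_le_def
proof (intro allI impI, goal_cases)
  case F: (1 F)
  have "(\<Sum>k\<in>F. cmod (m k * a k)) \<le> (\<Sum>k\<in>F. c * cmod (a k))"
    using assms by (intro sum_mono) (auto simp: norm_mult intro!: mult_right_mono)
  also have "\<dots> \<le> c * B" using assms F by (auto simp flip: sum_distrib_left intro!: mult_left_mono l1_leD)
  finally show "(\<Sum>k\<in>F. cmod (m k * a k)) \<le> c * B" .
qed

lemma l1_le_add:
  assumes "l1_le a A" "l1_le b B"
  shows "l1_le (\<lambda>k. a k + b k) (A + B)"
  unfolding l1_le_def
proof (intro allI impI, goal_cases)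
  case F: (1 F)
  have "(\<Sum>k\<in>F. cmod (a k + b k)) \<le> (\<Sum>k\<in>F. cmod (a k)) + (\<Sum>k\<in>F. cmod (b k))"
    unfolding sum.distrib[symmetric] by (intro sum_mono norm_triangle_ineq)
  also have "\<dots> \<le> A + B" using assms F by (intro add_mono l1_leD)
  finally show "(\<Sum>k\<in>F. cmod (a k + b k)) \<le> A + B" .
qed

lemma l1_le_uminus [simp]: "l1_le (\<lambda>k. - a k) B = l1_le a B"
  by (simp add: l1_le_def)

lemma l1_le_diff: "l1_le a A \<Longrightarrow> l1_le b B \<Longrightarrow> l1_le (\<lambda>k. a k - b k) (A + B)"
  using l1_le_add[of a A "\<lambda>k. - b k" B] by simp

section \<open>Lattice sums and the embedding of Sobolev spaces into the Wiener algebra\<close>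

lemma summable_on_int_powr:
  assumes "p > (1/2::real)"
  shows "(\<lambda>m::int. (1 + (real_of_int m)\<^sup>2) powr (- p)) summable_on UNIV"
proof -
  have nat: "(\<lambda>n::nat. (1 + (real n)\<^sup>2) powr (- p)) summable_on UNIV"
  proof -
    have *: "summable (\<lambda>n::nat. (1 + (real n)\<^sup>2) powr (- p))"
    proof (rule summable_comparison_test_ev)
      show "summable (\<lambda>n. real n powr (- 2 * p))" using assms by (subst summable_real_powr_iff) auto
      show "\<forall>\<^sub>F n in sequentially. norm ((1 + (real n)\<^sup>2) powr (- p)) \<le> real n powr (- 2 * p)"
      proof (rule eventually_mono[OF eventually_gt_at_top[of 0]])
        fix n :: nat assume "n > 0"
        then have "(1 + (real n)\<^sup>2) powr (- p) \<le> ((real n)\<^sup>2) powr (- p)"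
          using assms by (intro powr_mono2') auto
        also have "\<dots> = real n powr (- 2 * p)"
          using \<open>n > 0\<close> by (simp add: powr_powr powr_numeral[symmetric] del: powr_numeral)
        finally show "norm ((1 + (real n)\<^sup>2) powr (- p)) \<le> real n powr (- 2 * p)" by simp
      qed
    qed
    then show ?thesis by (subst summable_on_UNIV_nonneg_real_iff) auto
  qed
  let ?f = "\<lambda>m::int. (1 + (real_of_int m)\<^sup>2) powr (- p)"
  have 1: "?f summable_on range int"
    by (subst summable_on_reindex) (auto simp: o_def nat)
  have 2: "?f summable_on range (\<lambda>n. - int n)"
    by (subst summable_on_reindex) (auto simp: o_def nat inj_on_def)
  have "?f summable_on (range int \<union> range (\<lambda>n. - int n))"
    by (rule summable_on_union[OF 1 2])
  also have "range int \<union> range (\<lambda>n. - int n) = UNIV"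
    by (auto simp: image_iff) (metis int_cases2)
  finally show ?thesis .
qed

text \<open>The sum over the lattice is compared with a \<open>d\<close>-fold product of one-dimensional sums, because
  \<open>(1 + \<bar>k\<bar>\<^sup>2)\<^sup>d \<ge> (1 + k\<^sub>1\<^sup>2) \<cdots> (1 + k\<^sub>d\<^sup>2)\<close>.\<close>

lemma wt_summable:
  assumes "\<sigma> > real CARD('d::finite) / 2"
  shows "(\<lambda>k::int^'d. (wt (- \<sigma>) k)\<^sup>2) summable_on UNIV"
proof -
  define d where "d = real CARD('d)"
  have d: "d > 0" by (simp add: d_def)
  \<comment> \<open>The exponent is shared equally among the d coordinates; \<sigma> > d/2 is what
    makes each one-dimensional exponent exceed 1/2.\<close>
  define p where "p = \<sigma> / d"
  have p: "p > 1/2" using assms d by (simp add: p_def d_def field_simps)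
  define f where "f m = (1 + (real_of_int m)\<^sup>2) powr (- p)" for m
  have fs: "f summable_on UNIV" unfolding f_def by (rule summable_on_int_powr[OF p])
  have fpos: "f m \<ge> 0" for m by (simp add: f_def)
  have le: "(wt (- \<sigma>) k)\<^sup>2 \<le> (\<Prod>i\<in>UNIV. f (k $ i))" for k :: "int^'d"
  proof -
    have "(wt (- \<sigma>) k)\<^sup>2 = (\<Prod>i\<in>(UNIV::'d set). (1 + freq_sq k) powr (- p))"
      using d one_plus_freq_sq_pos[of k]
      by (simp add: wt_power2 p_def d_def powr_powr powr_realpow[symmetric, of "_ powr _"] del: one_plus_freq_sq_pos)
    also have "\<dots> \<le> (\<Prod>i\<in>UNIV. f (k $ i))"
    proof (intro prod_mono conjI)
      fix i
      have "(real_of_int (k $ i))\<^sup>2 \<le> freq_sq k"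
        unfolding freq_sq_def by (intro member_le_sum) auto
      then show "(1 + freq_sq k) powr (- p) \<le> f (k $ i)"
        unfolding f_def using p by (intro powr_mono2') (auto intro: add_pos_nonneg)
    qed auto
    finally show ?thesis .
  qed
  show ?thesis
  proof (rule nonneg_bdd_above_summable_on)
    show "bdd_above (sum (\<lambda>k::int^'d. (wt (- \<sigma>) k)\<^sup>2) ` {F. F \<subseteq> UNIV \<and> finite F})"
    proof (rule bdd_aboveI2)
      fix F :: "(int^'d) set" assume "F \<in> {F. F \<subseteq> UNIV \<and> finite F}"
      then have F: "finite F" by simp
      define G where "G i = (\<lambda>k::int^'d. k $ i) ` F" for i
      have "(\<Sum>k\<in>F. (wt (- \<sigma>) k)\<^sup>2) \<le> (\<Sum>k\<in>F. \<Prod>i\<in>UNIV. f (k $ i))"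
        by (intro sum_mono le)
      \<comment> \<open>F is viewed as a set of functions of the coordinate and enlarged to the box
        spanned by its projections, where the sum of products factors.\<close>
      also have "\<dots> = (\<Sum>g\<in>(\<lambda>k i. k $ i) ` F. \<Prod>i\<in>UNIV. f (g i))"
        by (subst sum.reindex) (auto simp: inj_on_def vec_eq_iff fun_eq_iff)
      also have "\<dots> \<le> (\<Sum>g\<in>PiE UNIV G. \<Prod>i\<in>UNIV. f (g i))"
        using F fpos by (intro sum_mono2) (auto simp: G_def finite_PiE intro!: prod_nonneg)
      also have "\<dots> = (\<Prod>i\<in>UNIV. \<Sum>m\<in>G i. f m)"
        using F by (subst prod_sum_PiE) (auto simp: G_def)
      also have "\<dots> \<le> (\<Prod>i\<in>(UNIV::'d set). infsum f UNIV)"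
        using fs fpos F by (intro prod_mono conjI sum_nonneg finite_sum_le_infsum) (auto simp: G_def)
      finally show "(\<Sum>k\<in>F. (wt (- \<sigma>) k)\<^sup>2) \<le> (\<Prod>i\<in>(UNIV::'d set). infsum f UNIV)" .
    qed
  qed auto
qed

text \<open>The Cauchy-Schwarz constant of the embedding of H^\<sigma> into the Wiener algebra. The
  added 1 keeps it positive whatever the value of the sum, so that it may be divided by.\<close>

definition sob_const :: "'d::finite itself \<Rightarrow> real \<Rightarrow> real" where
  "sob_const _ \<sigma> = 1 + sqrt (\<Sum>\<^sub>\<infinity>k::int^'d. (wt (- \<sigma>) k)\<^sup>2)"

lemma sob_const_ge_1: "sob_const TYPE('d::finite) \<sigma> \<ge> 1"
  by (simp add: sob_const_def infsum_nonneg)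

lemma sob_const_pos [simp]: "sob_const TYPE('d::finite) \<sigma> > 0"
  using sob_const_ge_1[of \<sigma>, where 'd='d] by linarith

lemma hs_le_imp_l1_le:
  fixes a :: "int^'d::finite \<Rightarrow> complex"
  assumes "hs_le \<sigma> a B" "\<sigma> > real CARD('d) / 2"
  shows "l1_le a (sob_const TYPE('d) \<sigma> * B)"
  unfolding l1_le_def
proof (intro allI impI, goal_cases)
  case F: (1 F)
  let ?S = "\<Sum>\<^sub>\<infinity>k::int^'d. (wt (- \<sigma>) k)\<^sup>2"
  have "(\<Sum>k\<in>F. cmod (a k)) = (\<Sum>k\<in>F. \<bar>wt (- \<sigma>) k\<bar> * \<bar>wt \<sigma> k * cmod (a k)\<bar>)"
    by (intro sum.cong refl) (simp add: mult.assoc[symmetric] wt_add[symmetric])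
  also have "\<dots> \<le> L2_set (wt (- \<sigma>)) F * L2_set (\<lambda>k. wt \<sigma> k * cmod (a k)) F"
    by (rule L2_set_mult_ineq)
  also have "\<dots> \<le> sob_const TYPE('d) \<sigma> * B"
  proof (intro mult_mono)
    have "(\<Sum>k\<in>F. (wt (- \<sigma>) k)\<^sup>2) \<le> ?S"
      by (rule finite_sum_le_infsum[OF wt_summable[OF assms(2)]]) (use F in auto)
    then show "L2_set (wt (- \<sigma>)) F \<le> sob_const TYPE('d) \<sigma>"
      unfolding L2_set_def sob_const_def by (simp add: add_increasing)
  qed (use assms F in \<open>auto intro: hs_leD less_imp_le\<close>)
  finally show "(\<Sum>k\<in>F. cmod (a k)) \<le> sob_const TYPE('d) \<sigma> * B" .
qed

section \<open>Convolutions and the cubic nonlinearity\<close>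

definition conv :: "(int ^ 'd::finite \<Rightarrow> complex) \<Rightarrow> (int ^ 'd \<Rightarrow> complex) \<Rightarrow> int ^ 'd \<Rightarrow> complex" where
  "conv a b k = (\<Sum>\<^sub>\<infinity>l. a (k - l) * b l)"

lemma bij_const_minus: "bij (\<lambda>l. k - l :: int ^ 'd::finite)"
  by (rule bijI') (auto intro: exI[of _ "k - _"])

lemma l1_le_shift: "l1_le a A \<Longrightarrow> l1_le (\<lambda>l. a (k - l)) A"
  unfolding l1_le_def
proof (intro allI impI, goal_cases)
  case (1 F)
  then have "(\<Sum>x\<in>(\<lambda>l. k - l) ` F. cmod (a x)) \<le> A" by blast
  then show ?case by (simp add: sum.reindex)
qed

lemma conv_l1_le_summand:
  assumes "l1_le a A" "\<And>l. cmod (b l) \<le> B" "0 \<le> B"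
  shows "l1_le (\<lambda>l. a (k - l) * b l) (B * A)"
  using l1_le_multiplier[OF l1_le_shift[OF assms(1)] assms(2,3)] by (simp add: mult.commute)

lemma conv_tendsto:
  assumes "l1_le a A" "\<And>l. cmod (b l) \<le> B"
  shows "((\<lambda>G. \<Sum>l\<in>G. a (k - l) * b l) \<longlongrightarrow> conv a b k) (finite_subsets_at_top UNIV)"
proof -
  have "0 \<le> B" using assms(2)[of undefined] norm_ge_zero[of "b undefined"] by linarith
  then show ?thesis unfolding conv_def
    by (intro infsum_tendsto l1_le_summable[OF conv_l1_le_summand[OF assms]])
qed

lemma conv_commute: "conv a b = conv b a"
proof
  fix k
  show "conv a b k = conv b a k"
    unfolding conv_def
    using infsum_reindex_bij_betw[OF bij_const_minus[of k], of "\<lambda>l. a (k - l) * b l"]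
    by (simp add: mult.commute)
qed

lemma conv_l1_le:
  fixes a b :: "int ^ 'd::finite \<Rightarrow> complex"
  assumes "l1_le a A" "l1_le b B"
  shows "l1_le (conv a b) (A * B)"
  unfolding l1_le_def
proof (intro allI impI, goal_cases)
  case F: (1 F)
  have fin: "(\<Sum>k\<in>F. cmod (\<Sum>l\<in>G. a (k - l) * b l)) \<le> A * B" if G: "finite G" for G
  proof -
    have "(\<Sum>k\<in>F. cmod (\<Sum>l\<in>G. a (k - l) * b l)) \<le> (\<Sum>k\<in>F. \<Sum>l\<in>G. cmod (a (k - l)) * cmod (b l))"
      by (intro sum_mono order_trans[OF norm_sum]) (auto simp: norm_mult)
    also have "\<dots> = (\<Sum>l\<in>G. (\<Sum>k\<in>F. cmod (a (k - l))) * cmod (b l))"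
      unfolding sum_distrib_right by (rule sum.swap)
    also have "\<dots> = (\<Sum>l\<in>G. (\<Sum>m\<in>(\<lambda>k. k - l) ` F. cmod (a m)) * cmod (b l))"
      by (simp add: sum.reindex)
    also have "\<dots> \<le> (\<Sum>l\<in>G. A * cmod (b l))"
      using F by (intro sum_mono mult_right_mono l1_leD[OF assms(1)]) auto
    also have "\<dots> \<le> A * B"
      using l1_leD[OF assms(2) G] l1_le_nonneg[OF assms(1)]
      by (simp add: sum_distrib_left[symmetric] mult_left_mono)
    finally show ?thesis .
  qed
  have "((\<lambda>G. \<Sum>k\<in>F. cmod (\<Sum>l\<in>G. a (k - l) * b l)) \<longlongrightarrow> (\<Sum>k\<in>F. cmod (conv a b k))) (finite_subsets_at_top UNIV)"
    by (intro tendsto_intros conv_tendsto[OF assms(1) l1_le_coord[OF assms(2)]])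
  then show ?case
    by (rule tendsto_upperbound) (auto simp: eventually_finite_subsets_at_top_weakI fin)
qed

text \<open>Young's inequality for an l2 and an l1 sequence: for fixed l the translate of f by l has
  the l2-bound X, and the triangle inequality adds these bounds with the weights g l.\<close>

lemma young_finite:
  fixes f g :: "int ^ 'd::finite \<Rightarrow> real"
  assumes "\<And>F. finite F \<Longrightarrow> L2_set f F \<le> X" "\<And>G. finite G \<Longrightarrow> sum g G \<le> Y"
    and "\<And>k. 0 \<le> f k" "\<And>k. 0 \<le> g k" "finite F" "finite G"
  shows "L2_set (\<lambda>k. \<Sum>l\<in>G. f (k - l) * g l) F \<le> X * Y"
proof -
  have X0: "0 \<le> X" using assms(1)[of "{}"] by simp
  have "L2_set (\<lambda>k. \<Sum>l\<in>G. f (k - l) * g l) F \<le> X * sum g G"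
    using \<open>finite G\<close>
  proof (induction G rule: finite_induct)
    case (insert x G)
    have "L2_set (\<lambda>k. f (k - x)) F = L2_set f ((\<lambda>k. k - x) ` F)"
      by (simp add: L2_set_def sum.reindex)
    also have "\<dots> \<le> X" using assms by auto
    finally have *: "L2_set (\<lambda>k. f (k - x) * g x) F \<le> X * g x"
      using assms(4)[of x] by (simp add: L2_set_left_distrib[symmetric] mult_right_mono)
    have "L2_set (\<lambda>k. \<Sum>l\<in>insert x G. f (k - l) * g l) F
        \<le> L2_set (\<lambda>k. f (k - x) * g x) F + L2_set (\<lambda>k. \<Sum>l\<in>G. f (k - l) * g l) F"
      using insert by (simp add: L2_set_triangle_ineq)
    also have "\<dots> \<le> X * g x + X * sum g G" by (intro add_mono * insert.IH)
    finally show ?case using insert by (simp add: distrib_left)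
  qed (simp add: L2_set_def)
  also have "\<dots> \<le> X * Y" using assms X0 by (intro mult_left_mono) auto
  finally show ?thesis .
qed

lemma young_finite':
  fixes f g :: "int ^ 'd::finite \<Rightarrow> real"
  assumes "\<And>F. finite F \<Longrightarrow> L2_set f F \<le> X" "\<And>G. finite G \<Longrightarrow> sum g G \<le> Y"
    and "\<And>k. 0 \<le> f k" "\<And>k. 0 \<le> g k" "finite F" "finite G"
  shows "L2_set (\<lambda>k. \<Sum>l\<in>G. g (k - l) * f l) F \<le> X * Y"
proof -
  \<comment> \<open>The substitution m = k - l depends on k; H contains all values it takes, so one
    index set serves for every k and the first form of the inequality applies.\<close>
  define H where "H = (\<lambda>(k, l). k - l) ` (F \<times> G)"
  have H: "finite H" using assms by (simp add: H_def)
  have "L2_set (\<lambda>k. \<Sum>l\<in>G. g (k - l) * f l) F \<le> L2_set (\<lambda>k. \<Sum>m\<in>H. f (k - m) * g m) F"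
  proof (rule L2_set_mono)
    fix k assume "k \<in> F"
    have "(\<Sum>l\<in>G. g (k - l) * f l) = (\<Sum>m\<in>(\<lambda>l. k - l) ` G. f (k - m) * g m)"
      by (simp add: sum.reindex mult.commute)
    also have "\<dots> \<le> (\<Sum>m\<in>H. f (k - m) * g m)"
      using assms H \<open>k \<in> F\<close> by (intro sum_mono2) (auto simp: H_def)
    finally show "(\<Sum>l\<in>G. g (k - l) * f l) \<le> (\<Sum>m\<in>H. f (k - m) * g m)" .
    show "0 \<le> (\<Sum>l\<in>G. g (k - l) * f l)" using assms by (intro sum_nonneg) auto
  qed
  also have "\<dots> \<le> X * Y" by (rule young_finite) (use assms H in auto)
  finally show ?thesis .
qed

text \<open>The common frame of the product estimates: once the weight at k is distributed over k -
  l and l, each of the two resulting sums pairs a summable with a square-summable sequence and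
  Young's inequality applies. Finite sections of the inner sum come first; the convolution is their
  coordinatewise limit.\<close>

lemma hs_le_conv_core:
  fixes a b :: "int ^ 'd::finite \<Rightarrow> complex"
  assumes a: "l1_le a A" and b: "\<And>l. cmod (b l) \<le> B"
    and le: "\<And>k l. wt s k * (cmod (a (k - l)) * cmod (b l)) \<le> c * (p (k - l) * q l + r (k - l) * t l)"
    and p: "\<And>G. finite G \<Longrightarrow> sum p G \<le> P" "\<And>k. 0 \<le> p k"
    and q: "\<And>F. finite F \<Longrightarrow> L2_set q F \<le> Q" "\<And>k. 0 \<le> q k"
    and r: "\<And>F. finite F \<Longrightarrow> L2_set r F \<le> R" "\<And>k. 0 \<le> r k"
    and t: "\<And>G. finite G \<Longrightarrow> sum t G \<le> T" "\<And>k. 0 \<le> t k"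
    and c: "0 \<le> c"
  shows "hs_le s (conv a b) (c * (P * Q + R * T))"
proof (rule hs_le_lim)
  show "((\<lambda>G. \<Sum>l\<in>G. a (k - l) * b l) \<longlongrightarrow> conv a b k) (finite_subsets_at_top UNIV)" for k
    by (rule conv_tendsto[OF a b])
  have "hs_le s (\<lambda>k. \<Sum>l\<in>G. a (k - l) * b l) (c * (P * Q + R * T))" if G: "finite G" for G
  proof (rule hs_leI)
    fix F :: "(int ^ 'd) set" assume F: "finite F"
    have "L2_set (\<lambda>k. wt s k * cmod (\<Sum>l\<in>G. a (k - l) * b l)) F
      \<le> L2_set (\<lambda>k. c * ((\<Sum>l\<in>G. p (k - l) * q l) + (\<Sum>l\<in>G. r (k - l) * t l))) F"
    proof (rule L2_set_mono)
      fix k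
      have "wt s k * cmod (\<Sum>l\<in>G. a (k - l) * b l) \<le> wt s k * (\<Sum>l\<in>G. cmod (a (k - l)) * cmod (b l))"
        by (intro mult_left_mono order_trans[OF norm_sum]) (auto simp: norm_mult)
      also have "\<dots> \<le> (\<Sum>l\<in>G. c * (p (k - l) * q l + r (k - l) * t l))"
        unfolding sum_distrib_left by (intro sum_mono le)
      finally show "wt s k * cmod (\<Sum>l\<in>G. a (k - l) * b l)
          \<le> c * ((\<Sum>l\<in>G. p (k - l) * q l) + (\<Sum>l\<in>G. r (k - l) * t l))"
        by (simp add: sum_distrib_left sum.distrib distrib_left)
    qed auto
    also have "\<dots> = c * L2_set (\<lambda>k. (\<Sum>l\<in>G. p (k - l) * q l) + (\<Sum>l\<in>G. r (k - l) * t l)) F"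
      using c by (simp add: L2_set_right_distrib)
    also have "\<dots> \<le> c * (P * Q + R * T)"
      using young_finite'[OF q(1) p(1) q(2) p(2) F G] young_finite[OF r(1) t(1) r(2) t(2) F G]
      by (intro mult_left_mono c order_trans[OF L2_set_triangle_ineq] add_mono) (simp_all add: mult.commute)
    finally show "L2_set (\<lambda>k. wt s k * cmod (\<Sum>l\<in>G. a (k - l) * b l)) F \<le> c * (P * Q + R * T)" .
  qed
  then show "\<forall>\<^sub>F G in finite_subsets_at_top UNIV. hs_le s (\<lambda>k. \<Sum>l\<in>G. a (k - l) * b l) (c * (P * Q + R * T))"
    by (simp add: eventually_finite_subsets_at_top_weakI)
qed auto

text \<open>The maximum of the two weights is at most their sum, so in each term one factor enters
  through H^s and the other through the Wiener algebra only. What matters is that no term contains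
  two strong norms.\<close>

lemma hs_le_conv_tame:
  fixes a b :: "int ^ 'd::finite \<Rightarrow> complex"
  assumes s: "0 \<le> s" and "l1_le a A'" "l1_le b B'" "hs_le s a A" "hs_le s b B"
  shows "hs_le s (conv a b) (2 powr s * (A' * B + A * B'))"
proof (rule hs_le_conv_core[OF assms(2) l1_le_coord[OF assms(3)],
    where p = "\<lambda>k. cmod (a k)" and q = "\<lambda>k. wt s k * cmod (b k)" and r = "\<lambda>k. wt s k * cmod (a k)"
      and t = "\<lambda>k. cmod (b k)"])
  fix k l :: "int ^ 'd"
  have "wt s k * (cmod (a (k - l)) * cmod (b l))
      \<le> 2 powr s * max (wt s (k - l)) (wt s l) * (cmod (a (k - l)) * cmod (b l))"
    by (intro mult_right_mono wt_le_diff_max s) auto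
  also have "\<dots> \<le> 2 powr s * (wt s (k - l) + wt s l) * (cmod (a (k - l)) * cmod (b l))"
    by (intro mult_right_mono mult_left_mono) (auto simp: max_def)
  finally show "wt s k * (cmod (a (k - l)) * cmod (b l))
      \<le> 2 powr s * (cmod (a (k - l)) * (wt s l * cmod (b l)) + wt s (k - l) * cmod (a (k - l)) * cmod (b l))"
    by (simp add: algebra_simps)
qed (use assms in \<open>auto dest: l1_leD hs_leD\<close>)

text \<open>Where the frequency \<open>k - l\<close> of the first factor dominates, \<open>\<langle>k - l\<rangle>\<^sup>s \<le> \<langle>k - l\<rangle>\<^sup>\<sigma> \<langle>l\<rangle>\<^sup>s\<^sup>-\<^sup>\<sigma>\<close>, which
  leaves a summable second factor although \<open>s\<close> itself may be below \<open>d/2\<close>.\<close>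

lemma hs_le_conv_mixed:
  fixes a b :: "int ^ 'd::finite \<Rightarrow> complex"
  assumes s: "0 \<le> s" "s \<le> \<sigma>" and \<sigma>: "\<sigma> > real CARD('d) / 2" and a: "hs_le \<sigma> a A" and b: "hs_le s b B"
  shows "hs_le s (conv a b) (2 powr \<sigma> * (2 * sob_const TYPE('d) \<sigma>) * (A * B))"
proof -
  let ?c = "sob_const TYPE('d) \<sigma>"
  have bbd: "cmod (b l) \<le> B" for l
    using hs_le_coord[OF b, of l] mult_right_mono[OF wt_ge_1[OF s(1)], of "cmod (b l)" l] by simp
  have a1: "l1_le a (?c * A)" by (rule hs_le_imp_l1_le[OF a \<sigma>])
  have "hs_le \<sigma> (\<lambda>k. of_real (wt (s - \<sigma>) k) * b k) (1 * B)"
    by (rule hs_le_dominated[OF b]) (auto simp: norm_mult mult.assoc[symmetric] wt_add[symmetric])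
  then have b1: "l1_le (\<lambda>k. of_real (wt (s - \<sigma>) k) * b k) (?c * B)"
    by (intro hs_le_imp_l1_le \<sigma>) simp
  have "hs_le s (conv a b) (2 powr s * ((?c * A) * B + A * (?c * B)))"
  proof (rule hs_le_conv_core[OF a1 bbd,
      where p = "\<lambda>k. cmod (a k)" and q = "\<lambda>k. wt s k * cmod (b k)" and r = "\<lambda>k. wt \<sigma> k * cmod (a k)"
        and t = "\<lambda>k. wt (s - \<sigma>) k * cmod (b k)"])
    fix k l :: "int ^ 'd"
    have max: "max (wt s (k - l)) (wt s l) \<le> wt s l + wt \<sigma> (k - l) * wt (s - \<sigma>) l"
    proof (cases "freq_sq l \<le> freq_sq (k - l)")
      case True
      have "wt s (k - l) = wt \<sigma> (k - l) * wt (s - \<sigma>) (k - l)" by (simp flip: wt_add)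
      also have "\<dots> \<le> wt \<sigma> (k - l) * wt (s - \<sigma>) l"
        using s True by (intro mult_left_mono) (auto simp: wt_def intro!: powr_mono2')
      finally show ?thesis by (auto simp: add_nonneg_nonneg add_increasing2 add_increasing)
    next
      case False
      then have "wt s (k - l) \<le> wt s l" using s by (auto simp: wt_def intro!: powr_mono2)
      then show ?thesis by (simp add: add_increasing2)
    qed
    have "wt s k * (cmod (a (k - l)) * cmod (b l))
        \<le> 2 powr s * max (wt s (k - l)) (wt s l) * (cmod (a (k - l)) * cmod (b l))"
      by (intro mult_right_mono wt_le_diff_max s) auto
    also have "\<dots> \<le> 2 powr s * (wt s l + wt \<sigma> (k - l) * wt (s - \<sigma>) l) * (cmod (a (k - l)) * cmod (b l))"
      by (intro mult_right_mono mult_left_mono max) auto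
    finally show "wt s k * (cmod (a (k - l)) * cmod (b l))
        \<le> 2 powr s * (cmod (a (k - l)) * (wt s l * cmod (b l)) + wt \<sigma> (k - l) * cmod (a (k - l)) * (wt (s - \<sigma>) l * cmod (b l)))"
      by (simp add: algebra_simps)
  qed (use a1 a b l1_leD[OF b1] in \<open>auto dest: l1_leD hs_leD simp: norm_mult\<close>)
  moreover have "2 powr s * ((?c * A) * B + A * (?c * B)) = 2 powr s * (2 * ?c) * (A * B)"
    by (simp add: algebra_simps)
  moreover have "\<dots> \<le> 2 powr \<sigma> * (2 * ?c) * (A * B)"
    using s hs_le_nonneg[OF a] hs_le_nonneg[OF b]
    by (intro mult_right_mono powr_mono) (auto intro: less_imp_le)
  ultimately show ?thesis by (simp only: hs_le_weaken)
qed

section \<open>The cubic nonlinearity as a trilinear form in the Wiener algebra\<close>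

definition l1 :: "(int ^ 'd::finite \<Rightarrow> complex) \<Rightarrow> bool" where
  "l1 a \<longleftrightarrow> (\<exists>A. l1_le a A)"

lemma l1I: "l1_le a A \<Longrightarrow> l1 a"
  by (auto simp: l1_def)

lemma hs_le_imp_l1:
  fixes a :: "int ^ 'd::finite \<Rightarrow> complex"
  shows "hs_le \<sigma> a A \<Longrightarrow> \<sigma> > real CARD('d) / 2 \<Longrightarrow> l1 a"
  using hs_le_imp_l1_le l1I by blast

lemma l1_add [intro]: "l1 a \<Longrightarrow> l1 b \<Longrightarrow> l1 (\<lambda>k. a k + b k)"
  unfolding l1_def using l1_le_add by blast

lemma l1_diff [intro]: "l1 a \<Longrightarrow> l1 b \<Longrightarrow> l1 (\<lambda>k. a k - b k)"
  unfolding l1_def using l1_le_diff by blast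

lemma l1_scale [intro]: "l1 a \<Longrightarrow> l1 (\<lambda>k. z * a k)"
  unfolding l1_def using l1_le_multiplier[of a _ "\<lambda>k. z" "cmod z"] by auto

lemma l1_multiplier: "l1 a \<Longrightarrow> (\<And>k. cmod (m k) \<le> c) \<Longrightarrow> l1 (\<lambda>k. m k * a k)"
  unfolding l1_def using l1_le_multiplier[of a _ m c] by (metis norm_ge_zero order_trans)

lemma l1_conv [intro]: "l1 a \<Longrightarrow> l1 b \<Longrightarrow> l1 (conv a b)"
  unfolding l1_def using conv_l1_le by blast

lemma conv_summable:
  assumes "l1 a" "l1 b" shows "(\<lambda>l. a (k - l) * b l) summable_on UNIV"
proof -
  obtain A B where A: "l1_le a A" and B: "l1_le b B" using assms by (auto simp: l1_def)
  show ?thesis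
    by (rule l1_le_summable[OF conv_l1_le_summand[OF A l1_le_coord[OF B] l1_le_nonneg[OF B]]])
qed

lemma conv_add_left: "l1 a \<Longrightarrow> l1 a' \<Longrightarrow> l1 b \<Longrightarrow> conv (\<lambda>k. a k + a' k) b = (\<lambda>k. conv a b k + conv a' b k)"
  unfolding conv_def by (auto simp: distrib_right infsum_add conv_summable)

lemma conv_add_right: "l1 a \<Longrightarrow> l1 b \<Longrightarrow> l1 b' \<Longrightarrow> conv a (\<lambda>k. b k + b' k) = (\<lambda>k. conv a b k + conv a b' k)"
  unfolding conv_def by (auto simp: distrib_left infsum_add conv_summable)

lemma conv_scale_left: "conv (\<lambda>k. z * a k) b = (\<lambda>k. z * conv a b k)"
  unfolding conv_def by (simp add: mult.assoc infsum_cmult_right')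

lemma conv_scale_right: "conv a (\<lambda>k. z * b k) = (\<lambda>k. z * conv a b k)"
  unfolding conv_def by (simp add: mult.left_commute[of _ z] infsum_cmult_right')

text \<open>The Fourier coefficients of the complex conjugate of the function with coefficients
  \<open>c\<close>.\<close>

definition reflect_cnj :: "(int ^ 'd::finite \<Rightarrow> complex) \<Rightarrow> int ^ 'd \<Rightarrow> complex" where
  "reflect_cnj c k = cnj (c (- k))"

lemma l1_le_reflect_cnj [simp]: "l1_le (reflect_cnj c) B \<longleftrightarrow> l1_le c B"
proof -
  have "l1_le (reflect_cnj c) B" if "l1_le c B" for c :: "int ^ 'd \<Rightarrow> complex"
    using l1_le_shift[OF that, of 0] by (simp add: l1_le_def reflect_cnj_def)
  moreover have "reflect_cnj (reflect_cnj c) = c" by (simp add: reflect_cnj_def fun_eq_iff)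
  ultimately show ?thesis by metis
qed

lemma hs_le_reflect_cnj:
  assumes "hs_le s c B" shows "hs_le s (reflect_cnj c) B"
proof (rule hs_leI, goal_cases)
  case (1 F)
  have "L2_set (\<lambda>k. wt s k * cmod (reflect_cnj c k)) F = L2_set (\<lambda>k. wt s k * cmod (c k)) (uminus ` F)"
    by (simp add: L2_set_def sum.reindex reflect_cnj_def)
  also have "\<dots> \<le> B" using 1 by (intro hs_leD assms) auto
  finally show ?case .
qed

lemma l1_reflect_cnj [intro]: "l1 c \<Longrightarrow> l1 (reflect_cnj c)"
  by (simp add: l1_def)

lemma reflect_cnj_add: "reflect_cnj (\<lambda>k. a k + b k) = (\<lambda>k. reflect_cnj a k + reflect_cnj b k)"
  by (auto simp: reflect_cnj_def)

lemma reflect_cnj_scale: "reflect_cnj (\<lambda>k. of_real r * a k) = (\<lambda>k. of_real r * reflect_cnj a k)"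
  by (auto simp: reflect_cnj_def)

text \<open>The polarized nonlinearity on the Fourier side, with the conjugated factor in third
  place: linear in the first two slots, conjugate-linear in the last.\<close>

definition tri :: "real \<Rightarrow> (int ^ 'd::finite \<Rightarrow> complex) \<Rightarrow> (int ^ 'd \<Rightarrow> complex) \<Rightarrow> (int ^ 'd \<Rightarrow> complex) \<Rightarrow> int ^ 'd \<Rightarrow> complex" where
  "tri lam a b c k = - \<i> * of_real lam * conv (conv a b) (reflect_cnj c) k"

definition cubic :: "real \<Rightarrow> (int ^ 'd::finite \<Rightarrow> complex) \<Rightarrow> int ^ 'd \<Rightarrow> complex" where
  "cubic lam a = tri lam a a a"

definition dcubic :: "real \<Rightarrow> (int ^ 'd::finite \<Rightarrow> complex) \<Rightarrow> (int ^ 'd \<Rightarrow> complex) \<Rightarrow> int ^ 'd \<Rightarrow> complex" where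
  "dcubic lam a h k = tri lam h a a k + tri lam a h a k + tri lam a a h k"

lemma l1_tri [intro]: "l1 a \<Longrightarrow> l1 b \<Longrightarrow> l1 c \<Longrightarrow> l1 (tri lam a b c)"
  unfolding tri_def by (intro l1_scale l1_conv l1_reflect_cnj)

lemma l1_cubic [intro]: "l1 a \<Longrightarrow> l1 (cubic lam a)"
  unfolding cubic_def by (intro l1_tri)

context
  fixes a a' b c :: "int ^ 'd::finite \<Rightarrow> complex"
  assumes [intro, simp]: "l1 a" "l1 a'" "l1 b" "l1 c"
begin

lemma tri_add1: "tri lam (\<lambda>k. a k + a' k) b c = (\<lambda>k. tri lam a b c k + tri lam a' b c k)"
  by (simp add: tri_def fun_eq_iff conv_add_left l1_conv l1_reflect_cnj algebra_simps)

lemma tri_add2: "tri lam b (\<lambda>k. a k + a' k) c = (\<lambda>k. tri lam b a c k + tri lam b a' c k)"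
  by (simp add: tri_def fun_eq_iff conv_add_left conv_add_right l1_conv l1_reflect_cnj algebra_simps)

lemma tri_add3: "tri lam b c (\<lambda>k. a k + a' k) = (\<lambda>k. tri lam b c a k + tri lam b c a' k)"
  by (simp add: tri_def fun_eq_iff reflect_cnj_add conv_add_right l1_conv l1_reflect_cnj algebra_simps)

end

text \<open>Only real scalars are pulled out: because of the conjugate-linear slot, the derivative
  of the nonlinearity is real-linear but in general not complex-linear.\<close>

lemma dcubic_scale: "dcubic lam a (\<lambda>k. of_real r * h k) k = of_real r * dcubic lam a h k"
  by (simp add: dcubic_def tri_def conv_scale_left conv_scale_right reflect_cnj_scale algebra_simps)

lemma cubic_add:
  assumes [simp]: "l1 a" "l1 h"
  shows "cubic lam (\<lambda>k. a k + h k) k = cubic lam a k + dcubic lam a h k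
    + (tri lam h h a k + tri lam h a h k + tri lam a h h k + tri lam h h h k)"
  by (simp add: cubic_def dcubic_def tri_add1 tri_add2 tri_add3 l1_add)

text \<open>The factors are exchanged one slot at a time, so that every term contains the difference
  exactly once.\<close>

lemma cubic_diff:
  assumes [simp]: "l1 a" "l1 b"
  shows "cubic lam a k - cubic lam b k
    = tri lam (\<lambda>k. a k - b k) a a k + tri lam b (\<lambda>k. a k - b k) a k + tri lam b b (\<lambda>k. a k - b k) k"
proof -
  have [simp]: "l1 (\<lambda>k. a k - b k)" by (intro l1_diff) auto
  have a: "a = (\<lambda>k. b k + (a k - b k))" by simp
  have "tri lam (\<lambda>k. b k + (a k - b k)) a a k = tri lam b a a k + tri lam (\<lambda>k. a k - b k) a a k"
    by (subst tri_add1) auto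
  moreover have "tri lam b (\<lambda>k. b k + (a k - b k)) a k = tri lam b b a k + tri lam b (\<lambda>k. a k - b k) a k"
    by (subst tri_add2) auto
  moreover have "tri lam b b (\<lambda>k. b k + (a k - b k)) k = tri lam b b b k + tri lam b b (\<lambda>k. a k - b k) k"
    by (subst tri_add3) auto
  ultimately show ?thesis unfolding cubic_def a[symmetric] by simp
qed

definition tri_const :: "'d::finite itself \<Rightarrow> real \<Rightarrow> real \<Rightarrow> real" where
  "tri_const t lam \<sigma> = \<bar>lam\<bar> * (2 powr \<sigma> * (2 * sob_const t \<sigma>))\<^sup>2"

lemma tri_const_nonneg [simp]: "0 \<le> tri_const TYPE('d::finite) lam \<sigma>"
  by (simp add: tri_const_def)

context
  fixes s \<sigma> lam :: real and a b c :: "int ^ 'd::finite \<Rightarrow> complex"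
  assumes s: "0 \<le> s" "s \<le> \<sigma>" and \<sigma>: "\<sigma> > real CARD('d) / 2"
begin

lemma hs_le_tri_aux:
  assumes "hs_le s (conv (conv a b) (reflect_cnj c)) (2 powr \<sigma> * (2 * sob_const TYPE('d) \<sigma>) *
    (2 powr \<sigma> * (2 * sob_const TYPE('d) \<sigma>) * X))"
  shows "hs_le s (tri lam a b c) (tri_const TYPE('d) lam \<sigma> * X)"
proof -
  have "hs_le s (\<lambda>k. (- \<i> * of_real lam) * conv (conv a b) (reflect_cnj c) k)
    (cmod (- \<i> * of_real lam) * (2 powr \<sigma> * (2 * sob_const TYPE('d) \<sigma>) * (2 powr \<sigma> * (2 * sob_const TYPE('d) \<sigma>) * X)))"
    by (rule hs_le_scale[OF assms])
  moreover have "tri lam a b c = (\<lambda>k. (- \<i> * of_real lam) * conv (conv a b) (reflect_cnj c) k)"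
    by (simp add: fun_eq_iff tri_def)
  moreover have "cmod (- \<i> * of_real lam) * (2 powr \<sigma> * (2 * sob_const TYPE('d) \<sigma>) * (2 powr \<sigma> * (2 * sob_const TYPE('d) \<sigma>) * X))
     = tri_const TYPE('d) lam \<sigma> * X"
    by (simp add: tri_const_def norm_mult power2_eq_square algebra_simps)
  ultimately show ?thesis by (simp only:)
qed

text \<open>The factor of low regularity may stand in any slot, since convolution commutes and
  conjugation preserves H^s. Here and in the next two lemmas only one factor is measured in H^s, so
  s may lie below d/2, where H^s is no algebra.\<close>

lemma hs_le_tri1:
  assumes "hs_le s a A" "hs_le \<sigma> b B" "hs_le \<sigma> c C"
  shows "hs_le s (tri lam a b c) (tri_const TYPE('d) lam \<sigma> * (A * B * C))"
proof (rule hs_le_tri_aux)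
  have "hs_le s (conv b a) (2 powr \<sigma> * (2 * sob_const TYPE('d) \<sigma>) * (B * A))"
    by (rule hs_le_conv_mixed[OF s \<sigma> assms(2,1)])
  from hs_le_conv_mixed[OF s \<sigma> hs_le_reflect_cnj[OF assms(3)] this]
  show "hs_le s (conv (conv a b) (reflect_cnj c)) (2 powr \<sigma> * (2 * sob_const TYPE('d) \<sigma>) *
    (2 powr \<sigma> * (2 * sob_const TYPE('d) \<sigma>) * (A * B * C)))"
    unfolding conv_commute[of b a] conv_commute[of "reflect_cnj c"] by (simp add: algebra_simps)
qed

lemma hs_le_tri2:
  assumes "hs_le \<sigma> a A" "hs_le s b B" "hs_le \<sigma> c C"
  shows "hs_le s (tri lam a b c) (tri_const TYPE('d) lam \<sigma> * (A * B * C))"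
proof (rule hs_le_tri_aux)
  have "hs_le s (conv a b) (2 powr \<sigma> * (2 * sob_const TYPE('d) \<sigma>) * (A * B))"
    by (rule hs_le_conv_mixed[OF s \<sigma> assms(1,2)])
  from hs_le_conv_mixed[OF s \<sigma> hs_le_reflect_cnj[OF assms(3)] this]
  show "hs_le s (conv (conv a b) (reflect_cnj c)) (2 powr \<sigma> * (2 * sob_const TYPE('d) \<sigma>) *
    (2 powr \<sigma> * (2 * sob_const TYPE('d) \<sigma>) * (A * B * C)))"
    unfolding conv_commute[of "reflect_cnj c"] by (simp add: algebra_simps)
qed

lemma hs_le_tri3:
  assumes "hs_le \<sigma> a A" "hs_le \<sigma> b B" "hs_le s c C"
  shows "hs_le s (tri lam a b c) (tri_const TYPE('d) lam \<sigma> * (A * B * C))"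
proof (rule hs_le_tri_aux)
  have "0 \<le> \<sigma>" using s by simp
  have "hs_le \<sigma> (conv a b) (2 powr \<sigma> * (2 * sob_const TYPE('d) \<sigma>) * (A * B))"
    by (rule hs_le_conv_mixed[OF \<open>0 \<le> \<sigma>\<close> order_refl \<sigma> assms(1,2)])
  from hs_le_conv_mixed[OF s \<sigma> this hs_le_reflect_cnj[OF assms(3)]]
  show "hs_le s (conv (conv a b) (reflect_cnj c)) (2 powr \<sigma> * (2 * sob_const TYPE('d) \<sigma>) *
    (2 powr \<sigma> * (2 * sob_const TYPE('d) \<sigma>) * (A * B * C)))"
    by (simp add: algebra_simps)
qed

end

context
  fixes s \<sigma> lam :: real and type_d :: "'d::finite itself"
  assumes s: "0 \<le> s" "s \<le> \<sigma>" and \<sigma>: "\<sigma> > real CARD('d) / 2"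
begin

lemma hs_le_dcubic:
  fixes a h :: "int ^ 'd \<Rightarrow> complex"
  assumes a: "hs_le \<sigma> a A" and h: "hs_le s h H"
  shows "hs_le s (dcubic lam a h) (3 * tri_const TYPE('d) lam \<sigma> * A\<^sup>2 * H)"
proof -
  let ?t = "tri_const TYPE('d) lam \<sigma>"
  have "hs_le s (\<lambda>k. tri lam h a a k + tri lam a h a k + tri lam a a h k)
    (?t * (H * A * A) + ?t * (A * H * A) + ?t * (A * A * H))"
    by (intro hs_le_add hs_le_tri1[OF s \<sigma> h a a] hs_le_tri2[OF s \<sigma> a h a] hs_le_tri3[OF s \<sigma> a a h])
  then show ?thesis
    by (rule hs_le_subst) (simp_all add: dcubic_def power2_eq_square algebra_simps)
qed

lemma hs_le_cubic_diff:
  fixes a b :: "int ^ 'd \<Rightarrow> complex"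
  assumes a: "hs_le \<sigma> a A" and b: "hs_le \<sigma> b A" and d: "hs_le s (\<lambda>k. a k - b k) X"
  shows "hs_le s (\<lambda>k. cubic lam a k - cubic lam b k) (3 * tri_const TYPE('d) lam \<sigma> * A\<^sup>2 * X)"
proof -
  let ?t = "tri_const TYPE('d) lam \<sigma>"
  have "hs_le s (\<lambda>k. tri lam (\<lambda>k. a k - b k) a a k + tri lam b (\<lambda>k. a k - b k) a k + tri lam b b (\<lambda>k. a k - b k) k)
    (?t * (X * A * A) + ?t * (A * X * A) + ?t * (A * A * X))"
    by (intro hs_le_add hs_le_tri1[OF s \<sigma> d a a] hs_le_tri2[OF s \<sigma> b d a] hs_le_tri3[OF s \<sigma> b b d])
  moreover have "l1 a" "l1 b" using hs_le_imp_l1 \<sigma> a b by blast+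
  ultimately show ?thesis
    by (elim hs_le_subst) (simp_all add: cubic_diff power2_eq_square algebra_simps)
qed

lemma hs_le_cubic_add:
  fixes a h :: "int ^ 'd \<Rightarrow> complex"
  assumes a: "hs_le \<sigma> a A" and h': "hs_le \<sigma> h H'" and h: "hs_le s h H"
  shows "hs_le s (\<lambda>k. cubic lam (\<lambda>k. a k + h k) k - cubic lam a k - dcubic lam a h k)
    (tri_const TYPE('d) lam \<sigma> * (3 * A + H') * H' * H)"
proof -
  let ?t = "tri_const TYPE('d) lam \<sigma>"
  have "hs_le s (\<lambda>k. tri lam h h a k + tri lam h a h k + tri lam a h h k + tri lam h h h k)
    (?t * (H * H' * A) + ?t * (H * A * H') + ?t * (A * H * H') + ?t * (H * H' * H'))"
    by (intro hs_le_add hs_le_tri1[OF s \<sigma> h h' a] hs_le_tri1[OF s \<sigma> h a h'] hs_le_tri2[OF s \<sigma> a h h']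
        hs_le_tri1[OF s \<sigma> h h' h'])
  moreover have "l1 a" "l1 h" using hs_le_imp_l1 \<sigma> a h' by blast+
  ultimately show ?thesis
    by (elim hs_le_subst) (simp_all add: cubic_add algebra_simps)
qed

end

lemma hs_le_cubic:
  fixes a :: "int ^ 'd::finite \<Rightarrow> complex"
  assumes "0 \<le> \<sigma>" "\<sigma> > real CARD('d) / 2" "hs_le \<sigma> a A"
  shows "hs_le \<sigma> (cubic lam a) (tri_const TYPE('d) lam \<sigma> * A ^ 3)"
  using hs_le_tri1[OF assms(1) order_refl assms(2) assms(3,3,3), of lam]
  by (simp add: cubic_def power3_eq_cube)

lemma hs_le_dcubic_diff:
  fixes a b h :: "int ^ 'd::finite \<Rightarrow> complex"
  assumes 0: "0 \<le> \<sigma>" and \<sigma>: "\<sigma> > real CARD('d) / 2"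
    and a: "hs_le \<sigma> a A" and b: "hs_le \<sigma> b A" and d: "hs_le \<sigma> (\<lambda>k. a k - b k) X" and h: "hs_le \<sigma> h H"
  shows "hs_le \<sigma> (\<lambda>k. dcubic lam a h k - dcubic lam b h k) (6 * tri_const TYPE('d) lam \<sigma> * A * X * H)"
proof -
  let ?t = "tri_const TYPE('d) lam \<sigma>" and ?d = "\<lambda>k. a k - b k"
  note [simp] = hs_le_imp_l1[OF a \<sigma>] hs_le_imp_l1[OF b \<sigma>] hs_le_imp_l1[OF d \<sigma>] hs_le_imp_l1[OF h \<sigma>]
  have "dcubic lam a h k - dcubic lam b h k =
     tri lam h ?d a k + tri lam h b ?d k + tri lam ?d h a k + tri lam b h ?d k
     + tri lam ?d a h k + tri lam b ?d h k" for k
  proof -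
    have "tri lam h (\<lambda>k. b k + ?d k) a k = tri lam h b a k + tri lam h ?d a k" by (subst tri_add2) auto
    moreover have "tri lam h b (\<lambda>k. b k + ?d k) k = tri lam h b b k + tri lam h b ?d k" by (subst tri_add3) auto
    moreover have "tri lam (\<lambda>k. b k + ?d k) h a k = tri lam b h a k + tri lam ?d h a k" by (subst tri_add1) auto
    moreover have "tri lam b h (\<lambda>k. b k + ?d k) k = tri lam b h b k + tri lam b h ?d k" by (subst tri_add3) auto
    moreover have "tri lam (\<lambda>k. b k + ?d k) a h k = tri lam b a h k + tri lam ?d a h k" by (subst tri_add1) auto
    moreover have "tri lam b (\<lambda>k. b k + ?d k) h k = tri lam b b h k + tri lam b ?d h k" by (subst tri_add2) auto
    moreover have "(\<lambda>k. b k + ?d k) = a" by simp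
    ultimately show ?thesis unfolding dcubic_def by (simp only:) simp
  qed
  moreover have "hs_le \<sigma> (\<lambda>k. tri lam h ?d a k + tri lam h b ?d k + tri lam ?d h a k + tri lam b h ?d k
     + tri lam ?d a h k + tri lam b ?d h k)
     (?t * (H * X * A) + ?t * (H * A * X) + ?t * (X * H * A) + ?t * (A * H * X) + ?t * (X * A * H) + ?t * (A * X * H))"
    by (intro hs_le_add hs_le_tri1[OF 0 order_refl \<sigma>] a b d h)
  ultimately show ?thesis by (elim hs_le_subst) (simp_all add: algebra_simps)
qed

text \<open>The tame product estimate used twice: every term keeps one factor in H^s and the other
  two in the Wiener algebra, so the bound is linear in X. The square of \<open>2 powr s\<close>
  counts the two convolutions.\<close>

lemma hs_le_cubic_tame:
  fixes a :: "int ^ 'd::finite \<Rightarrow> complex"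
  assumes s: "0 \<le> s" and a1: "l1_le a A" and a: "hs_le s a X"
  shows "hs_le s (cubic lam a) (\<bar>lam\<bar> * 3 * (2 powr s)\<^sup>2 * A\<^sup>2 * X)"
proof -
  let ?p = "2 powr s :: real"
  have X: "0 \<le> X" using hs_le_nonneg[OF a] .
  have A: "0 \<le> A" using l1_le_nonneg[OF a1] .
  have p: "1 \<le> ?p" using s ge_one_powr_ge_zero by simp
  have aa: "hs_le s (conv a a) (?p * (A * X + X * A))"
    by (rule hs_le_conv_tame[OF s a1 a1 a a])
  have "hs_le s (conv (conv a a) (reflect_cnj a)) (?p * ((A * A) * X + (?p * (A * X + X * A)) * A))"
    by (rule hs_le_conv_tame[OF s conv_l1_le[OF a1 a1] _ aa hs_le_reflect_cnj[OF a]]) (use a1 in simp)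
  from hs_le_scale[OF this, of "- \<i> * of_real lam"]
  have "hs_le s (cubic lam a) (\<bar>lam\<bar> * (?p * ((A * A) * X + (?p * (A * X + X * A)) * A)))"
    by (simp add: cubic_def tri_def[abs_def] norm_mult)
  moreover have "?p * ((A * A) * X + (?p * (A * X + X * A)) * A) \<le> 3 * ?p\<^sup>2 * A\<^sup>2 * X"
  proof -
    have "?p * (A\<^sup>2 * X) \<le> ?p\<^sup>2 * (A\<^sup>2 * X)"
      using p X by (intro mult_right_mono) (auto simp: power2_eq_square)
    then show ?thesis by (simp add: power2_eq_square algebra_simps)
  qed
  ultimately show ?thesis
    by (elim hs_le_weaken) (simp add: mult.assoc mult_left_mono)
qed

section \<open>Curves of coefficient sequences that are continuous in a Sobolev norm\<close>

definition hs_continuous_on :: "real \<Rightarrow> real set \<Rightarrow> (real \<Rightarrow> int ^ 'd::finite \<Rightarrow> complex) \<Rightarrow> bool" where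
  "hs_continuous_on s I h \<longleftrightarrow>
    (\<forall>t\<in>I. \<forall>e>0. \<exists>\<delta>>0. \<forall>t'\<in>I. \<bar>t' - t\<bar> < \<delta> \<longrightarrow> hs_le s (\<lambda>k. h t' k - h t k) e)"

lemma hs_continuous_onD:
  assumes "hs_continuous_on s I h"
  shows "continuous_on I (\<lambda>t. h t k)"
  unfolding continuous_on_iff
proof (intro ballI allI impI)
  fix t and e :: real assume t: "t \<in> I" and e: "0 < e"
  define e' where "e' = wt s k * e / 2"
  have e': "e' > 0" using e by (simp add: e'_def)
  then obtain \<delta> where \<delta>: "\<delta> > 0" "\<And>t'. t' \<in> I \<Longrightarrow> \<bar>t' - t\<bar> < \<delta> \<Longrightarrow> hs_le s (\<lambda>k. h t' k - h t k) e'"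
    using assms t unfolding hs_continuous_on_def by meson
  have "dist (h t' k) (h t k) < e" if "t' \<in> I" "dist t' t < \<delta>" for t'
  proof -
    have "wt s k * cmod (h t' k - h t k) \<le> wt s k * (e / 2)"
      using hs_le_coord[OF \<delta>(2)[OF that(1)], of k] that(2) by (simp add: dist_real_def e'_def)
    then have "cmod (h t' k - h t k) \<le> e / 2" by (rule mult_left_le_imp_le) simp
    then show ?thesis using e by (simp add: dist_norm)
  qed
  then show "\<exists>d>0. \<forall>x'\<in>I. dist x' t < d \<longrightarrow> dist (h x' k) (h t k) < e" using \<delta>(1) by blast
qed

lemma hs_continuous_on_mono:
  assumes "hs_continuous_on s I h" "s' \<le> s" "J \<subseteq> I"
  shows "hs_continuous_on s' J h"
  unfolding hs_continuous_on_def
proof (intro ballI allI impI)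
  fix t and e :: real assume t: "t \<in> J" and e: "0 < e"
  then obtain \<delta> where "\<delta> > 0" "\<And>t'. t' \<in> I \<Longrightarrow> \<bar>t' - t\<bar> < \<delta> \<Longrightarrow> hs_le s (\<lambda>k. h t' k - h t k) e"
    using assms unfolding hs_continuous_on_def by (meson subsetD)
  then show "\<exists>\<delta>>0. \<forall>t'\<in>J. \<bar>t' - t\<bar> < \<delta> \<longrightarrow> hs_le s' (\<lambda>k. h t' k - h t k) e"
    using assms by (meson hs_le_mono order_refl subsetD)
qed

lemma hs_continuous_on_lipschitz:
  assumes "\<And>t t'. t \<in> I \<Longrightarrow> t' \<in> I \<Longrightarrow> hs_le s (\<lambda>k. h t' k - h t k) (L * \<bar>t' - t\<bar>)"
  shows "hs_continuous_on s I h"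
  unfolding hs_continuous_on_def
proof (intro ballI allI impI)
  fix t and e :: real assume t: "t \<in> I" and e: "0 < e"
  have "hs_le s (\<lambda>k. h t' k - h t k) e" if "t' \<in> I" "\<bar>t' - t\<bar> < e / (\<bar>L\<bar> + 1)" for t'
  proof (rule hs_le_weaken[OF assms[OF t that(1)]])
    have "L * \<bar>t' - t\<bar> \<le> (\<bar>L\<bar> + 1) * \<bar>t' - t\<bar>" by (intro mult_right_mono) auto
    also have "\<dots> \<le> e" using that(2) by (simp add: pos_less_divide_eq mult.commute)
    finally show "L * \<bar>t' - t\<bar> \<le> e" .
  qed
  moreover have "e / (\<bar>L\<bar> + 1) > 0" using e by (simp add: add_nonneg_pos)
  ultimately show "\<exists>\<delta>>0. \<forall>t'\<in>I. \<bar>t' - t\<bar> < \<delta> \<longrightarrow> hs_le s (\<lambda>k. h t' k - h t k) e" by blast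
qed

lemma hs_continuous_on_cubic:
  fixes h :: "real \<Rightarrow> int ^ 'd::finite \<Rightarrow> complex"
  assumes 0: "0 \<le> \<sigma>" and \<sigma>: "\<sigma> > real CARD('d) / 2"
    and h: "hs_continuous_on \<sigma> I h" and bd: "\<And>t. t \<in> I \<Longrightarrow> hs_le \<sigma> (h t) A"
  shows "hs_continuous_on \<sigma> I (\<lambda>t. cubic lam (h t))"
  unfolding hs_continuous_on_def
proof (intro ballI allI impI)
  fix t and e :: real assume t: "t \<in> I" and e: "0 < e"
  define L where "L = 3 * tri_const TYPE('d) lam \<sigma> * A\<^sup>2"
  have L: "0 \<le> L" by (simp add: L_def)
  then have "e / (L + 1) > 0" using e by simp
  then obtain \<delta> where \<delta>: "\<delta> > 0" "\<And>t'. t' \<in> I \<Longrightarrow> \<bar>t' - t\<bar> < \<delta> \<Longrightarrow> hs_le \<sigma> (\<lambda>k. h t' k - h t k) (e / (L + 1))"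
    using h t unfolding hs_continuous_on_def by meson
  have "hs_le \<sigma> (\<lambda>k. cubic lam (h t') k - cubic lam (h t) k) e" if "t' \<in> I" "\<bar>t' - t\<bar> < \<delta>" for t'
  proof (rule hs_le_weaken[OF hs_le_cubic_diff[OF 0 order_refl \<sigma> bd bd \<delta>(2)]])
    show "3 * tri_const TYPE('d) lam \<sigma> * A\<^sup>2 * (e / (L + 1)) \<le> e"
      using L e unfolding L_def[symmetric] by (simp add: field_simps)
  qed (use that t in auto)
  then show "\<exists>\<delta>>0. \<forall>t'\<in>I. \<bar>t' - t\<bar> < \<delta> \<longrightarrow> hs_le \<sigma> (\<lambda>k. cubic lam (h t') k - cubic lam (h t) k) e"
    using \<delta>(1) by blast
qed

section \<open>Fourier series on the torus\<close>

definition torus_measure :: "(real ^ 'd::finite) measure" where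
  "torus_measure = restrict_space lborel torus_box"

lemma torus_box_borel [simp, measurable]: "torus_box \<in> sets borel"
  by (simp add: torus_box_def)

lemma space_torus_measure [simp]: "space torus_measure = torus_box"
  by (simp add: torus_measure_def space_restrict_space)

lemma borel_measurable_torus [measurable (raw)]:
  "f \<in> borel_measurable borel \<Longrightarrow> f \<in> borel_measurable torus_measure"
  by (simp add: torus_measure_def measurable_restrict_space1)

lemma integral_torus_measure: "integral\<^sup>L torus_measure f = (LINT x:torus_box|lborel. f x)"
  for f :: "real ^ 'd::finite \<Rightarrow> 'b::{banach, second_countable_topology}"
  unfolding torus_measure_def set_lebesgue_integral_def by (subst integral_restrict_space) auto

lemma integrable_torus_measure: "integrable torus_measure f \<longleftrightarrow> set_integrable lborel torus_box f"
  for f :: "real ^ 'd::finite \<Rightarrow> 'b::{banach, second_countable_topology}"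
  by (simp add: torus_measure_def integrable_restrict_space set_integrable_def)

lemma AE_torus_measure: "(AE x in torus_measure. P x) \<longleftrightarrow> (AE x in lborel. x \<in> torus_box \<longrightarrow> P x)"
  for P :: "real ^ 'd::finite \<Rightarrow> bool"
  unfolding torus_measure_def by (subst AE_restrict_space_iff) auto

lemma Basis_const_inner: "b \<in> Basis \<Longrightarrow> (\<chi> i. c) \<bullet> b = c" for c :: real and b :: "real ^ 'd::finite"
  by (auto simp: Basis_vec_def inner_axis)

lemma emeasure_torus: "emeasure torus_measure (torus_box :: (real ^ 'd::finite) set) = ennreal ((2 * pi) ^ CARD('d))"
proof -
  have "emeasure lborel (torus_box :: (real ^ 'd) set) = (\<Prod>b\<in>(Basis :: (real ^ 'd) set). 2 * pi)"
    unfolding torus_box_def emeasure_lborel_cbox_eq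
    by (auto simp: Basis_const_inner inner_diff_left intro!: arg_cong[where f = ennreal] prod.cong)
  then show ?thesis
    by (simp add: torus_measure_def emeasure_restrict_space)
qed

lemma measure_torus: "measure torus_measure (torus_box :: (real ^ 'd::finite) set) = (2 * pi) ^ CARD('d)"
  by (simp add: measure_def emeasure_torus)

interpretation torus: finite_measure "torus_measure :: (real ^ 'd::finite) measure"
  by standard (simp add: emeasure_torus)

lemma fourier_exp_norm [simp]: "cmod (fourier_exp k x) = 1"
  by (simp add: fourier_exp_def)

lemma continuous_on_fourier_exp [continuous_intros]: "continuous_on S (fourier_exp k)"
  unfolding fourier_exp_def[abs_def] by (intro continuous_intros)

lemma fourier_exp_measurable [measurable]: "fourier_exp k \<in> borel_measurable borel"
  by (intro borel_measurable_continuous_onI continuous_on_fourier_exp)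

lemma fourier_exp_add: "fourier_exp (k + l) x = fourier_exp k x * fourier_exp l x"
  by (simp add: fourier_exp_def cis_mult sum.distrib distrib_right)

lemma fourier_exp_minus: "fourier_exp (- k) x = cnj (fourier_exp k x)"
  by (simp add: fourier_exp_def cis_cnj sum_negf)

lemma fourier_exp_diff: "fourier_exp (k - l) x = fourier_exp k x * cnj (fourier_exp l x)"
  using fourier_exp_add[of k "- l" x] by (simp add: fourier_exp_minus)

lemma cnj_fourier_exp_measurable [measurable]: "(\<lambda>x. cnj (fourier_exp k x)) \<in> borel_measurable borel"
  by (simp add: fourier_exp_minus[symmetric])

lemma fourier_exp_0 [simp]: "fourier_exp 0 x = 1"
  by (simp add: fourier_exp_def)

lemma fourier_exp_periodic: "fourier_exp k (x + axis i (2 * pi)) = fourier_exp k x"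
proof -
  have "(\<Sum>j\<in>UNIV. real_of_int (k $ j) * (x + axis i (2 * pi)) $ j) =
    (\<Sum>j\<in>UNIV. real_of_int (k $ j) * x $ j) + (\<Sum>j\<in>UNIV. if j = i then 2 * pi * real_of_int (k $ j) else 0)"
    unfolding sum.distrib[symmetric] by (intro sum.cong) (auto simp: axis_def algebra_simps)
  then show ?thesis by (simp add: fourier_exp_def cis_mult[symmetric] cis_multiple_2pi)
qed

lemma fourier_coeff_eq:
  "fourier_coeff u k = integral\<^sup>L torus_measure (\<lambda>x. u x * cnj (fourier_exp k x)) / of_real ((2 * pi) ^ CARD('d))"
  for u :: "real ^ 'd::finite \<Rightarrow> complex"
  by (simp add: fourier_coeff_def integral_torus_measure)

lemma integrable_torus_bounded:
  fixes u :: "real ^ 'd::finite \<Rightarrow> 'b::{banach, second_countable_topology}"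
  assumes "u \<in> borel_measurable torus_measure" "\<And>x. norm (u x) \<le> B"
  shows "integrable torus_measure u"
  by (rule torus.integrable_const_bound[of _ B]) (use assms in auto)

lemma integrable_mult_fourier_exp:
  assumes "integrable torus_measure u" shows "integrable torus_measure (\<lambda>x. u x * fourier_exp k x)"
  by (rule Bochner_Integration.integrable_bound[OF assms]) (use assms in \<open>auto simp: norm_mult\<close>)

lemma integrable_mult_cnj_fourier_exp:
  assumes "integrable torus_measure u" shows "integrable torus_measure (\<lambda>x. u x * cnj (fourier_exp k x))"
  using integrable_mult_fourier_exp[OF assms, of "- k"] by (simp add: fourier_exp_minus)

lemma fourier_coeff_cong_AE:
  assumes "AE x in torus_measure. u x = v x" "u \<in> borel_measurable borel" "v \<in> borel_measurable borel"
  shows "fourier_coeff u k = fourier_coeff v k"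
proof -
  note assms(2,3)[measurable]
  have "(\<lambda>x. u x * cnj (fourier_exp k x)) \<in> borel_measurable borel"
    "(\<lambda>x. v x * cnj (fourier_exp k x)) \<in> borel_measurable borel" by measurable
  then show ?thesis
    unfolding fourier_coeff_eq using assms(1)
    by (intro arg_cong2[where f = "(/)"] integral_cong_AE borel_measurable_torus) auto
qed

lemma ae_eq_fourier_coeff:
  assumes "ae_eq u v" "u \<in> borel_measurable borel" "v \<in> borel_measurable borel"
  shows "fourier_coeff u k = fourier_coeff v k"
  using assms by (intro fourier_coeff_cong_AE) (auto simp: ae_eq_def AE_torus_measure)

lemma fourier_coeff_add:
  assumes "integrable torus_measure u" "integrable torus_measure v"
  shows "fourier_coeff (\<lambda>x. u x + v x) k = fourier_coeff u k + fourier_coeff v k"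
  using assms by (simp add: fourier_coeff_eq distrib_right add_divide_distrib integrable_mult_cnj_fourier_exp)

lemma fourier_coeff_diff:
  assumes "integrable torus_measure u" "integrable torus_measure v"
  shows "fourier_coeff (\<lambda>x. u x - v x) k = fourier_coeff u k - fourier_coeff v k"
  using assms by (simp add: fourier_coeff_eq left_diff_distrib diff_divide_distrib integrable_mult_cnj_fourier_exp)

lemma fourier_coeff_scale: "fourier_coeff (\<lambda>x. c * u x) k = c * fourier_coeff u k"
  by (simp add: fourier_coeff_eq mult.assoc)

lemma fourier_coeff_norm_le:
  fixes u :: "real ^ 'd::finite \<Rightarrow> complex"
  assumes "u \<in> borel_measurable borel" "\<And>x. cmod (u x) \<le> B"
  shows "cmod (fourier_coeff u k) \<le> B"
proof -
  have "cmod (integral\<^sup>L torus_measure (\<lambda>x. u x * cnj (fourier_exp k x)))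
      \<le> (\<integral>x. cmod (u x * cnj (fourier_exp k x)) \<partial>torus_measure)"
    by (rule integral_norm_bound)
  also have "\<dots> \<le> (\<integral>x. B \<partial>(torus_measure :: (real ^ 'd) measure))"
    by (rule integral_mono) (use assms in \<open>auto simp: norm_mult intro!: integrable_torus_bounded[where B = B]\<close>)
  also have "\<dots> = B * (2 * pi) ^ CARD('d)" by (simp add: measure_torus)
  finally show ?thesis
    by (simp add: fourier_coeff_eq norm_divide norm_power norm_mult power_mult_distrib pos_divide_le_eq)
qed

lemma integral_cis_real:
  "(\<integral>t. indicator {- pi..pi} t *\<^sub>R cis (real_of_int n * t) \<partial>lborel) = (if n = 0 then of_real (2 * pi) else 0)"
proof (cases "n = 0")
  case True
  have "(\<integral>t. indicator {- pi..pi} t *\<^sub>R (1::complex) \<partial>lborel) = of_real pi - of_real (- pi)"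
    by (rule integral_FTC_atLeastAtMost) (auto intro!: derivative_eq_intros continuous_intros)
  then show ?thesis using True by simp
next
  case False
  have "(\<integral>t. indicator {- pi..pi} t *\<^sub>R cis (real_of_int n * t) \<partial>lborel)
     = cis (real_of_int n * pi) / (\<i> * of_int n) - cis (real_of_int n * (- pi)) / (\<i> * of_int n)"
  proof (rule integral_FTC_atLeastAtMost)
    fix t :: real
    have "((\<lambda>z. exp (\<i> * of_int n * z) / (\<i> * of_int n)) has_field_derivative
      exp (\<i> * of_int n * of_real t)) (at (of_real t))"
      using False by (auto intro!: derivative_eq_intros)
    from has_vector_derivative_real_field[OF this, of "{- pi..pi}"]
    show "((\<lambda>t. cis (real_of_int n * t) / (\<i> * of_int n)) has_vector_derivative
      cis (real_of_int n * t)) (at t within {- pi..pi})"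
      by (simp add: cis_conv_exp mult.assoc)
  qed (auto intro!: continuous_intros)
  also have "cis (real_of_int n * pi) = cis (real_of_int n * (- pi)) * cis (2 * pi * real_of_int n)"
    by (simp add: cis_mult algebra_simps)
  finally show ?thesis using False by (simp add: cis_multiple_2pi)
qed

text \<open>Lebesgue measure is the image of a product measure indexed by \<open>Basis\<close>, so
  the integral splits into one-dimensional ones, and any nonzero component of m makes one factor
  vanish.\<close>

lemma integral_fourier_exp:
  fixes m :: "int ^ 'd::finite"
  shows "integral\<^sup>L torus_measure (fourier_exp m) = (if m = 0 then of_real ((2 * pi) ^ CARD('d)) else 0)"
proof -
  \<comment> \<open>The product measure is indexed by basis vectors, not by coordinates; the
    description operator recovers the coordinate i from the vector \<open>axis i 1\<close>.\<close>
  define g where "g b t = indicator {- pi..pi} t *\<^sub>R cis (real_of_int (m $ (THE i. b = axis i 1)) * t)"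
    for b :: "real ^ 'd" and t :: real
  have idx: "(THE i. (axis j 1 :: real ^ 'd) = axis i 1) = j" for j
    by (rule the_equality) (auto simp: axis_eq_axis)
  have Basis_eq: "(Basis :: (real ^ 'd) set) = (\<lambda>i. axis i 1) ` UNIV"
    by (auto simp: Basis_vec_def)
  have inj: "inj (\<lambda>i. axis i 1 :: real ^ 'd)" by (auto simp: inj_on_def axis_eq_axis)
  have g_int: "integrable lborel (g b)" for b
    unfolding g_def by (rule borel_integrable_compact) (auto intro!: continuous_intros)
  have [measurable]: "g b \<in> borel_measurable borel" for b
    using borel_measurable_integrable[OF g_int[of b]] by simp
  have ind: "indicator torus_box x *\<^sub>R fourier_exp m x = (\<Prod>b\<in>Basis. g b (x \<bullet> b))" for x
  proof -
    have "(\<Prod>b\<in>Basis. g b (x \<bullet> b)) = (\<Prod>i\<in>UNIV. indicator {- pi..pi} (x $ i) *\<^sub>R cis (real_of_int (m $ i) * x $ i))"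
      by (simp add: Basis_eq prod.reindex[OF inj] g_def idx inner_axis)
    also have "\<dots> = (\<Prod>i\<in>UNIV. indicator {- pi..pi} (x $ i)) *\<^sub>R (\<Prod>i\<in>UNIV. cis (real_of_int (m $ i) * x $ i))"
      by (simp add: scaleR_conv_of_real prod.distrib)
    also have "(\<Prod>i\<in>UNIV. cis (real_of_int (m $ i) * x $ i)) = fourier_exp m x"
      by (simp add: fourier_exp_def cis_conv_exp exp_sum sum_distrib_left)
    also have "(\<Prod>i\<in>UNIV. indicator {- pi..pi} (x $ i)) = (indicator torus_box x :: real)"
      by (auto simp: indicator_def torus_box_def mem_box_cart)
    finally show ?thesis by simp
  qed
  interpret product_sigma_finite "\<lambda>b :: real ^ 'd. lborel :: real measure"
    by standard
  have "integral\<^sup>L torus_measure (fourier_exp m) = (\<integral>x. (\<Prod>b\<in>Basis. g b (x \<bullet> b)) \<partial>lborel)"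
    by (simp add: integral_torus_measure set_lebesgue_integral_def ind)
  also have "\<dots> = (\<integral>f. (\<Prod>b\<in>Basis. g b ((\<Sum>b\<in>Basis. f b *\<^sub>R b) \<bullet> b)) \<partial>(\<Pi>\<^sub>M b\<in>(Basis :: (real ^ 'd) set). lborel))"
    by (subst lborel_eq, subst integral_distr) auto
  also have "\<dots> = (\<integral>f. (\<Prod>b\<in>Basis. g b (f b)) \<partial>(\<Pi>\<^sub>M b\<in>(Basis :: (real ^ 'd) set). lborel))"
    by simp
  also have "\<dots> = (\<Prod>b\<in>Basis. integral\<^sup>L lborel (g b))"
    by (rule product_integral_prod) (auto intro: g_int)
  also have "\<dots> = (\<Prod>i\<in>UNIV. if m $ i = 0 then of_real (2 * pi) else 0)"
    by (simp add: Basis_eq prod.reindex[OF inj] g_def[abs_def] idx integral_cis_real)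
  also have "\<dots> = (if m = 0 then of_real ((2 * pi) ^ CARD('d)) else 0)"
    by (auto simp: vec_eq_iff)
  finally show ?thesis .
qed

section \<open>Absolutely convergent Fourier series and their coefficients\<close>

definition fser :: "(int ^ 'd::finite \<Rightarrow> complex) \<Rightarrow> real ^ 'd \<Rightarrow> complex" where
  "fser a x = (\<Sum>\<^sub>\<infinity>k. a k * fourier_exp k x)"

lemma lap_fun_eq_fser: "lap_fun g u = fser (\<lambda>k. g (- of_real (freq_sq k)) * fourier_coeff u k)"
  by (simp add: lap_fun_def fser_def fun_eq_iff)

lemma fser_summable:
  assumes "l1 a" shows "(\<lambda>k. a k * fourier_exp k x) summable_on UNIV"
proof -
  obtain A where "l1_le a A" using assms by (auto simp: l1_def)
  then have "l1_le (\<lambda>k. fourier_exp k x * a k) (1 * A)" by (rule l1_le_multiplier) auto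
  from l1_le_summable[OF this] show ?thesis by (simp add: mult.commute)
qed

lemma fser_uniform_limit:
  assumes "l1 a"
  shows "uniform_limit UNIV (\<lambda>F x. \<Sum>k\<in>F. a k * fourier_exp k x) (fser a) (finite_subsets_at_top UNIV)"
proof -
  have "uniform_limit UNIV (\<lambda>F x. \<Sum>k\<in>F. a k * fourier_exp k x) (\<lambda>x. \<Sum>\<^sub>\<infinity>k. a k * fourier_exp k x) (finite_subsets_at_top UNIV)"
    by (rule Weierstrass_m_test_general[where M = "\<lambda>k. cmod (a k)"])
       (use assms l1_le_abs_summable in \<open>auto simp: norm_mult l1_def\<close>)
  then show ?thesis by (simp add: fser_def[abs_def])
qed

lemma continuous_on_fser: "l1 a \<Longrightarrow> continuous_on S (fser a)"
  by (rule continuous_on_subset[OF uniform_limit_theorem[OF _ fser_uniform_limit]])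
     (auto intro!: always_eventually continuous_intros)

lemma borel_measurable_fser: "l1 a \<Longrightarrow> fser a \<in> borel_measurable borel"
  by (intro borel_measurable_continuous_onI continuous_on_fser)

lemma fser_norm_le:
  assumes "l1_le a A" shows "cmod (fser a x) \<le> A"
proof -
  have "l1_le (\<lambda>k. fourier_exp k x * a k) (1 * A)" by (rule l1_le_multiplier[OF assms]) auto
  from l1_le_norm_infsum[OF this] show ?thesis by (simp add: fser_def mult.commute)
qed

lemma integrable_fser:
  assumes "l1 a" shows "integrable torus_measure (fser a)"
proof -
  obtain A where "l1_le a A" using assms by (auto simp: l1_def)
  then show ?thesis
    by (intro integrable_torus_bounded[where B = A] fser_norm_le borel_measurable_torus borel_measurable_fser assms)
qed

lemma periodic_fser: "periodic_fun (fser a)"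
  by (simp add: periodic_fun_def fser_def fourier_exp_periodic)

text \<open>By orthogonality a finite partial sum whose index set contains m has the coefficient a m
  exactly; the series is a uniform limit of such sums, and a uniformly small function has small
  coefficients.\<close>

lemma fourier_coeff_fser:
  fixes a :: "int ^ 'd::finite \<Rightarrow> complex"
  assumes "l1 a" shows "fourier_coeff (fser a) m = a m"
proof -
  have fin: "fourier_coeff (\<lambda>x. \<Sum>k\<in>F. a k * fourier_exp k x) m = a m" if "finite F" "m \<in> F" for F
  proof -
    have "fourier_coeff (\<lambda>x. \<Sum>k\<in>F. a k * fourier_exp k x) m
       = integral\<^sup>L torus_measure (\<lambda>x. \<Sum>k\<in>F. a k * fourier_exp (k - m) x) / of_real ((2 * pi) ^ CARD('d))"
      by (simp add: fourier_coeff_eq sum_distrib_right mult.assoc fourier_exp_diff)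
    also have "integral\<^sup>L torus_measure (\<lambda>x. \<Sum>k\<in>F. a k * fourier_exp (k - m) x)
       = (\<Sum>k\<in>F. a k * integral\<^sup>L torus_measure (fourier_exp (k - m)))"
      by (subst Bochner_Integration.integral_sum) (auto intro!: integrable_torus_bounded[where B = 1] integrable_mult_right)
    also have "\<dots> = (\<Sum>k\<in>F. if k = m then a k * of_real ((2 * pi) ^ CARD('d)) else 0)"
      by (intro sum.cong) (auto simp: integral_fourier_exp)
    finally show ?thesis using that by simp
  qed
  have "dist (fourier_coeff (fser a) m) (a m) \<le> e" if e: "e > 0" for e
  proof -
    have "\<forall>\<^sub>F F in finite_subsets_at_top UNIV. \<forall>x. dist (\<Sum>k\<in>F. a k * fourier_exp k x) (fser a x) < e"
      using fser_uniform_limit[OF assms] e by (auto simp: uniform_limit_iff)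
    moreover have "\<forall>\<^sub>F F in finite_subsets_at_top UNIV. finite F \<and> {m} \<subseteq> F"
      by (auto simp: eventually_finite_subsets_at_top intro!: exI[of _ "{m}"])
    ultimately have "\<forall>\<^sub>F F in finite_subsets_at_top UNIV.
        (\<forall>x. dist (\<Sum>k\<in>F. a k * fourier_exp k x) (fser a x) < e) \<and> finite F \<and> {m} \<subseteq> F"
      by (rule eventually_conj)
    from eventually_happens'[OF finite_subsets_at_top_neq_bot this]
    obtain F where F: "\<And>x. dist (\<Sum>k\<in>F. a k * fourier_exp k x) (fser a x) < e" "finite F" "m \<in> F"
      by auto
    have meas: "(\<lambda>x. \<Sum>k\<in>F. a k * fourier_exp k x) \<in> borel_measurable borel" by measurable
    have int: "integrable torus_measure (\<lambda>x. \<Sum>k\<in>F. a k * fourier_exp k x)"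
      by (intro Bochner_Integration.integrable_sum integrable_mult_right integrable_torus_bounded[where B = 1]) auto
    have "fourier_coeff (fser a) m - a m = fourier_coeff (\<lambda>x. fser a x - (\<Sum>k\<in>F. a k * fourier_exp k x)) m"
      using fin[OF F(2,3)] by (simp add: fourier_coeff_diff[OF integrable_fser[OF assms] int])
    also have "cmod \<dots> \<le> e"
      using F(1) borel_measurable_fser[OF assms] meas
      by (intro fourier_coeff_norm_le) (auto simp: dist_norm norm_minus_commute intro: less_imp_le)
    finally show ?thesis by (simp add: dist_norm)
  qed
  then have "dist (fourier_coeff (fser a) m) (a m) \<le> 0" by (rule field_le_epsilon) simp
  then show ?thesis by simp
qed

lemma fser_add: "l1 a \<Longrightarrow> l1 b \<Longrightarrow> fser (\<lambda>k. a k + b k) x = fser a x + fser b x"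
  by (simp add: fser_def distrib_right infsum_add fser_summable)

lemma fser_scale: "fser (\<lambda>k. c * a k) x = c * fser a x"
  by (simp add: fser_def mult.assoc infsum_cmult_right')

lemma fser_diff: "l1 a \<Longrightarrow> l1 b \<Longrightarrow> fser (\<lambda>k. a k - b k) x = fser a x - fser b x"
  using fser_add[of a "\<lambda>k. - 1 * b k" x] fser_scale[of "- 1" b x] l1_scale[of b "- 1"] by simp

lemma fser_reflect_cnj: "fser (reflect_cnj a) x = cnj (fser a x)"
proof -
  have "fser (reflect_cnj a) x = (\<Sum>\<^sub>\<infinity>k. cnj (a (- k) * fourier_exp (- k) x))"
    by (simp add: fser_def reflect_cnj_def fourier_exp_minus)
  also have "\<dots> = (\<Sum>\<^sub>\<infinity>k. cnj (a k * fourier_exp k x))"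
    using infsum_reindex_bij_betw[OF bij_uminus, of "\<lambda>k. cnj (a k * fourier_exp k x)"] by simp
  also have "\<dots> = cnj (fser a x)" by (simp only: infsum_cnj fser_def)
  finally show ?thesis .
qed

text \<open>Fubini for an absolutely summable double series: the change of variables from (k, l) to
  (k - l, l) bounds it by the product of the two l1-norms.\<close>

lemma fser_conv:
  fixes a b :: "int ^ 'd::finite \<Rightarrow> complex"
  assumes "l1 a" "l1 b"
  shows "fser (conv a b) x = fser a x * fser b x"
proof -
  obtain A B where A: "l1_le a A" and B: "l1_le b B" using assms by (auto simp: l1_def)
  let ?f = "\<lambda>(k, l). a (k - l) * b l * fourier_exp k x"
  have "(\<lambda>p. norm (?f p)) summable_on UNIV"
  proof (rule nonneg_bdd_above_summable_on)
    show "bdd_above (sum (\<lambda>p. norm (?f p)) ` {F. F \<subseteq> UNIV \<and> finite F})"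
    proof (rule bdd_aboveI2)
      fix F :: "((int ^ 'd) \<times> (int ^ 'd)) set" assume "F \<in> {F. F \<subseteq> UNIV \<and> finite F}"
      then have F: "finite F" by simp
      define G where "G = snd ` F"
      define H where "H = (\<lambda>(k, l). k - l) ` F"
      have fin: "finite G" "finite H" using F by (auto simp: G_def H_def)
      have "(\<Sum>p\<in>F. norm (?f p)) = (\<Sum>p\<in>(\<lambda>(k, l). (k - l, l)) ` F. cmod (a (fst p)) * cmod (b (snd p)))"
        by (subst sum.reindex) (auto simp: inj_on_def norm_mult intro!: sum.cong)
      also have "\<dots> \<le> (\<Sum>p\<in>H \<times> G. cmod (a (fst p)) * cmod (b (snd p)))"
        using fin by (intro sum_mono2) (force simp: H_def G_def)+
      also have "\<dots> = (\<Sum>k\<in>H. cmod (a k)) * (\<Sum>k\<in>G. cmod (b k))"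
        by (simp add: sum_product sum.cartesian_product case_prod_beta)
      also have "\<dots> \<le> A * B"
        using l1_leD[OF A fin(2)] l1_leD[OF B fin(1)] l1_le_nonneg[OF A] by (intro mult_mono) (auto intro: sum_nonneg)
      finally show "(\<Sum>p\<in>F. norm (?f p)) \<le> A * B" .
    qed
  qed auto
  then have sm: "?f summable_on UNIV \<times> UNIV" by (simp add: abs_summable_summable)
  have "fser (conv a b) x = (\<Sum>\<^sub>\<infinity>k. \<Sum>\<^sub>\<infinity>l. a (k - l) * b l * fourier_exp k x)"
    by (simp add: fser_def conv_def infsum_cmult_left')
  also have "\<dots> = (\<Sum>\<^sub>\<infinity>l. \<Sum>\<^sub>\<infinity>k. a (k - l) * b l * fourier_exp k x)"
    by (rule infsum_swap_banach[OF sm])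
  also have "\<dots> = (\<Sum>\<^sub>\<infinity>l. \<Sum>\<^sub>\<infinity>k. (b l * fourier_exp l x) * (a k * fourier_exp k x))"
  proof (rule infsum_cong)
    fix l :: "int ^ 'd"
    have "bij (\<lambda>k. k + l)" by (rule bijI') (auto intro: exI[of _ "_ - l"])
    from infsum_reindex_bij_betw[OF this, of "\<lambda>k. a (k - l) * b l * fourier_exp k x"]
    show "(\<Sum>\<^sub>\<infinity>k. a (k - l) * b l * fourier_exp k x) = (\<Sum>\<^sub>\<infinity>k. (b l * fourier_exp l x) * (a k * fourier_exp k x))"
      by (simp add: fourier_exp_add algebra_simps)
  qed
  also have "\<dots> = fser a x * fser b x"
    by (simp add: fser_def infsum_cmult_left' infsum_cmult_right' mult.commute)
  finally show ?thesis .
qed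

lemma nls_f_fser:
  assumes "l1 a" shows "nls_f lam (fser a) = fser (cubic lam a)"
proof
  fix x
  have "fser (cubic lam a) x = - \<i> * of_real lam * fser (conv (conv a a) (reflect_cnj a)) x"
    unfolding cubic_def tri_def[abs_def] by (rule fser_scale)
  also have "\<dots> = - \<i> * of_real lam * (fser a x * fser a x * cnj (fser a x))"
    using assms by (simp add: fser_conv fser_reflect_cnj l1_conv l1_reflect_cnj)
  finally have "fser (cubic lam a) x = - \<i> * of_real lam * (fser a x * fser a x * cnj (fser a x))" .
  then show "nls_f lam (fser a) x = fser (cubic lam a) x"
    by (simp add: nls_f_def complex_norm_square mult_ac flip: of_real_power)
qed

section \<open>Uniqueness of Fourier coefficients\<close>

text \<open>The functions that are to be shown zero almost everywhere. Stated with all characters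
  instead of coefficients, the class is visibly closed under multiplication by characters.\<close>

definition fourier_null :: "(real ^ 'd::finite \<Rightarrow> complex) \<Rightarrow> bool" where
  "fourier_null v \<longleftrightarrow> integrable torus_measure v \<and>
    (\<forall>k. integral\<^sup>L torus_measure (\<lambda>x. v x * fourier_exp k x) = 0)"

text \<open>Points that differ by a period have the same image, the image of the box is compact, and
  real polynomials in the real and imaginary parts of the coordinates pull back to trigonometric
  polynomials. This brings the Stone-Weierstrass theorem to bear on periodic functions.\<close>

definition torus_map :: "real ^ 'd::finite \<Rightarrow> complex ^ 'd" where
  "torus_map x = (\<chi> i. cis (x $ i))"

lemma continuous_on_torus_map [continuous_intros]: "continuous_on S torus_map"
  unfolding torus_map_def by (intro continuous_intros)

lemma torus_map_measurable [measurable]: "torus_map \<in> borel_measurable borel"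
  by (intro borel_measurable_continuous_onI continuous_on_torus_map)

lemma fourier_null_integrable: "fourier_null v \<Longrightarrow> integrable torus_measure v"
  by (simp add: fourier_null_def)

lemma fourier_null_integral: "fourier_null v \<Longrightarrow> integral\<^sup>L torus_measure v = 0"
  unfolding fourier_null_def by (auto dest: spec[of _ 0])

lemma fourier_null_add: "fourier_null u \<Longrightarrow> fourier_null v \<Longrightarrow> fourier_null (\<lambda>x. u x + v x)"
  by (simp add: fourier_null_def distrib_right integrable_mult_fourier_exp)

lemma fourier_null_scale: "fourier_null u \<Longrightarrow> fourier_null (\<lambda>x. c * u x)"
  by (simp add: fourier_null_def mult.assoc)

lemma fourier_null_fourier_exp: "fourier_null u \<Longrightarrow> fourier_null (\<lambda>x. u x * fourier_exp k x)"
  by (simp add: fourier_null_def integrable_mult_fourier_exp mult.assoc flip: fourier_exp_add)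

lemma fourier_null_sum:
  "(\<And>i. i \<in> I \<Longrightarrow> fourier_null (u i)) \<Longrightarrow> fourier_null (\<lambda>x. \<Sum>i\<in>I. u i x)"
  by (induction I rule: infinite_finite_induct) (auto intro: fourier_null_add, auto simp: fourier_null_def)

text \<open>By Euler's formulas the pulled-back coordinates are the cosine and the sine of
  \<open>x $ i\<close>, each a combination of two characters.\<close>

lemma fourier_null_coordinate:
  fixes u :: "real ^ 'd::finite \<Rightarrow> complex"
  assumes "fourier_null u" "b \<in> Basis"
  shows "fourier_null (\<lambda>x. u x * of_real (torus_map x \<bullet> b))"
proof -
  obtain i and c :: complex where b: "b = axis i c" and c: "c \<in> Basis"
    using assms(2) by (auto simp: Basis_vec_def)
  have e: "fourier_exp (axis i 1) x = cis (x $ i)" "fourier_exp (- axis i 1) x = cis (- x $ i)" for x :: "real ^ 'd"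
    by (simp_all add: fourier_exp_def axis_def if_distrib[of "\<lambda>z. real_of_int z * _"] if_distrib[of real_of_int]
        if_distribR sum.delta cong: if_cong)
      (simp_all add: fourier_exp_def axis_def if_distrib if_distribR cong: if_cong)
  consider "c = 1" | "c = \<i>" using c by (auto simp: Basis_complex_def)
  then show ?thesis
  proof cases
    case 1
    have eq: "of_real (torus_map x \<bullet> b) = 1/2 * fourier_exp (axis i 1) x + 1/2 * fourier_exp (- axis i 1) x" for x
      by (auto simp: e b 1 torus_map_def inner_axis inner_complex_def complex_eq_iff)
    have "(\<lambda>x. u x * of_real (torus_map x \<bullet> b))
      = (\<lambda>x. 1/2 * (u x * fourier_exp (axis i 1) x) + 1/2 * (u x * fourier_exp (- axis i 1) x))"
      by (intro ext, subst eq) (simp add: algebra_simps)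
    then show ?thesis
      using assms(1) by (simp only: fourier_null_add fourier_null_scale fourier_null_fourier_exp)
  next
    case 2
    have eq: "of_real (torus_map x \<bullet> b) = (- \<i>/2) * fourier_exp (axis i 1) x + \<i>/2 * fourier_exp (- axis i 1) x" for x
      by (auto simp: e b 2 torus_map_def inner_axis inner_complex_def complex_eq_iff)
    have "(\<lambda>x. u x * of_real (torus_map x \<bullet> b))
      = (\<lambda>x. (- \<i>/2) * (u x * fourier_exp (axis i 1) x) + \<i>/2 * (u x * fourier_exp (- axis i 1) x))"
      by (intro ext, subst eq) (simp add: algebra_simps)
    then show ?thesis
      using assms(1) by (simp only: fourier_null_add fourier_null_scale fourier_null_fourier_exp)
  qed
qed

text \<open>Induction over the generation of polynomials. The function u is generalized because a
  product is handled by multiplying first by one factor and then by the other.\<close>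

lemma fourier_null_polynomial:
  fixes u :: "real ^ 'd::finite \<Rightarrow> complex"
  assumes "real_polynomial_function p" "fourier_null u"
  shows "fourier_null (\<lambda>x. u x * of_real (p (torus_map x)))"
  using assms
proof (induction p arbitrary: u rule: real_polynomial_function.induct)
  case (linear f)
  have feq: "f z = (\<Sum>b\<in>Basis. (z \<bullet> b) * f b)" for z
  proof -
    have "f z = f (\<Sum>b\<in>Basis. (z \<bullet> b) *\<^sub>R b)" by (simp add: euclidean_representation)
    also have "\<dots> = (\<Sum>b\<in>Basis. (z \<bullet> b) * f b)"
      by (simp only: bounded_linear.linear[OF linear(1)] linear_sum linear_scale real_scaleR_def)
    finally show ?thesis .
  qed
  have "(\<lambda>x. u x * of_real (f (torus_map x))) =
     (\<lambda>x. \<Sum>b\<in>Basis. of_real (f b) * (u x * of_real (torus_map x \<bullet> b)))"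
    by (intro ext, subst feq) (simp add: sum_distrib_left mult_ac)
  then show ?case
    using linear by (simp only: fourier_null_sum fourier_null_scale fourier_null_coordinate)
next
  case (const c)
  then show ?case using fourier_null_scale[of u "of_real c"] by (simp add: mult.commute)
next
  case (add f g)
  then show ?case using fourier_null_add by (fastforce simp: distrib_left)
next
  case (mult f g)
  then show ?case using mult.IH(2)[OF mult.IH(1)[OF mult.prems]] by (simp add: mult.assoc)
qed

text \<open>Stone-Weierstrass on the compact image of the box: replacing g by a polynomial within e
  costs at most e times the L1-norm of u, and the polynomial contributes nothing.\<close>

lemma fourier_null_continuous:
  fixes u :: "real ^ 'd::finite \<Rightarrow> complex" and g :: "complex ^ 'd \<Rightarrow> real"
  assumes u: "fourier_null u" and g: "continuous_on UNIV g" and bd: "\<And>z. \<bar>g z\<bar> \<le> B"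
  shows "integral\<^sup>L torus_measure (\<lambda>x. u x * of_real (g (torus_map x))) = 0"
proof -
  define I where "I = (\<integral>x. cmod (u x) \<partial>torus_measure)"
  have ui: "integrable torus_measure u" using u by (rule fourier_null_integrable)
  have I0: "I \<ge> 0" by (simp add: I_def)
  have [measurable]: "u \<in> borel_measurable torus_measure" using ui by auto
  have [measurable]: "g \<in> borel_measurable borel" using g by (rule borel_measurable_continuous_onI)
  have gZ: "(\<lambda>x. of_real (g (torus_map x)) :: complex) \<in> borel_measurable torus_measure"
    by (rule borel_measurable_torus) measurable
  have int: "integrable torus_measure (\<lambda>x. u x * of_real (g (torus_map x)))"
  proof (rule Bochner_Integration.integrable_bound)
    show "integrable torus_measure (\<lambda>x. of_real B * u x)" using ui by simp
    show "(\<lambda>x. u x * of_real (g (torus_map x))) \<in> borel_measurable torus_measure" using gZ by simp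
    have "\<bar>g z\<bar> \<le> \<bar>B\<bar>" for z using bd[of z] by linarith
    then show "AE x in torus_measure. norm (u x * of_real (g (torus_map x))) \<le> norm (of_real B * u x)"
      by (intro AE_I2) (simp add: norm_mult mult.commute[of "cmod (u _)"] mult_right_mono)
  qed
  have "cmod (integral\<^sup>L torus_measure (\<lambda>x. u x * of_real (g (torus_map x)))) \<le> e * I" if "e > 0" for e
  proof -
    have cS: "compact (torus_map ` (torus_box :: (real ^ 'd) set))"
      by (intro compact_continuous_image continuous_on_torus_map) (simp add: torus_box_def)
    obtain p where p: "real_polynomial_function p" "\<And>z. z \<in> torus_map ` torus_box \<Longrightarrow> \<bar>g z - p z\<bar> < e"
      by (rule Stone_Weierstrass_real_polynomial_function[OF cS continuous_on_subset[OF g] \<open>e > 0\<close>]) auto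
    have up: "fourier_null (\<lambda>x. u x * of_real (p (torus_map x)))"
      by (rule fourier_null_polynomial[OF p(1) u])
    have "integral\<^sup>L torus_measure (\<lambda>x. u x * of_real (g (torus_map x)))
       = integral\<^sup>L torus_measure (\<lambda>x. u x * of_real (g (torus_map x)) - u x * of_real (p (torus_map x)))"
      by (subst Bochner_Integration.integral_diff[OF int fourier_null_integrable[OF up]])
         (simp add: fourier_null_integral[OF up])
    also have "cmod \<dots> \<le> (\<integral>x. cmod (u x * of_real (g (torus_map x)) - u x * of_real (p (torus_map x))) \<partial>torus_measure)"
      by (rule integral_norm_bound)
    also have "\<dots> \<le> (\<integral>x. e * cmod (u x) \<partial>torus_measure)"
    proof (rule integral_mono)
      show "integrable torus_measure (\<lambda>x. cmod (u x * of_real (g (torus_map x)) - u x * of_real (p (torus_map x))))"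
        using int fourier_null_integrable[OF up] by simp
      fix x assume "x \<in> space (torus_measure :: (real ^ 'd) measure)"
      then have "\<bar>g (torus_map x) - p (torus_map x)\<bar> \<le> e" using p(2)[of "torus_map x"] by auto
      then have "cmod (of_real (g (torus_map x) - p (torus_map x)) * u x) \<le> e * cmod (u x)"
        unfolding norm_mult norm_of_real by (intro mult_right_mono) auto
      then show "cmod (u x * of_real (g (torus_map x)) - u x * of_real (p (torus_map x))) \<le> e * cmod (u x)"
        by (simp add: algebra_simps)
    qed (use ui in auto)
    finally show ?thesis by (simp add: I_def)
  qed
  then have "cmod (integral\<^sup>L torus_measure (\<lambda>x. u x * of_real (g (torus_map x)))) \<le> 0 + e" if "e > 0" for e
  proof -
    \<comment> \<open>Dividing by I + 1 instead of I covers the case that the L1-norm of u is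
      0.\<close>
    have "e / (I + 1) * I \<le> e" "e / (I + 1) > 0" using that I0 by (auto simp: field_simps)
    then show ?thesis using \<open>\<And>e. e > 0 \<Longrightarrow> _ e\<close>[of "e / (I + 1)"] by simp
  qed
  then have "cmod (integral\<^sup>L torus_measure (\<lambda>x. u x * of_real (g (torus_map x)))) \<le> 0"
    by (rule field_le_epsilon)
  then show ?thesis by simp
qed

text \<open>A Dynkin argument. Closed sets form an intersection-stable generator, and their
  indicators are bounded pointwise limits of continuous functions of the distance. Complements
  follow by linearity, disjoint unions by dominated convergence.\<close>

lemma fourier_null_borel:
  fixes u :: "real ^ 'd::finite \<Rightarrow> complex"
  assumes u: "fourier_null u" and A: "A \<in> sets borel"
  shows "integral\<^sup>L torus_measure (\<lambda>x. u x * indicator A (torus_map x)) = 0"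
proof -
  have ui: "integrable torus_measure u" using u by (rule fourier_null_integrable)
  have [measurable]: "u \<in> borel_measurable torus_measure" using ui by auto
  have ind: "(\<lambda>x. indicator A (torus_map x) :: complex) \<in> borel_measurable torus_measure"
    if [measurable]: "A \<in> sets borel" for A :: "(complex ^ 'd) set"
    by (rule borel_measurable_torus) measurable
  have int: "integrable torus_measure (\<lambda>x. u x * indicator A (torus_map x))"
    if "A \<in> sets borel" for A :: "(complex ^ 'd) set"
    by (rule Bochner_Integration.integrable_bound[OF ui]) (use ind[OF that] in \<open>auto simp: indicator_def\<close>)
  have sets_eq: "sigma_sets UNIV (Collect closed) = sets (borel :: (complex ^ 'd) measure)"
    by (simp add: borel_eq_closed)
  have stable: "Int_stable (Collect closed :: (complex ^ 'd) set set)"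
    by (auto simp: Int_stable_def)
  from A have A': "A \<in> sigma_sets UNIV (Collect closed)" by (simp add: sets_eq)
  have "Collect closed \<subseteq> Pow (UNIV :: (complex ^ 'd) set)" by simp
  from stable this A' show ?thesis
  proof (induction rule: sigma_sets_induct_disjoint)
    case (basic K)
    then have K: "closed K" by simp
    show ?case
    proof (cases "K = {}")
      case False
      define g where "g n z = max 0 (1 - real n * infdist z K)" for n z
      have g01: "0 \<le> g n z" "g n z \<le> 1" for n z by (auto simp: g_def infdist_nonneg)
      have g_lim: "(\<lambda>n. g n z) \<longlonglongrightarrow> indicator K z" for z
      proof (cases "z \<in> K")
        case True
        then have "infdist z K = 0" by simp
        then show ?thesis using True by (simp add: g_def)
      next
        case z: False
        then have pos: "infdist z K > 0"
          using in_closed_iff_infdist_zero[OF K False] infdist_nonneg[of z K] by (metis less_le)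
        have "\<forall>\<^sub>F n in sequentially. g n z = 0"
        proof -
          obtain N :: nat where N: "1 / infdist z K < real N" using reals_Archimedean2 by blast
          have "g n z = 0" if "n \<ge> N" for n
          proof -
            have "1 / infdist z K < real n" using N that by (meson less_le_trans of_nat_mono)
            then show ?thesis using pos by (auto simp: g_def field_simps)
          qed
          then show ?thesis by (auto simp: eventually_sequentially)
        qed
        then show ?thesis using z by (simp add: tendsto_eventually)
      qed
      have "(\<lambda>n. integral\<^sup>L torus_measure (\<lambda>x. u x * of_real (g n (torus_map x))))
        \<longlonglongrightarrow> integral\<^sup>L torus_measure (\<lambda>x. u x * indicator K (torus_map x))"
      proof (rule integral_dominated_convergence[where w = "\<lambda>x. cmod (u x)"])
        show "(\<lambda>x. u x * indicator K (torus_map x)) \<in> borel_measurable torus_measure"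
          using ind[of K] K by simp
        show "(\<lambda>x. u x * of_real (g n (torus_map x))) \<in> borel_measurable torus_measure" for n
        proof -
          have [measurable]: "g n \<in> borel_measurable borel"
            unfolding g_def by (intro borel_measurable_continuous_onI continuous_intros)
          have "(\<lambda>x. of_real (g n (torus_map x)) :: complex) \<in> borel_measurable torus_measure"
            by (rule borel_measurable_torus) measurable
          then show ?thesis by simp
        qed
        show "integrable torus_measure (\<lambda>x. cmod (u x))" using ui by simp
        show "AE x in torus_measure. (\<lambda>n. u x * of_real (g n (torus_map x))) \<longlonglongrightarrow> u x * indicator K (torus_map x)"
        proof (intro AE_I2 tendsto_mult tendsto_const)
          fix x :: "real ^ 'd"
          have "(\<lambda>n. of_real (g n (torus_map x)) :: complex) \<longlonglongrightarrow> of_real (indicator K (torus_map x))"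
            by (intro tendsto_of_real g_lim)
          then show "(\<lambda>n. of_real (g n (torus_map x)) :: complex) \<longlonglongrightarrow> indicator K (torus_map x)"
            by (cases "torus_map x \<in> K") simp_all
        qed
        show "AE x in torus_measure. norm (u x * of_real (g n (torus_map x))) \<le> cmod (u x)" for n
          using g01 by (auto simp: norm_mult mult_left_le)
      qed
      moreover have "integral\<^sup>L torus_measure (\<lambda>x. u x * of_real (g n (torus_map x))) = 0" for n
        by (rule fourier_null_continuous[OF u, of _ 1])
           (use g01 in \<open>auto simp: g_def intro!: continuous_intros\<close>)
      ultimately show ?thesis by (simp add: LIMSEQ_const_iff)
    qed simp
  next
    case (compl A)
    then have A: "A \<in> sets borel" by (simp add: sets_eq)
    have "(\<lambda>x. u x * indicator (UNIV - A) (torus_map x)) = (\<lambda>x. u x - u x * indicator A (torus_map x))"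
      by (auto simp: indicator_def fun_eq_iff)
    then show ?case
      using compl int[OF A] ui by (simp add: fourier_null_integral[OF u])
  next
    case (union A)
    then have A: "A i \<in> sets borel" for i by (auto simp: sets_eq)
    have "(\<lambda>n. integral\<^sup>L torus_measure (\<lambda>x. u x * indicator (\<Union>i<n. A i) (torus_map x)))
        \<longlonglongrightarrow> integral\<^sup>L torus_measure (\<lambda>x. u x * indicator (\<Union>i. A i) (torus_map x))"
    proof (rule integral_dominated_convergence[where w = "\<lambda>x. cmod (u x)"])
      show "(\<lambda>x. u x * indicator (\<Union>i. A i) (torus_map x)) \<in> borel_measurable torus_measure"
        using int[of "\<Union>i. A i"] A by auto
      show "(\<lambda>x. u x * indicator (\<Union>i<n. A i) (torus_map x)) \<in> borel_measurable torus_measure" for n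
        using int[of "\<Union>i<n. A i"] A by auto
      show "integrable torus_measure (\<lambda>x. cmod (u x))" using ui by simp
      show "AE x in torus_measure. (\<lambda>n. u x * indicator (\<Union>i<n. A i) (torus_map x)) \<longlonglongrightarrow> u x * indicator (\<Union>i. A i) (torus_map x)"
        by (intro AE_I2 tendsto_mult tendsto_const LIMSEQ_indicator_UN)
      show "AE x in torus_measure. norm (u x * indicator (\<Union>i<n. A i) (torus_map x)) \<le> cmod (u x)" for n
        by (auto simp: indicator_def)
    qed
    moreover have "integral\<^sup>L torus_measure (\<lambda>x. u x * indicator (\<Union>i<n. A i) (torus_map x)) = 0" for n
    proof -
      have dj: "disjoint_family_on A {..<n}"
        using union.hyps(1) unfolding disjoint_family_on_def by auto
      have "integral\<^sup>L torus_measure (\<lambda>x. u x * indicator (\<Union>i<n. A i) (torus_map x))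
        = integral\<^sup>L torus_measure (\<lambda>x. \<Sum>i<n. u x * indicator (A i) (torus_map x))"
        by (simp add: indicator_UN_disjoint[OF _ dj] sum_distrib_left)
      also have "\<dots> = (\<Sum>i<n. integral\<^sup>L torus_measure (\<lambda>x. u x * indicator (A i) (torus_map x)))"
        by (rule Bochner_Integration.integral_sum) (auto intro: int A)
      finally show ?thesis using union by simp
    qed
    ultimately show ?case by (simp add: LIMSEQ_const_iff)
  qed auto
qed

text \<open>On the open box \<open>torus_map\<close> is inverted by \<open>Arg\<close> in each
  coordinate; the discarded boundary is a null set.\<close>

lemma AE_torus_interior: "AE x :: real ^ 'd::finite in torus_measure. \<forall>i. - pi < x $ i \<and> x $ i < pi"
proof -
  let ?a = "(\<chi> i. - pi) :: real ^ 'd" and ?b = "(\<chi> i. pi) :: real ^ 'd"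
  have "emeasure lborel (cbox ?a ?b - box ?a ?b) = emeasure lborel (cbox ?a ?b) - emeasure lborel (box ?a ?b)"
    by (rule emeasure_Diff[OF less_imp_neq[OF emeasure_lborel_box_finite]]) (auto simp: box_subset_cbox)
  also have "\<dots> = 0"
    by (simp add: emeasure_lborel_cbox_eq emeasure_lborel_box_eq)
  finally have "AE x in lborel. x \<notin> cbox ?a ?b - box ?a ?b"
    by (intro AE_not_in) (auto simp: null_sets_def)
  then show ?thesis
    by (auto simp: AE_torus_measure torus_box_def mem_box_cart elim!: eventually_mono)
qed

text \<open>The set where Re u > 0 has to be expressed through a Borel set A of values of
  \<open>torus_map\<close>. On the product of slit planes the coordinatewise \<open>Arg\<close> is a
  continuous inverse, so A is Borel and its preimage agrees with that set on the open box. Then the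
  integral of the positive part of Re u vanishes.\<close>

lemma fourier_null_Re_nonpos:
  fixes u :: "real ^ 'd::finite \<Rightarrow> complex"
  assumes u: "fourier_null u" and [measurable]: "u \<in> borel_measurable borel"
  shows "AE x in torus_measure. Re (u x) \<le> 0"
proof -
  define U where "U = {z :: complex ^ 'd. \<forall>i. z $ i \<notin> \<real>\<^sub>\<le>\<^sub>0}"
  define Q where "Q = (\<lambda>z :: complex ^ 'd. (\<chi> i. Arg (z $ i)) :: real ^ 'd)"
  have "open U"
  proof -
    have "U = (\<Inter>i\<in>UNIV. (\<lambda>z. z $ i) -` (- \<real>\<^sub>\<le>\<^sub>0))" by (auto simp: U_def)
    also have "open \<dots>"
      by (intro open_INT ballI open_vimage continuous_intros) (auto intro: closed_nonpos_Reals_complex)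
    finally show ?thesis .
  qed
  then have U: "U \<in> sets borel" by simp
  have "continuous_on U Q" unfolding Q_def by (intro continuous_intros) (auto simp: U_def)
  then have [measurable]: "(\<lambda>z. if z \<in> U then Q z else 0) \<in> borel_measurable borel"
    by (intro borel_measurable_continuous_on_if U continuous_intros)
  define A where "A = {z \<in> space borel. z \<in> U \<and> Re (u (if z \<in> U then Q z else 0)) > 0}"
  have A: "A \<in> sets borel" unfolding A_def using U by measurable
  have QZ: "torus_map x \<in> U \<and> Q (torus_map x) = x" if "\<forall>i. - pi < x $ i \<and> x $ i < pi" for x
  proof
    show "Q (torus_map x) = x"
      using that by (auto simp: Q_def torus_map_def vec_eq_iff intro!: Arg_cis less_imp_le)
    have "cis (x $ i) \<notin> \<real>\<^sub>\<le>\<^sub>0" for i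
    proof
      assume "cis (x $ i) \<in> \<real>\<^sub>\<le>\<^sub>0"
      then have "Arg (cis (x $ i)) = pi"
        by (metis Arg_eq_pi cis_neq_zero complex_nonpos_Reals_iff complex_eqI less_le norm_cis zero_complex.sel)
      then show False using that by (auto simp: Arg_cis less_imp_le dest: spec[of _ i])
    qed
    then show "torus_map x \<in> U" by (simp add: U_def torus_map_def)
  qed
  have ui: "integrable torus_measure u" using u by (rule fourier_null_integrable)
  have "0 = Re (integral\<^sup>L torus_measure (\<lambda>x. u x * indicator A (torus_map x)))"
    using fourier_null_borel[OF u A] by simp
  also have "integral\<^sup>L torus_measure (\<lambda>x. u x * indicator A (torus_map x))
     = integral\<^sup>L torus_measure (\<lambda>x. u x * indicator {x. Re (u x) > 0} x)"
  proof (rule integral_cong_AE)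
    note A[measurable]
    show "(\<lambda>x. u x * indicator A (torus_map x)) \<in> borel_measurable torus_measure"
      by (rule borel_measurable_torus) measurable
    show "(\<lambda>x. u x * indicator {x. Re (u x) > 0} x) \<in> borel_measurable torus_measure"
      by (rule borel_measurable_torus) measurable
    show "AE x in torus_measure. u x * indicator A (torus_map x) = u x * indicator {x. Re (u x) > 0} x"
      using AE_torus_interior by eventually_elim (use QZ in \<open>auto simp: A_def indicator_def\<close>)
  qed
  also have "Re \<dots> = (\<integral>x. max 0 (Re (u x)) \<partial>torus_measure)"
  proof -
    have int: "integrable torus_measure (\<lambda>x. u x * indicator {x. Re (u x) > 0} x)"
    proof (rule Bochner_Integration.integrable_bound[OF ui])
      show "(\<lambda>x. u x * indicator {x. Re (u x) > 0} x) \<in> borel_measurable torus_measure"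
        by (rule borel_measurable_torus) measurable
    qed (auto simp: indicator_def)
    show ?thesis
      by (subst integral_Re[OF int, symmetric]) (auto simp: indicator_def max_def intro!: Bochner_Integration.integral_cong)
  qed
  finally have "(\<integral>x. max 0 (Re (u x)) \<partial>torus_measure) = 0" by simp
  moreover have "integrable torus_measure (\<lambda>x. max 0 (Re (u x)))" using ui by auto
  ultimately have "AE x in torus_measure. max 0 (Re (u x)) = 0"
    by (subst (asm) integral_nonneg_eq_0_iff_AE) auto
  then show ?thesis by eventually_elim (auto simp: max_def split: if_splits)
qed

lemma fourier_null_AE_zero:
  assumes u: "fourier_null u" and [measurable]: "u \<in> borel_measurable borel"
  shows "AE x in torus_measure. u x = 0"
proof -
  have *: "AE x in torus_measure. Re (c * u x) \<le> 0" for c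
    by (rule fourier_null_Re_nonpos[OF fourier_null_scale[OF u]]) measurable
  \<comment> \<open>The four multipliers bound the real and the imaginary part of u from both
    sides.\<close>
  from *[of 1] *[of "- 1"] *[of \<i>] *[of "- \<i>"] show ?thesis
    by eventually_elim (auto simp: complex_eq_iff)
qed

lemma AE_eq_fser_fourier_coeff:
  assumes [measurable]: "u \<in> borel_measurable borel" and ui: "integrable torus_measure u" and l1: "l1 (fourier_coeff u)"
  shows "AE x in torus_measure. u x = fser (fourier_coeff u) x"
proof -
  let ?v = "\<lambda>x. u x - fser (fourier_coeff u) x"
  have [measurable]: "fser (fourier_coeff u) \<in> borel_measurable borel" by (rule borel_measurable_fser[OF l1])
  have vi: "integrable torus_measure ?v" using ui integrable_fser[OF l1] by simp
  have "fourier_coeff ?v k = 0" for k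
    by (simp add: fourier_coeff_diff[OF ui integrable_fser[OF l1]] fourier_coeff_fser[OF l1])
  from this[of "- _"] have "fourier_null ?v"
    using vi by (auto simp: fourier_null_def fourier_coeff_eq fourier_exp_minus)
  then have "AE x in torus_measure. ?v x = 0" by (rule fourier_null_AE_zero) measurable
  then show ?thesis by eventually_elim simp
qed

section \<open>Sobolev spaces on the Fourier side\<close>

lemma hs_le_infsum:
  assumes "(\<lambda>k. (1 + freq_sq k) powr s * (cmod (a k))\<^sup>2) summable_on UNIV"
  shows "hs_le s a (sqrt (\<Sum>\<^sub>\<infinity>k. (1 + freq_sq k) powr s * (cmod (a k))\<^sup>2))"
proof (rule hs_leI, goal_cases)
  case (1 F)
  have "(\<Sum>k\<in>F. (wt s k * cmod (a k))\<^sup>2) \<le> (\<Sum>\<^sub>\<infinity>k. (1 + freq_sq k) powr s * (cmod (a k))\<^sup>2)"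
    unfolding power_mult_distrib wt_power2 by (rule finite_sum_le_infsum[OF assms]) (use 1 in auto)
  then show ?case by (simp add: L2_set_def)
qed

lemma hs_le_sum_le:
  assumes "hs_le s a B" "finite F"
  shows "(\<Sum>k\<in>F. (1 + freq_sq k) powr s * (cmod (a k))\<^sup>2) \<le> B\<^sup>2"
proof -
  have "sqrt (\<Sum>k\<in>F. (wt s k * cmod (a k))\<^sup>2) \<le> B"
    using hs_leD[OF assms] by (simp add: L2_set_def)
  then have "(sqrt (\<Sum>k\<in>F. (wt s k * cmod (a k))\<^sup>2))\<^sup>2 \<le> B\<^sup>2"
    by (rule power_mono) (simp add: sum_nonneg)
  then show ?thesis by (simp add: sum_nonneg power_mult_distrib wt_power2)
qed

lemma hs_le_summable:
  assumes "hs_le s a B"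
  shows "(\<lambda>k. (1 + freq_sq k) powr s * (cmod (a k))\<^sup>2) summable_on UNIV"
  by (rule nonneg_bdd_above_summable_on)
     (use hs_le_sum_le[OF assms] in \<open>auto intro!: bdd_aboveI2[where M = "B\<^sup>2"]\<close>)

lemma sobolev_norm_le:
  assumes "hs_le s (fourier_coeff u) B" shows "sobolev_norm s u \<le> B"
proof -
  have "(\<Sum>\<^sub>\<infinity>k. (1 + freq_sq k) powr s * (cmod (fourier_coeff u k))\<^sup>2) \<le> B\<^sup>2"
    by (rule infsum_le_finite_sums[OF hs_le_summable[OF assms] hs_le_sum_le[OF assms]])
  then show ?thesis unfolding sobolev_norm_def
    using hs_le_nonneg[OF assms] by (simp add: real_le_lsqrt)
qed

lemma sobolev_norm_nonneg: "0 \<le> sobolev_norm s u"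
  by (simp add: sobolev_norm_def infsum_nonneg)

lemma sobolev_space_measurable [measurable_dest]: "u \<in> sobolev_space s \<Longrightarrow> u \<in> borel_measurable borel"
  by (simp add: sobolev_space_def)

lemma sobolev_space_integrable:
  fixes u :: "real ^ 'd::finite \<Rightarrow> complex"
  assumes "u \<in> sobolev_space s" shows "integrable torus_measure u"
proof (rule Bochner_Integration.integrable_bound)
  have "integrable torus_measure (\<lambda>x. (cmod (u x))\<^sup>2)"
    using assms by (simp add: sobolev_space_def integrable_torus_measure)
  then show "integrable torus_measure (\<lambda>x. 1 + (cmod (u x))\<^sup>2)" by simp
  show "u \<in> borel_measurable torus_measure"
    using assms by (intro borel_measurable_torus sobolev_space_measurable)
  have "cmod (u x) \<le> 1 + (cmod (u x))\<^sup>2" for x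
    using zero_le_power2[of "cmod (u x) - 1/2"] by (simp add: power2_eq_square algebra_simps)
  then show "AE x in torus_measure. norm (u x) \<le> norm (1 + (cmod (u x))\<^sup>2)" by auto
qed

lemma sobolev_space_hs_le: "u \<in> sobolev_space s \<Longrightarrow> hs_le s (fourier_coeff u) (sobolev_norm s u)"
  unfolding sobolev_norm_def by (intro hs_le_infsum) (simp add: sobolev_space_def)

text \<open>An infinite sum that does not converge has the value 0, so \<open>sobolev_norm\<close>
  bounds the coefficients only once summability is known; for the difference it comes from the
  bounds for u and v.\<close>

lemma sobolev_space_diff_hs_le:
  assumes "u \<in> sobolev_space s" "v \<in> sobolev_space s"
  shows "hs_le s (\<lambda>k. fourier_coeff u k - fourier_coeff v k) (sobolev_norm s (\<lambda>x. u x - v x))"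
  unfolding sobolev_norm_def
    fourier_coeff_diff[OF sobolev_space_integrable[OF assms(1)] sobolev_space_integrable[OF assms(2)]]
  by (intro hs_le_infsum hs_le_summable[OF hs_le_diff[OF sobolev_space_hs_le[OF assms(1)] sobolev_space_hs_le[OF assms(2)]]])

lemma fser_in_sobolev_space:
  fixes a :: "int ^ 'd::finite \<Rightarrow> complex"
  assumes a: "hs_le s a B" and s: "s > real CARD('d) / 2"
  shows "fser a \<in> sobolev_space s"
proof -
  have l1: "l1 a" by (rule hs_le_imp_l1[OF a s])
  then obtain A where A: "l1_le a A" by (auto simp: l1_def)
  have coeff: "fourier_coeff (fser a) = a" by (simp add: fun_eq_iff fourier_coeff_fser[OF l1])
  note borel_measurable_fser[OF l1, measurable]
  have "integrable torus_measure (\<lambda>x. (cmod (fser a x))\<^sup>2)"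
  proof (rule integrable_torus_bounded[where B = "A\<^sup>2"])
    show "(\<lambda>x. (cmod (fser a x))\<^sup>2) \<in> borel_measurable torus_measure"
      by (rule borel_measurable_torus) measurable
  qed (simp add: fser_norm_le[OF A] power_mono)
  then show ?thesis
    using hs_le_summable[OF a] by (simp add: sobolev_space_def periodic_fser coeff integrable_torus_measure)
qed

lemma sobolev_continuous_on_imp:
  assumes "sobolev_continuous_on s I W"
  shows "hs_continuous_on s I (\<lambda>t. fourier_coeff (W t))"
  unfolding hs_continuous_on_def
proof (intro ballI allI impI)
  fix t and e :: real assume t: "t \<in> I" and e: "0 < e"
  have "((\<lambda>r. sobolev_norm s (\<lambda>x. W r x - W t x)) \<longlongrightarrow> 0) (at t within I)"
    using assms t by (auto simp: sobolev_continuous_on_def)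
  then obtain \<delta> where \<delta>: "\<delta> > 0"
    "\<And>r. r \<in> I \<Longrightarrow> r \<noteq> t \<Longrightarrow> dist r t < \<delta> \<Longrightarrow> dist (sobolev_norm s (\<lambda>x. W r x - W t x)) 0 < e"
    using e unfolding tendsto_iff eventually_at by (auto simp: Ball_def)
  have "hs_le s (\<lambda>k. fourier_coeff (W r) k - fourier_coeff (W t) k) e" if "r \<in> I" "\<bar>r - t\<bar> < \<delta>" for r
  proof (cases "r = t")
    case False
    then have "sobolev_norm s (\<lambda>x. W r x - W t x) \<le> e" using \<delta>(2)[OF that(1)] that by (auto simp: dist_real_def)
    then show ?thesis
      using assms t that by (intro hs_le_weaken[OF sobolev_space_diff_hs_le]) (auto simp: sobolev_continuous_on_def)
  qed (use e in simp)
  then show "\<exists>\<delta>>0. \<forall>t'\<in>I. \<bar>t' - t\<bar> < \<delta> \<longrightarrow> hs_le s (\<lambda>k. fourier_coeff (W t') k - fourier_coeff (W t) k) e"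
    using \<delta>(1) by blast
qed

lemma sobolev_continuous_on_fser:
  fixes h :: "real \<Rightarrow> int ^ 'd::finite \<Rightarrow> complex"
  assumes h: "hs_continuous_on s I h" and bd: "\<And>t. t \<in> I \<Longrightarrow> hs_le s (h t) B" and s: "s > real CARD('d) / 2"
  shows "sobolev_continuous_on s I (\<lambda>t. fser (h t))"
  unfolding sobolev_continuous_on_def
proof (intro conjI ballI)
  fix t assume t: "t \<in> I"
  show "fser (h t) \<in> sobolev_space s" by (rule fser_in_sobolev_space[OF bd[OF t] s])
  show "((\<lambda>r. sobolev_norm s (\<lambda>x. fser (h r) x - fser (h t) x)) \<longlongrightarrow> 0) (at t within I)"
    unfolding tendsto_iff eventually_at
  proof (intro allI impI)
    fix e :: real assume e: "0 < e"
    then obtain \<delta> where \<delta>: "\<delta> > 0" "\<And>t'. t' \<in> I \<Longrightarrow> \<bar>t' - t\<bar> < \<delta> \<Longrightarrow> hs_le s (\<lambda>k. h t' k - h t k) (e / 2)"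
      using h t unfolding hs_continuous_on_def by (meson half_gt_zero)
    have "sobolev_norm s (\<lambda>x. fser (h r) x - fser (h t) x) < e" if "r \<in> I" "\<bar>r - t\<bar> < \<delta>" for r
    proof -
      have l: "l1 (h r)" "l1 (h t)" using bd that t s hs_le_imp_l1 by blast+
      then have "fourier_coeff (\<lambda>x. fser (h r) x - fser (h t) x) k = h r k - h t k" for k
        by (simp add: fourier_coeff_diff integrable_fser fourier_coeff_fser)
      then have "hs_le s (fourier_coeff (\<lambda>x. fser (h r) x - fser (h t) x)) (e / 2)"
        using \<delta>(2)[OF that] by (rule_tac hs_le_subst) auto
      from sobolev_norm_le[OF this] e show ?thesis by simp
    qed
    then show "\<exists>d>0. \<forall>x\<in>I. x \<noteq> t \<and> dist x t < d \<longrightarrow> dist (sobolev_norm s (\<lambda>y. fser (h x) y - fser (h t) y)) 0 < e"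
      using \<delta>(1) by (intro exI[of _ \<delta>]) (auto simp: dist_real_def abs_of_nonneg[OF sobolev_norm_nonneg])
  qed
qed

lemma AE_eq_fser_sobolev:
  fixes u :: "real ^ 'd::finite \<Rightarrow> complex"
  assumes "u \<in> sobolev_space s" "s > real CARD('d) / 2"
  shows "AE x in torus_measure. u x = fser (fourier_coeff u) x"
  using assms
  by (intro AE_eq_fser_fourier_coeff sobolev_space_measurable sobolev_space_integrable
      hs_le_imp_l1[OF sobolev_space_hs_le])

lemma nls_f_measurable:
  assumes [measurable]: "u \<in> borel_measurable borel" shows "nls_f lam u \<in> borel_measurable borel"
  unfolding nls_f_def[abs_def] by measurable

text \<open>Coefficients ignore null sets, so u may be replaced by its absolutely convergent series,
  for which the pointwise cubic expression becomes a convolution.\<close>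

lemma fourier_coeff_nls_f:
  fixes u :: "real ^ 'd::finite \<Rightarrow> complex"
  assumes u: "u \<in> sobolev_space s" and s: "s > real CARD('d) / 2"
  shows "fourier_coeff (nls_f lam u) = cubic lam (fourier_coeff u)"
proof
  fix k
  have l1: "l1 (fourier_coeff u)" by (rule hs_le_imp_l1[OF sobolev_space_hs_le[OF u] s])
  have "fourier_coeff (nls_f lam u) k = fourier_coeff (nls_f lam (fser (fourier_coeff u))) k"
  proof (rule fourier_coeff_cong_AE)
    show "AE x in torus_measure. nls_f lam u x = nls_f lam (fser (fourier_coeff u)) x"
      using AE_eq_fser_sobolev[OF u s] by eventually_elim (simp add: nls_f_def)
  qed (auto intro!: nls_f_measurable sobolev_space_measurable[OF u] borel_measurable_fser l1)
  then show "fourier_coeff (nls_f lam u) k = cubic lam (fourier_coeff u) k"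
    using l1 by (simp add: nls_f_fser fourier_coeff_fser l1_cubic)
qed

lemma hs_continuous_on_multiplier:
  fixes g :: "real \<Rightarrow> int ^ 'd::finite \<Rightarrow> complex"
  assumes g: "hs_continuous_on s I g" and bd: "\<And>t. t \<in> I \<Longrightarrow> hs_le s (g t) B" and c: "0 \<le> c"
    and m: "\<And>t k. t \<in> I \<Longrightarrow> cmod (m t k) \<le> c"
    and lip: "\<And>t t' k. t \<in> I \<Longrightarrow> t' \<in> I \<Longrightarrow> cmod (m t' k - m t k) \<le> c * \<bar>t' - t\<bar>"
  shows "hs_continuous_on s I (\<lambda>t k. m t k * g t k)"
  unfolding hs_continuous_on_def
proof (intro ballI allI impI)
  fix t and e :: real assume t: "t \<in> I" and e: "0 < e"
  have B: "0 \<le> B" using hs_le_nonneg[OF bd[OF t]] .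
  define e' where "e' = e / (2 * (c + 1))"
  have e': "e' > 0" "c * e' \<le> e / 2" using e c by (auto simp: e'_def field_simps)
  obtain \<delta> where \<delta>: "\<delta> > 0" "\<And>t'. t' \<in> I \<Longrightarrow> \<bar>t' - t\<bar> < \<delta> \<Longrightarrow> hs_le s (\<lambda>k. g t' k - g t k) e'"
    using g t e' unfolding hs_continuous_on_def by meson
  define \<delta>' where "\<delta>' = e / (2 * (c * B + 1))"
  have \<delta>': "\<delta>' > 0" using e c B by (auto simp: \<delta>'_def intro!: divide_pos_pos mult_pos_pos add_nonneg_pos)
  have "hs_le s (\<lambda>k. m t' k * g t' k - m t k * g t k) e" if t': "t' \<in> I" "\<bar>t' - t\<bar> < min \<delta> \<delta>'" for t'
  proof -
    have "hs_le s (\<lambda>k. m t' k * (g t' k - g t k)) (c * e')"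
      using t' by (intro hs_le_multiplier \<delta> m c) auto
    moreover have "hs_le s (\<lambda>k. (m t' k - m t k) * g t k) ((c * \<bar>t' - t\<bar>) * B)"
      using t' t c by (intro hs_le_multiplier bd lip) auto
    ultimately have "hs_le s (\<lambda>k. m t' k * (g t' k - g t k) + (m t' k - m t k) * g t k) (c * e' + (c * \<bar>t' - t\<bar>) * B)"
      by (rule hs_le_add)
    then show ?thesis
    proof (rule hs_le_subst)
      have "(c * \<bar>t' - t\<bar>) * B \<le> (c * B + 1) * \<delta>'"
        using t' c B \<delta>' by (auto simp: distrib_right mult.assoc mult.commute[of B] intro!: add_increasing2 mult_left_mono mult_right_mono)
      also have "\<dots> = e / 2"
      proof -
        have "c * B + 1 \<noteq> 0" using mult_nonneg_nonneg[OF c B] by linarith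
        moreover have "D * (e / (2 * D)) = e / 2" if "D \<noteq> 0" for D :: real using that by simp
        ultimately show ?thesis unfolding \<delta>'_def by blast
      qed
      finally show "c * e' + (c * \<bar>t' - t\<bar>) * B \<le> e" using e' by simp
    qed (simp add: algebra_simps)
  qed
  then show "\<exists>\<delta>>0. \<forall>t'\<in>I. \<bar>t' - t\<bar> < \<delta> \<longrightarrow> hs_le s (\<lambda>k. m t' k * g t' k - m t k * g t k) e"
    using \<delta>(1) \<delta>' by (intro exI[of _ "min \<delta> \<delta>'"]) auto
qed

text \<open>The partial Fourier sums converge uniformly in time, since on a compact interval the continuous
  curve \<open>h\<close> has uniformly small tails in \<open>\<ell>\<^sup>1\<close>.\<close>

lemma integral_fser:
  fixes h :: "real \<Rightarrow> int ^ 'd::finite \<Rightarrow> complex"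
  assumes h: "hs_continuous_on s {a..b} h" and bd: "\<And>t. t \<in> {a..b} \<Longrightarrow> hs_le s (h t) B"
    and s: "s > real CARD('d) / 2"
  shows "integral {a..b} (\<lambda>t. fser (h t) x) = fser (\<lambda>k. integral {a..b} (\<lambda>t. h t k)) x"
proof -
  let ?f = "\<lambda>F t. \<Sum>k\<in>F. h t k * fourier_exp k x"
  let ?c = "sob_const TYPE('d) s"
  have l1: "l1 (h t)" if "t \<in> {a..b}" for t by (rule hs_le_imp_l1[OF bd[OF that] s])
  have unif: "uniform_limit {a..b} ?f (\<lambda>t. fser (h t) x) (finite_subsets_at_top UNIV)"
    unfolding uniform_limit_iff
  proof (intro allI impI)
    fix e :: real assume e: "e > 0"
    define P where "P t \<delta> F \<longleftrightarrow> \<delta> > 0 \<and> finite F \<and> (\<forall>G t'. t' \<in> {a..b} \<longrightarrow> \<bar>t' - t\<bar> < \<delta> \<longrightarrow> finite G \<longrightarrow> F \<subseteq> G \<longrightarrow>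
        dist (?f G t') (fser (h t') x) < e)" for t \<delta> F
    have ex: "\<exists>\<delta> F. P t \<delta> F" if t: "t \<in> {a..b}" for t
    proof -
      have "e / (3 * ?c) > 0" using e by simp
      then obtain \<delta> where \<delta>: "\<delta> > 0"
        "\<And>t'. t' \<in> {a..b} \<Longrightarrow> \<bar>t' - t\<bar> < \<delta> \<Longrightarrow> hs_le s (\<lambda>k. h t' k - h t k) (e / (3 * ?c))"
        using h t unfolding hs_continuous_on_def by meson
      have "((\<lambda>F. ?f F t) \<longlongrightarrow> fser (h t) x) (finite_subsets_at_top UNIV)"
        unfolding fser_def by (rule infsum_tendsto[OF fser_summable[OF l1[OF t]]])
      then have "\<forall>\<^sub>F F in finite_subsets_at_top UNIV. dist (?f F t) (fser (h t) x) < e / 3"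
        by (rule tendstoD) (use e in simp)
      then obtain F where F: "finite F" "\<And>G. finite G \<Longrightarrow> F \<subseteq> G \<Longrightarrow> dist (?f G t) (fser (h t) x) < e / 3"
        by (auto simp: eventually_finite_subsets_at_top)
      have "dist (?f G t') (fser (h t') x) < e" if t': "t' \<in> {a..b}" "\<bar>t' - t\<bar> < \<delta>" "finite G" "F \<subseteq> G" for G t'
      proof -
        have d: "l1_le (\<lambda>k. h t' k - h t k) (e / 3)"
          using hs_le_imp_l1_le[OF \<delta>(2)[OF t'(1,2)] s] by (simp add: less_imp_neq[OF sob_const_pos, symmetric])
        have "cmod (fser (h t) x - fser (h t') x) \<le> e / 3"
          using fser_norm_le[OF d, of x] l1[OF t] l1[OF t'(1)] by (simp add: fser_diff norm_minus_commute)
        moreover have "cmod (?f G t' - ?f G t) \<le> e / 3"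
        proof -
          have "cmod (?f G t' - ?f G t) = cmod (\<Sum>k\<in>G. (h t' k - h t k) * fourier_exp k x)"
            by (simp add: sum_subtractf left_diff_distrib)
          also have "\<dots> \<le> (\<Sum>k\<in>G. cmod (h t' k - h t k))"
            by (rule order_trans[OF norm_sum]) (simp add: norm_mult)
          also have "\<dots> \<le> e / 3" by (rule l1_leD[OF d t'(3)])
          finally show ?thesis .
        qed
        moreover have "cmod (?f G t - fser (h t) x) < e / 3" using F(2)[OF t'(3,4)] by (simp add: dist_norm)
        ultimately show ?thesis
          using dist_triangle[of "?f G t'" "fser (h t') x" "?f G t"] dist_triangle[of "?f G t" "fser (h t') x" "fser (h t) x"]
          by (simp add: dist_norm[symmetric] dist_commute)
      qed
      then show ?thesis using \<delta>(1) F(1) by (intro exI[of _ \<delta>] exI[of _ F]) (auto simp: P_def)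
    qed
    then obtain \<delta> F where "\<And>t. t \<in> {a..b} \<Longrightarrow> P t (\<delta> t) (F t)" by metis
    then have \<delta>F: "\<And>t. t \<in> {a..b} \<Longrightarrow> \<delta> t > (0::real)" "\<And>t. t \<in> {a..b} \<Longrightarrow> finite (F t)"
      "\<And>t G t'. t \<in> {a..b} \<Longrightarrow> t' \<in> {a..b} \<Longrightarrow> \<bar>t' - t\<bar> < \<delta> t \<Longrightarrow> finite G \<Longrightarrow> F t \<subseteq> G \<Longrightarrow>
        dist (?f G t') (fser (h t') x) < e"
      by (auto simp: P_def)
    obtain T where T: "T \<subseteq> {a..b}" "finite T" "{a..b} \<subseteq> (\<Union>t\<in>T. ball t (\<delta> t))"
    proof (rule compactE_image[of "{a..b}" "{a..b}" "\<lambda>t. ball t (\<delta> t)"])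
      show "{a..b} \<subseteq> (\<Union>c\<in>{a..b}. ball c (\<delta> c))" using \<delta>F(1) by force
    qed auto
    have fin: "finite (\<Union>t\<in>T. F t)" using T \<delta>F(2) by auto
    have "\<forall>t\<in>{a..b}. dist (?f G t) (fser (h t) x) < e" if "finite G" "(\<Union>t\<in>T. F t) \<subseteq> G" for G
    proof
      fix t assume t: "t \<in> {a..b}"
      then obtain t0 where "t0 \<in> T" "\<bar>t - t0\<bar> < \<delta> t0"
        using T(3) by (force simp: dist_real_def abs_minus_commute)
      then show "dist (?f G t) (fser (h t) x) < e"
        using \<delta>F(3)[of t0 t G] T(1) t that by blast
    qed
    then show "\<forall>\<^sub>F G in finite_subsets_at_top UNIV. \<forall>t\<in>{a..b}. dist (?f G t) (fser (h t) x) < e"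
      using fin by (auto simp: eventually_finite_subsets_at_top intro!: exI[of _ "\<Union>t\<in>T. F t"])
  qed
  have cont: "continuous_on {a..b} (\<lambda>t. h t k)" for k by (rule hs_continuous_onD[OF h])
  obtain I J where IJ: "\<And>F. (?f F has_integral I F) {a..b}" "((\<lambda>t. fser (h t) x) has_integral J) {a..b}"
    "(I \<longlongrightarrow> J) (finite_subsets_at_top UNIV)"
  proof (rule uniform_limit_integral[OF unif])
    show "continuous_on {a..b} (?f F)" for F by (intro continuous_intros cont)
  qed auto
  have "I F = (\<Sum>k\<in>F. integral {a..b} (\<lambda>t. h t k) * fourier_exp k x)" if "finite F" for F
  proof (rule has_integral_unique[OF IJ(1)])
    show "(?f F has_integral (\<Sum>k\<in>F. integral {a..b} (\<lambda>t. h t k) * fourier_exp k x)) {a..b}"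
      by (intro has_integral_sum that has_integral_mult_left integrable_integral integrable_continuous_interval cont)
  qed
  then have "((\<lambda>F. \<Sum>k\<in>F. integral {a..b} (\<lambda>t. h t k) * fourier_exp k x) \<longlongrightarrow> J) (finite_subsets_at_top UNIV)"
    by (intro Lim_transform_eventually[OF IJ(3)] eventually_finite_subsets_at_top_weakI) auto
  then have "((\<lambda>k. integral {a..b} (\<lambda>t. h t k) * fourier_exp k x) has_sum J) UNIV"
    by (simp add: has_sum_def)
  then show ?thesis using IJ(2) by (simp add: fser_def infsumI integral_unique)
qed

section \<open>Stage equations\<close>

text \<open>The improvement from X to A + X/2 has the fixed point 2A, and iterating it contracts any
  starting bound to it. As the starting bound disappears from the conclusion, an arbitrarily crude
  one will do.\<close>

lemma hs_le_contraction_family: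
  fixes A :: real
  assumes X: "\<And>t. t \<in> I \<Longrightarrow> hs_le s (a t) X"
    and step: "\<And>X t. (\<And>t. t \<in> I \<Longrightarrow> hs_le s (a t) X) \<Longrightarrow> t \<in> I \<Longrightarrow> hs_le s (a t) (A + X / 2)"
    and t: "t \<in> I"
  shows "hs_le s (a t) (2 * A)"
proof -
  have iter: "hs_le s (a t) (2 * A + (X - 2 * A) / 2 ^ n)" if "t \<in> I" for t n
    using that
  proof (induction n arbitrary: t)
    case (Suc n)
    have eq: "A + (2 * A + (X - 2 * A) / 2 ^ n) / 2 = 2 * A + (X - 2 * A) / 2 ^ Suc n"
      by (simp add: field_simps)
    show ?case using step[OF Suc.IH Suc.prems] unfolding eq .
  qed (simp add: X)
  have "(\<lambda>n. 2 * A + (X - 2 * A) / 2 ^ n) \<longlonglongrightarrow> 2 * A + 0"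
    by (intro tendsto_intros LIMSEQ_divide_realpow_zero) simp
  then show ?thesis
    by (intro hs_le_const_lim[of s "a t" _ sequentially]) (auto simp: iter t)
qed

text \<open>The value of \<W> on the mode k. It is purely imaginary, which is why bounds on the
  coefficient functions are required on the imaginary axis only.\<close>

definition freq_arg :: "real \<Rightarrow> int ^ 'd::finite \<Rightarrow> complex" where
  "freq_arg dk k = \<i> * of_real dk * (- of_real (freq_sq k))"

lemma Re_freq_arg [simp]: "Re (freq_arg dk k) = 0"
  by (simp add: freq_arg_def)

lemma norm_freq_arg: "0 \<le> dk \<Longrightarrow> cmod (freq_arg dk k) = dk * freq_sq k"
  by (simp add: freq_arg_def norm_mult)

lemma continuous_on_lipschitz_bound:
  fixes f :: "real \<Rightarrow> complex"
  assumes "\<And>x y. x \<in> S \<Longrightarrow> y \<in> S \<Longrightarrow> cmod (f x - f y) \<le> c * \<bar>x - y\<bar>" "0 \<le> c"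
  shows "continuous_on S f"
  by (rule lipschitz_on_continuous_on[of c], rule lipschitz_onI) (use assms in \<open>auto simp: dist_norm\<close>)

text \<open>What the theory of the stage equations needs: boundedness and Lipschitz dependence on
  the stage variables, uniformly on the imaginary axis and hence in the step size and the frequency.
  One constant, at least 1, serves for everything.\<close>

locale ep_regular =
  fixes C :: C_coeff and A :: A_coeff and cm :: real
  assumes cm: "1 \<le> cm"
    and C_bound: "\<And>\<tau> z. Re z = 0 \<Longrightarrow> \<tau> \<in> {0..1} \<Longrightarrow> cmod (C \<tau> z) \<le> cm"
    and A_bound: "\<And>\<tau> \<sigma> z. Re z = 0 \<Longrightarrow> \<tau> \<in> {0..1} \<Longrightarrow> \<sigma> \<in> {0..1} \<Longrightarrow> cmod (A \<tau> \<sigma> z) \<le> cm"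
    and C_lipschitz: "\<And>\<tau> \<tau>' z. Re z = 0 \<Longrightarrow> \<tau> \<in> {0..1} \<Longrightarrow> \<tau>' \<in> {0..1} \<Longrightarrow>
      cmod (C \<tau>' z - C \<tau> z) \<le> cm * \<bar>\<tau>' - \<tau>\<bar>"
    and A_lipschitz_left: "\<And>\<tau> \<tau>' \<sigma> z. Re z = 0 \<Longrightarrow> \<tau> \<in> {0..1} \<Longrightarrow> \<tau>' \<in> {0..1} \<Longrightarrow> \<sigma> \<in> {0..1} \<Longrightarrow>
      cmod (A \<tau>' \<sigma> z - A \<tau> \<sigma> z) \<le> cm * \<bar>\<tau>' - \<tau>\<bar>"
    and A_lipschitz_right: "\<And>\<tau> \<sigma> \<sigma>' z. Re z = 0 \<Longrightarrow> \<tau> \<in> {0..1} \<Longrightarrow> \<sigma> \<in> {0..1} \<Longrightarrow> \<sigma>' \<in> {0..1} \<Longrightarrow>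
      cmod (A \<tau> \<sigma>' z - A \<tau> \<sigma> z) \<le> cm * \<bar>\<sigma>' - \<sigma>\<bar>"
begin

lemma cm_nonneg [simp]: "0 \<le> cm"
  using cm by linarith

lemma continuous_on_A: "Re z = 0 \<Longrightarrow> \<tau> \<in> {0..1} \<Longrightarrow> continuous_on {0..1} (\<lambda>\<sigma>. A \<tau> \<sigma> z)"
  by (rule continuous_on_lipschitz_bound[where c = cm]) (auto intro: A_lipschitz_right)

definition stage_int :: "real \<Rightarrow> (real \<Rightarrow> int ^ 'd::finite \<Rightarrow> complex) \<Rightarrow> real \<Rightarrow> int ^ 'd \<Rightarrow> complex" where
  "stage_int dk g \<tau> k = integral {0..1} (\<lambda>\<sigma>. A \<tau> \<sigma> (freq_arg dk k) * g \<sigma> k)"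

definition stage_map :: "real \<Rightarrow> real \<Rightarrow> real \<Rightarrow> (int ^ 'd::finite \<Rightarrow> complex) \<Rightarrow> (real \<Rightarrow> int ^ 'd \<Rightarrow> complex) \<Rightarrow>
    real \<Rightarrow> int ^ 'd \<Rightarrow> complex" where
  "stage_map lam \<epsilon> dk a U \<tau> k =
     C \<tau> (freq_arg dk k) * a k + of_real (\<epsilon> * dk) * stage_int dk (\<lambda>\<sigma>. cubic lam (U \<sigma>)) \<tau> k"

lemma stage_int_integrable:
  "\<tau> \<in> {0..1} \<Longrightarrow> continuous_on {0..1} (\<lambda>\<sigma>. g \<sigma> k) \<Longrightarrow>
    (\<lambda>\<sigma>. A \<tau> \<sigma> (freq_arg dk k) * g \<sigma> k) integrable_on {0..1}"
  by (intro integrable_continuous_interval continuous_intros continuous_on_A) auto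

lemma stage_int_diff:
  assumes "\<tau> \<in> {0..1}" "continuous_on {0..1} (\<lambda>\<sigma>. g \<sigma> k)" "continuous_on {0..1} (\<lambda>\<sigma>. h \<sigma> k)"
  shows "stage_int dk g \<tau> k - stage_int dk h \<tau> k = stage_int dk (\<lambda>\<sigma> k. g \<sigma> k - h \<sigma> k) \<tau> k"
  unfolding stage_int_def right_diff_distrib
  by (rule Henstock_Kurzweil_Integration.integral_diff[symmetric]) (intro stage_int_integrable assms)+

lemma hs_le_stage_int:
  assumes "\<tau> \<in> {0..1}" "\<And>\<sigma>. \<sigma> \<in> {0..1} \<Longrightarrow> hs_le s (g \<sigma>) G" "\<And>k. continuous_on {0..1} (\<lambda>\<sigma>. g \<sigma> k)"
  shows "hs_le s (stage_int dk g \<tau>) (cm * G)"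
proof -
  have "hs_le s (\<lambda>k. integral {0..1} (\<lambda>\<sigma>. A \<tau> \<sigma> (freq_arg dk k) * g \<sigma> k)) ((1 - 0) * (cm * G))"
  proof (rule hs_le_integral)
    fix \<sigma> :: real assume "\<sigma> \<in> {0..1}"
    then show "hs_le s (\<lambda>k. A \<tau> \<sigma> (freq_arg dk k) * g \<sigma> k) (cm * G)"
      using assms by (intro hs_le_multiplier A_bound) auto
  qed (use assms in \<open>auto intro!: continuous_intros continuous_on_A\<close>)
  then show ?thesis by (simp add: stage_int_def[abs_def])
qed

lemma hs_le_stage_int_lipschitz:
  assumes \<tau>: "\<tau> \<in> {0..1}" "\<tau>' \<in> {0..1}" and g: "\<And>\<sigma>. \<sigma> \<in> {0..1} \<Longrightarrow> hs_le s (g \<sigma>) G"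
    and c: "\<And>k. continuous_on {0..1} (\<lambda>\<sigma>. g \<sigma> k)"
  shows "hs_le s (\<lambda>k. stage_int dk g \<tau>' k - stage_int dk g \<tau> k) (cm * \<bar>\<tau>' - \<tau>\<bar> * G)"
proof -
  have "hs_le s (\<lambda>k. integral {0..1} (\<lambda>\<sigma>. (A \<tau>' \<sigma> (freq_arg dk k) - A \<tau> \<sigma> (freq_arg dk k)) * g \<sigma> k))
    ((1 - 0) * ((cm * \<bar>\<tau>' - \<tau>\<bar>) * G))"
  proof (rule hs_le_integral)
    fix \<sigma> :: real assume "\<sigma> \<in> {0..1}"
    then show "hs_le s (\<lambda>k. (A \<tau>' \<sigma> (freq_arg dk k) - A \<tau> \<sigma> (freq_arg dk k)) * g \<sigma> k) (cm * \<bar>\<tau>' - \<tau>\<bar> * G)"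
      using \<tau> g by (intro hs_le_multiplier A_lipschitz_left) auto
  qed (use assms in \<open>auto intro!: continuous_intros continuous_on_A\<close>)
  moreover have "integral {0..1} (\<lambda>\<sigma>. (A \<tau>' \<sigma> (freq_arg dk k) - A \<tau> \<sigma> (freq_arg dk k)) * g \<sigma> k)
      = stage_int dk g \<tau>' k - stage_int dk g \<tau> k" for k
    unfolding stage_int_def left_diff_distrib
    by (rule Henstock_Kurzweil_Integration.integral_diff) (intro stage_int_integrable \<tau> c)+
  ultimately show ?thesis by simp
qed

lemma hs_le_C: "\<tau> \<in> {0..1} \<Longrightarrow> hs_le s a B \<Longrightarrow> hs_le s (\<lambda>k. C \<tau> (freq_arg dk k) * a k) (cm * B)"
  by (intro hs_le_multiplier C_bound) auto

lemma hs_le_stage_map: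
  assumes "\<tau> \<in> {0..1}" "hs_le s a Y" "\<And>\<sigma>. \<sigma> \<in> {0..1} \<Longrightarrow> hs_le s (cubic lam (U \<sigma>)) G"
    "\<And>k. continuous_on {0..1} (\<lambda>\<sigma>. cubic lam (U \<sigma>) k)" "0 \<le> \<epsilon>" "0 \<le> dk"
  shows "hs_le s (stage_map lam \<epsilon> dk a U \<tau>) (cm * Y + \<epsilon> * dk * (cm * G))"
proof -
  have "hs_le s (\<lambda>k. C \<tau> (freq_arg dk k) * a k + of_real (\<epsilon> * dk) * stage_int dk (\<lambda>\<sigma>. cubic lam (U \<sigma>)) \<tau> k)
    (cm * Y + cmod (of_real (\<epsilon> * dk)) * (cm * G))"
    by (intro hs_le_add hs_le_C hs_le_scale hs_le_stage_int assms)
  then show ?thesis using assms by (simp add: stage_map_def[abs_def] norm_mult)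
qed

lemma hs_le_stage_map_lipschitz:
  assumes "\<tau> \<in> {0..1}" "\<tau>' \<in> {0..1}" "hs_le s a Y" "\<And>\<sigma>. \<sigma> \<in> {0..1} \<Longrightarrow> hs_le s (cubic lam (U \<sigma>)) G"
    "\<And>k. continuous_on {0..1} (\<lambda>\<sigma>. cubic lam (U \<sigma>) k)" "0 \<le> \<epsilon>" "0 \<le> dk"
  shows "hs_le s (\<lambda>k. stage_map lam \<epsilon> dk a U \<tau>' k - stage_map lam \<epsilon> dk a U \<tau> k)
    ((cm * Y + \<epsilon> * dk * (cm * G)) * \<bar>\<tau>' - \<tau>\<bar>)"
proof -
  let ?g = "\<lambda>\<sigma>. cubic lam (U \<sigma>)"
  have "hs_le s (\<lambda>k. (C \<tau>' (freq_arg dk k) - C \<tau> (freq_arg dk k)) * a k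
      + of_real (\<epsilon> * dk) * (stage_int dk ?g \<tau>' k - stage_int dk ?g \<tau> k))
    ((cm * \<bar>\<tau>' - \<tau>\<bar>) * Y + cmod (of_real (\<epsilon> * dk)) * (cm * \<bar>\<tau>' - \<tau>\<bar> * G))"
    using assms by (intro hs_le_add hs_le_multiplier hs_le_scale hs_le_stage_int_lipschitz C_lipschitz) auto
  then show ?thesis
    using assms by (elim hs_le_subst) (simp_all add: stage_map_def norm_mult algebra_simps)
qed

lemma hs_le_stage_map_diff:
  fixes a b :: "int ^ 'd::finite \<Rightarrow> complex"
  assumes \<tau>: "\<tau> \<in> {0..1}" and ab: "hs_le s (\<lambda>k. a k - b k) E"
    and d: "\<And>\<sigma>. \<sigma> \<in> {0..1} \<Longrightarrow> hs_le s (\<lambda>k. cubic lam (U \<sigma>) k - cubic lam (V \<sigma>) k) G"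
    and c: "\<And>k. continuous_on {0..1} (\<lambda>\<sigma>. cubic lam (U \<sigma>) k)" "\<And>k. continuous_on {0..1} (\<lambda>\<sigma>. cubic lam (V \<sigma>) k)"
    and \<epsilon>: "0 \<le> \<epsilon>" "0 \<le> dk"
  shows "hs_le s (\<lambda>k. stage_map lam \<epsilon> dk a U \<tau> k - stage_map lam \<epsilon> dk b V \<tau> k) (cm * E + \<epsilon> * dk * (cm * G))"
proof -
  have "hs_le s (\<lambda>k. C \<tau> (freq_arg dk k) * (a k - b k) +
      of_real (\<epsilon> * dk) * stage_int dk (\<lambda>\<sigma> k. cubic lam (U \<sigma>) k - cubic lam (V \<sigma>) k) \<tau> k)
    (cm * E + cmod (of_real (\<epsilon> * dk)) * (cm * G))"
    by (intro hs_le_add hs_le_C hs_le_scale hs_le_stage_int \<tau> ab d continuous_on_diff c)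
  then show ?thesis
    using \<epsilon> by (elim hs_le_subst)
      (simp_all add: stage_map_def norm_mult algebra_simps stage_int_diff[OF \<tau> c, symmetric])
qed

text \<open>V solves the stage equations up to the residual \<delta>. Smallness of \<epsilon> dk
  makes the nonlinear part of the difference at most half of its bound, so the contraction lemma
  applies with the crude start B + B. The solutions are bounded in H^r, while the error is measured
  in the possibly weaker H^s.\<close>

lemma stage_stability:
  fixes a b :: "int ^ 'd::finite \<Rightarrow> complex"
  assumes s: "0 \<le> s" "s \<le> r" and r: "r > real CARD('d) / 2"
    and U: "hs_continuous_on r {0..1} U" "\<And>\<tau>. \<tau> \<in> {0..1} \<Longrightarrow> hs_le r (U \<tau>) B"
    and V: "hs_continuous_on r {0..1} V" "\<And>\<tau>. \<tau> \<in> {0..1} \<Longrightarrow> hs_le r (V \<tau>) B"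
    and eqU: "\<And>\<tau> k. \<tau> \<in> {0..1} \<Longrightarrow> U \<tau> k = stage_map lam \<epsilon> dk a U \<tau> k"
    and eqV: "\<And>\<tau> k. \<tau> \<in> {0..1} \<Longrightarrow> V \<tau> k = stage_map lam \<epsilon> dk b V \<tau> k + \<delta> \<tau> k"
    and \<delta>: "\<And>\<tau>. \<tau> \<in> {0..1} \<Longrightarrow> hs_le s (\<delta> \<tau>) D"
    and ab: "hs_le s (\<lambda>k. a k - b k) E" and \<epsilon>: "0 \<le> \<epsilon>" "0 \<le> dk"
    and small: "\<epsilon> * dk * (cm * (3 * tri_const TYPE('d) lam r * B\<^sup>2)) \<le> 1 / 2"
    and \<tau>: "\<tau> \<in> {0..1}"
  shows "hs_le s (\<lambda>k. U \<tau> k - V \<tau> k) (2 * (cm * E + D))"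
proof (rule hs_le_contraction_family[where a = "\<lambda>\<tau> k. U \<tau> k - V \<tau> k" and I = "{0..1}" and X = "B + B"])
  fix t :: real assume t: "t \<in> {0..1}"
  show "hs_le s (\<lambda>k. U t k - V t k) (B + B)"
    by (rule hs_le_mono[OF hs_le_diff[OF U(2) V(2)] s(2) order_refl]) fact+
next
  fix X and t :: real
  assume X: "\<And>t. t \<in> {0..1} \<Longrightarrow> hs_le s (\<lambda>k. U t k - V t k) X" and t: "t \<in> {0..1}"
  have r0: "0 \<le> r" using s by simp
  have X0: "0 \<le> X" using hs_le_nonneg[OF X[OF t]] .
  have cont: "continuous_on {0..1} (\<lambda>\<sigma>. cubic lam (U \<sigma>) k)" "continuous_on {0..1} (\<lambda>\<sigma>. cubic lam (V \<sigma>) k)" for k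
    by (rule hs_continuous_onD[OF hs_continuous_on_cubic[OF r0 r U]] hs_continuous_onD[OF hs_continuous_on_cubic[OF r0 r V]], assumption)+
  have "hs_le s (\<lambda>k. stage_map lam \<epsilon> dk a U t k - stage_map lam \<epsilon> dk b V t k - \<delta> t k)
      (cm * E + \<epsilon> * dk * (cm * (3 * tri_const TYPE('d) lam r * B\<^sup>2 * X)) + D)"
    by (rule hs_le_diff[OF hs_le_stage_map_diff[OF t ab hs_le_cubic_diff[OF s r U(2) V(2) X] cont \<epsilon>] \<delta>[OF t]])
  then show "hs_le s (\<lambda>k. U t k - V t k) (cm * E + D + X / 2)"
  proof (rule hs_le_subst)
    show "U t k - V t k = stage_map lam \<epsilon> dk a U t k - stage_map lam \<epsilon> dk b V t k - \<delta> t k" for k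
      using eqU[OF t, of k] eqV[OF t, of k] by simp
    have "\<epsilon> * dk * (cm * (3 * tri_const TYPE('d) lam r * B\<^sup>2)) * X \<le> 1 / 2 * X"
      by (rule mult_right_mono[OF small X0])
    then show "cm * E + \<epsilon> * dk * (cm * (3 * tri_const TYPE('d) lam r * B\<^sup>2 * X)) + D \<le> cm * E + D + X / 2"
      by (simp add: algebra_simps)
  qed
qed fact

text \<open>Stability with equal data and zero residual.\<close>

lemma stage_unique:
  fixes a :: "int ^ 'd::finite \<Rightarrow> complex"
  assumes r: "0 \<le> r" "r > real CARD('d) / 2"
    and U: "hs_continuous_on r {0..1} U" "\<And>\<tau>. \<tau> \<in> {0..1} \<Longrightarrow> hs_le r (U \<tau>) B"
    and V: "hs_continuous_on r {0..1} V" "\<And>\<tau>. \<tau> \<in> {0..1} \<Longrightarrow> hs_le r (V \<tau>) B"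
    and eqU: "\<And>\<tau> k. \<tau> \<in> {0..1} \<Longrightarrow> U \<tau> k = stage_map lam \<epsilon> dk a U \<tau> k"
    and eqV: "\<And>\<tau> k. \<tau> \<in> {0..1} \<Longrightarrow> V \<tau> k = stage_map lam \<epsilon> dk a V \<tau> k"
    and \<epsilon>: "0 \<le> \<epsilon>" "0 \<le> dk"
    and small: "\<epsilon> * dk * (cm * (3 * tri_const TYPE('d) lam r * B\<^sup>2)) \<le> 1 / 2"
    and \<tau>: "\<tau> \<in> {0..1}"
  shows "U \<tau> = V \<tau>"
proof
  fix k
  have "hs_le r (\<lambda>k. U \<tau> k - V \<tau> k) (2 * (cm * 0 + 0))"
    by (rule stage_stability[OF r(1) order_refl r(2) U V eqU, where \<delta> = "\<lambda>_ _. 0"])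
       (use eqV \<epsilon> small \<tau> in auto)
  then show "U \<tau> k = V \<tau> k" using hs_le_0D[of r "\<lambda>k. U \<tau> k - V \<tau> k" k] by simp
qed

text \<open>Picard iteration from 0. The margin 1 in R pays for the nonlinear term, and the same R
  is a Lipschitz constant in the stage variable; carrying this Lipschitz bound along makes the
  coordinatewise limit continuous in H^r.\<close>

lemma stage_exists:
  fixes a :: "int ^ 'd::finite \<Rightarrow> complex"
  assumes r: "0 \<le> r" "r > real CARD('d) / 2" and a: "hs_le r a Y" and \<epsilon>: "0 \<le> \<epsilon>" "0 \<le> dk"
    and R: "R = cm * Y + 1"
    and small: "\<epsilon> * dk * (cm * (tri_const TYPE('d) lam r * R ^ 3)) \<le> 1"
      "\<epsilon> * dk * (cm * (3 * tri_const TYPE('d) lam r * R\<^sup>2)) \<le> 1 / 2"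
  obtains U where "hs_continuous_on r {0..1} U" "\<And>\<tau>. \<tau> \<in> {0..1} \<Longrightarrow> hs_le r (U \<tau>) R"
    "\<And>\<tau> k. \<tau> \<in> {0..1} \<Longrightarrow> U \<tau> k = stage_map lam \<epsilon> dk a U \<tau> k"
proof -
  have Y0: "0 \<le> Y" using hs_le_nonneg[OF a] .
  have R0: "0 \<le> R" using Y0 by (simp add: R)
  define P where "P n = ((\<lambda>U. stage_map lam \<epsilon> dk a U) ^^ n) (\<lambda>\<tau> k. 0)" for n
  have P0: "P 0 = (\<lambda>\<tau> k. 0)" and PS: "P (Suc n) = stage_map lam \<epsilon> dk a (P n)" for n
    by (simp_all add: P_def)
  have inv: "(\<forall>\<tau>\<in>{0..1}. hs_le r (P n \<tau>) R) \<and>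
      (\<forall>\<tau>\<in>{0..1}. \<forall>\<tau>'\<in>{0..1}. hs_le r (\<lambda>k. P n \<tau>' k - P n \<tau> k) (R * \<bar>\<tau>' - \<tau>\<bar>))" for n
  proof (induction n)
    case (Suc n)
    have hc: "hs_continuous_on r {0..1} (P n)"
      by (rule hs_continuous_on_lipschitz[where L = R]) (use Suc in auto)
    have cub: "hs_le r (cubic lam (P n \<sigma>)) (tri_const TYPE('d) lam r * R ^ 3)" if "\<sigma> \<in> {0..1}" for \<sigma>
      using Suc that by (intro hs_le_cubic r) auto
    have cont: "continuous_on {0..1} (\<lambda>\<sigma>. cubic lam (P n \<sigma>) k)" for k
      by (rule hs_continuous_onD[OF hs_continuous_on_cubic[OF r hc]]) (use Suc in auto)
    have le: "cm * Y + \<epsilon> * dk * (cm * (tri_const TYPE('d) lam r * R ^ 3)) \<le> R"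
      using small(1) by (simp add: R)
    show ?case
      unfolding PS
      by (intro conjI ballI hs_le_weaken[OF hs_le_stage_map[OF _ a cub cont \<epsilon>] le]
         hs_le_weaken[OF hs_le_stage_map_lipschitz[OF _ _ a cub cont \<epsilon>]] mult_right_mono[OF le]) auto
  qed (simp add: P0 R0)
  have bd: "hs_le r (P n \<tau>) R" if "\<tau> \<in> {0..1}" for n \<tau> using inv that by blast
  have lip: "hs_le r (\<lambda>k. P n \<tau>' k - P n \<tau> k) (R * \<bar>\<tau>' - \<tau>\<bar>)" if "\<tau> \<in> {0..1}" "\<tau>' \<in> {0..1}" for n \<tau> \<tau>'
    using inv that by blast
  have hc: "hs_continuous_on r {0..1} (P n)" for n
    by (rule hs_continuous_on_lipschitz[where L = R]) (rule lip)
  have contr: "hs_le r (\<lambda>k. stage_map lam \<epsilon> dk a V \<tau> k - stage_map lam \<epsilon> dk a W \<tau> k) (X / 2)"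
    if V: "hs_continuous_on r {0..1} V" "\<And>\<tau>. \<tau> \<in> {0..1} \<Longrightarrow> hs_le r (V \<tau>) R"
      and W: "hs_continuous_on r {0..1} W" "\<And>\<tau>. \<tau> \<in> {0..1} \<Longrightarrow> hs_le r (W \<tau>) R"
      and X: "\<And>\<tau>. \<tau> \<in> {0..1} \<Longrightarrow> hs_le r (\<lambda>k. V \<tau> k - W \<tau> k) X" and \<tau>: "\<tau> \<in> {0..1}" for V W X \<tau>
  proof -
    have X0: "0 \<le> X" using hs_le_nonneg[OF X[OF \<tau>]] .
    have cont: "continuous_on {0..1} (\<lambda>\<sigma>. cubic lam (V \<sigma>) k)" "continuous_on {0..1} (\<lambda>\<sigma>. cubic lam (W \<sigma>) k)" for k
      by (rule hs_continuous_onD[OF hs_continuous_on_cubic[OF r V]] hs_continuous_onD[OF hs_continuous_on_cubic[OF r W]], assumption)+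
    have z: "hs_le r (\<lambda>k. a k - a k) 0" by simp
    have "\<epsilon> * dk * (cm * (3 * tri_const TYPE('d) lam r * R\<^sup>2)) * X \<le> 1 / 2 * X"
      by (rule mult_right_mono[OF small(2) X0])
    then show ?thesis
      by (intro hs_le_weaken[OF hs_le_stage_map_diff[OF \<tau> z hs_le_cubic_diff[OF r(1) order_refl r(2) V(2) W(2) X] cont \<epsilon>]])
         (auto simp: algebra_simps)
  qed
  have diff: "hs_le r (\<lambda>k. P (Suc n) \<tau> k - P n \<tau> k) (R / 2 ^ n)" if "\<tau> \<in> {0..1}" for n \<tau>
    using that
  proof (induction n arbitrary: \<tau>)
    case 0
    then show ?case using bd[of \<tau> "Suc 0"] by (simp add: P0)
  next
    case (Suc n)
    then have "hs_le r (\<lambda>k. P (Suc (Suc n)) \<tau> k - P (Suc n) \<tau> k) (R / 2 ^ n / 2)"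
      unfolding PS[of "Suc n"] PS[of n] by (intro contr) (auto simp flip: PS intro: hc bd)
    then show ?case by (simp add: field_simps)
  qed
  define U where "U \<tau> k = lim (\<lambda>n. P n \<tau> k)" for \<tau> k
  have lim: "(\<lambda>n. P n \<tau> k) \<longlonglongrightarrow> U \<tau> k" if \<tau>: "\<tau> \<in> {0..1}" for \<tau> k
  proof -
    have "summable (\<lambda>n. P (Suc n) \<tau> k - P n \<tau> k)"
    proof (rule summable_comparison_test')
      show "summable (\<lambda>n. R * (1 / 2) ^ n)" by (intro summable_mult summable_geometric) simp
      fix n
      have "1 * cmod (P (Suc n) \<tau> k - P n \<tau> k) \<le> wt r k * cmod (P (Suc n) \<tau> k - P n \<tau> k)"
        using r by (intro mult_right_mono wt_ge_1) auto
      then show "norm (P (Suc n) \<tau> k - P n \<tau> k) \<le> R * (1 / 2) ^ n"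
        using hs_le_coord[OF diff[OF \<tau>, of n], of k] by (simp add: power_one_over)
    qed
    then have "(\<lambda>n. \<Sum>i<n. P (Suc i) \<tau> k - P i \<tau> k) \<longlonglongrightarrow> (\<Sum>n. P (Suc n) \<tau> k - P n \<tau> k)"
      by (rule summable_LIMSEQ)
    then have "(\<lambda>n. P n \<tau> k) \<longlonglongrightarrow> (\<Sum>n. P (Suc n) \<tau> k - P n \<tau> k)"
      unfolding sum_lessThan_telescope[of "\<lambda>n. P n \<tau> k"] by (simp add: P0)
    then show ?thesis by (simp add: U_def limI)
  qed
  have Ubd: "hs_le r (U \<tau>) R" if "\<tau> \<in> {0..1}" for \<tau>
    by (rule hs_le_lim[of r "\<lambda>n. P n \<tau>" R sequentially]) (auto intro!: always_eventually lim bd that)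
  have "hs_le r (\<lambda>k. U \<tau>' k - U \<tau> k) (R * \<bar>\<tau>' - \<tau>\<bar>)" if "\<tau> \<in> {0..1}" "\<tau>' \<in> {0..1}" for \<tau> \<tau>'
    by (rule hs_le_lim[of r "\<lambda>n k. P n \<tau>' k - P n \<tau> k" _ sequentially]) (auto intro!: always_eventually lim lip tendsto_diff that)
  then have hcU: "hs_continuous_on r {0..1} U" by (intro hs_continuous_on_lipschitz)
  \<comment> \<open>A telescoped geometric sum in closed form; letting m grow gives the distance to
    the limit.\<close>
  have far: "hs_le r (\<lambda>k. P (n + m) \<tau> k - P n \<tau> k) (2 * R / 2 ^ n - 2 * R / 2 ^ (n + m))" if "\<tau> \<in> {0..1}" for n m \<tau>
  proof (induction m)
    case (Suc m)
    from hs_le_add[OF Suc diff[OF that, of "n + m"]] show ?case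
      by (elim hs_le_subst) (simp_all add: field_simps)
  qed simp
  have dist: "hs_le r (\<lambda>k. P n \<tau> k - U \<tau> k) (2 * R / 2 ^ n)" if "\<tau> \<in> {0..1}" for n \<tau>
  proof -
    have "hs_le r (\<lambda>k. U \<tau> k - P n \<tau> k) (2 * R / 2 ^ n)"
    proof (rule hs_le_lim[of r "\<lambda>m k. P (n + m) \<tau> k - P n \<tau> k" _ sequentially])
      show "\<forall>\<^sub>F m in sequentially. hs_le r (\<lambda>k. P (n + m) \<tau> k - P n \<tau> k) (2 * R / 2 ^ n)"
        using R0 by (intro always_eventually allI hs_le_weaken[OF far[OF that]]) simp
      show "(\<lambda>m. P (n + m) \<tau> k - P n \<tau> k) \<longlonglongrightarrow> U \<tau> k - P n \<tau> k" for k
        using LIMSEQ_ignore_initial_segment[OF lim[OF that], of n k]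
        by (intro tendsto_diff tendsto_const) (simp add: add.commute)
    qed auto
    then show ?thesis by (simp add: hs_le_minus_commute[of r "P n \<tau>"])
  qed
  have eq: "U \<tau> k = stage_map lam \<epsilon> dk a U \<tau> k" if \<tau>: "\<tau> \<in> {0..1}" for \<tau> k
  proof (rule LIMSEQ_unique)
    show "(\<lambda>n. P (Suc n) \<tau> k) \<longlonglongrightarrow> U \<tau> k" using lim[OF \<tau>] by (rule LIMSEQ_Suc)
    have "cmod (P (Suc n) \<tau> k - stage_map lam \<epsilon> dk a U \<tau> k) \<le> R / 2 ^ n" for n
    proof -
      have "hs_le r (\<lambda>k. P (Suc n) \<tau> k - stage_map lam \<epsilon> dk a U \<tau> k) (2 * R / 2 ^ n / 2)"
        unfolding PS by (rule contr[OF hc bd hcU Ubd dist \<tau>])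
      note le = hs_le_coord[OF this, of k]
      have "1 * cmod (P (Suc n) \<tau> k - stage_map lam \<epsilon> dk a U \<tau> k)
         \<le> wt r k * cmod (P (Suc n) \<tau> k - stage_map lam \<epsilon> dk a U \<tau> k)"
        using r by (intro mult_right_mono wt_ge_1) auto
      then show ?thesis using le by simp
    qed
    then have "\<forall>\<^sub>F n in sequentially. norm (P (Suc n) \<tau> k - stage_map lam \<epsilon> dk a U \<tau> k) \<le> R / 2 ^ n"
      by (rule always_eventually[OF allI])
    moreover have "(\<lambda>n. R / 2 ^ n) \<longlonglongrightarrow> 0" by (intro LIMSEQ_divide_realpow_zero) simp
    ultimately have "(\<lambda>n. P (Suc n) \<tau> k - stage_map lam \<epsilon> dk a U \<tau> k) \<longlonglongrightarrow> 0"
      by (rule Lim_null_comparison)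
    then show "(\<lambda>n. P (Suc n) \<tau> k) \<longlonglongrightarrow> stage_map lam \<epsilon> dk a U \<tau> k"
      by (simp add: LIM_zero_iff)
  qed
  show thesis by (rule that[OF hcU Ubd eq])
qed

text \<open>Only the first factor \<open>B\<close>, a bound in the weaker space \<open>H\<^sup>r\<close>, enters nonlinearly; this is what
  lets the \<open>H\<^sup>\<alpha>\<close>-norm of the iterates be propagated over long times.\<close>

lemma stage_tame:
  fixes a :: "int ^ 'd::finite \<Rightarrow> complex"
  assumes r: "0 \<le> r" "r > real CARD('d) / 2" and \<alpha>: "r \<le> \<alpha>"
    and U: "hs_continuous_on \<alpha> {0..1} U" "\<And>\<tau>. \<tau> \<in> {0..1} \<Longrightarrow> hs_le \<alpha> (U \<tau>) R"
      "\<And>\<tau>. \<tau> \<in> {0..1} \<Longrightarrow> hs_le r (U \<tau>) B"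
    and eqU: "\<And>\<tau> k. \<tau> \<in> {0..1} \<Longrightarrow> U \<tau> k = stage_map lam \<epsilon> dk a U \<tau> k"
    and a: "hs_le \<alpha> a Y" and \<epsilon>: "0 \<le> \<epsilon>" "0 \<le> dk"
    and c: "c = \<bar>lam\<bar> * 3 * (2 powr \<alpha>)\<^sup>2 * (sob_const TYPE('d) r * B)\<^sup>2"
    and small: "\<epsilon> * dk * (cm * c) \<le> 1 / 2"
    and C1: "\<And>z. Re z = 0 \<Longrightarrow> cmod (C 1 z) \<le> 1"
  shows "hs_le \<alpha> (U 1) ((1 + \<epsilon> * dk * (cm * c * (2 * cm))) * Y)"
proof -
  have \<alpha>': "0 \<le> \<alpha>" "\<alpha> > real CARD('d) / 2" using r \<alpha> by auto
  have c0: "0 \<le> c" by (simp add: c)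
  have Y0: "0 \<le> Y" using hs_le_nonneg[OF a] .
  have cont: "continuous_on {0..1} (\<lambda>\<sigma>. cubic lam (U \<sigma>) k)" for k
    by (rule hs_continuous_onD[OF hs_continuous_on_cubic[OF \<alpha>' U(1,2)]])
  have cub: "hs_le \<alpha> (cubic lam (U \<sigma>)) (c * X)" if "\<sigma> \<in> {0..1}" "hs_le \<alpha> (U \<sigma>) X" for \<sigma> X
    unfolding c by (rule hs_le_cubic_tame[OF \<alpha>'(1) hs_le_imp_l1_le[OF U(3) r(2)]]) (use that in auto)
  have bd: "hs_le \<alpha> (U \<tau>) (2 * (cm * Y))" if "\<tau> \<in> {0..1}" for \<tau>
  proof (rule hs_le_contraction_family[where a = U and I = "{0..1}" and X = R])
    fix X t assume X: "\<And>t. t \<in> {0..1} \<Longrightarrow> hs_le \<alpha> (U t) X" and t: "t \<in> {0..1::real}"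
    have "hs_le \<alpha> (stage_map lam \<epsilon> dk a U t) (cm * Y + \<epsilon> * dk * (cm * (c * X)))"
      by (rule hs_le_stage_map[OF t a cub cont \<epsilon>]) (auto intro: X)
    moreover have "\<epsilon> * dk * (cm * c) * X \<le> 1 / 2 * X"
      by (rule mult_right_mono[OF small hs_le_nonneg[OF X[OF t]]])
    ultimately show "hs_le \<alpha> (U t) (cm * Y + X / 2)"
      by (elim hs_le_subst) (auto simp: eqU[OF t] algebra_simps)
  qed (use U that in auto)
  have 1: "(1::real) \<in> {0..1}" by simp
  \<comment> \<open>The bound for all stages loses the factor 2 cm, which is harmless behind
    \<epsilon> dk. Inserted there, it leaves the factor 1 in front of Y, since C at \<tau> = 1 has
    modulus at most 1.\<close>
  have "hs_le \<alpha> (\<lambda>k. C 1 (freq_arg dk k) * a k + of_real (\<epsilon> * dk) * stage_int dk (\<lambda>\<sigma>. cubic lam (U \<sigma>)) 1 k)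
     (1 * Y + cmod (of_real (\<epsilon> * dk)) * (cm * (c * (2 * (cm * Y)))))"
    by (intro hs_le_add hs_le_multiplier a hs_le_scale hs_le_stage_int cub bd cont C1) auto
  then show ?thesis
    using \<epsilon> by (elim hs_le_subst) (simp_all add: eqU[OF 1] stage_map_def norm_mult algebra_simps)
qed

text \<open>Passage to Fourier coefficients: by \<open>integral_fser\<close> the pointwise integral
  over the stages may be taken coefficientwise. The last conclusion recovers W itself up to null
  sets, because uniqueness is asked for functions.\<close>

lemma stage_solution_imp_stage_map:
  fixes u :: "real ^ 'd::finite \<Rightarrow> complex"
  assumes W: "stage_solution C A lam \<epsilon> dk \<alpha> R u W" and u: "u \<in> sobolev_space \<alpha>"
    and \<alpha>: "0 \<le> \<alpha>" "\<alpha> > real CARD('d) / 2"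
  defines "U \<equiv> \<lambda>\<tau>. fourier_coeff (W \<tau>)"
  shows "hs_continuous_on \<alpha> {0..1} U" "\<And>\<tau>. \<tau> \<in> {0..1} \<Longrightarrow> hs_le \<alpha> (U \<tau>) R"
    "\<And>\<tau> k. \<tau> \<in> {0..1} \<Longrightarrow> U \<tau> k = stage_map lam \<epsilon> dk (fourier_coeff u) U \<tau> k"
    "\<And>\<tau>. \<tau> \<in> {0..1} \<Longrightarrow> ae_eq (W \<tau>) (fser (stage_map lam \<epsilon> dk (fourier_coeff u) U \<tau>))"
proof -
  have W': "sobolev_continuous_on \<alpha> {0..1} W" "\<And>\<tau>. \<tau> \<in> {0..1} \<Longrightarrow> sobolev_norm \<alpha> (W \<tau>) \<le> R"
    using W by (auto simp: stage_solution_def)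
  have Wsp: "W \<tau> \<in> sobolev_space \<alpha>" if "\<tau> \<in> {0..1}" for \<tau>
    using W' that by (auto simp: sobolev_continuous_on_def)
  show hc: "hs_continuous_on \<alpha> {0..1} U" unfolding U_def by (rule sobolev_continuous_on_imp[OF W'(1)])
  show bd: "hs_le \<alpha> (U \<tau>) R" if "\<tau> \<in> {0..1}" for \<tau>
    unfolding U_def by (rule hs_le_weaken[OF sobolev_space_hs_le[OF Wsp[OF that]] W'(2)[OF that]])
  have a: "l1 (fourier_coeff u)" by (rule hs_le_imp_l1[OF sobolev_space_hs_le[OF u] \<alpha>(2)])
  have cub_bd: "hs_le \<alpha> (cubic lam (U \<sigma>)) (tri_const TYPE('d) lam \<alpha> * R ^ 3)" if "\<sigma> \<in> {0..1}" for \<sigma>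
    by (rule hs_le_cubic[OF \<alpha> bd[OF that]])
  have cub_hc: "hs_continuous_on \<alpha> {0..1} (\<lambda>\<sigma>. cubic lam (U \<sigma>))"
    by (rule hs_continuous_on_cubic[OF \<alpha> hc bd])
  have main: "l1 (stage_map lam \<epsilon> dk (fourier_coeff u) U \<tau>)"
    "(\<lambda>x. lap_fun (\<lambda>z. C \<tau> (\<i> * of_real dk * z)) u x
           + of_real (\<epsilon> * dk) * integral {0..1}
               (\<lambda>\<sigma>. lap_fun (\<lambda>z. A \<tau> \<sigma> (\<i> * of_real dk * z)) (nls_f lam (W \<sigma>)) x))
      = fser (stage_map lam \<epsilon> dk (fourier_coeff u) U \<tau>)" if \<tau>: "\<tau> \<in> {0..1}" for \<tau>
  proof -
    define h where "h \<sigma> k = A \<tau> \<sigma> (freq_arg dk k) * cubic lam (U \<sigma>) k" for \<sigma> k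
    have lap_h: "lap_fun (\<lambda>z. A \<tau> \<sigma> (\<i> * of_real dk * z)) (nls_f lam (W \<sigma>)) x = fser (h \<sigma>) x"
      if "\<sigma> \<in> {0..1}" for \<sigma> x
      by (simp add: lap_fun_eq_fser h_def[abs_def] fourier_coeff_nls_f[OF Wsp[OF that] \<alpha>(2)] U_def freq_arg_def)
    have h_hc: "hs_continuous_on \<alpha> {0..1} h"
      unfolding h_def
      by (rule hs_continuous_on_multiplier[OF cub_hc cub_bd cm_nonneg]) (use \<tau> in \<open>auto intro!: A_bound A_lipschitz_right\<close>)
    have h_bd: "hs_le \<alpha> (h \<sigma>) (cm * (tri_const TYPE('d) lam \<alpha> * R ^ 3))" if "\<sigma> \<in> {0..1}" for \<sigma>
      unfolding h_def by (intro hs_le_multiplier cub_bd A_bound) (use that \<tau> in auto)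
    have int: "integral {0..1} (\<lambda>\<sigma>. lap_fun (\<lambda>z. A \<tau> \<sigma> (\<i> * of_real dk * z)) (nls_f lam (W \<sigma>)) x)
       = fser (stage_int dk (\<lambda>\<sigma>. cubic lam (U \<sigma>)) \<tau>) x" for x
    proof -
      have "integral {0..1} (\<lambda>\<sigma>. lap_fun (\<lambda>z. A \<tau> \<sigma> (\<i> * of_real dk * z)) (nls_f lam (W \<sigma>)) x)
        = integral {0..1} (\<lambda>\<sigma>. fser (h \<sigma>) x)"
        by (rule Henstock_Kurzweil_Integration.integral_cong) (rule lap_h)
      also have "\<dots> = fser (\<lambda>k. integral {0..1} (\<lambda>\<sigma>. h \<sigma> k)) x"
        by (rule integral_fser[OF h_hc h_bd \<alpha>(2)])
      finally show ?thesis by (simp add: h_def stage_int_def[abs_def])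
    qed
    have l1C: "l1 (\<lambda>k. C \<tau> (freq_arg dk k) * fourier_coeff u k)"
      by (rule l1_multiplier[OF a C_bound]) (use \<tau> in auto)
    have "hs_le \<alpha> (stage_int dk (\<lambda>\<sigma>. cubic lam (U \<sigma>)) \<tau>) (cm * (tri_const TYPE('d) lam \<alpha> * R ^ 3))"
      by (rule hs_le_stage_int[OF \<tau> cub_bd hs_continuous_onD[OF cub_hc]])
    then have "l1 (stage_int dk (\<lambda>\<sigma>. cubic lam (U \<sigma>)) \<tau>)" by (rule hs_le_imp_l1) (rule \<alpha>)
    then have l1I: "l1 (\<lambda>k. of_real (\<epsilon> * dk) * stage_int dk (\<lambda>\<sigma>. cubic lam (U \<sigma>)) \<tau> k)" by (rule l1_scale)
    show "l1 (stage_map lam \<epsilon> dk (fourier_coeff u) U \<tau>)"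
      unfolding stage_map_def[abs_def] by (rule l1_add[OF l1C l1I])
    show "(\<lambda>x. lap_fun (\<lambda>z. C \<tau> (\<i> * of_real dk * z)) u x
           + of_real (\<epsilon> * dk) * integral {0..1}
               (\<lambda>\<sigma>. lap_fun (\<lambda>z. A \<tau> \<sigma> (\<i> * of_real dk * z)) (nls_f lam (W \<sigma>)) x))
      = fser (stage_map lam \<epsilon> dk (fourier_coeff u) U \<tau>)"
      unfolding int stage_map_def[abs_def]
      by (simp only: fun_eq_iff fser_add[OF l1C l1I] fser_scale lap_fun_eq_fser) (simp add: freq_arg_def)
  qed
  show ae: "ae_eq (W \<tau>) (fser (stage_map lam \<epsilon> dk (fourier_coeff u) U \<tau>))" if "\<tau> \<in> {0..1}" for \<tau>
    using W that unfolding main(2)[OF that, symmetric] stage_solution_def by blast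
  show "U \<tau> k = stage_map lam \<epsilon> dk (fourier_coeff u) U \<tau> k" if "\<tau> \<in> {0..1}" for \<tau> k
    using ae_eq_fourier_coeff[OF ae[OF that], of k] sobolev_space_measurable[OF Wsp[OF that]]
      borel_measurable_fser[OF main(1)[OF that]] fourier_coeff_fser[OF main(1)[OF that]]
    unfolding U_def by simp
qed

text \<open>The converse passage; for the continuous representative \<open>fser\<close> the stage
  equation holds at every point.\<close>

lemma stage_map_imp_stage_solution:
  fixes u :: "real ^ 'd::finite \<Rightarrow> complex"
  assumes u: "u \<in> sobolev_space \<alpha>" and \<alpha>: "0 \<le> \<alpha>" "\<alpha> > real CARD('d) / 2"
    and hc: "hs_continuous_on \<alpha> {0..1} U" and bd: "\<And>\<tau>. \<tau> \<in> {0..1} \<Longrightarrow> hs_le \<alpha> (U \<tau>) R"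
    and eq: "\<And>\<tau> k. \<tau> \<in> {0..1} \<Longrightarrow> U \<tau> k = stage_map lam \<epsilon> dk (fourier_coeff u) U \<tau> k"
  shows "stage_solution C A lam \<epsilon> dk \<alpha> R u (\<lambda>\<tau>. fser (U \<tau>))"
  unfolding stage_solution_def
proof (intro conjI ballI)
  show "sobolev_continuous_on \<alpha> {0..1} (\<lambda>\<tau>. fser (U \<tau>))"
    by (rule sobolev_continuous_on_fser[OF hc bd \<alpha>(2)])
  fix \<tau> :: real assume \<tau>: "\<tau> \<in> {0..1}"
  have lU: "l1 (U \<sigma>)" if "\<sigma> \<in> {0..1}" for \<sigma> by (rule hs_le_imp_l1[OF bd[OF that] \<alpha>(2)])
  have cf: "fourier_coeff (fser (U \<sigma>)) = U \<sigma>" if "\<sigma> \<in> {0..1}" for \<sigma>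
    by (simp add: fun_eq_iff fourier_coeff_fser[OF lU[OF that]])
  show "sobolev_norm \<alpha> (fser (U \<tau>)) \<le> R" by (rule sobolev_norm_le) (simp only: cf[OF \<tau>] bd[OF \<tau>])
  define h where "h \<sigma> k = A \<tau> \<sigma> (freq_arg dk k) * cubic lam (U \<sigma>) k" for \<sigma> k
  have cub_bd: "hs_le \<alpha> (cubic lam (U \<sigma>)) (tri_const TYPE('d) lam \<alpha> * R ^ 3)" if "\<sigma> \<in> {0..1}" for \<sigma>
    by (rule hs_le_cubic[OF \<alpha> bd[OF that]])
  have cub_hc: "hs_continuous_on \<alpha> {0..1} (\<lambda>\<sigma>. cubic lam (U \<sigma>))"
    by (rule hs_continuous_on_cubic[OF \<alpha> hc bd])
  have lap_h: "lap_fun (\<lambda>z. A \<tau> \<sigma> (\<i> * of_real dk * z)) (nls_f lam (fser (U \<sigma>))) x = fser (h \<sigma>) x"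
    if "\<sigma> \<in> {0..1}" for \<sigma> x
    by (simp add: lap_fun_eq_fser h_def[abs_def] nls_f_fser[OF lU[OF that]] fourier_coeff_fser l1_cubic[OF lU[OF that]] freq_arg_def)
  have h_hc: "hs_continuous_on \<alpha> {0..1} h"
    unfolding h_def
    by (rule hs_continuous_on_multiplier[OF cub_hc cub_bd cm_nonneg]) (use \<tau> in \<open>auto intro!: A_bound A_lipschitz_right\<close>)
  have h_bd: "hs_le \<alpha> (h \<sigma>) (cm * (tri_const TYPE('d) lam \<alpha> * R ^ 3))" if "\<sigma> \<in> {0..1}" for \<sigma>
    unfolding h_def by (intro hs_le_multiplier cub_bd A_bound) (use that \<tau> in auto)
  have int: "integral {0..1} (\<lambda>\<sigma>. lap_fun (\<lambda>z. A \<tau> \<sigma> (\<i> * of_real dk * z)) (nls_f lam (fser (U \<sigma>))) x)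
     = fser (stage_int dk (\<lambda>\<sigma>. cubic lam (U \<sigma>)) \<tau>) x" for x
  proof -
    have "integral {0..1} (\<lambda>\<sigma>. lap_fun (\<lambda>z. A \<tau> \<sigma> (\<i> * of_real dk * z)) (nls_f lam (fser (U \<sigma>))) x)
      = integral {0..1} (\<lambda>\<sigma>. fser (h \<sigma>) x)"
      by (rule Henstock_Kurzweil_Integration.integral_cong) (rule lap_h)
    also have "\<dots> = fser (\<lambda>k. integral {0..1} (\<lambda>\<sigma>. h \<sigma> k)) x"
      by (rule integral_fser[OF h_hc h_bd \<alpha>(2)])
    finally show ?thesis by (simp add: h_def stage_int_def[abs_def])
  qed
  have l1C: "l1 (\<lambda>k. C \<tau> (freq_arg dk k) * fourier_coeff u k)"
    by (rule l1_multiplier[OF hs_le_imp_l1[OF sobolev_space_hs_le[OF u] \<alpha>(2)] C_bound]) (use \<tau> in auto)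
  have "hs_le \<alpha> (stage_int dk (\<lambda>\<sigma>. cubic lam (U \<sigma>)) \<tau>) (cm * (tri_const TYPE('d) lam \<alpha> * R ^ 3))"
    by (rule hs_le_stage_int[OF \<tau> cub_bd hs_continuous_onD[OF cub_hc]])
  then have "l1 (stage_int dk (\<lambda>\<sigma>. cubic lam (U \<sigma>)) \<tau>)" by (rule hs_le_imp_l1) (rule \<alpha>)
  then have l1I: "l1 (\<lambda>k. of_real (\<epsilon> * dk) * stage_int dk (\<lambda>\<sigma>. cubic lam (U \<sigma>)) \<tau> k)" by (rule l1_scale)
  have Ueq: "U \<tau> = (\<lambda>k. C \<tau> (freq_arg dk k) * fourier_coeff u k
      + of_real (\<epsilon> * dk) * stage_int dk (\<lambda>\<sigma>. cubic lam (U \<sigma>)) \<tau> k)"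
    using eq[OF \<tau>] by (simp only: fun_eq_iff stage_map_def) simp
  have "fser (U \<tau>) x = lap_fun (\<lambda>z. C \<tau> (\<i> * of_real dk * z)) u x
           + of_real (\<epsilon> * dk) * integral {0..1}
               (\<lambda>\<sigma>. lap_fun (\<lambda>z. A \<tau> \<sigma> (\<i> * of_real dk * z)) (nls_f lam (fser (U \<sigma>))) x)" for x
    unfolding int
    by (subst Ueq, simp only: fser_add[OF l1C l1I] fser_scale lap_fun_eq_fser) (simp add: freq_arg_def)
  then show "ae_eq (fser (U \<tau>)) (\<lambda>x. lap_fun (\<lambda>z. C \<tau> (\<i> * of_real dk * z)) u x
           + of_real (\<epsilon> * dk) * integral {0..1}
               (\<lambda>\<sigma>. lap_fun (\<lambda>z. A \<tau> \<sigma> (\<i> * of_real dk * z)) (nls_f lam (fser (U \<sigma>))) x))"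
    by (simp add: ae_eq_def)
qed

end

section \<open>Methods given by interpolation nodes\<close>

lemma norm_exp_Re_0: "Re z = 0 \<Longrightarrow> cmod (exp z) = 1"
  by (simp add: norm_exp_eq_Re)

definition exp_rem :: "nat \<Rightarrow> complex \<Rightarrow> complex" where
  "exp_rem q z = exp z - (\<Sum>j<q. z ^ j / fact j)"

text \<open>On the imaginary axis the remainder is bounded by the first omitted power, with no
  exponential factor. The bound from characteristic functions covers q \<ge> 1; for q = 0 it is the
  unimodularity of the exponential.\<close>

lemma exp_rem_le:
  assumes "Re z = 0" shows "cmod (exp_rem q z) \<le> cmod z ^ q"
proof (cases q)
  case 0
  then show ?thesis using assms by (simp add: exp_rem_def norm_exp_Re_0)
next
  case (Suc n)
  define y where "y = Im z"
  have z: "z = \<i> * of_real y" using assms by (simp add: y_def complex_eq_iff)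
  have "{..<Suc n} = {..n}" by auto
  then have "cmod (exp_rem q z) \<le> \<bar>y\<bar> ^ Suc n / fact (Suc n)"
    using iexp_approx1[of y n] by (simp only: exp_rem_def Suc z)
  also have "\<dots> \<le> \<bar>y\<bar> ^ Suc n / 1" by (intro divide_left_mono fact_ge_1) auto
  finally show ?thesis by (simp add: Suc z norm_mult)
qed

lemma phi1_mult: "z * phi1 z = exp z - 1"
proof -
  have "((\<lambda>\<xi>. z * exp ((1 - of_real \<xi>) * z)) has_integral (- exp ((1 - of_real 1) * z) - (- exp ((1 - of_real 0) * z)))) {0..1}"
  proof (rule fundamental_theorem_of_calculus)
    fix x :: real
    have "((\<lambda>w. - exp ((1 - w) * z)) has_field_derivative z * exp ((1 - of_real x) * z)) (at (of_real x))"
      by (auto intro!: derivative_eq_intros)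
    from has_vector_derivative_real_field[OF this]
    show "((\<lambda>\<xi>. - exp ((1 - of_real \<xi>) * z)) has_vector_derivative z * exp ((1 - of_real x) * z)) (at x within {0..1})" .
  qed simp
  from integral_unique[OF this] show ?thesis by (simp add: phi1_def)
qed

lemma phi1_0 [simp]: "phi1 0 = 1"
  by (simp add: phi1_def)

definition phi1_rem :: "nat \<Rightarrow> complex \<Rightarrow> complex" where
  "phi1_rem q z = phi1 z - (\<Sum>j<q. z ^ j / fact (Suc j))"

text \<open>Multiplication by z turns this remainder into \<open>exp_rem (Suc q) z\<close>; z = 0
  has to be treated directly.\<close>

lemma phi1_rem_le:
  assumes "Re z = 0" shows "cmod (phi1_rem q z) \<le> cmod z ^ q"
proof (cases "z = 0")
  case True
  then show ?thesis
    by (cases q) (auto simp: phi1_rem_def lessThan_Suc_atMost atMost_atLeast0 sum.atLeast_Suc_atMost power_0_left)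
next
  case False
  have "z * phi1_rem q z = exp_rem (Suc q) z"
    by (simp only: phi1_rem_def exp_rem_def right_diff_distrib phi1_mult sum.lessThan_Suc_shift)
       (simp add: sum_distrib_left)
  then have "cmod z * cmod (phi1_rem q z) \<le> cmod z * cmod z ^ q"
    using exp_rem_le[OF assms, of "Suc q"] by (simp flip: norm_mult)
  then show ?thesis using False by simp
qed

lemma phi1_le: "Re z = 0 \<Longrightarrow> cmod (phi1 z) \<le> 1"
  using phi1_rem_le[of z 0] by (simp add: phi1_rem_def)

definition lagr :: "(nat \<Rightarrow> real) \<Rightarrow> nat \<Rightarrow> nat \<Rightarrow> real poly" where
  "lagr c r j = (\<Prod>k\<in>{0..r} - {j}. smult (1 / (c j - c k)) [:- c k, 1:])"

definition node_C :: "(nat \<Rightarrow> real) \<Rightarrow> nat \<Rightarrow> C_coeff" where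
  "node_C c r \<tau> z = (\<Sum>k=0..r. of_real (poly (lagr c r k) \<tau>) * exp (of_real (c k) * z))"

text \<open>For nodes with c_0 = 0 and c_r = 1: at \<tau> = 1 this is minus the derivative of the
  interpolant of (1 - \<sigma>) phi1((1 - \<sigma>) z), whose exact derivative is -exp((1 -
  \<sigma>) z), so it approximates the Duhamel kernel. Its integral over \<sigma> interpolates
  \<tau> phi1(\<tau> z). Collecting powers of \<tau> and \<sigma> gives the coefficients of the
  three methods.\<close>

definition node_A :: "(nat \<Rightarrow> real) \<Rightarrow> nat \<Rightarrow> A_coeff" where
  "node_A c r \<tau> \<sigma> z = - (\<Sum>i=0..r. \<Sum>k<i. of_real ((c i - c k) * poly (lagr c r i) \<tau> * poly (pderiv (lagr c r k)) \<sigma>)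
     * phi1 (of_real (c i - c k) * z))"

text \<open>Consistency with the exact flow, for the linear part, the kernel of the update and the
  total weight of the stage kernel. The free q lets powers of the step be traded for derivatives, up
  to the order of the method. In the update, linear part and total weight are exact.\<close>

locale ep_method = ep_regular +
  fixes r :: nat
  assumes C_1: "\<And>z. C 1 z = exp z"
    and C_approx: "\<And>z \<tau> q. Re z = 0 \<Longrightarrow> \<tau> \<in> {0..1} \<Longrightarrow> q \<le> Suc r \<Longrightarrow>
      cmod (C \<tau> z - exp (of_real \<tau> * z)) \<le> cm * cmod z ^ q"
    and A_1_integral: "\<And>z. integral {0..1} (\<lambda>\<sigma>. A 1 \<sigma> z) = phi1 z"
    and A_1_approx: "\<And>z \<sigma> q. Re z = 0 \<Longrightarrow> \<sigma> \<in> {0..1} \<Longrightarrow> q \<le> r \<Longrightarrow>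
      cmod (A 1 \<sigma> z - exp (of_real (1 - \<sigma>) * z)) \<le> cm * cmod z ^ q"
    and A_integral_approx: "\<And>z \<tau> q. Re z = 0 \<Longrightarrow> \<tau> \<in> {0..1} \<Longrightarrow> q \<le> r \<Longrightarrow>
      cmod (integral {0..1} (\<lambda>\<sigma>. A \<tau> \<sigma> z) - of_real \<tau> * phi1 (of_real \<tau> * z)) \<le> cm * cmod z ^ q"
    and A_0_approx: "\<And>z \<tau> \<sigma>. Re z = 0 \<Longrightarrow> \<tau> \<in> {0..1} \<Longrightarrow> \<sigma> \<in> {0..1} \<Longrightarrow>
      cmod (A \<tau> \<sigma> z - A \<tau> \<sigma> 0) \<le> cm * cmod z"

text \<open>\<open>P \<tau>\<close> is the coefficient of the second order term in the error of the stage at \<open>\<tau>\<close>.\<close>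

locale ep_method3 = ep_method +
  fixes P :: "real \<Rightarrow> real"
  assumes A_0_moment: "\<And>\<tau>. \<tau> \<in> {0..1} \<Longrightarrow>
      integral {0..1} (\<lambda>\<sigma>. A \<tau> \<sigma> 0 * of_real \<sigma>) = of_real (P \<tau> + \<tau>\<^sup>2 / 2)"
    and P_lipschitz: "\<And>\<tau> \<tau>'. \<tau> \<in> {0..1} \<Longrightarrow> \<tau>' \<in> {0..1} \<Longrightarrow> \<bar>P \<tau>' - P \<tau>\<bar> \<le> cm * \<bar>\<tau>' - \<tau>\<bar>"
    and P_bound: "\<And>\<tau>. \<tau> \<in> {0..1} \<Longrightarrow> \<bar>P \<tau>\<bar> \<le> cm"
    and P_mean: "integral {0..1} P = 0"

lemma poly_bounded_interval:
  fixes p :: "real poly"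
  shows "\<exists>B. \<forall>t\<in>{0..1}. \<bar>poly p t\<bar> \<le> B"
proof -
  have "compact (poly p ` {0..1})" by (intro compact_continuous_image continuous_intros) simp
  then have "bounded (poly p ` {0..1})" by (rule compact_imp_bounded)
  then show ?thesis by (auto simp: bounded_iff)
qed

lemma poly_lipschitz_interval:
  fixes p :: "real poly"
  assumes "\<And>t. t \<in> {0..1} \<Longrightarrow> \<bar>poly (pderiv p) t\<bar> \<le> B" "x \<in> {0..1}" "y \<in> {0..1}"
  shows "\<bar>poly p y - poly p x\<bar> \<le> B * \<bar>y - x\<bar>"
proof -
  have "norm (poly p y - poly p x) \<le> B * norm (y - x)"
    by (rule field_differentiable_bound[of "{0..1}" "poly p" "poly (pderiv p)" B])
       (use assms in \<open>auto intro!: DERIV_subset[OF poly_DERIV]\<close>)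
  then show ?thesis by simp
qed

section \<open>Lagrange interpolation of the exponential and of \<open>phi1\<close>\<close>

context
  fixes c :: "nat \<Rightarrow> real" and r :: nat
  assumes inj: "inj_on c {0..r}" and c0: "c 0 = 0" and cr: "c r = 1"
begin

lemma poly_lagr_node:
  assumes "j \<le> r" "i \<le> r"
  shows "poly (lagr c r j) (c i) = (if i = j then 1 else 0)"
proof (cases "i = j")
  case True
  have "poly (smult (1 / (c j - c k)) [:- c k, 1:]) (c j) = 1" if "k \<in> {0..r} - {j}" for k
  proof -
    have ne: "c j - c k \<noteq> 0" using inj_onD[OF inj, of j k] that assms by auto
    have "poly (smult (1 / (c j - c k)) [:- c k, 1:]) (c j) = 1 / (c j - c k) * (- c k + c j)"
      by (simp only: poly_smult poly_pCons poly_0 mult_zero_right add_0_right mult_1_right)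
    also have "- c k + c j = c j - c k" by simp
    also have "1 / (c j - c k) * (c j - c k) = 1" by (rule nonzero_eq_divide_eq[OF ne, THEN iffD1, OF refl])
    finally show ?thesis .
  qed
  then have "poly (lagr c r j) (c j) = 1"
    unfolding lagr_def poly_prod by (intro prod.neutral) blast
  then show ?thesis using True by simp
next
  case False
  then have "\<exists>k\<in>{0..r} - {j}. poly (smult (1 / (c j - c k)) [:- c k, 1:]) (c i) = 0"
    using assms by (intro bexI[of _ i]) auto
  then show ?thesis using False by (auto simp: lagr_def poly_prod)
qed

lemma degree_lagr:
  assumes "j \<le> r" shows "degree (lagr c r j) \<le> r"
proof -
  have "degree (lagr c r j) \<le> (\<Sum>k\<in>{0..r} - {j}. degree (smult (1 / (c j - c k)) [:- c k, 1:]))"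
    unfolding lagr_def by (rule order_trans[OF degree_prod_sum_le]) (simp, simp only: o_def order_refl)
  also have "\<dots> \<le> (\<Sum>k\<in>{0..r} - {j}. 1)"
    by (intro sum_mono order_trans[OF degree_smult_le]) simp
  also have "\<dots> = r" using assms by simp
  finally show ?thesis .
qed

lemma lagr_interpolation:
  assumes "degree p \<le> r"
  shows "(\<Sum>k=0..r. smult (poly p (c k)) (lagr c r k)) = p"
proof (rule poly_eqI_degree[where A = "c ` {0..r}"])
  have card: "card (c ` {0..r}) = Suc r" using inj by (simp add: card_image)
  show "degree p < card (c ` {0..r})" using assms card by simp
  have "degree (\<Sum>k=0..r. smult (poly p (c k)) (lagr c r k)) \<le> r"
    by (intro degree_sum_le order_trans[OF degree_smult_le] degree_lagr) auto
  then show "degree (\<Sum>k=0..r. smult (poly p (c k)) (lagr c r k)) < card (c ` {0..r})"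
    using card by simp
  fix x assume "x \<in> c ` {0..r}"
  then obtain i where i: "i \<le> r" "x = c i" by auto
  have "poly (\<Sum>k=0..r. smult (poly p (c k)) (lagr c r k)) x = (\<Sum>k=0..r. if i = k then poly p (c k) else 0)"
    unfolding poly_sum using i by (intro sum.cong) (auto simp: poly_lagr_node)
  then show "poly (\<Sum>k=0..r. smult (poly p (c k)) (lagr c r k)) x = poly p x"
    using i by simp
qed

lemma lagr_interpolation_poly:
  "degree p \<le> r \<Longrightarrow> (\<Sum>k=0..r. poly p (c k) * poly (lagr c r k) t) = poly p t"
  using arg_cong[OF lagr_interpolation, of p "\<lambda>p. poly p t"] by (simp add: poly_sum)

lemma pderiv_sum: "pderiv (\<Sum>k\<in>S. f k) = (\<Sum>k\<in>S. pderiv (f k))" for f :: "nat \<Rightarrow> real poly"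
  by (induction S rule: infinite_finite_induct) (auto simp: pderiv_add)

lemma lagr_interpolation_pderiv:
  assumes "degree p \<le> r"
  shows "(\<Sum>k=0..r. poly p (c k) * poly (pderiv (lagr c r k)) t) = poly (pderiv p) t"
proof -
  have "pderiv (\<Sum>k=0..r. smult (poly p (c k)) (lagr c r k)) = pderiv p"
    by (simp add: lagr_interpolation[OF assms])
  then have "poly (\<Sum>k=0..r. smult (poly p (c k)) (pderiv (lagr c r k))) t = poly (pderiv p) t"
    by (simp add: pderiv_sum pderiv_smult)
  then show ?thesis by (simp add: poly_sum)
qed

lemma lagr_at_0: "k \<le> r \<Longrightarrow> poly (lagr c r k) 0 = (if k = 0 then 1 else 0)"
  using poly_lagr_node[of k 0] c0 by auto

lemma lagr_at_1: "k \<le> r \<Longrightarrow> poly (lagr c r k) 1 = (if k = r then 1 else 0)"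
  using poly_lagr_node[of k r] cr by auto

lemma node_C_1: "node_C c r 1 z = exp z"
proof -
  have "node_C c r 1 z = (\<Sum>k=0..r. if k = r then exp (of_real (c k) * z) else 0)"
    unfolding node_C_def by (intro sum.cong) (auto simp: lagr_at_1)
  then show ?thesis using cr by simp
qed

lemma node_A_1: "node_A c r 1 \<sigma> z =
  - (\<Sum>k=0..r. of_real (1 - c k) * of_real (poly (pderiv (lagr c r k)) \<sigma>) * phi1 (of_real (1 - c k) * z))"
proof -
  have "node_A c r 1 \<sigma> z = - (\<Sum>i=0..r. if i = r then \<Sum>k<i. of_real ((c i - c k) * poly (pderiv (lagr c r k)) \<sigma>)
     * phi1 (of_real (c i - c k) * z) else 0)"
    unfolding node_A_def by (intro arg_cong[where f = uminus] sum.cong) (auto simp: lagr_at_1)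
  also have "\<dots> = - (\<Sum>k<r. of_real ((1 - c k) * poly (pderiv (lagr c r k)) \<sigma>) * phi1 (of_real (1 - c k) * z))"
    using cr by simp
  \<comment> \<open>The term k = r vanishes because c_r = 1; adding it completes the sum to all
    nodes, as interpolation requires.\<close>
  also have "\<dots> = - (\<Sum>k\<in>insert r {..<r}. of_real ((1 - c k) * poly (pderiv (lagr c r k)) \<sigma>) * phi1 (of_real (1 - c k) * z))"
    using cr by (subst sum.insert) auto
  also have "insert r {..<r} = {0..r}" by auto
  finally show ?thesis by simp
qed

lemma pderiv_has_integral:
  "((\<lambda>\<sigma>. of_real (poly (pderiv p) \<sigma>) :: complex) has_integral of_real (poly p 1 - poly p 0)) {0..1}" for p :: "real poly"
proof -
  have "(poly (pderiv p) has_integral (poly p 1 - poly p 0)) {0..1}"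
    by (rule fundamental_theorem_of_calculus)
       (auto intro!: DERIV_subset[OF poly_DERIV] simp flip: has_real_derivative_iff_has_vector_derivative)
  then show ?thesis by (rule has_integral_of_real)
qed

text \<open>Each inner integral is the difference of l_k at 1 and at 0. As k < i \<le> r, the node 1
  contributes nothing, and only k = 0 survives, with the value -1.\<close>

lemma node_A_integral:
  "integral {0..1} (\<lambda>\<sigma>. node_A c r \<tau> \<sigma> z) = (\<Sum>i=0..r. of_real (c i) * of_real (poly (lagr c r i) \<tau>) * phi1 (of_real (c i) * z))"
proof -
  have "((\<lambda>\<sigma>. - (\<Sum>i=0..r. \<Sum>k<i. of_real ((c i - c k) * poly (lagr c r i) \<tau>) * phi1 (of_real (c i - c k) * z)
        * of_real (poly (pderiv (lagr c r k)) \<sigma>))) has_integral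
      - (\<Sum>i=0..r. \<Sum>k<i. of_real ((c i - c k) * poly (lagr c r i) \<tau>) * phi1 (of_real (c i - c k) * z)
        * of_real (poly (lagr c r k) 1 - poly (lagr c r k) 0))) {0..1}"
    by (intro has_integral_neg has_integral_sum has_integral_mult_right pderiv_has_integral) auto
  moreover have "(\<Sum>k<i. of_real ((c i - c k) * poly (lagr c r i) \<tau>) * phi1 (of_real (c i - c k) * z)
        * of_real (poly (lagr c r k) 1 - poly (lagr c r k) 0))
     = - (of_real (c i) * of_real (poly (lagr c r i) \<tau>) * phi1 (of_real (c i) * z))" if "i \<in> {0..r}" for i
  proof (cases "i = 0")
    case False
    have "(\<Sum>k<i. of_real ((c i - c k) * poly (lagr c r i) \<tau>) * phi1 (of_real (c i - c k) * z)
        * of_real (poly (lagr c r k) 1 - poly (lagr c r k) 0))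
      = (\<Sum>k<i. if k = 0 then - (of_real (c i * poly (lagr c r i) \<tau>) * phi1 (of_real (c i) * z)) else 0)"
      using that by (intro sum.cong) (auto simp: lagr_at_1 lagr_at_0 c0)
    then show ?thesis using False by simp
  qed (simp add: c0)
  ultimately have "((\<lambda>\<sigma>. node_A c r \<tau> \<sigma> z) has_integral
      (\<Sum>i=0..r. of_real (c i) * of_real (poly (lagr c r i) \<tau>) * phi1 (of_real (c i) * z))) {0..1}"
    by (simp add: node_A_def[abs_def] sum_negf mult_ac)
  then show ?thesis by (rule integral_unique)
qed

text \<open>Interpolation at r + 1 nodes reproduces powers up to degree r, so a Taylor polynomial
  with q \<le> r + 1 terms cancels and only remainders are left.\<close>

lemma node_C_approx_eq:
  assumes "q \<le> Suc r"
  shows "node_C c r \<tau> z - exp (of_real \<tau> * z)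
    = (\<Sum>k=0..r. of_real (poly (lagr c r k) \<tau>) * exp_rem q (of_real (c k) * z)) - exp_rem q (of_real \<tau> * z)"
proof -
  have "(\<Sum>k=0..r. of_real (poly (lagr c r k) \<tau>) * (\<Sum>j<q. (of_real (c k) * z) ^ j / fact j))
      = (\<Sum>j<q. (\<Sum>k=0..r. of_real (c k ^ j * poly (lagr c r k) \<tau>)) * (z ^ j / fact j))"
    by (subst sum_distrib_left, subst sum.swap) (simp add: sum_distrib_left sum_distrib_right sum_divide_distrib power_mult_distrib mult_ac)
  also have "\<dots> = (\<Sum>j<q. (of_real \<tau> * z) ^ j / fact j)"
  proof (intro sum.cong refl)
    fix j assume "j \<in> {..<q}"
    then have "degree (monom 1 j :: real poly) \<le> r" using assms by (simp add: degree_monom_eq)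
    from lagr_interpolation_poly[OF this, of \<tau>]
    have "(\<Sum>k=0..r. c k ^ j * poly (lagr c r k) \<tau>) = \<tau> ^ j" by (simp add: poly_monom)
    then have "(\<Sum>k=0..r. of_real (c k ^ j * poly (lagr c r k) \<tau>)) = (of_real (\<tau> ^ j) :: complex)"
      by (metis of_real_sum)
    then show "(\<Sum>k=0..r. of_real (c k ^ j * poly (lagr c r k) \<tau>)) * (z ^ j / fact j) = (of_real \<tau> * z) ^ j / fact j"
      by (simp add: power_mult_distrib)
  qed
  finally show ?thesis
    by (simp add: node_C_def exp_rem_def right_diff_distrib sum_subtractf)
qed

text \<open>The same cancellation for the derivative of the interpolant, applied to the powers (1 -
  x)^(j + 1). They have one degree more than the powers in the kernel, so q stops at r.\<close>

lemma node_A_1_approx_eq: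
  assumes "q \<le> r"
  shows "node_A c r 1 \<sigma> z - exp (of_real (1 - \<sigma>) * z)
    = - (\<Sum>k=0..r. of_real (1 - c k) * of_real (poly (pderiv (lagr c r k)) \<sigma>) * phi1_rem q (of_real (1 - c k) * z))
      - exp_rem q (of_real (1 - \<sigma>) * z)"
proof -
  have "(\<Sum>k=0..r. of_real (1 - c k) * of_real (poly (pderiv (lagr c r k)) \<sigma>) * (\<Sum>j<q. (of_real (1 - c k) * z) ^ j / fact (Suc j)))
      = (\<Sum>j<q. (\<Sum>k=0..r. of_real ((1 - c k) ^ Suc j * poly (pderiv (lagr c r k)) \<sigma>)) * (z ^ j / fact (Suc j)))"
    by (subst sum_distrib_left, subst sum.swap) (simp add: sum_distrib_left sum_distrib_right sum_divide_distrib power_mult_distrib mult_ac)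
  also have "\<dots> = - (\<Sum>j<q. (of_real (1 - \<sigma>) * z) ^ j / fact j)"
    unfolding sum_negf[symmetric]
  proof (intro sum.cong refl)
    fix j assume "j \<in> {..<q}"
    then have "degree ([:1, - 1:] ^ Suc j :: real poly) \<le> r"
      using assms by (simp add: degree_power_eq del: power_Suc)
    from lagr_interpolation_pderiv[OF this, of \<sigma>]
    have "(\<Sum>k=0..r. (1 - c k) ^ Suc j * poly (pderiv (lagr c r k)) \<sigma>) = - (real (Suc j) * (1 - \<sigma>) ^ j)"
      by (simp add: poly_power pderiv_power_Suc pderiv_pCons algebra_simps del: power_Suc)
    then have "(\<Sum>k=0..r. of_real ((1 - c k) ^ Suc j * poly (pderiv (lagr c r k)) \<sigma>)) = (of_real (- (real (Suc j) * (1 - \<sigma>) ^ j)) :: complex)"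
      by (metis of_real_sum)
    moreover have "of_real (- (real (Suc j) * (1 - \<sigma>) ^ j)) * (z ^ j / fact (Suc j)) = - ((of_real (1 - \<sigma>) * z) ^ j / fact j)"
      by (simp add: power_mult_distrib mult.assoc del: of_nat_Suc)
    ultimately show "(\<Sum>k=0..r. of_real ((1 - c k) ^ Suc j * poly (pderiv (lagr c r k)) \<sigma>)) * (z ^ j / fact (Suc j)) = - ((of_real (1 - \<sigma>) * z) ^ j / fact j)"
      by simp
  qed
  finally show ?thesis
    unfolding node_A_1 by (simp add: exp_rem_def phi1_rem_def right_diff_distrib sum_subtractf)
qed

text \<open>The powers of \<tau> in \<tau> phi1(\<tau> z) start with degree 1, which again costs one
  order.\<close>

lemma node_A_integral_approx_eq:
  assumes "q \<le> r"
  shows "integral {0..1} (\<lambda>\<sigma>. node_A c r \<tau> \<sigma> z) - of_real \<tau> * phi1 (of_real \<tau> * z)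
    = (\<Sum>i=0..r. of_real (c i) * of_real (poly (lagr c r i) \<tau>) * phi1_rem q (of_real (c i) * z))
      - of_real \<tau> * phi1_rem q (of_real \<tau> * z)"
proof -
  have "(\<Sum>i=0..r. of_real (c i) * of_real (poly (lagr c r i) \<tau>) * (\<Sum>j<q. (of_real (c i) * z) ^ j / fact (Suc j)))
      = (\<Sum>j<q. (\<Sum>k=0..r. of_real (c k ^ Suc j * poly (lagr c r k) \<tau>)) * (z ^ j / fact (Suc j)))"
    by (subst sum_distrib_left, subst sum.swap) (simp add: sum_distrib_left sum_distrib_right sum_divide_distrib power_mult_distrib mult_ac)
  also have "\<dots> = (\<Sum>j<q. of_real \<tau> * ((of_real \<tau> * z) ^ j / fact (Suc j)))"
  proof (intro sum.cong refl)
    fix j assume "j \<in> {..<q}"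
    then have "degree (monom 1 (Suc j) :: real poly) \<le> r" using assms by (simp add: degree_monom_eq)
    from lagr_interpolation_poly[OF this, of \<tau>]
    have "(\<Sum>k=0..r. c k ^ Suc j * poly (lagr c r k) \<tau>) = \<tau> ^ Suc j" by (simp add: poly_monom del: power_Suc)
    then have "(\<Sum>k=0..r. of_real (c k ^ Suc j * poly (lagr c r k) \<tau>)) = (of_real (\<tau> ^ Suc j) :: complex)"
      by (metis of_real_sum)
    then show "(\<Sum>k=0..r. of_real (c k ^ Suc j * poly (lagr c r k) \<tau>)) * (z ^ j / fact (Suc j)) = of_real \<tau> * ((of_real \<tau> * z) ^ j / fact (Suc j))"
      by (simp add: power_mult_distrib)
  qed
  finally show ?thesis
    unfolding node_A_integral by (simp add: phi1_rem_def right_diff_distrib sum_subtractf sum_distrib_left)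
qed

lemma node_bound_exists:
  obtains K where "1 \<le> K" "\<And>k. k \<le> r \<Longrightarrow> \<bar>c k\<bar> \<le> K"
    "\<And>k t. k \<le> r \<Longrightarrow> t \<in> {0..1} \<Longrightarrow> \<bar>poly (lagr c r k) t\<bar> \<le> K"
    "\<And>k t. k \<le> r \<Longrightarrow> t \<in> {0..1} \<Longrightarrow> \<bar>poly (pderiv (lagr c r k)) t\<bar> \<le> K"
    "\<And>k t. k \<le> r \<Longrightarrow> t \<in> {0..1} \<Longrightarrow> \<bar>poly (pderiv (pderiv (lagr c r k))) t\<bar> \<le> K"
proof -
  obtain B :: "real poly \<Rightarrow> real" where B: "\<bar>poly p t\<bar> \<le> B p" if "t \<in> {0..1}" for p t
    using poly_bounded_interval by metis
  have B0: "0 \<le> B p" for p using B[of 0 p] by (auto intro: order_trans[OF abs_ge_zero])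
  define S where "S k = \<bar>c k\<bar> + B (lagr c r k) + B (pderiv (lagr c r k)) + B (pderiv (pderiv (lagr c r k)))" for k
  have S0: "0 \<le> S k" for k by (simp add: S_def B0)
  have S: "S k \<le> 1 + (\<Sum>k=0..r. S k)" if "k \<le> r" for k
    using member_le_sum[of k "{0..r}" S] that S0 by auto
  show ?thesis
  proof (rule that)
    show "1 \<le> 1 + (\<Sum>k=0..r. S k)" by (simp add: sum_nonneg S0)
    fix k assume k: "k \<le> r"
    show "\<bar>c k\<bar> \<le> 1 + (\<Sum>k=0..r. S k)"
      by (rule order_trans[OF _ S[OF k]]) (simp add: S_def B0)
    fix t :: real assume t: "t \<in> {0..1}"
    show "\<bar>poly (lagr c r k) t\<bar> \<le> 1 + (\<Sum>k=0..r. S k)"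
      by (rule order_trans[OF B[OF t] order_trans[OF _ S[OF k]]]) (simp add: S_def B0)
    show "\<bar>poly (pderiv (lagr c r k)) t\<bar> \<le> 1 + (\<Sum>k=0..r. S k)"
      by (rule order_trans[OF B[OF t] order_trans[OF _ S[OF k]]]) (simp add: S_def B0)
    show "\<bar>poly (pderiv (pderiv (lagr c r k))) t\<bar> \<le> 1 + (\<Sum>k=0..r. S k)"
      by (rule order_trans[OF B[OF t] order_trans[OF _ S[OF k]]]) (simp add: S_def B0)
  qed
qed

lemma norm_node_sum_le:
  fixes f :: "nat \<Rightarrow> complex"
  assumes "\<And>k. k \<le> r \<Longrightarrow> cmod (f k) \<le> X"
  shows "cmod (\<Sum>k=0..r. f k) \<le> real (Suc r) * X"
  using sum_norm_bound[of "{0..r}" f X] assms by simp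

lemma norm_node_double_sum_le:
  fixes f :: "nat \<Rightarrow> nat \<Rightarrow> complex"
  assumes "\<And>i k. i \<le> r \<Longrightarrow> k < i \<Longrightarrow> cmod (f i k) \<le> X" "0 \<le> X"
  shows "cmod (\<Sum>i=0..r. \<Sum>k<i. f i k) \<le> real (Suc r) * (real (Suc r) * X)"
proof (rule norm_node_sum_le)
  fix i assume i: "i \<le> r"
  have "cmod (\<Sum>k<i. f i k) \<le> of_nat (card {..<i}) * X"
    using assms i by (intro sum_norm_bound) auto
  also have "\<dots> \<le> real (Suc r) * X" using i assms by (intro mult_right_mono) auto
  finally show "cmod (\<Sum>k<i. f i k) \<le> real (Suc r) * X" .
qed

lemma node_method_exists:
  obtains cm0 where "\<And>cm. cm0 \<le> cm \<Longrightarrow> ep_method (node_C c r) (node_A c r) cm r"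
proof -
  obtain K where K: "1 \<le> K" "\<And>k. k \<le> r \<Longrightarrow> \<bar>c k\<bar> \<le> K"
    "\<And>k t. k \<le> r \<Longrightarrow> t \<in> {0..1} \<Longrightarrow> \<bar>poly (lagr c r k) t\<bar> \<le> K"
    "\<And>k t. k \<le> r \<Longrightarrow> t \<in> {0..1} \<Longrightarrow> \<bar>poly (pderiv (lagr c r k)) t\<bar> \<le> K"
    "\<And>k t. k \<le> r \<Longrightarrow> t \<in> {0..1} \<Longrightarrow> \<bar>poly (pderiv (pderiv (lagr c r k))) t\<bar> \<le> K"
    by (rule node_bound_exists, rule that)
  \<comment> \<open>L bounds the differences of nodes, which need not lie in [0, 1].\<close>
  define L where "L = 2 * K"
  define n where "n = real (Suc r)"
  \<comment> \<open>The exponent r + 5 majorizes every power of L that occurs: at most r + 2 in the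
    approximation bounds, at most 4 in the others. The two factors n count the double sums, and the
    summand 1 absorbs the remainder of the exact term.\<close>
  define cm0 where "cm0 = n * (n * L ^ (r + 5)) + 1"
  have L: "1 \<le> L" "K \<le> L" using K by (auto simp: L_def)
  have n: "1 \<le> n" by (simp add: n_def)
  have Lp: "0 \<le> L ^ j" "1 \<le> L ^ j" for j using L by (auto intro: one_le_power)
  have nn: "n * x + 1 \<le> cm0" "n * x \<le> cm0" "n * (n * x) \<le> cm0" if "x \<le> L ^ j" "j \<le> r + 5" "0 \<le> x" for x j
  proof -
    have x: "x \<le> L ^ (r + 5)" using that power_increasing[OF that(2) L(1)] by linarith
    have "n * (n * x) \<le> n * (n * L ^ (r + 5))" using x n by (intro mult_left_mono) auto
    moreover have "1 * (n * x) \<le> n * (n * x)" using n that by (intro mult_right_mono) auto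
    ultimately show "n * x + 1 \<le> cm0" "n * x \<le> cm0" "n * (n * x) \<le> cm0" by (auto simp: cm0_def)
  qed
  have cd: "\<bar>c i - c k\<bar> \<le> L" if "i \<le> r" "k \<le> r" for i k
    using K(2)[OF that(1)] K(2)[OF that(2)] by (simp add: L_def)
  have cd1: "\<bar>1 - c k\<bar> \<le> L" if "k \<le> r" for k
    using cd[OF order_refl that] cr by simp
  have KL: "\<bar>x\<bar> \<le> K \<Longrightarrow> \<bar>x\<bar> \<le> L" for x using L by linarith
  have phi: "cmod (phi1 (of_real a * z)) \<le> 1" if "Re z = 0" for a z
    using that by (intro phi1_le) simp
  have pw: "cmod (of_real a * z) ^ q \<le> cmod z ^ q" if "\<bar>a\<bar> \<le> 1" for a z q
    by (intro power_mono) (use that in \<open>auto simp: norm_mult intro!: mult_left_le_one_le\<close>)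
  show thesis
  proof (rule that)
    fix cm assume cm: "cm0 \<le> cm"
    note nn' = order_trans[OF nn(1) cm] order_trans[OF nn(2) cm] order_trans[OF nn(3) cm]
    show "ep_method (node_C c r) (node_A c r) cm r"
    proof unfold_locales
      show "1 \<le> cm" using cm n Lp by (auto simp: cm0_def intro: order_trans[rotated])
      fix z :: complex
      show "node_C c r 1 z = exp z" by (rule node_C_1)
      show "integral {0..1} (\<lambda>\<sigma>. node_A c r 1 \<sigma> z) = phi1 z"
      proof -
        have "(\<Sum>i=0..r. of_real (c i) * of_real (poly (lagr c r i) 1) * phi1 (of_real (c i) * z))
          = (\<Sum>i=0..r. if i = r then phi1 z else 0)"
          by (intro sum.cong) (auto simp: lagr_at_1 cr)
        then show ?thesis by (simp add: node_A_integral)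
      qed
      assume z: "Re z = 0"
      note e1 = norm_exp_Re_0[of "of_real a * z" for a]
      fix \<tau> :: real assume \<tau>: "\<tau> \<in> {0..1}"
      have \<tau>1: "\<bar>\<tau>\<bar> \<le> 1" using \<tau> by auto
      show "cmod (node_C c r \<tau> z) \<le> cm"
      proof -
        have "cmod (node_C c r \<tau> z) \<le> real (Suc r) * K"
          unfolding node_C_def
          by (rule norm_node_sum_le) (use K \<tau> z in \<open>auto simp: norm_mult e1\<close>)
        also have "\<dots> \<le> cm" unfolding n_def[symmetric]
          by (rule nn'(2)[of _ 1]) (use K L in auto)
        finally show ?thesis .
      qed
      show "cmod (node_C c r \<tau> z - exp (of_real \<tau> * z)) \<le> cm * cmod z ^ q" if q: "q \<le> Suc r" for q
      proof -
        have "cmod (of_real (poly (lagr c r k) \<tau>) * exp_rem q (of_real (c k) * z)) \<le> L ^ Suc q * cmod z ^ q" if k: "k \<le> r" for k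
        proof -
          have "cmod (exp_rem q (of_real (c k) * z)) \<le> cmod (of_real (c k) * z) ^ q"
            by (rule exp_rem_le) (use z in simp)
          also have "\<dots> = \<bar>c k\<bar> ^ q * cmod z ^ q" by (simp add: norm_mult power_mult_distrib)
          also have "\<dots> \<le> L ^ q * cmod z ^ q" using KL[OF K(2)[OF k]] by (intro mult_right_mono power_mono) auto
          finally have "cmod (exp_rem q (of_real (c k) * z)) \<le> L ^ q * cmod z ^ q" .
          then have "\<bar>poly (lagr c r k) \<tau>\<bar> * cmod (exp_rem q (of_real (c k) * z)) \<le> L * (L ^ q * cmod z ^ q)"
            using KL[OF K(3)[OF k \<tau>]] L by (intro mult_mono) auto
          then show ?thesis by (simp add: norm_mult mult.assoc)
        qed
        then have "cmod (\<Sum>k=0..r. of_real (poly (lagr c r k) \<tau>) * exp_rem q (of_real (c k) * z)) \<le> n * (L ^ Suc q * cmod z ^ q)"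
          unfolding n_def by (rule norm_node_sum_le)
        moreover have "cmod (exp_rem q (of_real \<tau> * z)) \<le> cmod z ^ q"
          by (rule order_trans[OF exp_rem_le pw[OF \<tau>1]]) (use z in simp)
        ultimately have "cmod (node_C c r \<tau> z - exp (of_real \<tau> * z)) \<le> (n * L ^ Suc q + 1) * cmod z ^ q"
          unfolding node_C_approx_eq[OF q] by (intro order_trans[OF norm_triangle_ineq4]) (simp add: algebra_simps)
        also have "\<dots> \<le> cm * cmod z ^ q"
          by (intro mult_right_mono nn'(1)[of _ "Suc q"]) (use q Lp in \<open>auto simp del: power_Suc\<close>)
        finally show ?thesis .
      qed
      show "cmod (integral {0..1} (\<lambda>\<sigma>. node_A c r \<tau> \<sigma> z) - of_real \<tau> * phi1 (of_real \<tau> * z)) \<le> cm * cmod z ^ q"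
        if q: "q \<le> r" for q
      proof -
        have "cmod (of_real (c k) * of_real (poly (lagr c r k) \<tau>) * phi1_rem q (of_real (c k) * z)) \<le> L ^ (q + 2) * cmod z ^ q"
          if k: "k \<le> r" for k
        proof -
          have "cmod (phi1_rem q (of_real (c k) * z)) \<le> cmod (of_real (c k) * z) ^ q"
            by (rule phi1_rem_le) (use z in simp)
          also have "\<dots> = \<bar>c k\<bar> ^ q * cmod z ^ q" by (simp add: norm_mult power_mult_distrib)
          also have "\<dots> \<le> L ^ q * cmod z ^ q" using KL[OF K(2)[OF k]] by (intro mult_right_mono power_mono) auto
          finally have "cmod (phi1_rem q (of_real (c k) * z)) \<le> L ^ q * cmod z ^ q" .
          then have "\<bar>c k\<bar> * \<bar>poly (lagr c r k) \<tau>\<bar> * cmod (phi1_rem q (of_real (c k) * z)) \<le> L * L * (L ^ q * cmod z ^ q)"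
            using KL[OF K(3)[OF k \<tau>]] KL[OF K(2)[OF k]] L by (intro mult_mono) auto
          then show ?thesis by (simp add: norm_mult mult.assoc)
        qed
        then have "cmod (\<Sum>k=0..r. of_real (c k) * of_real (poly (lagr c r k) \<tau>) * phi1_rem q (of_real (c k) * z)) \<le> n * (L ^ (q + 2) * cmod z ^ q)"
          unfolding n_def by (rule norm_node_sum_le)
        moreover have "cmod (of_real \<tau> * phi1_rem q (of_real \<tau> * z)) \<le> cmod z ^ q"
        proof -
          have "cmod (phi1_rem q (of_real \<tau> * z)) \<le> cmod z ^ q"
            by (rule order_trans[OF phi1_rem_le pw[OF \<tau>1]]) (use z in simp)
          then have "\<bar>\<tau>\<bar> * cmod (phi1_rem q (of_real \<tau> * z)) \<le> 1 * cmod z ^ q"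
            using \<tau>1 by (intro mult_mono) auto
          then show ?thesis by (simp add: norm_mult)
        qed
        ultimately have "cmod (integral {0..1} (\<lambda>\<sigma>. node_A c r \<tau> \<sigma> z) - of_real \<tau> * phi1 (of_real \<tau> * z)) \<le> (n * L ^ (q + 2) + 1) * cmod z ^ q"
          unfolding node_A_integral_approx_eq[OF q] by (intro order_trans[OF norm_triangle_ineq4]) (simp add: algebra_simps)
        also have "\<dots> \<le> cm * cmod z ^ q"
          by (intro mult_right_mono nn'(1)[of _ "q + 2"]) (use q Lp in \<open>auto simp del: power_Suc\<close>)
        finally show ?thesis .
      qed
      fix \<sigma> :: real
      show "cmod (node_C c r \<sigma> z - node_C c r \<tau> z) \<le> cm * \<bar>\<sigma> - \<tau>\<bar>" if \<sigma>: "\<sigma> \<in> {0..1}"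
      proof -
        have "cmod (\<Sum>k=0..r. of_real (poly (lagr c r k) \<sigma> - poly (lagr c r k) \<tau>) * exp (of_real (c k) * z))
            \<le> real (Suc r) * (K * \<bar>\<sigma> - \<tau>\<bar>)"
          by (rule norm_node_sum_le)
             (use poly_lipschitz_interval[OF K(4) \<tau> \<sigma>] z in \<open>simp add: norm_mult e1 del: of_real_diff\<close>)
        also have "\<dots> = (n * K) * \<bar>\<sigma> - \<tau>\<bar>" by (simp add: n_def)
        also have "\<dots> \<le> cm * \<bar>\<sigma> - \<tau>\<bar>"
          by (intro mult_right_mono nn'(2)[of _ 1]) (use K L in auto)
        finally show ?thesis by (simp add: node_C_def sum_subtractf left_diff_distrib)
      qed
      assume \<sigma>: "\<sigma> \<in> {0..1}"
      have b2: "\<bar>c i - c k\<bar> * u * v * w \<le> L * L * L * X"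
        if "i \<le> r" "k \<le> r" "0 \<le> u" "u \<le> L" "0 \<le> v" "v \<le> L" "0 \<le> w" "w \<le> X" for i k u v w X
        using that cd[OF that(1,2)] L by (intro mult_mono) auto
      show "cmod (node_A c r \<tau> \<sigma> z) \<le> cm"
      proof -
        have "cmod (node_A c r \<tau> \<sigma> z) \<le> real (Suc r) * (real (Suc r) * (L * L * L * 1))"
          unfolding node_A_def norm_minus_cancel
        proof (rule norm_node_double_sum_le)
          fix i k assume "i \<le> r" "k < i"
          then show "cmod (of_real ((c i - c k) * poly (lagr c r i) \<tau> * poly (pderiv (lagr c r k)) \<sigma>)
              * phi1 (of_real (c i - c k) * z)) \<le> L * L * L * 1"
            unfolding norm_mult norm_of_real abs_mult
            using KL[OF K(3)] KL[OF K(4)] \<tau> \<sigma> by (intro b2 phi z) auto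
        qed (use L in auto)
        also have "\<dots> \<le> cm" unfolding n_def[symmetric]
          by (rule nn'(3)[of _ 3]) (use L in \<open>auto simp: power3_eq_cube\<close>)
        finally show ?thesis .
      qed
      show "cmod (node_A c r \<tau> \<sigma> z - node_A c r \<tau> \<sigma> 0) \<le> cm * cmod z"
      proof -
        have "cmod (\<Sum>i=0..r. \<Sum>k<i. of_real ((c i - c k) * poly (lagr c r i) \<tau> * poly (pderiv (lagr c r k)) \<sigma>)
              * phi1_rem 1 (of_real (c i - c k) * z)) \<le> real (Suc r) * (real (Suc r) * (L * L * L * (L * cmod z)))"
        proof (rule norm_node_double_sum_le)
          fix i k assume ik: "i \<le> r" "k < i"
          have "cmod (phi1_rem 1 (of_real (c i - c k) * z)) \<le> cmod (of_real (c i - c k) * z) ^ 1"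
            by (rule phi1_rem_le) (use z in simp)
          also have "\<dots> \<le> L * cmod z"
            using cd[of i k] ik by (auto simp: norm_mult simp del: of_real_diff intro!: mult_right_mono)
          finally show "cmod (of_real ((c i - c k) * poly (lagr c r i) \<tau> * poly (pderiv (lagr c r k)) \<sigma>)
              * phi1_rem 1 (of_real (c i - c k) * z)) \<le> L * L * L * (L * cmod z)"
            unfolding norm_mult norm_of_real abs_mult
            using KL[OF K(3)] KL[OF K(4)] \<tau> \<sigma> ik by (intro b2) auto
        qed (use L in auto)
        also have "\<dots> = (n * (n * L ^ 4)) * cmod z" by (simp add: n_def power4_eq_xxxx)
        also have "\<dots> \<le> cm * cmod z" by (intro mult_right_mono nn'(3)[of _ 4]) (use Lp in auto)
        finally have "cmod (- (\<Sum>i=0..r. \<Sum>k<i. of_real ((c i - c k) * poly (lagr c r i) \<tau> * poly (pderiv (lagr c r k)) \<sigma>)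
              * phi1_rem 1 (of_real (c i - c k) * z))) \<le> cm * cmod z" by simp
        also have "- (\<Sum>i=0..r. \<Sum>k<i. of_real ((c i - c k) * poly (lagr c r i) \<tau> * poly (pderiv (lagr c r k)) \<sigma>)
              * phi1_rem 1 (of_real (c i - c k) * z)) = node_A c r \<tau> \<sigma> z - node_A c r \<tau> \<sigma> 0"
          by (simp add: node_A_def phi1_rem_def right_diff_distrib sum_subtractf)
        finally show ?thesis .
      qed
      show "cmod (node_A c r 1 \<sigma> z - exp (of_real (1 - \<sigma>) * z)) \<le> cm * cmod z ^ q" if q: "q \<le> r" for q
      proof -
        have "cmod (of_real (1 - c k) * of_real (poly (pderiv (lagr c r k)) \<sigma>) * phi1_rem q (of_real (1 - c k) * z)) \<le> L ^ (q + 2) * cmod z ^ q"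
          if k: "k \<le> r" for k
        proof -
          have "cmod (phi1_rem q (of_real (1 - c k) * z)) \<le> cmod (of_real (1 - c k) * z) ^ q"
            by (rule phi1_rem_le) (use z in simp)
          also have "\<dots> = \<bar>1 - c k\<bar> ^ q * cmod z ^ q" by (simp add: norm_mult power_mult_distrib del: of_real_diff)
          also have "\<dots> \<le> L ^ q * cmod z ^ q" using cd1[OF k] by (intro mult_right_mono power_mono) auto
          finally have "cmod (phi1_rem q (of_real (1 - c k) * z)) \<le> L ^ q * cmod z ^ q" .
          then have "\<bar>1 - c k\<bar> * \<bar>poly (pderiv (lagr c r k)) \<sigma>\<bar> * cmod (phi1_rem q (of_real (1 - c k) * z)) \<le> L * L * (L ^ q * cmod z ^ q)"
            using KL[OF K(4)[OF k \<sigma>]] cd1[OF k] L by (intro mult_mono) auto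
          then show ?thesis by (simp add: norm_mult mult.assoc del: of_real_diff)
        qed
        then have "cmod (\<Sum>k=0..r. of_real (1 - c k) * of_real (poly (pderiv (lagr c r k)) \<sigma>) * phi1_rem q (of_real (1 - c k) * z)) \<le> n * (L ^ (q + 2) * cmod z ^ q)"
          unfolding n_def by (rule norm_node_sum_le)
        moreover have "cmod (exp_rem q (of_real (1 - \<sigma>) * z)) \<le> cmod z ^ q"
        proof -
          have "cmod (exp_rem q (of_real (1 - \<sigma>) * z)) \<le> cmod (of_real (1 - \<sigma>) * z) ^ q"
            by (rule exp_rem_le) (use z in simp)
          also have "\<dots> \<le> cmod z ^ q"
            using \<sigma> by (intro power_mono) (auto simp: norm_mult simp del: of_real_diff intro!: mult_left_le_one_le)
          finally show ?thesis .
        qed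
        ultimately have "cmod (node_A c r 1 \<sigma> z - exp (of_real (1 - \<sigma>) * z)) \<le> (n * L ^ (q + 2) + 1) * cmod z ^ q"
          unfolding node_A_1_approx_eq[OF q]
          by (intro order_trans[OF norm_triangle_ineq4]) (simp add: algebra_simps)
        also have "\<dots> \<le> cm * cmod z ^ q"
          by (intro mult_right_mono nn'(1)[of _ "q + 2"]) (use q Lp in \<open>auto simp del: power_Suc\<close>)
        finally show ?thesis .
      qed
      fix \<rho> :: real assume \<rho>: "\<rho> \<in> {0..1}"
      have lip: "cmod (\<Sum>i=0..r. \<Sum>k<i. of_real ((c i - c k) * u i * v k) * phi1 (of_real (c i - c k) * z)) \<le> cm * X"
        if uv: "\<And>i. i \<le> r \<Longrightarrow> \<bar>u i\<bar> \<le> L * x" "\<And>k. k \<le> r \<Longrightarrow> \<bar>v k\<bar> \<le> L * y" and X: "x * y = X" "0 \<le> x" "0 \<le> y"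
        for u v :: "nat \<Rightarrow> real" and X x y
      proof -
        have "cmod (\<Sum>i=0..r. \<Sum>k<i. of_real ((c i - c k) * u i * v k) * phi1 (of_real (c i - c k) * z))
          \<le> real (Suc r) * (real (Suc r) * (L * (L * x) * (L * y) * 1))"
        proof (rule norm_node_double_sum_le)
          fix i k assume ik: "i \<le> r" "k < i"
          show "cmod (of_real ((c i - c k) * u i * v k) * phi1 (of_real (c i - c k) * z)) \<le> L * (L * x) * (L * y) * 1"
            unfolding norm_mult norm_of_real abs_mult
            using cd[of i k] uv ik L X phi[OF z, of "c i - c k"] by (intro mult_mono mult_nonneg_nonneg) auto
        qed (use L X in auto)
        also have "\<dots> = (n * (n * L ^ 3)) * X" by (simp add: n_def power3_eq_cube X(1)[symmetric])
        also have "\<dots> \<le> cm * X" by (intro mult_right_mono nn'(3)[of _ 3]) (use Lp L X in auto)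
        finally show ?thesis .
      qed
      have lipK: "K * x \<le> L * x" if "0 \<le> x" for x using L that by (intro mult_right_mono) auto
      show "cmod (node_A c r \<rho> \<sigma> z - node_A c r \<tau> \<sigma> z) \<le> cm * \<bar>\<rho> - \<tau>\<bar>"
      proof -
        have "cmod (\<Sum>i=0..r. \<Sum>k<i. of_real ((c i - c k) * (poly (lagr c r i) \<rho> - poly (lagr c r i) \<tau>) * poly (pderiv (lagr c r k)) \<sigma>)
            * phi1 (of_real (c i - c k) * z)) \<le> cm * \<bar>\<rho> - \<tau>\<bar>"
          by (rule lip[where x = "\<bar>\<rho> - \<tau>\<bar>" and y = 1])
             (use KL[OF K(4)] \<sigma> order_trans[OF poly_lipschitz_interval[OF K(4) \<tau> \<rho>] lipK] in auto)
        then have "cmod (- (\<Sum>i=0..r. \<Sum>k<i. of_real ((c i - c k) * (poly (lagr c r i) \<rho> - poly (lagr c r i) \<tau>) * poly (pderiv (lagr c r k)) \<sigma>)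
            * phi1 (of_real (c i - c k) * z))) \<le> cm * \<bar>\<rho> - \<tau>\<bar>" by simp
        then show ?thesis
          by (simp add: node_A_def sum_subtractf[symmetric] sum_negf[symmetric] algebra_simps)
      qed
      show "cmod (node_A c r \<tau> \<rho> z - node_A c r \<tau> \<sigma> z) \<le> cm * \<bar>\<rho> - \<sigma>\<bar>"
      proof -
        have "cmod (\<Sum>i=0..r. \<Sum>k<i. of_real ((c i - c k) * poly (lagr c r i) \<tau> * (poly (pderiv (lagr c r k)) \<rho> - poly (pderiv (lagr c r k)) \<sigma>))
            * phi1 (of_real (c i - c k) * z)) \<le> cm * \<bar>\<rho> - \<sigma>\<bar>"
          by (rule lip[where y = "\<bar>\<rho> - \<sigma>\<bar>" and x = 1])
             (use KL[OF K(3)] \<tau> order_trans[OF poly_lipschitz_interval[OF K(5) \<sigma> \<rho>] lipK] in auto)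
        then have "cmod (- (\<Sum>i=0..r. \<Sum>k<i. of_real ((c i - c k) * poly (lagr c r i) \<tau> * (poly (pderiv (lagr c r k)) \<rho> - poly (pderiv (lagr c r k)) \<sigma>))
            * phi1 (of_real (c i - c k) * z))) \<le> cm * \<bar>\<rho> - \<sigma>\<bar>" by simp
        then show ?thesis
          by (simp add: node_A_def sum_subtractf[symmetric] sum_negf[symmetric] algebra_simps)
      qed
    qed
  qed
qed

end

section \<open>The methods EP1, EP2 and EP3\<close>

text \<open>The weights of the interpolatory quadrature rule on [0, 1].\<close>

definition node_weight :: "(nat \<Rightarrow> real) \<Rightarrow> nat \<Rightarrow> nat \<Rightarrow> real" where
  "node_weight c r k = integral {0..1} (poly (lagr c r k))"

text \<open>For nodes from 0 to 1, the first moment of the stage kernel at z = 0 minus \<tau>^2/2,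
  the first moment of the exact kernel on [0, \<tau>].\<close>

definition node_P :: "(nat \<Rightarrow> real) \<Rightarrow> nat \<Rightarrow> real \<Rightarrow> real" where
  "node_P c r \<tau> = (\<Sum>i=0..r. \<Sum>k<i. (c i - c k) * poly (lagr c r i) \<tau> * node_weight c r k) - \<tau>\<^sup>2 / 2"

lemma poly_has_integral: "(poly p has_integral integral {0..1} (poly p)) {0..1}" for p :: "real poly"
  by (intro integrable_integral integrable_continuous_interval continuous_intros)

lemma pderiv_moment_has_integral:
  fixes p :: "real poly"
  shows "((\<lambda>\<sigma>. poly (pderiv p) \<sigma> * \<sigma>) has_integral (poly p 1 - integral {0..1} (poly p))) {0..1}"
proof -
  have "((\<lambda>\<sigma>. poly p \<sigma> + poly (pderiv p) \<sigma> * \<sigma>) has_integral (poly p 1 * 1 - poly p 0 * 0)) {0..1}"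
    by (rule fundamental_theorem_of_calculus[where f = "\<lambda>\<sigma>. poly p \<sigma> * \<sigma>"])
       (auto intro!: derivative_eq_intros DERIV_subset[OF poly_DERIV]
          simp: has_real_derivative_iff_has_vector_derivative[symmetric])
  from has_integral_diff[OF this poly_has_integral[of p]] show ?thesis by simp
qed

text \<open>The order condition is the vanishing mean of \<open>node_P\<close>: integrating l_i over
  the stages gives its weight, and the mean of \<tau>^2/2 is 1/6.\<close>

lemma node_method3_exists:
  fixes c :: "nat \<Rightarrow> real" and r :: nat
  assumes inj: "inj_on c {0..r}" and c0: "c 0 = 0" and cr: "c r = 1"
    and order: "(\<Sum>i=0..r. \<Sum>k<i. (c i - c k) * node_weight c r i * node_weight c r k) = 1 / 6"
  obtains cm where "ep_method3 (node_C c r) (node_A c r) cm r (node_P c r)"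
proof -
  obtain cm0 where cm0: "\<And>cm. cm0 \<le> cm \<Longrightarrow> ep_method (node_C c r) (node_A c r) cm r"
    by (rule node_method_exists[OF inj c0 cr], rule that)
  define p where "p = (\<Sum>i=0..r. \<Sum>k<i. smult ((c i - c k) * node_weight c r k) (lagr c r i)) - monom (1/2) 2"
  have P: "node_P c r \<tau> = poly p \<tau>" for \<tau>
    by (simp add: node_P_def p_def poly_sum poly_monom mult_ac)
  obtain B1 where B1: "\<bar>poly p t\<bar> \<le> B1" if "t \<in> {0..1}" for t using poly_bounded_interval by metis
  obtain B2 where B2: "\<bar>poly (pderiv p) t\<bar> \<le> B2" if "t \<in> {0..1}" for t using poly_bounded_interval by metis
  define cm where "cm = \<bar>cm0\<bar> + \<bar>B1\<bar> + \<bar>B2\<bar>"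
  interpret ep_method "node_C c r" "node_A c r" cm r
    by (rule cm0) (simp add: cm_def)
  have "ep_method3 (node_C c r) (node_A c r) cm r (node_P c r)"
  proof unfold_locales
    fix \<tau> :: real assume \<tau>: "\<tau> \<in> {0..1}"
    show "\<bar>node_P c r \<tau>\<bar> \<le> cm" using B1[OF \<tau>] by (simp add: P cm_def)
    have "((\<lambda>\<sigma>. - (\<Sum>i=0..r. \<Sum>k<i. (c i - c k) * poly (lagr c r i) \<tau> * (poly (pderiv (lagr c r k)) \<sigma> * \<sigma>))) has_integral
        - (\<Sum>i=0..r. \<Sum>k<i. (c i - c k) * poly (lagr c r i) \<tau> * (poly (lagr c r k) 1 - node_weight c r k))) {0..1}"
      unfolding node_weight_def
      by (intro has_integral_neg has_integral_sum has_integral_mult_right pderiv_moment_has_integral) auto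
    moreover have "(\<Sum>i=0..r. \<Sum>k<i. (c i - c k) * poly (lagr c r i) \<tau> * (poly (lagr c r k) 1 - node_weight c r k))
       = - (\<Sum>i=0..r. \<Sum>k<i. (c i - c k) * poly (lagr c r i) \<tau> * node_weight c r k)"
      unfolding sum_negf[symmetric] by (intro sum.cong refl) (auto simp: lagr_at_1[OF inj c0 cr])
    ultimately have "((\<lambda>\<sigma>. - (\<Sum>i=0..r. \<Sum>k<i. (c i - c k) * poly (lagr c r i) \<tau> * (poly (pderiv (lagr c r k)) \<sigma> * \<sigma>))) has_integral
        (node_P c r \<tau> + \<tau>\<^sup>2 / 2)) {0..1}"
      by (simp add: node_P_def)
    from integral_unique[OF has_integral_of_real[OF this, where 'b = complex]]
    show "integral {0..1} (\<lambda>\<sigma>. node_A c r \<tau> \<sigma> 0 * of_real \<sigma>) = of_real (node_P c r \<tau> + \<tau>\<^sup>2 / 2)"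
      by (simp add: node_A_def sum_distrib_right mult.assoc)
    fix \<tau>' :: real assume \<tau>': "\<tau>' \<in> {0..1}"
    have "\<bar>poly p \<tau>' - poly p \<tau>\<bar> \<le> B2 * \<bar>\<tau>' - \<tau>\<bar>" by (rule poly_lipschitz_interval[OF B2 \<tau> \<tau>'])
    also have "\<dots> \<le> cm * \<bar>\<tau>' - \<tau>\<bar>" by (intro mult_right_mono) (auto simp: cm_def)
    finally show "\<bar>node_P c r \<tau>' - node_P c r \<tau>\<bar> \<le> cm * \<bar>\<tau>' - \<tau>\<bar>" by (simp add: P)
  next
    have "((\<lambda>\<tau>::real. \<tau>\<^sup>2 / 2) has_integral (1 ^ 3 / 6 - 0 ^ 3 / 6)) {0..1}"
      by (rule fundamental_theorem_of_calculus[where f = "\<lambda>\<tau>. \<tau> ^ 3 / 6"])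
         (auto intro!: derivative_eq_intros simp: has_real_derivative_iff_has_vector_derivative[symmetric])
    moreover have "((\<lambda>\<tau>. \<Sum>i=0..r. \<Sum>k<i. ((c i - c k) * node_weight c r k) * poly (lagr c r i) \<tau>) has_integral
        (\<Sum>i=0..r. \<Sum>k<i. ((c i - c k) * node_weight c r k) * node_weight c r i)) {0..1}"
      unfolding node_weight_def[of c r i for i]
      by (intro has_integral_sum has_integral_mult_right poly_has_integral) auto
    ultimately have "((\<lambda>\<tau>. (\<Sum>i=0..r. \<Sum>k<i. ((c i - c k) * node_weight c r k) * poly (lagr c r i) \<tau>) - \<tau>\<^sup>2 / 2) has_integral
        (\<Sum>i=0..r. \<Sum>k<i. ((c i - c k) * node_weight c r k) * node_weight c r i) - (1 ^ 3 / 6 - 0 ^ 3 / 6)) {0..1}"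
      by (intro has_integral_diff)
    moreover have "(\<Sum>i=0..r. \<Sum>k<i. ((c i - c k) * node_weight c r k) * node_weight c r i) = 1 / 6"
      using order by (simp add: mult_ac)
    moreover have "(\<lambda>\<tau>. (\<Sum>i=0..r. \<Sum>k<i. ((c i - c k) * node_weight c r k) * poly (lagr c r i) \<tau>) - \<tau>\<^sup>2 / 2) = node_P c r"
      by (simp add: node_P_def fun_eq_iff mult_ac)
    ultimately have "(node_P c r has_integral 0) {0..1}" by simp
    then show "integral {0..1} (node_P c r) = 0" by (rule integral_unique)
  qed
  then show thesis by (rule that)
qed

section \<open>The three given methods as node methods\<close>

lemma EP1_nodes: "EP1_C = node_C real 1" "EP1_A = node_A real 1"
proof -
  have 0: "{0..Suc 0} - {0} = {Suc 0}" "{0..Suc 0} - {Suc 0} = {0}" by auto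
  have l: "lagr real (Suc 0) 0 = [:1, - 1:]" "lagr real (Suc 0) (Suc 0) = [:0, 1:]"
    by (simp_all add: lagr_def 0)
  show "EP1_C = node_C real 1"
    by (simp add: EP1_C_def node_C_def fun_eq_iff l)
  show "EP1_A = node_A real 1"
    by (simp add: EP1_A_def node_A_def fun_eq_iff l pderiv_pCons)
qed

definition EP2_c :: "nat \<Rightarrow> real" where
  "EP2_c j = real j / 2"

text \<open>The coefficients of EP2 arise by multiplying out the quadratic Lagrange polynomials for
  the nodes 0, 1/2, 1.\<close>

lemma EP2_nodes: "EP2_C = node_C EP2_c 2" "EP2_A = node_A EP2_c 2"
proof -
  have 0: "{0..2} - {0} = {Suc 0, 2}" "{0..2} - {Suc 0} = {0, 2}" "{0..2} - {2} = {0, Suc 0}" by auto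
  have l: "lagr EP2_c 2 0 = [:1, - 3, 2:]" "lagr EP2_c 2 (Suc 0) = [:0, 4, - 4:]" "lagr EP2_c 2 2 = [:0, - 1, 2:]"
    by (simp_all add: lagr_def 0 EP2_c_def)
  have sm: "(\<Sum>i=0..2. f i) = f 0 + f (Suc 0) + f 2" for f :: "nat \<Rightarrow> complex"
    by (simp add: numeral_2_eq_2)
  have lt: "{..<2} = {0, Suc 0}" by auto
  show "EP2_C = node_C EP2_c 2"
    by (simp add: EP2_C_def node_C_def fun_eq_iff sm l EP2_c_def EP2_m_def algebra_simps power2_eq_square)
  show "EP2_A = node_A EP2_c 2"
    by (simp add: EP2_A_def EP2_a11_def EP2_a12_def EP2_a21_def EP2_a22_def node_A_def fun_eq_iff sm lt l EP2_c_def EP2_m_def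
       pderiv_pCons field_simps power2_eq_square)
qed

lemma EP3_l_eq: "EP3_l = lagr EP3_c 3"
  by (simp add: EP3_l_def lagr_def fun_eq_iff)

text \<open>Cardano's formula: the product of the radicands is 71^2 - 81 * 58 = 343, so s t = 7, and
  y = s + t solves y^3 = 142 + 21 y; the substitution c = (14 + y)/18 gives the cubic. The root
  exceeds 1, so the nodes are not increasing, but they are distinct.\<close>

lemma EP3_c_2_cubic:
  defines "c \<equiv> EP3_c 2"
  shows "36 * c ^ 3 - 84 * c\<^sup>2 + 63 * c - 16 = 0" "1 < c"
proof -
  define s where "s = root 3 (71 - 9 * sqrt 58)"
  define t where "t = root 3 (71 + 9 * sqrt 58)"
  have s3: "s ^ 3 = 71 - 9 * sqrt 58" and t3: "t ^ 3 = 71 + 9 * sqrt 58"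
    by (simp_all add: s_def t_def odd_real_root_pow)
  have "s * t = root 3 ((71 - 9 * sqrt 58) * (71 + 9 * sqrt 58))"
    by (simp add: s_def t_def real_root_mult)
  also have "(71 - 9 * sqrt 58) * (71 + 9 * sqrt 58) = 7 ^ 3" by (simp add: algebra_simps)
  also have "root 3 (7 ^ 3) = 7" by (rule real_root_power_cancel) auto
  finally have st: "s * t = 7" .
  have c: "c = (14 + s + t) / 18" by (simp add: c_def EP3_c_def s_def t_def)
  define y where "y = s + t"
  have "y ^ 3 = s ^ 3 + t ^ 3 + 3 * (s * t) * y" by (simp add: y_def power3_eq_cube algebra_simps)
  then have y3: "y ^ 3 = 142 + 21 * y" by (simp add: s3 t3 st)
  have y: "y = 18 * c - 14" by (simp add: c y_def field_simps)
  have "(18 * c - 14) ^ 3 = 142 + 21 * (18 * c - 14)" using y3 unfolding y .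
  then show "36 * c ^ 3 - 84 * c\<^sup>2 + 63 * c - 16 = 0"
    by (simp add: power3_eq_cube power2_eq_square algebra_simps)
  have "sqrt 58 < 71 / 9" by (rule real_less_lsqrt) (auto simp: power2_eq_square)
  then have "0 < s" by (simp add: s_def)
  have "root 3 (4 ^ 3) < root 3 (71 + 9 * sqrt 58)"
    by (rule real_root_less_mono) (auto intro: less_le_trans[of 64 71] simp: add_pos_pos)
  then have "4 < t" by (simp add: t_def real_root_power_cancel)
  then show "1 < c" using \<open>0 < s\<close> by (simp add: c)
qed

lemma EP3_nodes_inj: "inj_on EP3_c {0..3}"
proof -
  have "{0..3} = {0, 1, 2, 3::nat}" by auto
  moreover have "EP3_c 0 = 0" "EP3_c (Suc 0) = 1 / 3" "EP3_c 3 = 1" by (simp_all add: EP3_c_def)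
  ultimately show ?thesis using EP3_c_2_cubic(2) by (auto simp: inj_on_def)
qed

lemma EP3_c_simps: "EP3_c 0 = 0" "EP3_c 3 = 1"
  by (simp_all add: EP3_c_def)

text \<open>For i > 0 the polynomial l_i has no constant term, so its coefficient at \<tau>^l is
  \<open>EP3_dcoeff (l - 1) i\<close> divided by l; this explains the factor 1/l in
  \<open>EP3_a\<close>. The rest is an exchange of finite sums.\<close>

lemma EP3_nodes: "EP3_C = node_C EP3_c 3" "EP3_A = node_A EP3_c 3"
proof -
  show "EP3_C = node_C EP3_c 3" by (simp add: EP3_C_def node_C_def fun_eq_iff EP3_l_eq)
  have deg: "degree (lagr EP3_c 3 k) \<le> 3" if "k \<le> 3" for k
    by (rule degree_lagr[OF EP3_nodes_inj EP3_c_simps that])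
  have poly_expand: "poly p t = coeff p 0 + (\<Sum>l=1..3. coeff p l * t ^ l)" if "degree p \<le> 3" for p :: "real poly" and t
  proof -
    have "poly p t = (\<Sum>l\<le>3. coeff p l * t ^ l)"
      using arg_cong[OF poly_as_sum_of_monoms'[OF that], of "\<lambda>p. poly p t"] by (simp add: poly_sum poly_monom)
    also have "{..3} = insert 0 {1..3::nat}" by auto
    finally show ?thesis by simp
  qed
  have P: "(\<Sum>l=1..3. EP3_dcoeff (l - 1) i * (t ^ l / real l)) = poly (lagr EP3_c 3 i) t" if i: "i \<le> 3" "0 < i" for i t
  proof -
    have "coeff (lagr EP3_c 3 i) 0 = 0"
      using lagr_at_0[OF EP3_nodes_inj EP3_c_simps i(1)] i(2) by (simp add: poly_0_coeff_0)
    then have "poly (lagr EP3_c 3 i) t = (\<Sum>l=1..3. coeff (lagr EP3_c 3 i) l * t ^ l)"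
      by (simp add: poly_expand[OF deg[OF i(1)]])
    also have "\<dots> = (\<Sum>l=1..3. EP3_dcoeff (l - 1) i * (t ^ l / real l))"
      by (intro sum.cong refl) (auto simp: EP3_dcoeff_def coeff_pderiv EP3_l_eq)
    finally show ?thesis by simp
  qed
  have Q: "(\<Sum>n=1..3. EP3_dcoeff (n - 1) k * t ^ (n - 1)) = poly (pderiv (lagr EP3_c 3 k)) t" if "k \<le> 3" for k t
  proof -
    have "degree (pderiv (lagr EP3_c 3 k)) \<le> 2" using deg[OF that] by (simp add: degree_pderiv)
    then have "poly (pderiv (lagr EP3_c 3 k)) t = (\<Sum>n\<le>2. coeff (pderiv (lagr EP3_c 3 k)) n * t ^ n)"
      using arg_cong[OF poly_as_sum_of_monoms', of _ 2 "\<lambda>p. poly p t"] by (simp add: poly_sum poly_monom)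
    also have "\<dots> = (\<Sum>n=1..3. EP3_dcoeff (n - 1) k * t ^ (n - 1))"
      by (simp add: EP3_dcoeff_def EP3_l_eq numeral_3_eq_3 numeral_2_eq_2 sum.atLeast_Suc_atMost atMost_atLeast0)
    finally show ?thesis by simp
  qed
  show "EP3_A = node_A EP3_c 3"
  proof (intro ext)
    fix \<tau> \<sigma> z
    define \<Phi> where "\<Phi> i k = of_real (EP3_c i - EP3_c k) * phi1 (of_real (EP3_c i - EP3_c k) * z)" for i k
    have "EP3_A \<tau> \<sigma> z = (\<Sum>l=1..3. \<Sum>n=1..3. \<Sum>i=0..3. \<Sum>k<i.
        - (\<Phi> i k * (of_real (EP3_dcoeff (l - 1) i * (\<tau> ^ l / real l)) * of_real (EP3_dcoeff (n - 1) k * \<sigma> ^ (n - 1)))))"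
      by (simp add: EP3_A_def EP3_a_def \<Phi>_def sum_distrib_left sum_distrib_right sum_negf mult_ac)
    also have "\<dots> = (\<Sum>i=0..3. \<Sum>k<i. \<Sum>l=1..3. \<Sum>n=1..3.
        - (\<Phi> i k * (of_real (EP3_dcoeff (l - 1) i * (\<tau> ^ l / real l)) * of_real (EP3_dcoeff (n - 1) k * \<sigma> ^ (n - 1)))))"
    proof -
      have "(\<Sum>l=1..3. \<Sum>n=1..3. \<Sum>i=0..3. \<Sum>k<i. F l n i k) = (\<Sum>i=0..3. \<Sum>k<i. \<Sum>l=1..3. \<Sum>n=1..3. F l n i k)"
        for F :: "nat \<Rightarrow> nat \<Rightarrow> nat \<Rightarrow> nat \<Rightarrow> complex"
      proof -
        have "(\<Sum>l=1..3. \<Sum>n=1..3. \<Sum>i=0..3. \<Sum>k<i. F l n i k) = (\<Sum>l=1..3. \<Sum>i=0..3. \<Sum>n=1..3. \<Sum>k<i. F l n i k)"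
          by (rule sum.cong[OF refl], rule sum.swap)
        also have "\<dots> = (\<Sum>i=0..3. \<Sum>l=1..3. \<Sum>n=1..3. \<Sum>k<i. F l n i k)" by (rule sum.swap)
        also have "\<dots> = (\<Sum>i=0..3. \<Sum>l=1..3. \<Sum>k<i. \<Sum>n=1..3. F l n i k)"
          by (rule sum.cong[OF refl], rule sum.cong[OF refl], rule sum.swap)
        also have "\<dots> = (\<Sum>i=0..3. \<Sum>k<i. \<Sum>l=1..3. \<Sum>n=1..3. F l n i k)"
          by (rule sum.cong[OF refl], rule sum.swap)
        finally show ?thesis .
      qed
      then show ?thesis .
    qed
    also have "\<dots> = (\<Sum>i=0..3. \<Sum>k<i. - (\<Phi> i k * ((\<Sum>l=1..3. of_real (EP3_dcoeff (l - 1) i * (\<tau> ^ l / real l)))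
        * (\<Sum>n=1..3. of_real (EP3_dcoeff (n - 1) k * \<sigma> ^ (n - 1))))))"
    proof -
      have prod: "(\<Sum>l=1..3. \<Sum>n=1..3. - (u * (X l * Y n))) = - (u * ((\<Sum>l=1..3. X l) * (\<Sum>n=1..3. Y n)))"
        for u :: complex and X Y :: "nat \<Rightarrow> complex"
        by (subst sum_product) (simp only: sum_distrib_left sum_negf)
      show ?thesis by (intro sum.cong refl prod)
    qed
    also have "\<dots> = (\<Sum>i=0..3. \<Sum>k<i. - (\<Phi> i k * (of_real (poly (lagr EP3_c 3 i) \<tau>) * of_real (poly (pderiv (lagr EP3_c 3 k)) \<sigma>))))"
    proof (intro sum.cong refl)
      fix i k :: nat assume "i \<in> {0..3}" "k \<in> {..<i}"
      then have ik: "i \<le> 3" "0 < i" "k \<le> 3" by auto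
      show "- (\<Phi> i k * ((\<Sum>l=1..3. of_real (EP3_dcoeff (l - 1) i * (\<tau> ^ l / real l)))
        * (\<Sum>n=1..3. of_real (EP3_dcoeff (n - 1) k * \<sigma> ^ (n - 1))))) =
        - (\<Phi> i k * (of_real (poly (lagr EP3_c 3 i) \<tau>) * of_real (poly (pderiv (lagr EP3_c 3 k)) \<sigma>)))"
        by (simp only: of_real_sum[symmetric] P[OF ik(1,2)] Q[OF ik(3)])
    qed
    also have "\<dots> = node_A EP3_c 3 \<tau> \<sigma> z"
      by (simp add: node_A_def \<Phi>_def sum_negf mult_ac)
    finally show "EP3_A \<tau> \<sigma> z = node_A EP3_c 3 \<tau> \<sigma> z" .
  qed
qed

lemma cubic_integral:
  fixes a b d :: real
  shows "integral {0..1} (\<lambda>t. (t - a) * ((t - b) * (t - d))) = 1/4 - (a + b + d) / 3 + (a * b + a * d + b * d) / 2 - a * b * d"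
proof -
  define F where "F t = t ^ 4 / 4 - (a + b + d) * t ^ 3 / 3 + (a * b + a * d + b * d) * t\<^sup>2 / 2 - a * b * d * t" for t
  have "((\<lambda>t. (t - a) * ((t - b) * (t - d))) has_integral (F 1 - F 0)) {0..1}"
    unfolding F_def
    by (rule fundamental_theorem_of_calculus)
       (auto intro!: derivative_eq_intros simp: has_real_derivative_iff_has_vector_derivative[symmetric]
          power3_eq_cube power2_eq_square field_simps)
  then show ?thesis by (simp add: integral_unique F_def)
qed

text \<open>This equation is where c_2 comes from: with the other nodes fixed, the difference of
  both sides is a multiple of the cubic satisfied by \<open>EP3_c 2\<close>.\<close>

lemma EP3_order:
  "(\<Sum>i=0..3. \<Sum>k<i. (EP3_c i - EP3_c k) * node_weight EP3_c 3 i * node_weight EP3_c 3 k) = 1 / 6"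
proof -
  define c where "c = EP3_c 2"
  have c: "36 * c ^ 3 - 84 * c\<^sup>2 + 63 * c - 16 = 0" "1 < c"
    unfolding c_def by (rule EP3_c_2_cubic)+
  have ne: "c \<noteq> 0" "c - 1 \<noteq> 0" "3 * c - 1 \<noteq> 0" "1 - c \<noteq> 0" "c - 1 / 3 \<noteq> 0" "1 / 3 - c \<noteq> 0" using c(2) by auto
  have cs: "EP3_c 0 = 0" "EP3_c (Suc 0) = 1 / 3" "EP3_c 1 = 1 / 3" "EP3_c 2 = c" "EP3_c 3 = 1"
    by (simp_all add: EP3_c_def c_def)
  have sets: "{0..3} - {0} = {1, 2, 3::nat}" "{0..3} - {1} = {0, 2, 3::nat}" "{0..3} - {2} = {0, 1, 3::nat}" "{0..3} - {3} = {0, 1, 2::nat}"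
    by auto
  have w: "node_weight EP3_c 3 j = (1 / (EP3_c j - x) * (1 / (EP3_c j - y) * (1 / (EP3_c j - v)))) *
      (1/4 - (x + y + v) / 3 + (x * y + x * v + y * v) / 2 - x * y * v)"
    if "{0..3} - {j} = {p, q, s}" "distinct [p, q, s]" "EP3_c p = x" "EP3_c q = y" "EP3_c s = v" for j p q s x y v
  proof -
    have "poly (lagr EP3_c 3 j) = (\<lambda>t. (1 / (EP3_c j - x) * (1 / (EP3_c j - y) * (1 / (EP3_c j - v)))) * ((t - x) * ((t - y) * (t - v))))"
    proof
      fix t
      have "poly (lagr EP3_c 3 j) t = (\<Prod>k\<in>{p, q, s}. 1 / (EP3_c j - EP3_c k) * (t - EP3_c k))"
        unfolding lagr_def that(1) poly_prod by (intro prod.cong refl, simp only: poly_smult poly_pCons poly_0 mult_zero_right add_0_right mult_1_right)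
          (simp only: uminus_add_conv_diff)
      also have "\<dots> = (1 / (EP3_c j - x) * (t - x)) * ((1 / (EP3_c j - y) * (t - y)) * (1 / (EP3_c j - v) * (t - v)))"
        using that(2-) by simp
      finally show "poly (lagr EP3_c 3 j) t = (1 / (EP3_c j - x) * (1 / (EP3_c j - y) * (1 / (EP3_c j - v)))) * ((t - x) * ((t - y) * (t - v)))"
        by (simp only: mult_ac)
    qed
    then show ?thesis by (simp only: node_weight_def integral_mult_right cubic_integral)
  qed
  \<comment> \<open>Closed forms of the quadrature weights for the nodes 0, 1/3, c, 1.\<close>
  define b0 where "b0 = 1 / (12 * c)"
  define b1 where "b1 = 9 * (2 * c - 1) / (8 * (3 * c - 1))"
  define b2 where "b2 = - 1 / (12 * c * (3 * c - 1) * (c - 1))"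
  define b3 where "b3 = (6 * c - 5) / (24 * (c - 1))"
  have w0: "node_weight EP3_c 3 0 = b0"
    using w[OF sets(1) _ cs(3,4,5)] ne by (simp add: cs b0_def field_simps)
  have w1: "node_weight EP3_c 3 1 = b1"
    using w[OF sets(2) _ cs(1,4,5)] ne by (simp add: cs b1_def) (simp add: divide_simps, simp add: algebra_simps)
  have w2: "node_weight EP3_c 3 2 = b2"
    using w[OF sets(3) _ cs(1,3,5)] ne by (simp add: cs b2_def) (simp add: divide_simps, simp add: algebra_simps)
  have w3: "node_weight EP3_c 3 3 = b3"
    using w[OF sets(4) _ cs(1,3,4)] ne by (simp add: cs b3_def) (simp add: divide_simps, simp add: algebra_simps)
  have sm: "(\<Sum>i=0..3. f i) = f 0 + f 1 + f 2 + f 3" for f :: "nat \<Rightarrow> real"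
    by (simp add: numeral_eq_Suc)
  have lt: "(\<Sum>k<0. f k) = 0" "(\<Sum>k<1. f k) = f 0" "(\<Sum>k<2. f k) = f 0 + f 1" "(\<Sum>k<3. f k) = f 0 + f 1 + f 2"
    for f :: "nat \<Rightarrow> real"
    by (simp_all add: numeral_eq_Suc)
  have "(\<Sum>i=0..3. \<Sum>k<i. (EP3_c i - EP3_c k) * node_weight EP3_c 3 i * node_weight EP3_c 3 k)
    = 1 / 3 * b1 * b0 + (c * b2 * b0 + (c - 1 / 3) * b2 * b1) + (b3 * b0 + 2 / 3 * b3 * b1 + (1 - c) * b3 * b2)"
    by (simp only: sm lt w0 w1 w2 w3 cs) simp
  moreover have "1 / 3 * b1 * b0 + (c * b2 * b0 + (c - 1 / 3) * b2 * b1) + (b3 * b0 + 2 / 3 * b3 * b1 + (1 - c) * b3 * b2) - 1 / 6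
     = - (36 * c ^ 3 - 84 * c\<^sup>2 + 63 * c - 16) / (288 * c * (3 * c - 1) * (c - 1))"
    unfolding b0_def b1_def b2_def b3_def using ne
    by (simp add: divide_simps) (simp add: power3_eq_cube power2_eq_square algebra_simps)
  ultimately show ?thesis using c(1) by simp
qed

section \<open>Local error\<close>

lemma sobolev_space_fser_freq_sq:
  fixes u :: "real ^ 'd::finite \<Rightarrow> complex"
  assumes "u \<in> sobolev_space \<alpha>"
  shows "hs_le (\<alpha> - 2) (\<lambda>k. - of_real (freq_sq k) * fourier_coeff u k) (sobolev_norm \<alpha> u)"
proof -
  have "hs_le (\<alpha> - 2) (\<lambda>k. - of_real (freq_sq k) * fourier_coeff u k) (1 * sobolev_norm \<alpha> u)"
    by (rule hs_le_multiplier_wt[OF sobolev_space_hs_le[OF assms]]) (auto simp: freq_sq_le_wt)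
  then show ?thesis by simp
qed

text \<open>The weights of H^(\<alpha> - 2) are at least 1, so convergence of the difference
  quotients there implies convergence in every mode. As \<alpha> > d/2 + 2, the series of the
  Laplacian converges absolutely and its coefficients can be read off.\<close>

lemma nls_solution_coeff_derivative:
  fixes w :: "real \<Rightarrow> real ^ 'd::finite \<Rightarrow> complex"
  assumes w: "nls_solution lam \<alpha> T \<epsilon> w0 w" and \<alpha>: "\<alpha> > real CARD('d) / 2 + 2"
    and t: "t \<in> {0..T / \<epsilon>}"
  shows "((\<lambda>t. fourier_coeff (w t) k) has_vector_derivative
     (- \<i> * of_real (freq_sq k) * fourier_coeff (w t) k + of_real \<epsilon> * cubic lam (fourier_coeff (w t)) k))
     (at t within {0..T / \<epsilon>})"
proof -
  let ?I = "{0..T / \<epsilon>}"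
  obtain w' where w': "sobolev_continuous_on (\<alpha> - 2) ?I w'" "sobolev_has_derivative_on (\<alpha> - 2) ?I w w'"
    "\<And>\<kappa>. \<kappa> \<in> ?I \<Longrightarrow> ae_eq (\<lambda>x. \<i> * w' \<kappa> x)
           (\<lambda>x. - laplacian (w \<kappa>) x + of_real (\<epsilon> * lam) * of_real ((cmod (w \<kappa> x))\<^sup>2) * w \<kappa> x)"
    using w unfolding nls_solution_def by blast
  have wsp: "w s \<in> sobolev_space \<alpha>" if "s \<in> ?I" for s
    using w that by (auto simp: nls_solution_def sobolev_continuous_on_def)
  have w'sp: "w' t \<in> sobolev_space (\<alpha> - 2)" using w'(1) t by (auto simp: sobolev_continuous_on_def)
  have \<alpha>2: "\<alpha> - 2 > real CARD('d) / 2" "0 \<le> \<alpha> - 2" "\<alpha> > real CARD('d) / 2" using \<alpha> by (auto intro: order_trans[of 0 "real CARD('d) / 2"])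
  define d where "d = fourier_coeff (w' t)"
  have lap: "laplacian (w t) = fser (\<lambda>k. - of_real (freq_sq k) * fourier_coeff (w t) k)"
    by (simp add: lap_fun_eq_fser)
  have l1lap: "l1 (\<lambda>k. - of_real (freq_sq k) * fourier_coeff (w t) k)"
    by (rule hs_le_imp_l1[OF sobolev_space_fser_freq_sq[OF wsp[OF t]] \<alpha>2(1)])
  have l1w: "l1 (fourier_coeff (w t))" by (rule hs_le_imp_l1[OF sobolev_space_hs_le[OF wsp[OF t]] \<alpha>2(3)])
  have d_eq: "d k = - \<i> * of_real (freq_sq k) * fourier_coeff (w t) k + of_real \<epsilon> * cubic lam (fourier_coeff (w t)) k" for k
  proof -
    note [measurable] = sobolev_space_measurable[OF wsp[OF t]] sobolev_space_measurable[OF w'sp] borel_measurable_fser[OF l1lap]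
      nls_f_measurable[OF sobolev_space_measurable[OF wsp[OF t]]]
    let ?N = "nls_f lam (w t)"
    have Nint: "integrable torus_measure ?N"
    proof (subst integrable_cong_AE)
      show "AE x in torus_measure. ?N x = fser (cubic lam (fourier_coeff (w t))) x"
        using AE_eq_fser_sobolev[OF wsp[OF t] \<alpha>2(3)]
        by eventually_elim (simp add: nls_f_fser[OF l1w, symmetric] nls_f_def)
      show "integrable torus_measure (fser (cubic lam (fourier_coeff (w t))))"
        by (intro integrable_fser l1_cubic l1w)
    qed (auto intro!: borel_measurable_torus borel_measurable_fser l1_cubic l1w)
    have "ae_eq (\<lambda>x. \<i> * w' t x) (\<lambda>x. (- 1) * fser (\<lambda>k. - of_real (freq_sq k) * fourier_coeff (w t) k) x + (\<i> * of_real \<epsilon>) * ?N x)"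
      using w'(3)[OF t] unfolding lap by (simp add: nls_f_def algebra_simps)
    then have "fourier_coeff (\<lambda>x. \<i> * w' t x) k
      = fourier_coeff (\<lambda>x. (- 1) * fser (\<lambda>k. - of_real (freq_sq k) * fourier_coeff (w t) k) x + (\<i> * of_real \<epsilon>) * ?N x) k"
      by (rule ae_eq_fourier_coeff) measurable
    also have "\<dots> = (- 1) * (- of_real (freq_sq k) * fourier_coeff (w t) k) + (\<i> * of_real \<epsilon>) * cubic lam (fourier_coeff (w t)) k"
      using integrable_fser[OF l1lap] Nint
      by (subst fourier_coeff_add) (auto simp only: fourier_coeff_scale fourier_coeff_fser[OF l1lap] fourier_coeff_nls_f[OF wsp[OF t] \<alpha>2(3)]
        intro!: integrable_mult_right)
    finally have "\<i> * d k = of_real (freq_sq k) * fourier_coeff (w t) k + \<i> * of_real \<epsilon> * cubic lam (fourier_coeff (w t)) k"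
      by (simp add: fourier_coeff_scale d_def)
    then have "- \<i> * (\<i> * d k) = - \<i> * (of_real (freq_sq k) * fourier_coeff (w t) k + \<i> * of_real \<epsilon> * cubic lam (fourier_coeff (w t)) k)"
      by (rule arg_cong)
    then show ?thesis by (simp add: algebra_simps)
  qed
  let ?q = "\<lambda>s. sobolev_norm (\<alpha> - 2) (\<lambda>x. (w s x - w t x) / of_real (s - t) - w' t x)"
  have bound: "cmod ((fourier_coeff (w s) k - fourier_coeff (w t) k) / of_real (s - t) - d k) \<le> ?q s" if s: "s \<in> ?I" for s
  proof -
    let ?v = "\<lambda>x. (w s x - w t x) / of_real (s - t) - w' t x"
    have cf: "fourier_coeff ?v k = (fourier_coeff (w s) k - fourier_coeff (w t) k) / of_real (s - t) - d k" for k
    proof -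
      have i: "integrable torus_measure (w s)" "integrable torus_measure (w t)" "integrable torus_measure (w' t)"
        using wsp[OF s] wsp[OF t] w'sp sobolev_space_integrable by blast+
      have "fourier_coeff ?v k = fourier_coeff (\<lambda>x. (1 / of_real (s - t)) * (w s x - w t x)) k - d k"
      proof -
        have "?v = (\<lambda>x. (1 / of_real (s - t)) * (w s x - w t x) - w' t x)" by (simp add: fun_eq_iff)
        moreover have "integrable torus_measure (\<lambda>x. (1 / of_real (s - t)) * (w s x - w t x))"
          by (intro integrable_mult_right Bochner_Integration.integrable_diff i)
        ultimately show ?thesis using i(3) by (simp only: fourier_coeff_diff d_def)
      qed
      then show ?thesis using i by (simp only: fourier_coeff_scale fourier_coeff_diff) simp
    qed
    \<comment> \<open>The size of this bound does not matter: it provides the summability without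
      which the norm \<open>?q s\<close> would not control the coefficients.\<close>
    have "hs_le (\<alpha> - 2) (\<lambda>k. (1 / of_real (s - t)) * (fourier_coeff (w s) k - fourier_coeff (w t) k) - d k)
      (cmod (1 / of_real (s - t)) * (sobolev_norm \<alpha> (w s) + sobolev_norm \<alpha> (w t)) + sobolev_norm (\<alpha> - 2) (w' t))"
      unfolding d_def
      by (intro hs_le_diff hs_le_scale hs_le_mono[OF sobolev_space_hs_le[OF wsp[OF s]]] hs_le_mono[OF sobolev_space_hs_le[OF wsp[OF t]]]
          sobolev_space_hs_le w'sp) auto
    then have "hs_le (\<alpha> - 2) (fourier_coeff ?v) (cmod (1 / of_real (s - t)) * (sobolev_norm \<alpha> (w s) + sobolev_norm \<alpha> (w t)) + sobolev_norm (\<alpha> - 2) (w' t))"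
      by (rule hs_le_subst) (simp_all only: cf times_divide_eq_left mult_1_left order_refl)
    from hs_le_infsum[OF hs_le_summable[OF this]] have "hs_le (\<alpha> - 2) (fourier_coeff ?v) (?q s)"
      by (simp add: sobolev_norm_def)
    from hs_le_coord[OF this, of k] have le: "wt (\<alpha> - 2) k * cmod (fourier_coeff ?v k) \<le> ?q s" .
    have "1 * cmod (fourier_coeff ?v k) \<le> wt (\<alpha> - 2) k * cmod (fourier_coeff ?v k)"
      by (intro mult_right_mono wt_ge_1 \<alpha>2) auto
    from order_trans[OF this le] show ?thesis by (simp only: cf mult_1_left)
  qed
  have "(?q \<longlongrightarrow> 0) (at t within ?I)" using w'(2) t by (simp add: sobolev_has_derivative_on_def)
  then have "((\<lambda>s. (fourier_coeff (w s) k - fourier_coeff (w t) k) / of_real (s - t) - d k) \<longlongrightarrow> 0) (at t within ?I)"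
  proof (rule Lim_null_comparison[rotated])
    show "\<forall>\<^sub>F s in at t within ?I. norm ((fourier_coeff (w s) k - fourier_coeff (w t) k) / of_real (s - t) - d k) \<le> ?q s"
      unfolding eventually_at_filter by (rule always_eventually) (use bound in blast)
  qed
  then have lim: "((\<lambda>s. cmod ((fourier_coeff (w s) k - fourier_coeff (w t) k) / of_real (s - t) - d k)) \<longlongrightarrow> 0) (at t within ?I)"
    by (rule tendsto_norm_zero)
  have "\<forall>\<^sub>F s in at t within ?I. cmod ((fourier_coeff (w s) k - fourier_coeff (w t) k) / of_real (s - t) - d k)
     = cmod (fourier_coeff (w s) k - fourier_coeff (w t) k - (s - t) *\<^sub>R d k) / norm (s - t)"
    unfolding eventually_at_filter
  proof (rule always_eventually, intro allI impI)
    fix s assume "s \<noteq> t"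
    then have ne: "of_real (s - t) \<noteq> (0 :: complex)" by simp
    have "(fourier_coeff (w s) k - fourier_coeff (w t) k) / of_real (s - t) - d k
      = (fourier_coeff (w s) k - fourier_coeff (w t) k - of_real (s - t) * d k) / of_real (s - t)"
      by (simp only: diff_divide_distrib nonzero_mult_div_cancel_left[OF ne])
    then show "cmod ((fourier_coeff (w s) k - fourier_coeff (w t) k) / of_real (s - t) - d k)
     = cmod (fourier_coeff (w s) k - fourier_coeff (w t) k - (s - t) *\<^sub>R d k) / norm (s - t)"
      by (simp only: norm_divide norm_of_real scaleR_conv_of_real real_norm_def)
  qed
  from Lim_transform_eventually[OF lim this]
  have "((\<lambda>t. fourier_coeff (w t) k) has_vector_derivative d k) (at t within ?I)"
    unfolding has_vector_derivative_def has_derivative_iff_norm using bounded_linear_scaleR_left by blast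
  then show ?thesis by (simp only: d_eq)
qed

text \<open>The exact solution over one time step in the stage variable: \<open>b \<sigma>\<close>
  stands for its coefficients at the time \<sigma> dk after the beginning of the step, which turns
  the Laplacian into \<open>freq_arg dk\<close>.\<close>

locale nls_window =
  fixes lam \<epsilon> dk \<alpha> Mb :: real and b :: "real \<Rightarrow> int ^ 'd::finite \<Rightarrow> complex"
  assumes \<alpha>: "\<alpha> - 2 > real CARD('d) / 2" and \<epsilon>: "0 \<le> \<epsilon>" "\<epsilon> \<le> 1" and dk: "0 \<le> dk" "dk \<le> 1"
    and b_continuous: "hs_continuous_on \<alpha> {0..1} b"
    and b_le: "\<And>\<sigma>. \<sigma> \<in> {0..1} \<Longrightarrow> hs_le \<alpha> (b \<sigma>) Mb"
    and b_deriv: "\<And>\<sigma> k. \<sigma> \<in> {0..1} \<Longrightarrow> ((\<lambda>\<sigma>. b \<sigma> k) has_vector_derivative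
      (freq_arg dk k * b \<sigma> k + of_real (\<epsilon> * dk) * cubic lam (b \<sigma>) k)) (at \<sigma> within {0..1})"

text \<open>The three constants are defined outside the locale, from \<open>lam\<close>, \<alpha>
  and the a priori bound, so their independence of \<epsilon> and of the step is visible. They bound
  the nonlinear term, the speed of the solution per dk, and the change of the nonlinear term over a
  step per dk.\<close>

definition const_G :: "'d::finite itself \<Rightarrow> real \<Rightarrow> real \<Rightarrow> real \<Rightarrow> real" where
  "const_G t lam \<alpha> Mb = tri_const t lam \<alpha> * Mb ^ 3"

definition const_L :: "'d::finite itself \<Rightarrow> real \<Rightarrow> real \<Rightarrow> real \<Rightarrow> real" where
  "const_L t lam \<alpha> Mb = Mb + const_G t lam \<alpha> Mb"

definition const_g :: "'d::finite itself \<Rightarrow> real \<Rightarrow> real \<Rightarrow> real \<Rightarrow> real" where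
  "const_g t lam \<alpha> Mb = 3 * tri_const t lam (\<alpha> - 2) * Mb\<^sup>2 * const_L t lam \<alpha> Mb"

lemma norm_freq_arg_le: "0 \<le> dk \<Longrightarrow> cmod (freq_arg dk k) \<le> dk * wt 2 k"
  by (simp add: norm_freq_arg mult_left_mono freq_sq_le_wt)

lemma norm_freq_arg_power_le: "0 \<le> dk \<Longrightarrow> cmod (freq_arg dk k) ^ q \<le> dk ^ q * wt (2 * real q) k"
  by (simp add: norm_freq_arg power_mult_distrib mult_left_mono freq_sq_power_le_wt)

lemma phi1_integral:
  assumes "0 \<le> \<tau>"
  shows "integral {0..\<tau>} (\<lambda>\<sigma>. exp (of_real (\<tau> - \<sigma>) * z)) = of_real \<tau> * phi1 (of_real \<tau> * z)"
proof (cases "z = 0")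
  case True
  then show ?thesis using assms by (simp add: scaleR_conv_of_real)
next
  case False
  have "((\<lambda>\<sigma>. exp (of_real (\<tau> - \<sigma>) * z)) has_integral
     (- exp ((of_real \<tau> - of_real \<tau>) * z) / z - (- exp ((of_real \<tau> - of_real 0) * z) / z))) {0..\<tau>}"
  proof (rule fundamental_theorem_of_calculus)
    fix x :: real
    have "((\<lambda>w. - exp ((of_real \<tau> - w) * z) / z) has_field_derivative exp (of_real (\<tau> - x) * z)) (at (of_real x))"
      using False by (auto intro!: derivative_eq_intros)
    from has_vector_derivative_real_field[OF this]
    show "((\<lambda>\<xi>. - exp ((of_real \<tau> - of_real \<xi>) * z) / z) has_vector_derivative exp (of_real (\<tau> - x) * z)) (at x within {0..\<tau>})" .
  qed (use assms in simp)
  then have "z * integral {0..\<tau>} (\<lambda>\<sigma>. exp (of_real (\<tau> - \<sigma>) * z)) = exp (of_real \<tau> * z) - 1"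
    using False by (simp add: integral_unique field_simps)
  also have "\<dots> = z * (of_real \<tau> * phi1 (of_real \<tau> * z))"
    using phi1_mult[of "of_real \<tau> * z"] by (simp add: mult_ac)
  finally show ?thesis using False by simp
qed

section \<open>Regularity of the exact solution over one time step\<close>

context nls_window
begin

definition TC :: real where "TC = tri_const TYPE('d) lam (\<alpha> - 2)"
definition cG :: real where "cG = const_G TYPE('d) lam \<alpha> Mb"
definition cL :: real where "cL = const_L TYPE('d) lam \<alpha> Mb"
definition cg :: real where "cg = const_g TYPE('d) lam \<alpha> Mb"

definition g :: "real \<Rightarrow> int ^ 'd \<Rightarrow> complex" where
  "g \<sigma> = cubic lam (b \<sigma>)"

lemma \<alpha>_pos: "0 \<le> \<alpha> - 2" "0 \<le> \<alpha>" "\<alpha> > real CARD('d) / 2"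
  using \<alpha> by (auto intro: order_trans[of 0 "real CARD('d) / 2"] simp: field_simps)

lemma Mb_nonneg: "0 \<le> Mb" using hs_le_nonneg[OF b_le[of 0]] by simp
lemma cG_nonneg: "0 \<le> cG" using Mb_nonneg by (simp add: cG_def const_G_def)
lemma cL_nonneg: "0 \<le> cL" using Mb_nonneg cG_nonneg by (simp add: cL_def const_L_def cG_def)
lemma cg_nonneg: "0 \<le> cg" using Mb_nonneg cL_nonneg by (simp add: cg_def const_g_def cL_def)

lemma eps_dk: "0 \<le> \<epsilon> * dk" "\<epsilon> * dk \<le> dk" "\<epsilon> * dk \<le> 1"
proof -
  show "0 \<le> \<epsilon> * dk" using \<epsilon> dk by simp
  show "\<epsilon> * dk \<le> dk" using \<epsilon> dk mult_right_mono[of \<epsilon> 1 dk] by simp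
  then show "\<epsilon> * dk \<le> 1" using dk by linarith
qed

lemma b_le': "\<sigma> \<in> {0..1} \<Longrightarrow> hs_le (\<alpha> - 2) (b \<sigma>) Mb"
  by (rule hs_le_mono[OF b_le]) auto

lemma g_le: "\<sigma> \<in> {0..1} \<Longrightarrow> hs_le \<alpha> (g \<sigma>) cG"
  unfolding g_def cG_def const_G_def by (rule hs_le_cubic[OF \<alpha>_pos(2,3) b_le])

lemma g_continuous: "hs_continuous_on \<alpha> {0..1} g"
  unfolding g_def[abs_def] by (rule hs_continuous_on_cubic[OF \<alpha>_pos(2,3) b_continuous b_le])

lemma g_cont [continuous_intros]: "continuous_on {0..1} (\<lambda>\<sigma>. g \<sigma> k)"
  by (rule hs_continuous_onD[OF g_continuous])

lemma b_cont [continuous_intros]: "continuous_on {0..1} (\<lambda>\<sigma>. b \<sigma> k)"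
  by (rule hs_continuous_onD[OF b_continuous])

definition b' :: "real \<Rightarrow> int ^ 'd \<Rightarrow> complex" where
  "b' \<sigma> k = freq_arg dk k * b \<sigma> k + of_real (\<epsilon> * dk) * g \<sigma> k"

lemma hs_le_freq_arg: "hs_le s a B \<Longrightarrow> hs_le (s - 2) (\<lambda>k. freq_arg dk k * a k) (dk * B)"
  by (rule hs_le_multiplier_wt) (auto intro: norm_freq_arg_le dk)

lemma b'_le: "\<sigma> \<in> {0..1} \<Longrightarrow> hs_le (\<alpha> - 2) (b' \<sigma>) (cL * dk)"
proof -
  assume \<sigma>: "\<sigma> \<in> {0..1}"
  have "hs_le (\<alpha> - 2) (\<lambda>k. freq_arg dk k * b \<sigma> k + of_real (\<epsilon> * dk) * g \<sigma> k) (dk * Mb + cmod (of_real (\<epsilon> * dk)) * cG)"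
    by (intro hs_le_add hs_le_freq_arg b_le hs_le_scale hs_le_mono[OF g_le] \<sigma>) auto
  moreover have "dk * Mb + cmod (of_real (\<epsilon> * dk)) * cG \<le> cL * dk"
    using mult_right_mono[OF eps_dk(2) cG_nonneg] eps_dk(1) \<epsilon> dk by (simp add: norm_mult cL_def const_L_def cG_def algebra_simps)
  ultimately show ?thesis by (simp add: b'_def[abs_def] hs_le_weaken)
qed

lemma b'_integral:
  assumes "0 \<le> x" "x \<le> y" "y \<le> 1"
  shows "((\<lambda>\<sigma>. b' \<sigma> k) has_integral b y k - b x k) {x..y}"
proof (rule fundamental_theorem_of_calculus)
  fix \<sigma> assume "\<sigma> \<in> {x..y}"
  then show "((\<lambda>\<sigma>. b \<sigma> k) has_vector_derivative b' \<sigma> k) (at \<sigma> within {x..y})"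
    unfolding b'_def g_def
    by (intro has_vector_derivative_within_subset[OF b_deriv]) (use assms in auto)
qed fact

lemma b'_cont: "continuous_on {0..1} (\<lambda>\<sigma>. b' \<sigma> k)"
  unfolding b'_def by (intro continuous_intros)

lemma b_lipschitz_aux:
  assumes "0 \<le> x" "x \<le> y" "y \<le> 1"
  shows "hs_le (\<alpha> - 2) (\<lambda>k. b y k - b x k) (cL * dk * \<bar>y - x\<bar>)"
proof -
  have "hs_le (\<alpha> - 2) (\<lambda>k. integral {x..y} (\<lambda>\<sigma>. b' \<sigma> k)) ((y - x) * (cL * dk))"
    by (rule hs_le_integral) (use assms in \<open>auto intro!: b'_le continuous_on_subset[OF b'_cont]\<close>)
  then show ?thesis
    using assms by (elim hs_le_subst) (auto simp: integral_unique[OF b'_integral] mult_ac)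
qed

lemma b_lipschitz:
  assumes "x \<in> {0..1}" "y \<in> {0..1}"
  shows "hs_le (\<alpha> - 2) (\<lambda>k. b y k - b x k) (cL * dk * \<bar>y - x\<bar>)"
proof (cases "x \<le> y")
  case True
  then show ?thesis using assms by (intro b_lipschitz_aux) auto
next
  case False
  then show ?thesis using b_lipschitz_aux[of y x] assms
    by (simp add: hs_le_minus_commute[of _ "b y"] abs_minus_commute)
qed

lemma b_diff_0: "\<sigma> \<in> {0..1} \<Longrightarrow> hs_le (\<alpha> - 2) (\<lambda>k. b \<sigma> k - b 0 k) (cL * dk)"
proof -
  assume "\<sigma> \<in> {0..1}"
  then show ?thesis
    using cL_nonneg dk mult_left_mono[of "\<bar>\<sigma> - 0\<bar>" 1 "cL * dk"]
    by (intro hs_le_weaken[OF b_lipschitz]) auto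
qed

text \<open>Freezing the nonlinear term at the beginning of the step leaves this part, which is of
  size dk after the loss of two derivatives.\<close>

definition \<rho> :: "real \<Rightarrow> int ^ 'd \<Rightarrow> complex" where
  "\<rho> \<sigma> k = g \<sigma> k - g 0 k"

lemma \<rho>_le: "\<sigma> \<in> {0..1} \<Longrightarrow> hs_le (\<alpha> - 2) (\<rho> \<sigma>) (cg * dk)"
proof -
  assume \<sigma>: "\<sigma> \<in> {0..1}"
  have "hs_le (\<alpha> - 2) (\<lambda>k. cubic lam (b \<sigma>) k - cubic lam (b 0) k) (3 * TC * Mb\<^sup>2 * (cL * dk))"
    unfolding TC_def by (rule hs_le_cubic_diff[OF \<alpha>_pos(1) order_refl \<alpha> b_le' b_le' b_diff_0]) (use \<sigma> in auto)
  then show ?thesis by (elim hs_le_subst) (auto simp: \<rho>_def g_def cg_def const_g_def TC_def cL_def)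
qed

lemma \<rho>_cont [continuous_intros]: "continuous_on {0..1} (\<lambda>\<sigma>. \<rho> \<sigma> k)"
  unfolding \<rho>_def by (intro continuous_intros)

text \<open>In the derivative of exp((\<tau> - \<sigma>) z) b(\<sigma>) the linear terms cancel,
  which leaves the nonlinear term under the integral.\<close>

lemma duhamel:
  assumes "\<tau> \<in> {0..1}"
  shows "b \<tau> k = exp (of_real \<tau> * freq_arg dk k) * b 0 k
    + of_real (\<epsilon> * dk) * integral {0..\<tau>} (\<lambda>\<sigma>. exp (of_real (\<tau> - \<sigma>) * freq_arg dk k) * g \<sigma> k)"
proof -
  let ?z = "freq_arg dk k"
  have "((\<lambda>\<sigma>. exp (of_real (\<tau> - \<sigma>) * ?z) * (of_real (\<epsilon> * dk) * g \<sigma> k)) has_integral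
      (exp ((of_real \<tau> - of_real \<tau>) * ?z) * b \<tau> k - exp ((of_real \<tau> - of_real 0) * ?z) * b 0 k)) {0..\<tau>}"
  proof (rule fundamental_theorem_of_calculus)
    show "0 \<le> \<tau>" using assms by simp
    fix x assume x: "x \<in> {0..\<tau>}"
    then have x1: "x \<in> {0..1}" using assms by auto
    have "((\<lambda>w. exp ((of_real \<tau> - w) * ?z)) has_field_derivative - ?z * exp ((of_real \<tau> - of_real x) * ?z)) (at (of_real x))"
      by (auto intro!: derivative_eq_intros)
    from has_vector_derivative_real_field[OF this]
    have e: "((\<lambda>\<xi>. exp ((of_real \<tau> - of_real \<xi>) * ?z)) has_vector_derivative - ?z * exp ((of_real \<tau> - of_real x) * ?z)) (at x within {0..\<tau>})" .
    have d: "((\<lambda>\<sigma>. b \<sigma> k) has_vector_derivative (?z * b x k + of_real (\<epsilon> * dk) * g x k)) (at x within {0..\<tau>})"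
      unfolding g_def by (rule has_vector_derivative_within_subset[OF b_deriv[OF x1]]) (use assms in auto)
    show "((\<lambda>\<sigma>. exp ((of_real \<tau> - of_real \<sigma>) * ?z) * b \<sigma> k) has_vector_derivative
        exp (of_real (\<tau> - x) * ?z) * (of_real (\<epsilon> * dk) * g x k)) (at x within {0..\<tau>})"
      using has_vector_derivative_mult[OF e d] by (simp add: algebra_simps)
  qed
  from integral_unique[OF this]
  have "integral {0..\<tau>} (\<lambda>\<sigma>. of_real (\<epsilon> * dk) * (exp (of_real (\<tau> - \<sigma>) * ?z) * g \<sigma> k)) = b \<tau> k - exp (of_real \<tau> * ?z) * b 0 k"
    by (simp only: mult.left_commute[of _ "of_real (\<epsilon> * dk)"]) simp
  then show ?thesis by (simp only: Henstock_Kurzweil_Integration.integral_mult_right) (simp add: algebra_simps)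
qed

end

section \<open>Residual of the exact solution in the stage equations\<close>

locale ep_window = ep_method C A cm r + nls_window lam \<epsilon> dk \<alpha> Mb b
  for C A cm r lam \<epsilon> dk \<alpha> Mb and b :: "real \<Rightarrow> int ^ 'd::finite \<Rightarrow> complex" +
  assumes r: "1 \<le> r"
begin

definition defect :: "real \<Rightarrow> int ^ 'd \<Rightarrow> complex" where
  "defect \<tau> k = stage_map lam \<epsilon> dk (b 0) b \<tau> k - b \<tau> k"

text \<open>With the nonlinear term frozen at \<sigma> = 0 three errors separate: interpolation of
  the flow, total weight of the stage kernel, and the difference of the numerical and the exact
  kernel acting on \<open>\<rho>\<close>.\<close>

lemma defect_eq:
  assumes \<tau>: "\<tau> \<in> {0..1}"
  shows "defect \<tau> k = (C \<tau> (freq_arg dk k) - exp (of_real \<tau> * freq_arg dk k)) * b 0 k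
    + of_real (\<epsilon> * dk) * ((integral {0..1} (\<lambda>\<sigma>. A \<tau> \<sigma> (freq_arg dk k)) - of_real \<tau> * phi1 (of_real \<tau> * freq_arg dk k)) * g 0 k
      + stage_int dk \<rho> \<tau> k - integral {0..\<tau>} (\<lambda>\<sigma>. exp (of_real (\<tau> - \<sigma>) * freq_arg dk k) * \<rho> \<sigma> k))"
proof -
  let ?z = "freq_arg dk k"
  have c: "continuous_on {0..1} (\<lambda>\<sigma>. A \<tau> \<sigma> ?z)" using \<tau> by (intro continuous_on_A) auto
  have sub: "{0..\<tau>} \<subseteq> {0..1}" using \<tau> by auto
  have "integral {0..1} (\<lambda>\<sigma>. A \<tau> \<sigma> ?z * g \<sigma> k) = integral {0..1} (\<lambda>\<sigma>. A \<tau> \<sigma> ?z * g 0 k + A \<tau> \<sigma> ?z * \<rho> \<sigma> k)"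
    by (simp add: \<rho>_def algebra_simps)
  also have "\<dots> = integral {0..1} (\<lambda>\<sigma>. A \<tau> \<sigma> ?z) * g 0 k + stage_int dk \<rho> \<tau> k"
    unfolding stage_int_def
    by (subst Henstock_Kurzweil_Integration.integral_add)
       (auto intro!: integrable_continuous_interval continuous_intros c)
  finally have 1: "stage_int dk g \<tau> k = integral {0..1} (\<lambda>\<sigma>. A \<tau> \<sigma> ?z) * g 0 k + stage_int dk \<rho> \<tau> k"
    by (simp add: stage_int_def)
  have "integral {0..\<tau>} (\<lambda>\<sigma>. exp (of_real (\<tau> - \<sigma>) * ?z) * g \<sigma> k)
     = integral {0..\<tau>} (\<lambda>\<sigma>. exp (of_real (\<tau> - \<sigma>) * ?z) * g 0 k + exp (of_real (\<tau> - \<sigma>) * ?z) * \<rho> \<sigma> k)"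
    by (simp add: \<rho>_def algebra_simps)
  also have "\<dots> = of_real \<tau> * phi1 (of_real \<tau> * ?z) * g 0 k + integral {0..\<tau>} (\<lambda>\<sigma>. exp (of_real (\<tau> - \<sigma>) * ?z) * \<rho> \<sigma> k)"
    using \<tau> by (subst Henstock_Kurzweil_Integration.integral_add)
       (auto intro!: integrable_continuous_interval continuous_intros continuous_on_subset[OF \<rho>_cont sub]
         simp: phi1_integral[unfolded of_real_diff])
  finally show ?thesis
    unfolding defect_def stage_map_def duhamel[OF \<tau>, of k] g_def[symmetric] 1 by (simp add: algebra_simps)
qed

lemma hs_le_exp_integral:
  fixes h :: "real \<Rightarrow> int ^ 'd \<Rightarrow> complex"
  assumes \<tau>: "\<tau> \<in> {0..1}" and h: "\<And>\<sigma>. \<sigma> \<in> {0..1} \<Longrightarrow> hs_le s (h \<sigma>) H" and c: "\<And>k. continuous_on {0..1} (\<lambda>\<sigma>. h \<sigma> k)"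
  shows "hs_le s (\<lambda>k. integral {0..\<tau>} (\<lambda>\<sigma>. h \<sigma> k)) H"
proof -
  have sub: "{0..\<tau>} \<subseteq> {0..1}" using \<tau> by auto
  have "hs_le s (\<lambda>k. integral {0..\<tau>} (\<lambda>\<sigma>. h \<sigma> k)) ((\<tau> - 0) * H)"
  proof (rule hs_le_integral)
    show "hs_le s (h \<sigma>) H" if "\<sigma> \<in> {0..\<tau>}" for \<sigma> by (rule h[OF subsetD[OF sub that]])
    show "continuous_on {0..\<tau>} (\<lambda>\<sigma>. h \<sigma> k)" for k by (rule continuous_on_subset[OF c sub])
  qed (use \<tau> in simp)
  moreover have "\<tau> * H \<le> H" using \<tau> hs_le_nonneg[OF h[of 0]] by (simp add: mult_left_le_one_le)
  ultimately show ?thesis by (elim hs_le_weaken) simp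
qed

lemma hs_le_C_defect:
  assumes "\<tau> \<in> {0..1}" "q \<le> Suc r"
  shows "hs_le (\<alpha> - 2 * real q) (\<lambda>k. (C \<tau> (freq_arg dk k) - exp (of_real \<tau> * freq_arg dk k)) * b 0 k) (cm * dk ^ q * Mb)"
proof (rule hs_le_multiplier_wt[OF b_le])
  fix k
  have "cmod (C \<tau> (freq_arg dk k) - exp (of_real \<tau> * freq_arg dk k)) \<le> cm * cmod (freq_arg dk k) ^ q"
    by (rule C_approx) (use assms in auto)
  also have "\<dots> \<le> cm * (dk ^ q * wt (2 * real q) k)"
    by (intro mult_left_mono norm_freq_arg_power_le dk) auto
  finally show "cmod (C \<tau> (freq_arg dk k) - exp (of_real \<tau> * freq_arg dk k)) \<le> cm * dk ^ q * wt (2 * real q) k"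
    by (simp add: mult.assoc)
qed (use dk in auto)

lemma hs_le_A_integral_defect:
  assumes "\<tau> \<in> {0..1}" "q \<le> r"
  shows "hs_le (\<alpha> - 2 * real q) (\<lambda>k. (integral {0..1} (\<lambda>\<sigma>. A \<tau> \<sigma> (freq_arg dk k)) - of_real \<tau> * phi1 (of_real \<tau> * freq_arg dk k)) * g 0 k) (cm * dk ^ q * cG)"
proof (rule hs_le_multiplier_wt[OF g_le])
  fix k
  have "cmod (integral {0..1} (\<lambda>\<sigma>. A \<tau> \<sigma> (freq_arg dk k)) - of_real \<tau> * phi1 (of_real \<tau> * freq_arg dk k)) \<le> cm * cmod (freq_arg dk k) ^ q"
    by (rule A_integral_approx) (use assms in auto)
  also have "\<dots> \<le> cm * (dk ^ q * wt (2 * real q) k)"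
    by (intro mult_left_mono norm_freq_arg_power_le dk) auto
  finally show "cmod (integral {0..1} (\<lambda>\<sigma>. A \<tau> \<sigma> (freq_arg dk k)) - of_real \<tau> * phi1 (of_real \<tau> * freq_arg dk k)) \<le> cm * dk ^ q * wt (2 * real q) k"
    by (simp add: mult.assoc)
qed (use dk in auto)

text \<open>Only the interpolation of the flow gains with q. The nonlinear part is estimated to
  first order: \<open>\<rho>\<close> and the error of the total weight are O(dk), which with the
  factor \<epsilon> dk in front gives \<epsilon> dk^2.\<close>

lemma defect_le:
  assumes \<tau>: "\<tau> \<in> {0..1}" and q: "1 \<le> q" "q \<le> Suc r"
  shows "hs_le (\<alpha> - 2 * real q) (defect \<tau>) ((cm * Mb + cm * cG + cm * cg + cg) * (dk ^ q + \<epsilon> * dk ^ 2))"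
proof -
  have s: "\<alpha> - 2 * real q \<le> \<alpha> - 2" using q by simp
  have "hs_le (\<alpha> - 2) (\<lambda>k. (integral {0..1} (\<lambda>\<sigma>. A \<tau> \<sigma> (freq_arg dk k)) - of_real \<tau> * phi1 (of_real \<tau> * freq_arg dk k)) * g 0 k) (cm * dk * cG)"
    using hs_le_A_integral_defect[OF \<tau> r] by simp
  moreover have "hs_le (\<alpha> - 2) (stage_int dk \<rho> \<tau>) (cm * (cg * dk))"
    by (rule hs_le_stage_int[OF \<tau> \<rho>_le \<rho>_cont])
  moreover have "hs_le (\<alpha> - 2) (\<lambda>k. integral {0..\<tau>} (\<lambda>\<sigma>. exp (of_real (\<tau> - \<sigma>) * freq_arg dk k) * \<rho> \<sigma> k)) (cg * dk)"
  proof (rule hs_le_exp_integral[OF \<tau>])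
    fix \<sigma> :: real assume "\<sigma> \<in> {0..1}"
    then have "hs_le (\<alpha> - 2) (\<lambda>k. exp (of_real (\<tau> - \<sigma>) * freq_arg dk k) * \<rho> \<sigma> k) (1 * (cg * dk))"
      by (intro hs_le_multiplier \<rho>_le) (auto simp: norm_exp_Re_0)
    then show "hs_le (\<alpha> - 2) (\<lambda>k. exp (of_real (\<tau> - \<sigma>) * freq_arg dk k) * \<rho> \<sigma> k) (cg * dk)" by simp
  qed (intro continuous_intros)
  ultimately have "hs_le (\<alpha> - 2 * real q) (\<lambda>k. of_real (\<epsilon> * dk) * ((integral {0..1} (\<lambda>\<sigma>. A \<tau> \<sigma> (freq_arg dk k)) - of_real \<tau> * phi1 (of_real \<tau> * freq_arg dk k)) * g 0 k
      + stage_int dk \<rho> \<tau> k - integral {0..\<tau>} (\<lambda>\<sigma>. exp (of_real (\<tau> - \<sigma>) * freq_arg dk k) * \<rho> \<sigma> k)))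
      (cmod (of_real (\<epsilon> * dk)) * (cm * dk * cG + cm * (cg * dk) + cg * dk))"
    by (intro hs_le_scale hs_le_mono[OF _ s order_refl] hs_le_add hs_le_diff)
  from hs_le_add[OF hs_le_C_defect[OF \<tau> q(2)] this] show ?thesis
  proof (rule hs_le_subst)
    have "cm * Mb * dk ^ q \<le> (cm * Mb + cm * cG + cm * cg + cg) * dk ^ q"
      using cG_nonneg cg_nonneg dk by (intro mult_right_mono) auto
    moreover have "(cm * cG + cm * cg + cg) * (\<epsilon> * dk ^ 2) \<le> (cm * Mb + cm * cG + cm * cg + cg) * (\<epsilon> * dk ^ 2)"
      using Mb_nonneg \<epsilon> by (intro mult_right_mono) auto
    moreover have "cmod (of_real (\<epsilon> * dk)) = \<epsilon> * dk" using eps_dk(1) by (simp only: norm_of_real abs_of_nonneg)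
    ultimately show "cm * dk ^ q * Mb + cmod (of_real (\<epsilon> * dk)) * (cm * dk * cG + cm * (cg * dk) + cg * dk)
        \<le> (cm * Mb + cm * cG + cm * cg + cg) * (dk ^ q + \<epsilon> * dk ^ 2)"
      by (simp add: algebra_simps power2_eq_square)
  qed (rule defect_eq[OF \<tau>])
qed

text \<open>At \<tau> = 1 the linear part and the total weight are exact, which leaves a difference
  of kernels acting on \<open>\<rho>\<close>. That function already has one power of dk, so the
  kernel error is needed to order q - 1 only.\<close>

lemma defect_1_le:
  assumes q: "1 \<le> q" "q \<le> Suc r"
  shows "hs_le (\<alpha> - 2 * real q) (defect 1) (\<epsilon> * dk * (cm * cg * dk ^ q))"
proof -
  obtain p where p: "q = Suc p" "p \<le> r" using q by (cases q) auto
  have s: "\<alpha> - 2 * real q = \<alpha> - 2 - 2 * real p" by (simp add: p)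
  have 1: "(1::real) \<in> {0..1}" by simp
  have "hs_le (\<alpha> - 2 * real q) (\<lambda>k. integral {0..1} (\<lambda>\<sigma>. (A 1 \<sigma> (freq_arg dk k) - exp (of_real (1 - \<sigma>) * freq_arg dk k)) * \<rho> \<sigma> k))
    ((1 - 0) * (cm * dk ^ p * (cg * dk)))"
  proof (rule hs_le_integral)
    fix \<sigma> :: real assume \<sigma>: "\<sigma> \<in> {0..1}"
    show "hs_le (\<alpha> - 2 * real q) (\<lambda>k. (A 1 \<sigma> (freq_arg dk k) - exp (of_real (1 - \<sigma>) * freq_arg dk k)) * \<rho> \<sigma> k) (cm * dk ^ p * (cg * dk))"
      unfolding s
    proof (rule hs_le_multiplier_wt[OF \<rho>_le[OF \<sigma>]])
      fix k
      have "cmod (A 1 \<sigma> (freq_arg dk k) - exp (of_real (1 - \<sigma>) * freq_arg dk k)) \<le> cm * cmod (freq_arg dk k) ^ p"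
        by (rule A_1_approx) (use \<sigma> p in auto)
      also have "\<dots> \<le> cm * (dk ^ p * wt (2 * real p) k)"
        by (intro mult_left_mono norm_freq_arg_power_le dk) auto
      finally show "cmod (A 1 \<sigma> (freq_arg dk k) - exp (of_real (1 - \<sigma>) * freq_arg dk k)) \<le> cm * dk ^ p * wt (2 * real p) k"
        by (simp add: mult.assoc)
    qed (use dk in auto)
  qed (auto intro!: continuous_intros continuous_on_A)
  from hs_le_scale[OF this, of "of_real (\<epsilon> * dk)"] show ?thesis
  proof (rule hs_le_subst)
    fix k
    have "stage_int dk \<rho> 1 k - integral {0..1} (\<lambda>\<sigma>. exp (of_real (1 - \<sigma>) * freq_arg dk k) * \<rho> \<sigma> k)
       = integral {0..1} (\<lambda>\<sigma>. (A 1 \<sigma> (freq_arg dk k) - exp (of_real (1 - \<sigma>) * freq_arg dk k)) * \<rho> \<sigma> k)"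
      unfolding stage_int_def left_diff_distrib
      by (rule Henstock_Kurzweil_Integration.integral_diff[symmetric])
         (auto intro!: integrable_continuous_interval continuous_intros continuous_on_A)
    then show "defect 1 k = of_real (\<epsilon> * dk) * integral {0..1} (\<lambda>\<sigma>. (A 1 \<sigma> (freq_arg dk k) - exp (of_real (1 - \<sigma>) * freq_arg dk k)) * \<rho> \<sigma> k)"
      unfolding defect_eq[OF 1] by (simp add: C_1 A_1_integral)
    have "cmod (of_real (\<epsilon> * dk)) = \<epsilon> * dk" using eps_dk(1) by (simp only: norm_of_real abs_of_nonneg)
    then show "cmod (of_real (\<epsilon> * dk)) * ((1 - 0) * (cm * dk ^ p * (cg * dk))) \<le> \<epsilon> * dk * (cm * cg * dk ^ q)"
      by (simp add: p mult_ac)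
  qed
qed

text \<open>The comparison curve \<open>V\<close> is the exact solution or a correction of it; \<open>\<eta>\<close> collects what is left of
  the one-step error once the stages are compared with \<open>V\<close>.\<close>

lemma step_error:
  assumes s: "0 \<le> s" "s \<le> \<alpha> - 2"
    and U: "hs_continuous_on (\<alpha> - 2) {0..1} U" "\<And>\<tau>. \<tau> \<in> {0..1} \<Longrightarrow> hs_le (\<alpha> - 2) (U \<tau>) B"
    and V: "hs_continuous_on (\<alpha> - 2) {0..1} V" "\<And>\<tau>. \<tau> \<in> {0..1} \<Longrightarrow> hs_le (\<alpha> - 2) (V \<tau>) B"
    and eqU: "\<And>\<tau> k. \<tau> \<in> {0..1} \<Longrightarrow> U \<tau> k = stage_map lam \<epsilon> dk a U \<tau> k"
    and eqV: "\<And>\<tau> k. \<tau> \<in> {0..1} \<Longrightarrow> V \<tau> k = stage_map lam \<epsilon> dk (b 0) V \<tau> k + \<delta> \<tau> k"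
    and \<delta>: "\<And>\<tau>. \<tau> \<in> {0..1} \<Longrightarrow> hs_le s (\<delta> \<tau>) D"
    and eqb: "\<And>k. b 1 k = stage_map lam \<epsilon> dk (b 0) V 1 k + \<eta> k" and \<eta>: "hs_le s \<eta> H"
    and ab: "hs_le s (\<lambda>k. a k - b 0 k) E"
    and small: "\<epsilon> * dk * (cm * (3 * TC * B\<^sup>2)) \<le> 1 / 2"
  shows "hs_le s (\<lambda>k. U 1 k - b 1 k)
    ((1 + \<epsilon> * dk * (6 * cm\<^sup>2 * TC * B\<^sup>2)) * E + \<epsilon> * dk * (6 * cm * TC * B\<^sup>2 * D) + H)"
proof -
  have 1: "(1::real) \<in> {0..1}" by simp
  have UV: "hs_le s (\<lambda>k. U \<tau> k - V \<tau> k) (2 * (cm * E + D))" if "\<tau> \<in> {0..1}" for \<tau>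
    by (rule stage_stability[OF s \<alpha> U V eqU eqV \<delta> ab \<epsilon>(1) dk(1) small[unfolded TC_def] that])
  have contU: "continuous_on {0..1} (\<lambda>\<sigma>. cubic lam (U \<sigma>) k)" for k
    by (rule hs_continuous_onD[OF hs_continuous_on_cubic[OF \<alpha>_pos(1) \<alpha> U]])
  have contV: "continuous_on {0..1} (\<lambda>\<sigma>. cubic lam (V \<sigma>) k)" for k
    by (rule hs_continuous_onD[OF hs_continuous_on_cubic[OF \<alpha>_pos(1) \<alpha> V]])
  \<comment> \<open>The initial error enters with the factor 1, since the exponential is unimodular
    here; the stability constant of the stages appears behind \<epsilon> dk only.\<close>
  have "hs_le s (\<lambda>k. exp (freq_arg dk k) * (a k - b 0 k)
      + of_real (\<epsilon> * dk) * stage_int dk (\<lambda>\<sigma> k. cubic lam (U \<sigma>) k - cubic lam (V \<sigma>) k) 1 k - \<eta> k)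
    (1 * E + cmod (of_real (\<epsilon> * dk)) * (cm * (3 * TC * B\<^sup>2 * (2 * (cm * E + D)))) + H)"
    unfolding TC_def
    by (intro hs_le_diff hs_le_add hs_le_multiplier ab hs_le_scale hs_le_stage_int 1 \<eta>
        hs_le_cubic_diff[OF s \<alpha> U(2) V(2) UV] continuous_on_diff contU contV) (auto simp: norm_exp_Re_0)
  then show ?thesis
  proof (rule hs_le_subst)
    show "U 1 k - b 1 k = exp (freq_arg dk k) * (a k - b 0 k)
      + of_real (\<epsilon> * dk) * stage_int dk (\<lambda>\<sigma> k. cubic lam (U \<sigma>) k - cubic lam (V \<sigma>) k) 1 k - \<eta> k" for k
      unfolding eqU[OF 1] eqb stage_map_def stage_int_diff[OF 1 contU contV, symmetric] C_1 by (simp add: algebra_simps)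
    have "cmod (of_real (\<epsilon> * dk)) = \<epsilon> * dk" using eps_dk(1) by (simp only: norm_of_real abs_of_nonneg)
    then show "1 * E + cmod (of_real (\<epsilon> * dk)) * (cm * (3 * TC * B\<^sup>2 * (2 * (cm * E + D)))) + H
      \<le> (1 + \<epsilon> * dk * (6 * cm\<^sup>2 * TC * B\<^sup>2)) * E + \<epsilon> * dk * (6 * cm * TC * B\<^sup>2 * D) + H"
      by (simp add: algebra_simps power2_eq_square)
  qed
qed

text \<open>The comparison curve is the exact solution; its residual is minus the defect, in the
  stages as well as in the update.\<close>

lemma step_error_order2:
  assumes q: "1 \<le> q" "q \<le> Suc r" "0 \<le> \<alpha> - 2 * real q"
    and U: "hs_continuous_on (\<alpha> - 2) {0..1} U" "\<And>\<tau>. \<tau> \<in> {0..1} \<Longrightarrow> hs_le (\<alpha> - 2) (U \<tau>) B" and B: "Mb \<le> B"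
    and eqU: "\<And>\<tau> k. \<tau> \<in> {0..1} \<Longrightarrow> U \<tau> k = stage_map lam \<epsilon> dk a U \<tau> k"
    and ab: "hs_le (\<alpha> - 2 * real q) (\<lambda>k. a k - b 0 k) E"
    and small: "\<epsilon> * dk * (cm * (3 * TC * B\<^sup>2)) \<le> 1 / 2"
  shows "hs_le (\<alpha> - 2 * real q) (\<lambda>k. U 1 k - b 1 k)
    ((1 + \<epsilon> * dk * (6 * cm\<^sup>2 * TC * B\<^sup>2)) * E
      + \<epsilon> * dk * ((6 * cm * TC * B\<^sup>2 * (cm * Mb + cm * cG + cm * cg + cg) + cm * cg) * (dk ^ q + \<epsilon> * dk ^ 2)))"
proof -
  have bB: "hs_le (\<alpha> - 2) (b \<tau>) B" if "\<tau> \<in> {0..1}" for \<tau>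
    by (rule hs_le_weaken[OF b_le'[OF that] B])
  have "hs_le (\<alpha> - 2 * real q) (\<lambda>k. U 1 k - b 1 k)
    ((1 + \<epsilon> * dk * (6 * cm\<^sup>2 * TC * B\<^sup>2)) * E
      + \<epsilon> * dk * (6 * cm * TC * B\<^sup>2 * ((cm * Mb + cm * cG + cm * cg + cg) * (dk ^ q + \<epsilon> * dk ^ 2)))
      + \<epsilon> * dk * (cm * cg * dk ^ q))"
  proof (rule step_error[where V = b and \<delta> = "\<lambda>\<tau> k. - defect \<tau> k" and \<eta> = "\<lambda>k. - defect 1 k",
        OF q(3) _ U _ bB eqU _ _ _ _ ab small])
    show "\<alpha> - 2 * real q \<le> \<alpha> - 2" using q by simp
    show "hs_continuous_on (\<alpha> - 2) {0..1} b" by (rule hs_continuous_on_mono[OF b_continuous]) auto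
    show "hs_le (\<alpha> - 2 * real q) (\<lambda>k. - defect \<tau> k) ((cm * Mb + cm * cG + cm * cg + cg) * (dk ^ q + \<epsilon> * dk ^ 2))"
      if "\<tau> \<in> {0..1}" for \<tau> using defect_le[OF that q(1,2)] by simp
    show "hs_le (\<alpha> - 2 * real q) (\<lambda>k. - defect 1 k) (\<epsilon> * dk * (cm * cg * dk ^ q))" using defect_1_le[OF q(1,2)] by simp
    show "b \<tau> k = stage_map lam \<epsilon> dk (b 0) b \<tau> k + - defect \<tau> k" for \<tau> k by (simp add: defect_def)
    show "b 1 k = stage_map lam \<epsilon> dk (b 0) b 1 k + - defect 1 k" for k by (simp add: defect_def)
  qed
  then show ?thesis
  proof (rule hs_le_weaken)
    have "\<epsilon> * dk * (cm * cg * dk ^ q) \<le> \<epsilon> * dk * (cm * cg * (dk ^ q + \<epsilon> * dk ^ 2))"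
      using eps_dk(1) cg_nonneg \<epsilon> dk by (intro mult_left_mono) auto
    then show "(1 + \<epsilon> * dk * (6 * cm\<^sup>2 * TC * B\<^sup>2)) * E
      + \<epsilon> * dk * (6 * cm * TC * B\<^sup>2 * ((cm * Mb + cm * cG + cm * cg + cg) * (dk ^ q + \<epsilon> * dk ^ 2)))
      + \<epsilon> * dk * (cm * cg * dk ^ q)
      \<le> (1 + \<epsilon> * dk * (6 * cm\<^sup>2 * TC * B\<^sup>2)) * E
      + \<epsilon> * dk * ((6 * cm * TC * B\<^sup>2 * (cm * Mb + cm * cG + cm * cg + cg) + cm * cg) * (dk ^ q + \<epsilon> * dk ^ 2))"
      unfolding distrib_right[of "6 * cm * TC * B\<^sup>2 * _" "cm * cg"] distrib_left[of "\<epsilon> * dk"] by (simp add: mult.assoc)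
  qed
qed

end

section \<open>Local error of third order\<close>

lemma hs_continuous_on_add:
  assumes "hs_continuous_on s I u" "hs_continuous_on s I v"
  shows "hs_continuous_on s I (\<lambda>t k. u t k + v t k)"
  unfolding hs_continuous_on_def
proof (intro ballI allI impI)
  fix t and e :: real assume t: "t \<in> I" and e: "0 < e"
  then have "e / 2 > 0" by simp
  obtain \<delta>1 where 1: "\<delta>1 > 0" "\<And>t'. t' \<in> I \<Longrightarrow> \<bar>t' - t\<bar> < \<delta>1 \<Longrightarrow> hs_le s (\<lambda>k. u t' k - u t k) (e / 2)"
    using assms(1) t \<open>e / 2 > 0\<close> unfolding hs_continuous_on_def by meson
  obtain \<delta>2 where 2: "\<delta>2 > 0" "\<And>t'. t' \<in> I \<Longrightarrow> \<bar>t' - t\<bar> < \<delta>2 \<Longrightarrow> hs_le s (\<lambda>k. v t' k - v t k) (e / 2)"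
    using assms(2) t \<open>e / 2 > 0\<close> unfolding hs_continuous_on_def by meson
  have "hs_le s (\<lambda>k. u t' k + v t' k - (u t k + v t k)) e" if "t' \<in> I" "\<bar>t' - t\<bar> < min \<delta>1 \<delta>2" for t'
  proof -
    have "hs_le s (\<lambda>k. (u t' k - u t k) + (v t' k - v t k)) (e / 2 + e / 2)"
      using that by (intro hs_le_add 1 2) auto
    then show ?thesis by (rule hs_le_subst) simp_all
  qed
  then show "\<exists>\<delta>>0. \<forall>t'\<in>I. \<bar>t' - t\<bar> < \<delta> \<longrightarrow> hs_le s (\<lambda>k. u t' k + v t' k - (u t k + v t k)) e"
    using 1(1) 2(1) by (intro exI[of _ "min \<delta>1 \<delta>2"]) auto
qed

lemma dcubic_add:
  assumes "l1 a" "l1 h" "l1 h'"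
  shows "dcubic lam a (\<lambda>k. h k + h' k) k = dcubic lam a h k + dcubic lam a h' k"
  using assms by (simp add: dcubic_def tri_add1 tri_add2 tri_add3)

locale ep_window3 = ep_window C A cm r lam \<epsilon> dk \<alpha> Mb b + ep_method3 C A cm r P
  for C A cm r lam \<epsilon> dk \<alpha> Mb and b :: "real \<Rightarrow> int ^ 'd::finite \<Rightarrow> complex" and P +
  assumes r2: "2 \<le> r" and \<alpha>4: "0 \<le> \<alpha> - 4"
begin

text \<open>The first summand accounts for the part of the nonlinear term of degree two and three in
  the increment of the solution, the second for its derivative applied to the Taylor remainder of
  the solution.\<close>

definition c3 :: real where
  "c3 = TC * (3 * Mb + cL) * cL\<^sup>2 + 3 * TC * Mb\<^sup>2 * (cL + cg)"

text \<open>The derivative at \<sigma> = 0 of the nonlinear term along the exact solution.\<close>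

definition \<rho>' :: "int ^ 'd \<Rightarrow> complex" where
  "\<rho>' = dcubic lam (b 0) (b' 0)"

lemma TC_nonneg: "0 \<le> TC" by (simp add: TC_def)

lemma c3_nonneg: "0 \<le> c3"
  using TC_nonneg Mb_nonneg cL_nonneg cg_nonneg by (simp add: c3_def)

lemma l1_b: "\<sigma> \<in> {0..1} \<Longrightarrow> l1 (b \<sigma>)" by (rule hs_le_imp_l1[OF b_le \<alpha>_pos(3)])

lemma l1_b'0: "l1 (b' 0)" by (rule hs_le_imp_l1[OF b'_le \<alpha>]) simp

lemma cg_eq: "3 * TC * Mb\<^sup>2 * (cL * dk) = cg * dk"
  by (simp add: cg_def const_g_def TC_def cL_def)

lemma \<rho>'_le: "hs_le (\<alpha> - 2) \<rho>' (cg * dk)"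
proof -
  have "hs_le (\<alpha> - 2) \<rho>' (3 * TC * Mb\<^sup>2 * (cL * dk))"
    unfolding \<rho>'_def TC_def by (rule hs_le_dcubic[OF \<alpha>_pos(1) order_refl \<alpha> b_le' b'_le]) auto
  then show ?thesis by (simp only: cg_eq)
qed

text \<open>Second order in dk costs four derivatives: the equation expresses b' through the
  Laplacian of b, so the variation of b' loses two derivatives more than that of b.\<close>

lemma b_taylor:
  assumes \<sigma>: "\<sigma> \<in> {0..1}"
  shows "hs_le (\<alpha> - 4) (\<lambda>k. b \<sigma> k - b 0 k - of_real \<sigma> * b' 0 k) ((cL + cg) * dk\<^sup>2)"
proof -
  have "hs_le (\<alpha> - 4) (\<lambda>k. integral {0..\<sigma>} (\<lambda>t. b' t k - b' 0 k)) ((cL + cg) * dk\<^sup>2)"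
  proof (rule hs_le_exp_integral[OF \<sigma>])
    show "continuous_on {0..1} (\<lambda>t. b' t k - b' 0 k)" for k by (intro continuous_intros b'_cont)
    fix t :: real assume t: "t \<in> {0..1}"
    have "hs_le (\<alpha> - 2 - 2) (\<lambda>k. freq_arg dk k * (b t k - b 0 k)) (dk * (cL * dk))"
      by (rule hs_le_freq_arg[OF b_diff_0[OF t]])
    moreover have "hs_le (\<alpha> - 2 - 2) (\<lambda>k. of_real (\<epsilon> * dk) * \<rho> t k) (cmod (of_real (\<epsilon> * dk)) * (cg * dk))"
      by (intro hs_le_scale hs_le_mono[OF \<rho>_le[OF t]]) auto
    ultimately have "hs_le (\<alpha> - 2 - 2) (\<lambda>k. freq_arg dk k * (b t k - b 0 k) + of_real (\<epsilon> * dk) * \<rho> t k)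
      (dk * (cL * dk) + cmod (of_real (\<epsilon> * dk)) * (cg * dk))" by (rule hs_le_add)
    moreover have "cmod (of_real (\<epsilon> * dk)) * (cg * dk) \<le> dk * (cg * dk)"
      using eps_dk cg_nonneg dk by (intro mult_right_mono) (simp_all only: norm_of_real abs_of_nonneg mult_nonneg_nonneg)
    ultimately have "hs_le (\<alpha> - 2 - 2) (\<lambda>k. b' t k - b' 0 k) ((cL + cg) * dk\<^sup>2)"
      by (elim hs_le_subst) (simp_all add: b'_def \<rho>_def algebra_simps power2_eq_square)
    then show "hs_le (\<alpha> - 4) (\<lambda>k. b' t k - b' 0 k) ((cL + cg) * dk\<^sup>2)" by simp
  qed
  moreover have "integral {0..\<sigma>} (\<lambda>t. b' t k - b' 0 k) = b \<sigma> k - b 0 k - of_real \<sigma> * b' 0 k" for k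
  proof -
    have "((\<lambda>t. b' t k - b' 0 k) has_integral (b \<sigma> k - b 0 k - (\<sigma> - 0) *\<^sub>R b' 0 k)) {0..\<sigma>}"
      using \<sigma> has_integral_const_real[of "b' 0 k" 0 \<sigma>] by (intro has_integral_diff b'_integral) (auto simp: content_real)
    then show ?thesis by (simp add: integral_unique scaleR_conv_of_real)
  qed
  ultimately show ?thesis by simp
qed

lemma \<rho>_taylor:
  assumes \<sigma>: "\<sigma> \<in> {0..1}"
  shows "hs_le (\<alpha> - 4) (\<lambda>k. \<rho> \<sigma> k - of_real \<sigma> * \<rho>' k) (c3 * dk\<^sup>2)"
proof -
  let ?h = "\<lambda>k. b \<sigma> k - b 0 k" and ?e = "\<lambda>k. b \<sigma> k - b 0 k - of_real \<sigma> * b' 0 k"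
  have l: "l1 (b 0)" "l1 ?h" "l1 (\<lambda>k. of_real \<sigma> * b' 0 k)" "l1 ?e"
    using \<sigma> l1_b l1_b'0 by (auto intro!: l1_diff l1_scale)
  have "hs_le (\<alpha> - 2) (\<lambda>k. cubic lam (\<lambda>k. b 0 k + ?h k) k - cubic lam (b 0) k - dcubic lam (b 0) ?h k)
     (TC * (3 * Mb + cL * dk) * (cL * dk) * (cL * dk))"
    unfolding TC_def
    by (rule hs_le_cubic_add[OF \<alpha>_pos(1) order_refl \<alpha> b_le' b_diff_0[OF \<sigma>] b_diff_0[OF \<sigma>]]) simp
  then have 1: "hs_le (\<alpha> - 4) (\<lambda>k. \<rho> \<sigma> k - dcubic lam (b 0) ?h k) (TC * (3 * Mb + cL) * cL\<^sup>2 * dk\<^sup>2)"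
  proof (rule hs_le_mono[OF hs_le_subst])
    show "\<rho> \<sigma> k - dcubic lam (b 0) ?h k = cubic lam (\<lambda>k. b 0 k + ?h k) k - cubic lam (b 0) k - dcubic lam (b 0) ?h k" for k
      by (simp add: \<rho>_def g_def)
    have "cL * dk \<le> cL" using cL_nonneg dk by (simp add: mult_left_le)
    then have "TC * (3 * Mb + cL * dk) * (cL\<^sup>2 * dk\<^sup>2) \<le> TC * (3 * Mb + cL) * (cL\<^sup>2 * dk\<^sup>2)"
      using TC_nonneg by (intro mult_right_mono mult_left_mono) auto
    then show "TC * (3 * Mb + cL * dk) * (cL * dk) * (cL * dk) \<le> TC * (3 * Mb + cL) * cL\<^sup>2 * dk\<^sup>2"
      by (simp add: power2_eq_square mult_ac)
  qed auto
  have 2: "hs_le (\<alpha> - 4) (dcubic lam (b 0) ?e) (3 * TC * Mb\<^sup>2 * ((cL + cg) * dk\<^sup>2))"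
    unfolding TC_def by (rule hs_le_dcubic[OF \<alpha>4 _ \<alpha> b_le' b_taylor[OF \<sigma>]]) auto
  have "dcubic lam (b 0) ?h k = of_real \<sigma> * \<rho>' k + dcubic lam (b 0) ?e k" for k
    using dcubic_add[OF l(1,3,4), of lam k] by (simp add: dcubic_scale \<rho>'_def)
  then show ?thesis
    by (intro hs_le_subst[OF hs_le_add[OF 1 2]]) (simp_all add: c3_def algebra_simps)
qed

definition K3 :: real where
  "K3 = cm * Mb + cm * cG + cm * cg + cm * c3 + cg + c3"

text \<open>The leading term of the stage defect. Its size is \<epsilon> dk^2, since
  \<open>\<rho>'\<close> has itself the size dk.\<close>

definition \<Delta> :: "real \<Rightarrow> int ^ 'd \<Rightarrow> complex" where
  "\<Delta> \<tau> k = of_real (\<epsilon> * dk * P \<tau>) * \<rho>' k"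

text \<open>Both kernels are replaced by their values at z = 0, and \<open>\<rho>\<close> by its
  linear part. The main terms are then first moments, P(\<tau>) + \<tau>^2/2 and \<tau>^2/2, whose
  difference is P(\<tau>); the four integrals on the right are the errors of the
  replacements.\<close>

lemma stage_remainder_eq:
  assumes \<tau>: "\<tau> \<in> {0..1}"
  shows "stage_int dk \<rho> \<tau> k - integral {0..\<tau>} (\<lambda>\<sigma>. exp (of_real (\<tau> - \<sigma>) * freq_arg dk k) * \<rho> \<sigma> k) - of_real (P \<tau>) * \<rho>' k
    = integral {0..1} (\<lambda>\<sigma>. (A \<tau> \<sigma> (freq_arg dk k) - A \<tau> \<sigma> 0) * \<rho> \<sigma> k)
      + integral {0..1} (\<lambda>\<sigma>. A \<tau> \<sigma> 0 * (\<rho> \<sigma> k - of_real \<sigma> * \<rho>' k))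
      - integral {0..\<tau>} (\<lambda>\<sigma>. (exp (of_real (\<tau> - \<sigma>) * freq_arg dk k) - 1) * \<rho> \<sigma> k)
      - integral {0..\<tau>} (\<lambda>\<sigma>. \<rho> \<sigma> k - of_real \<sigma> * \<rho>' k)"
proof -
  let ?z = "freq_arg dk k"
  have c: "continuous_on {0..1} (\<lambda>\<sigma>. A \<tau> \<sigma> ?z)" "continuous_on {0..1} (\<lambda>\<sigma>. A \<tau> \<sigma> 0)"
    using \<tau> by (auto intro!: continuous_on_A)
  have sub: "{0..\<tau>} \<subseteq> {0..1}" using \<tau> by auto
  note \<rho>c = continuous_on_subset[OF \<rho>_cont sub]
  have m: "integral {0..1} (\<lambda>\<sigma>. A \<tau> \<sigma> 0 * (of_real \<sigma> * \<rho>' k)) = of_real (P \<tau> + \<tau>\<^sup>2 / 2) * \<rho>' k"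
    using A_0_moment[OF \<tau>] by (simp add: mult.assoc[symmetric])
  have "((\<lambda>\<sigma>. \<sigma>) has_integral (\<tau>\<^sup>2 / 2 - 0\<^sup>2 / 2)) {0..\<tau>}"
    by (rule fundamental_theorem_of_calculus)
       (use \<tau> in \<open>auto intro!: derivative_eq_intros simp: has_real_derivative_iff_has_vector_derivative[symmetric]\<close>)
  from integral_unique[OF has_integral_of_real[OF this, where 'b = complex]]
  have m': "integral {0..\<tau>} (\<lambda>\<sigma>. of_real \<sigma> * \<rho>' k) = of_real (\<tau>\<^sup>2 / 2) * \<rho>' k" by simp
  have i1: "integral {0..1} (\<lambda>\<sigma>. (A \<tau> \<sigma> ?z - A \<tau> \<sigma> 0) * \<rho> \<sigma> k)
     = integral {0..1} (\<lambda>\<sigma>. A \<tau> \<sigma> ?z * \<rho> \<sigma> k) - integral {0..1} (\<lambda>\<sigma>. A \<tau> \<sigma> 0 * \<rho> \<sigma> k)"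
    unfolding left_diff_distrib
    by (rule Henstock_Kurzweil_Integration.integral_diff) (auto intro!: integrable_continuous_interval continuous_intros c)
  have i2: "integral {0..1} (\<lambda>\<sigma>. A \<tau> \<sigma> 0 * (\<rho> \<sigma> k - of_real \<sigma> * \<rho>' k))
     = integral {0..1} (\<lambda>\<sigma>. A \<tau> \<sigma> 0 * \<rho> \<sigma> k) - integral {0..1} (\<lambda>\<sigma>. A \<tau> \<sigma> 0 * (of_real \<sigma> * \<rho>' k))"
    unfolding right_diff_distrib
    by (rule Henstock_Kurzweil_Integration.integral_diff) (auto intro!: integrable_continuous_interval continuous_intros c)
  have i3: "integral {0..\<tau>} (\<lambda>\<sigma>. (exp (of_real (\<tau> - \<sigma>) * ?z) - 1) * \<rho> \<sigma> k)
     = integral {0..\<tau>} (\<lambda>\<sigma>. exp (of_real (\<tau> - \<sigma>) * ?z) * \<rho> \<sigma> k) - integral {0..\<tau>} (\<lambda>\<sigma>. 1 * \<rho> \<sigma> k)"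
    unfolding left_diff_distrib
    by (rule Henstock_Kurzweil_Integration.integral_diff) (auto intro!: integrable_continuous_interval continuous_intros \<rho>c)
  have i4: "integral {0..\<tau>} (\<lambda>\<sigma>. \<rho> \<sigma> k - of_real \<sigma> * \<rho>' k)
     = integral {0..\<tau>} (\<lambda>\<sigma>. \<rho> \<sigma> k) - integral {0..\<tau>} (\<lambda>\<sigma>. of_real \<sigma> * \<rho>' k)"
    by (rule Henstock_Kurzweil_Integration.integral_diff) (auto intro!: integrable_continuous_interval continuous_intros \<rho>c)
  show ?thesis
    unfolding stage_int_def i1 i2 i3 i4 m m' mult_1_left of_real_add distrib_right by simp
qed

lemma defect_le_order3:
  assumes \<tau>: "\<tau> \<in> {0..1}" and q: "2 \<le> q" "q \<le> Suc r"
  shows "hs_le (\<alpha> - 2 * real q) (\<lambda>k. defect \<tau> k - \<Delta> \<tau> k) (K3 * (dk ^ q + \<epsilon> * dk ^ 3))"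
proof -
  have s: "\<alpha> - 2 * real q \<le> \<alpha> - 4" using q by simp
  have c: "continuous_on {0..1} (\<lambda>\<sigma>. A \<tau> \<sigma> z)" if "Re z = 0" for z
    using \<tau> that by (auto intro!: continuous_on_A)
  have 0: "hs_le (\<alpha> - 4) (\<lambda>k. (integral {0..1} (\<lambda>\<sigma>. A \<tau> \<sigma> (freq_arg dk k)) - of_real \<tau> * phi1 (of_real \<tau> * freq_arg dk k)) * g 0 k) (cm * dk ^ 2 * cG)"
    using hs_le_A_integral_defect[OF \<tau> r2] by simp
  have 1: "hs_le (\<alpha> - 2 - 2) (\<lambda>k. integral {0..1} (\<lambda>\<sigma>. (A \<tau> \<sigma> (freq_arg dk k) - A \<tau> \<sigma> 0) * \<rho> \<sigma> k)) ((1 - 0) * (cm * dk * (cg * dk)))"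
  proof (rule hs_le_integral)
    fix \<sigma> :: real assume \<sigma>: "\<sigma> \<in> {0..1}"
    show "hs_le (\<alpha> - 2 - 2) (\<lambda>k. (A \<tau> \<sigma> (freq_arg dk k) - A \<tau> \<sigma> 0) * \<rho> \<sigma> k) (cm * dk * (cg * dk))"
    proof (rule hs_le_multiplier_wt[OF \<rho>_le[OF \<sigma>]])
      fix k
      have "cmod (A \<tau> \<sigma> (freq_arg dk k) - A \<tau> \<sigma> 0) \<le> cm * cmod (freq_arg dk k)"
        by (rule A_0_approx) (use \<sigma> \<tau> in auto)
      also have "\<dots> \<le> cm * (dk * wt 2 k)" by (intro mult_left_mono norm_freq_arg_le dk) auto
      finally show "cmod (A \<tau> \<sigma> (freq_arg dk k) - A \<tau> \<sigma> 0) \<le> cm * dk * wt 2 k" by (simp add: mult.assoc)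
    qed (use dk in auto)
  qed (auto intro!: continuous_intros c)
  have 2: "hs_le (\<alpha> - 4) (\<lambda>k. integral {0..1} (\<lambda>\<sigma>. A \<tau> \<sigma> 0 * (\<rho> \<sigma> k - of_real \<sigma> * \<rho>' k))) ((1 - 0) * (cm * (c3 * dk\<^sup>2)))"
  proof (rule hs_le_integral)
    fix \<sigma> :: real assume \<sigma>: "\<sigma> \<in> {0..1}"
    then show "hs_le (\<alpha> - 4) (\<lambda>k. A \<tau> \<sigma> 0 * (\<rho> \<sigma> k - of_real \<sigma> * \<rho>' k)) (cm * (c3 * dk\<^sup>2))"
      using \<tau> by (intro hs_le_multiplier \<rho>_taylor A_bound) auto
  qed (auto intro!: continuous_intros c)
  have 3: "hs_le (\<alpha> - 2 - 2) (\<lambda>k. integral {0..\<tau>} (\<lambda>\<sigma>. (exp (of_real (\<tau> - \<sigma>) * freq_arg dk k) - 1) * \<rho> \<sigma> k)) (dk * (cg * dk))"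
  proof (rule hs_le_exp_integral[OF \<tau>])
    fix \<sigma> :: real assume \<sigma>: "\<sigma> \<in> {0..1}"
    show "hs_le (\<alpha> - 2 - 2) (\<lambda>k. (exp (of_real (\<tau> - \<sigma>) * freq_arg dk k) - 1) * \<rho> \<sigma> k) (dk * (cg * dk))"
    proof (rule hs_le_multiplier_wt[OF \<rho>_le[OF \<sigma>]])
      fix k
      have "cmod (exp (of_real (\<tau> - \<sigma>) * freq_arg dk k) - 1) \<le> cmod (of_real (\<tau> - \<sigma>) * freq_arg dk k)"
        using exp_rem_le[of "of_real (\<tau> - \<sigma>) * freq_arg dk k" 1] by (simp add: exp_rem_def)
      also have "\<dots> \<le> 1 * cmod (freq_arg dk k)"
        unfolding norm_mult norm_of_real using \<sigma> \<tau> by (intro mult_right_mono) auto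
      also have "\<dots> \<le> dk * wt 2 k" using norm_freq_arg_le[OF dk(1), of k] by simp
      finally show "cmod (exp (of_real (\<tau> - \<sigma>) * freq_arg dk k) - 1) \<le> dk * wt 2 k" .
    qed (use dk in auto)
  qed (intro continuous_intros)
  have 4: "hs_le (\<alpha> - 4) (\<lambda>k. integral {0..\<tau>} (\<lambda>\<sigma>. \<rho> \<sigma> k - of_real \<sigma> * \<rho>' k)) (c3 * dk\<^sup>2)"
    by (rule hs_le_exp_integral[OF \<tau> \<rho>_taylor]) (auto intro!: continuous_intros)
  have e4: "\<alpha> - 2 - 2 = \<alpha> - 4" by simp
  note 134 = 1[unfolded e4] 3[unfolded e4]
  have "hs_le (\<alpha> - 4) (\<lambda>k. (integral {0..1} (\<lambda>\<sigma>. A \<tau> \<sigma> (freq_arg dk k)) - of_real \<tau> * phi1 (of_real \<tau> * freq_arg dk k)) * g 0 k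
    + (integral {0..1} (\<lambda>\<sigma>. (A \<tau> \<sigma> (freq_arg dk k) - A \<tau> \<sigma> 0) * \<rho> \<sigma> k)
      + integral {0..1} (\<lambda>\<sigma>. A \<tau> \<sigma> 0 * (\<rho> \<sigma> k - of_real \<sigma> * \<rho>' k))
      - integral {0..\<tau>} (\<lambda>\<sigma>. (exp (of_real (\<tau> - \<sigma>) * freq_arg dk k) - 1) * \<rho> \<sigma> k)
      - integral {0..\<tau>} (\<lambda>\<sigma>. \<rho> \<sigma> k - of_real \<sigma> * \<rho>' k)))
    (cm * dk ^ 2 * cG + ((1 - 0) * (cm * dk * (cg * dk)) + (1 - 0) * (cm * (c3 * dk\<^sup>2)) + dk * (cg * dk) + c3 * dk\<^sup>2))"
    by (rule hs_le_add[OF 0 hs_le_diff[OF hs_le_diff[OF hs_le_add[OF 134(1) 2] 134(2)] 4]])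
  then have "hs_le (\<alpha> - 4) (\<lambda>k. (integral {0..1} (\<lambda>\<sigma>. A \<tau> \<sigma> (freq_arg dk k)) - of_real \<tau> * phi1 (of_real \<tau> * freq_arg dk k)) * g 0 k
      + (stage_int dk \<rho> \<tau> k - integral {0..\<tau>} (\<lambda>\<sigma>. exp (of_real (\<tau> - \<sigma>) * freq_arg dk k) * \<rho> \<sigma> k) - of_real (P \<tau>) * \<rho>' k))
     ((cm * cG + cm * cg + cm * c3 + cg + c3) * dk\<^sup>2)"
    by (rule hs_le_subst) (simp only: stage_remainder_eq[OF \<tau>], simp add: algebra_simps power2_eq_square)
  from hs_le_add[OF hs_le_C_defect[OF \<tau> q(2)] hs_le_scale[OF hs_le_mono[OF this s order_refl], of "of_real (\<epsilon> * dk)"]]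
  show ?thesis
  proof (rule hs_le_subst)
    fix k
    show "defect \<tau> k - \<Delta> \<tau> k = (C \<tau> (freq_arg dk k) - exp (of_real \<tau> * freq_arg dk k)) * b 0 k +
         of_real (\<epsilon> * dk) * ((integral {0..1} (\<lambda>\<sigma>. A \<tau> \<sigma> (freq_arg dk k)) - of_real \<tau> * phi1 (of_real \<tau> * freq_arg dk k)) * g 0 k
      + (stage_int dk \<rho> \<tau> k - integral {0..\<tau>} (\<lambda>\<sigma>. exp (of_real (\<tau> - \<sigma>) * freq_arg dk k) * \<rho> \<sigma> k) - of_real (P \<tau>) * \<rho>' k))"
      unfolding defect_eq[OF \<tau>] \<Delta>_def by (simp add: algebra_simps)
    have "cm * Mb * dk ^ q \<le> K3 * dk ^ q"
      using cG_nonneg cg_nonneg c3_nonneg dk by (intro mult_right_mono) (auto simp: K3_def)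
    moreover have "(cm * cG + cm * cg + cm * c3 + cg + c3) * (\<epsilon> * dk ^ 3) \<le> K3 * (\<epsilon> * dk ^ 3)"
      using Mb_nonneg \<epsilon> dk by (intro mult_right_mono) (auto simp: K3_def)
    moreover have "cmod (of_real (\<epsilon> * dk)) = \<epsilon> * dk" using eps_dk(1) by (simp only: norm_of_real abs_of_nonneg)
    ultimately show "cm * dk ^ q * Mb + cmod (of_real (\<epsilon> * dk)) * ((cm * cG + cm * cg + cm * c3 + cg + c3) * dk\<^sup>2)
       \<le> K3 * (dk ^ q + \<epsilon> * dk ^ 3)"
      by (simp add: algebra_simps power2_eq_square power3_eq_cube)
  qed
qed

text \<open>The exact solution moved by the leading stage error. With this shift the residual in the
  stage equations improves from \<epsilon> dk^2 to \<epsilon> dk^3 in its nonlinear part.\<close>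

definition V :: "real \<Rightarrow> int ^ 'd \<Rightarrow> complex" where
  "V \<tau> k = b \<tau> k + \<Delta> \<tau> k"

definition F :: "real \<Rightarrow> int ^ 'd \<Rightarrow> complex" where
  "F \<tau> k = cubic lam (V \<tau>) k - cubic lam (b \<tau>) k"

lemma \<Delta>_le: "\<tau> \<in> {0..1} \<Longrightarrow> hs_le (\<alpha> - 2) (\<Delta> \<tau>) (cm * cg * (\<epsilon> * dk\<^sup>2))"
proof -
  assume \<tau>: "\<tau> \<in> {0..1}"
  have "hs_le (\<alpha> - 2) (\<lambda>k. of_real (\<epsilon> * dk * P \<tau>) * \<rho>' k) (cmod (of_real (\<epsilon> * dk * P \<tau>)) * (cg * dk))"
    by (rule hs_le_scale[OF \<rho>'_le])
  then show ?thesis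
  proof (rule hs_le_subst)
    have "cmod (of_real (\<epsilon> * dk * P \<tau>)) = \<epsilon> * dk * \<bar>P \<tau>\<bar>"
      unfolding norm_of_real abs_mult using \<epsilon> dk by simp
    also have "\<dots> \<le> \<epsilon> * dk * cm" using eps_dk P_bound[OF \<tau>] by (intro mult_left_mono) auto
    finally have "cmod (of_real (\<epsilon> * dk * P \<tau>)) * (cg * dk) \<le> (\<epsilon> * dk * cm) * (cg * dk)"
      using cg_nonneg dk by (intro mult_right_mono) auto
    then show "cmod (of_real (\<epsilon> * dk * P \<tau>)) * (cg * dk) \<le> cm * cg * (\<epsilon> * dk\<^sup>2)"
      by (simp add: power2_eq_square mult_ac)
  qed (simp add: \<Delta>_def)
qed

lemma eps_dk2: "\<epsilon> * dk\<^sup>2 \<le> 1" "0 \<le> \<epsilon> * dk\<^sup>2"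
proof -
  have "\<epsilon> * dk\<^sup>2 \<le> 1 * 1" using \<epsilon> dk by (intro mult_mono) (auto simp: power_le_one)
  then show "\<epsilon> * dk\<^sup>2 \<le> 1" by simp
  show "0 \<le> \<epsilon> * dk\<^sup>2" using \<epsilon> by simp
qed

lemma V_le: "\<tau> \<in> {0..1} \<Longrightarrow> hs_le (\<alpha> - 2) (V \<tau>) (Mb + cm * cg)"
proof -
  assume \<tau>: "\<tau> \<in> {0..1}"
  have "cm * cg * (\<epsilon> * dk\<^sup>2) \<le> cm * cg"
    using eps_dk2 cg_nonneg by (simp add: mult_left_le)
  then show ?thesis unfolding V_def[abs_def]
    by (intro hs_le_weaken[OF hs_le_add[OF b_le'[OF \<tau>] \<Delta>_le[OF \<tau>]]]) simp
qed

lemma V_continuous: "hs_continuous_on (\<alpha> - 2) {0..1} V"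
  unfolding V_def[abs_def]
proof (rule hs_continuous_on_add)
  show "hs_continuous_on (\<alpha> - 2) {0..1} b" by (rule hs_continuous_on_mono[OF b_continuous]) auto
  show "hs_continuous_on (\<alpha> - 2) {0..1} \<Delta>"
  proof (rule hs_continuous_on_lipschitz)
    fix t t' :: real assume t: "t \<in> {0..1}" "t' \<in> {0..1}"
    have "hs_le (\<alpha> - 2) (\<lambda>k. of_real (\<epsilon> * dk * (P t' - P t)) * \<rho>' k) (cmod (of_real (\<epsilon> * dk * (P t' - P t))) * (cg * dk))"
      by (rule hs_le_scale[OF \<rho>'_le])
    then show "hs_le (\<alpha> - 2) (\<lambda>k. \<Delta> t' k - \<Delta> t k) ((\<epsilon> * dk * cm * (cg * dk)) * \<bar>t' - t\<bar>)"
    proof (rule hs_le_subst)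
      have "cmod (of_real (\<epsilon> * dk * (P t' - P t))) = \<epsilon> * dk * \<bar>P t' - P t\<bar>"
        unfolding norm_of_real abs_mult using \<epsilon> dk by simp
      also have "\<dots> \<le> \<epsilon> * dk * (cm * \<bar>t' - t\<bar>)" using eps_dk P_lipschitz[OF t] by (intro mult_left_mono) auto
      finally have "cmod (of_real (\<epsilon> * dk * (P t' - P t))) * (cg * dk) \<le> (\<epsilon> * dk * (cm * \<bar>t' - t\<bar>)) * (cg * dk)"
        using cg_nonneg dk by (intro mult_right_mono) auto
      then show "cmod (of_real (\<epsilon> * dk * (P t' - P t))) * (cg * dk) \<le> (\<epsilon> * dk * cm * (cg * dk)) * \<bar>t' - t\<bar>"
        by (simp add: mult_ac)
    qed (simp add: \<Delta>_def algebra_simps)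
  qed
qed

lemma cubic_V_cont: "continuous_on {0..1} (\<lambda>\<sigma>. cubic lam (V \<sigma>) k)"
  by (rule hs_continuous_onD[OF hs_continuous_on_cubic[OF \<alpha>_pos(1) \<alpha> V_continuous V_le]])

lemma cubic_b_cont: "continuous_on {0..1} (\<lambda>\<sigma>. cubic lam (b \<sigma>) k)"
  using g_cont by (simp add: g_def)

lemma F_cont [continuous_intros]: "continuous_on {0..1} (\<lambda>\<sigma>. F \<sigma> k)"
  unfolding F_def by (intro continuous_intros cubic_V_cont cubic_b_cont)

section \<open>Cancellation of the leading stage error in the update\<close>

context
  fixes B :: real
  assumes B: "Mb + cm * cg \<le> B"
begin

lemma Mb_B: "Mb \<le> B"
  using B mult_nonneg_nonneg[OF cm_nonneg cg_nonneg] by linarith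

definition cF :: real where "cF = 3 * TC * B\<^sup>2 * (cm * cg)"

lemma cF_nonneg: "0 \<le> cF" using TC_nonneg cg_nonneg by (simp add: cF_def)

lemma F_le: "\<tau> \<in> {0..1} \<Longrightarrow> hs_le (\<alpha> - 2) (F \<tau>) (cF * (\<epsilon> * dk\<^sup>2))"
proof -
  assume \<tau>: "\<tau> \<in> {0..1}"
  have "hs_le (\<alpha> - 2) (\<lambda>k. V \<tau> k - b \<tau> k) (cm * cg * (\<epsilon> * dk\<^sup>2))"
    using \<Delta>_le[OF \<tau>] by (simp add: V_def)
  from hs_le_cubic_diff[OF \<alpha>_pos(1) order_refl \<alpha> hs_le_weaken[OF V_le[OF \<tau>] B] hs_le_weaken[OF b_le'[OF \<tau>] Mb_B] this, of lam]
  show ?thesis by (elim hs_le_subst) (simp_all add: F_def cF_def TC_def mult_ac)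
qed

definition c5 :: real where
  "c5 = TC * (3 * Mb + cm * cg) * (cm * cg)\<^sup>2 + 6 * TC * Mb * cL * (cm * cg)"

definition c6 :: real where "c6 = (cm + 1) * cF + c5"

lemma c6_nonneg: "0 \<le> c6"
  using TC_nonneg Mb_nonneg cL_nonneg cg_nonneg cF_nonneg by (simp add: c6_def c5_def)

text \<open>Freezing the base point at \<sigma> = 0 turns the linear part of F into a multiple of
  \<open>P \<sigma>\<close> times one fixed sequence, the form in which the mean of P
  appears.\<close>

lemma F_expand:
  assumes \<sigma>: "\<sigma> \<in> {0..1}"
  shows "hs_le (\<alpha> - 2) (\<lambda>k. F \<sigma> k - of_real (\<epsilon> * dk * P \<sigma>) * dcubic lam (b 0) \<rho>' k) (c5 * (\<epsilon> * dk ^ 3))"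
proof -
  let ?D = "cm * cg * (\<epsilon> * dk\<^sup>2)"
  have D0: "0 \<le> ?D" using hs_le_nonneg[OF \<Delta>_le[OF \<sigma>]] .
  have D1: "?D \<le> cm * cg" using eps_dk2 cg_nonneg by (simp add: mult_left_le)
  have 1: "hs_le (\<alpha> - 2) (\<lambda>k. cubic lam (\<lambda>k. b \<sigma> k + \<Delta> \<sigma> k) k - cubic lam (b \<sigma>) k - dcubic lam (b \<sigma>) (\<Delta> \<sigma>) k) (TC * (3 * Mb + ?D) * ?D * ?D)"
    unfolding TC_def by (rule hs_le_cubic_add[OF \<alpha>_pos(1) order_refl \<alpha> b_le'[OF \<sigma>] \<Delta>_le[OF \<sigma>] \<Delta>_le[OF \<sigma>]])
  have 2: "hs_le (\<alpha> - 2) (\<lambda>k. dcubic lam (b \<sigma>) (\<Delta> \<sigma>) k - dcubic lam (b 0) (\<Delta> \<sigma>) k) (6 * TC * Mb * (cL * dk) * ?D)"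
    unfolding TC_def by (rule hs_le_dcubic_diff[OF \<alpha>_pos(1) \<alpha> b_le'[OF \<sigma>] b_le' b_diff_0[OF \<sigma>] \<Delta>_le[OF \<sigma>]]) simp
  have 3: "dcubic lam (b 0) (\<Delta> \<sigma>) k = of_real (\<epsilon> * dk * P \<sigma>) * dcubic lam (b 0) \<rho>' k" for k
    unfolding \<Delta>_def[abs_def] by (rule dcubic_scale)
  from hs_le_add[OF 1 2] show ?thesis
  proof (rule hs_le_subst)
    show "F \<sigma> k - of_real (\<epsilon> * dk * P \<sigma>) * dcubic lam (b 0) \<rho>' k = cubic lam (\<lambda>k. b \<sigma> k + \<Delta> \<sigma> k) k - cubic lam (b \<sigma>) k - dcubic lam (b \<sigma>) (\<Delta> \<sigma>) k
       + (dcubic lam (b \<sigma>) (\<Delta> \<sigma>) k - dcubic lam (b 0) (\<Delta> \<sigma>) k)" for k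
      by (simp only: F_def V_def[abs_def] 3[symmetric]) simp
    \<comment> \<open>The square of the shift has four powers of dk and two of \<epsilon>; one of
      each is given up to work with the single scale \<epsilon> dk^3.\<close>
    have "(\<epsilon> * dk\<^sup>2) * (\<epsilon> * dk\<^sup>2) \<le> \<epsilon> * dk ^ 3"
    proof -
      have "(\<epsilon> * dk\<^sup>2) * (\<epsilon> * dk\<^sup>2) = (\<epsilon> * dk) * (\<epsilon> * dk ^ 3)" by (simp add: power2_eq_square power3_eq_cube)
      also have "\<dots> \<le> 1 * (\<epsilon> * dk ^ 3)" using eps_dk \<epsilon> dk by (intro mult_right_mono) auto
      finally show ?thesis by simp
    qed
    then have DD: "?D * ?D \<le> (cm * cg)\<^sup>2 * (\<epsilon> * dk ^ 3)"
      using mult_left_mono[of "(\<epsilon> * dk\<^sup>2) * (\<epsilon> * dk\<^sup>2)" "\<epsilon> * dk ^ 3" "(cm * cg)\<^sup>2"] by (simp add: power2_eq_square mult_ac)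
    have "TC * (3 * Mb + ?D) * (?D * ?D) \<le> TC * (3 * Mb + cm * cg) * ((cm * cg)\<^sup>2 * (\<epsilon> * dk ^ 3))"
    proof (rule mult_mono[OF _ DD])
      show "TC * (3 * Mb + ?D) \<le> TC * (3 * Mb + cm * cg)"
        by (rule mult_left_mono[OF add_left_mono[OF D1] TC_nonneg])
      show "0 \<le> TC * (3 * Mb + cm * cg)" using TC_nonneg Mb_nonneg cg_nonneg by simp
      show "0 \<le> ?D * ?D" by (rule mult_nonneg_nonneg[OF D0 D0])
    qed
    moreover have "6 * TC * Mb * (cL * dk) * ?D = 6 * TC * Mb * cL * (cm * cg) * (\<epsilon> * dk ^ 3)"
      by (simp add: power2_eq_square power3_eq_cube)
    moreover have "TC * (3 * Mb + ?D) * ?D * ?D = TC * (3 * Mb + ?D) * (?D * ?D)" by (simp only: mult.assoc)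
    moreover have "c5 * (\<epsilon> * dk ^ 3) = TC * (3 * Mb + cm * cg) * ((cm * cg)\<^sup>2 * (\<epsilon> * dk ^ 3)) + 6 * TC * Mb * cL * (cm * cg) * (\<epsilon> * dk ^ 3)"
      by (simp only: c5_def distrib_right mult.assoc)
    ultimately show "TC * (3 * Mb + ?D) * ?D * ?D + 6 * TC * Mb * (cL * dk) * ?D \<le> c5 * (\<epsilon> * dk ^ 3)"
      by (simp only: add_mono order_refl)
  qed
qed

text \<open>Here the vanishing mean of P pays off: the kernel of the update is 1 up to O(dk) with a
  loss of two derivatives, and the leading part of F integrates to 0, so a term of order \<epsilon>
  dk^2 shrinks to \<epsilon> dk^3.\<close>

lemma stage_int_F_1: "hs_le (\<alpha> - 4) (stage_int dk F 1) (c6 * (\<epsilon> * dk ^ 3))"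
proof -
  have 1: "(1::real) \<in> {0..1}" by simp
  let ?Y = "dcubic lam (b 0) \<rho>'"
  have cA: "continuous_on {0..1} (\<lambda>\<sigma>. A 1 \<sigma> (freq_arg dk k))" for k by (intro continuous_on_A) auto
  have Pc: "continuous_on {0..1} (\<lambda>\<sigma>. of_real (P \<sigma>) :: complex)"
    by (rule continuous_on_lipschitz_bound[where c = cm]) (auto simp flip: of_real_diff intro!: P_lipschitz)
  have a: "hs_le (\<alpha> - 2 - 2) (\<lambda>k. integral {0..1} (\<lambda>\<sigma>. (A 1 \<sigma> (freq_arg dk k) - 1) * F \<sigma> k)) ((1 - 0) * ((cm + 1) * dk * (cF * (\<epsilon> * dk\<^sup>2))))"
  proof (rule hs_le_integral)
    fix \<sigma> :: real assume \<sigma>: "\<sigma> \<in> {0..1}"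
    show "hs_le (\<alpha> - 2 - 2) (\<lambda>k. (A 1 \<sigma> (freq_arg dk k) - 1) * F \<sigma> k) ((cm + 1) * dk * (cF * (\<epsilon> * dk\<^sup>2)))"
    proof (rule hs_le_multiplier_wt[OF F_le[OF \<sigma>]])
      fix k
      have "cmod (A 1 \<sigma> (freq_arg dk k) - exp (of_real (1 - \<sigma>) * freq_arg dk k)) \<le> cm * cmod (freq_arg dk k) ^ 1"
        by (rule A_1_approx) (use \<sigma> r in auto)
      moreover have "cmod (exp (of_real (1 - \<sigma>) * freq_arg dk k) - 1) \<le> cmod (freq_arg dk k)"
      proof -
        have "cmod (exp (of_real (1 - \<sigma>) * freq_arg dk k) - 1) \<le> cmod (of_real (1 - \<sigma>) * freq_arg dk k)"
          using exp_rem_le[of "of_real (1 - \<sigma>) * freq_arg dk k" 1] by (simp add: exp_rem_def)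
        also have "\<dots> \<le> 1 * cmod (freq_arg dk k)"
          unfolding norm_mult norm_of_real using \<sigma> by (intro mult_right_mono) auto
        finally show ?thesis by simp
      qed
      ultimately have "cmod (A 1 \<sigma> (freq_arg dk k) - 1) \<le> (cm + 1) * cmod (freq_arg dk k)"
        using norm_triangle_ineq[of "A 1 \<sigma> (freq_arg dk k) - exp (of_real (1 - \<sigma>) * freq_arg dk k)" "exp (of_real (1 - \<sigma>) * freq_arg dk k) - 1"]
        by (simp add: distrib_right del: of_real_diff)
      also have "\<dots> \<le> (cm + 1) * (dk * wt 2 k)"
        using cm by (intro mult_left_mono norm_freq_arg_le dk) auto
      finally show "cmod (A 1 \<sigma> (freq_arg dk k) - 1) \<le> (cm + 1) * dk * wt 2 k" by (simp add: mult.assoc)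
    qed (use dk cm in auto)
  qed (auto intro!: continuous_intros cA)
  have b: "hs_le (\<alpha> - 2) (\<lambda>k. integral {0..1} (\<lambda>\<sigma>. F \<sigma> k - of_real (\<epsilon> * dk * P \<sigma>) * ?Y k)) ((1 - 0) * (c5 * (\<epsilon> * dk ^ 3)))"
    by (rule hs_le_integral[OF _ F_expand]) (auto intro!: continuous_intros Pc)
  have "hs_le (\<alpha> - 4) (\<lambda>k. integral {0..1} (\<lambda>\<sigma>. (A 1 \<sigma> (freq_arg dk k) - 1) * F \<sigma> k)
       + integral {0..1} (\<lambda>\<sigma>. F \<sigma> k - of_real (\<epsilon> * dk * P \<sigma>) * ?Y k))
     ((1 - 0) * ((cm + 1) * dk * (cF * (\<epsilon> * dk\<^sup>2))) + (1 - 0) * (c5 * (\<epsilon> * dk ^ 3)))"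
    using a by (intro hs_le_add hs_le_mono[OF b]) auto
  then show ?thesis
  proof (rule hs_le_subst)
    fix k
    have "P integrable_on {0..1}"
      by (intro integrable_continuous_interval lipschitz_on_continuous_on[of cm] lipschitz_onI)
         (auto simp: dist_real_def intro!: P_lipschitz)
    then have "(P has_integral 0) {0..1}" using P_mean by (simp add: has_integral_iff)
    from integral_unique[OF has_integral_of_real[OF this, where 'b = complex]]
    have "integral {0..1} (\<lambda>\<sigma>. of_real (\<epsilon> * dk * P \<sigma>) * ?Y k) = 0" by (simp add: mult.assoc)
    moreover have "integral {0..1} (\<lambda>\<sigma>. F \<sigma> k - of_real (\<epsilon> * dk * P \<sigma>) * ?Y k)
       = integral {0..1} (\<lambda>\<sigma>. F \<sigma> k) - integral {0..1} (\<lambda>\<sigma>. of_real (\<epsilon> * dk * P \<sigma>) * ?Y k)"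
      by (rule Henstock_Kurzweil_Integration.integral_diff) (auto intro!: integrable_continuous_interval continuous_intros Pc)
    moreover have "integral {0..1} (\<lambda>\<sigma>. (A 1 \<sigma> (freq_arg dk k) - 1) * F \<sigma> k)
       = integral {0..1} (\<lambda>\<sigma>. A 1 \<sigma> (freq_arg dk k) * F \<sigma> k) - integral {0..1} (\<lambda>\<sigma>. 1 * F \<sigma> k)"
      unfolding left_diff_distrib
      by (rule Henstock_Kurzweil_Integration.integral_diff) (auto intro!: integrable_continuous_interval continuous_intros cA)
    ultimately show "stage_int dk F 1 k = integral {0..1} (\<lambda>\<sigma>. (A 1 \<sigma> (freq_arg dk k) - 1) * F \<sigma> k)
       + integral {0..1} (\<lambda>\<sigma>. F \<sigma> k - of_real (\<epsilon> * dk * P \<sigma>) * ?Y k)"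
      by (simp add: stage_int_def)
  next
    show "(1 - 0) * ((cm + 1) * dk * (cF * (\<epsilon> * dk\<^sup>2))) + (1 - 0) * (c5 * (\<epsilon> * dk ^ 3)) \<le> c6 * (\<epsilon> * dk ^ 3)"
      by (simp add: c6_def algebra_simps power2_eq_square power3_eq_cube)
  qed
qed

lemma stage_map_V:
  assumes "\<tau> \<in> {0..1}"
  shows "stage_map lam \<epsilon> dk (b 0) V \<tau> k = stage_map lam \<epsilon> dk (b 0) b \<tau> k + of_real (\<epsilon> * dk) * stage_int dk F \<tau> k"
  unfolding stage_map_def F_def[abs_def] stage_int_diff[OF assms cubic_V_cont cubic_b_cont, symmetric]
  by (simp add: algebra_simps)

text \<open>The stage residual of V is the defect with its leading term removed. The update,
  however, is compared with b at \<tau> = 1 and not with V, so its remainder consists of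
  \<open>defect 1\<close> and the effect of the shift, which \<open>stage_int_F_1\<close> makes
  small.\<close>

lemma step_error_order3:
  assumes q: "2 \<le> q" "q \<le> Suc r" "0 \<le> \<alpha> - 2 * real q"
    and U: "hs_continuous_on (\<alpha> - 2) {0..1} U" "\<And>\<tau>. \<tau> \<in> {0..1} \<Longrightarrow> hs_le (\<alpha> - 2) (U \<tau>) B"
    and eqU: "\<And>\<tau> k. \<tau> \<in> {0..1} \<Longrightarrow> U \<tau> k = stage_map lam \<epsilon> dk a U \<tau> k"
    and ab: "hs_le (\<alpha> - 2 * real q) (\<lambda>k. a k - b 0 k) E"
    and small: "\<epsilon> * dk * (cm * (3 * TC * B\<^sup>2)) \<le> 1 / 2"
  shows "hs_le (\<alpha> - 2 * real q) (\<lambda>k. U 1 k - b 1 k)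
    ((1 + \<epsilon> * dk * (6 * cm\<^sup>2 * TC * B\<^sup>2)) * E
      + \<epsilon> * dk * ((6 * cm * TC * B\<^sup>2 * (K3 + cm * cF) + (cm * cg + c6)) * (dk ^ q + \<epsilon> * dk ^ 3)))"
proof -
  have s: "\<alpha> - 2 * real q \<le> \<alpha> - 4" "\<alpha> - 2 * real q \<le> \<alpha> - 2" using q by auto
  have 1: "(1::real) \<in> {0..1}" by simp
  have ed: "cmod (of_real (\<epsilon> * dk)) = \<epsilon> * dk" using eps_dk(1) by (simp only: norm_of_real abs_of_nonneg)
  have e3: "0 \<le> \<epsilon> * dk ^ 3" "0 \<le> dk ^ q" using \<epsilon> dk by auto
  have \<delta>: "hs_le (\<alpha> - 2 * real q) (\<lambda>k. V \<tau> k - stage_map lam \<epsilon> dk (b 0) V \<tau> k) ((K3 + cm * cF) * (dk ^ q + \<epsilon> * dk ^ 3))"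
    if \<tau>: "\<tau> \<in> {0..1}" for \<tau>
  proof -
    have "hs_le (\<alpha> - 2 * real q) (\<lambda>k. - (defect \<tau> k - \<Delta> \<tau> k) - of_real (\<epsilon> * dk) * stage_int dk F \<tau> k)
      (K3 * (dk ^ q + \<epsilon> * dk ^ 3) + cmod (of_real (\<epsilon> * dk)) * (cm * (cF * (\<epsilon> * dk\<^sup>2))))"
    proof (intro hs_le_diff hs_le_scale hs_le_mono[OF hs_le_stage_int[OF \<tau> F_le F_cont] s(2) order_refl])
      show "hs_le (\<alpha> - 2 * real q) (\<lambda>k. - (defect \<tau> k - \<Delta> \<tau> k)) (K3 * (dk ^ q + \<epsilon> * dk ^ 3))"
        unfolding hs_le_uminus by (rule defect_le_order3[OF \<tau> q(1,2)])
    qed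
    then show ?thesis
    proof (rule hs_le_subst)
      show "V \<tau> k - stage_map lam \<epsilon> dk (b 0) V \<tau> k = - (defect \<tau> k - \<Delta> \<tau> k) - of_real (\<epsilon> * dk) * stage_int dk F \<tau> k" for k
        unfolding stage_map_V[OF \<tau>] by (simp add: V_def defect_def)
      have "(\<epsilon> * dk) * (cm * (cF * (\<epsilon> * dk\<^sup>2))) = (\<epsilon> * (cm * cF)) * (\<epsilon> * dk ^ 3)"
        by (simp add: power2_eq_square power3_eq_cube)
      also have "\<dots> \<le> (1 * (cm * cF)) * (dk ^ q + \<epsilon> * dk ^ 3)"
        using \<epsilon> cF_nonneg e3 by (intro mult_mono) auto
      finally show "K3 * (dk ^ q + \<epsilon> * dk ^ 3) + cmod (of_real (\<epsilon> * dk)) * (cm * (cF * (\<epsilon> * dk\<^sup>2))) \<le> (K3 + cm * cF) * (dk ^ q + \<epsilon> * dk ^ 3)"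
        unfolding ed by (simp add: distrib_right)
    qed
  qed
  have \<eta>: "hs_le (\<alpha> - 2 * real q) (\<lambda>k. b 1 k - stage_map lam \<epsilon> dk (b 0) V 1 k) (\<epsilon> * dk * ((cm * cg + c6) * (dk ^ q + \<epsilon> * dk ^ 3)))"
  proof -
    have "hs_le (\<alpha> - 2 * real q) (\<lambda>k. - defect 1 k - of_real (\<epsilon> * dk) * stage_int dk F 1 k)
      (\<epsilon> * dk * (cm * cg * dk ^ q) + cmod (of_real (\<epsilon> * dk)) * (c6 * (\<epsilon> * dk ^ 3)))"
      using defect_1_le[OF _ q(2)] q(1)
      by (intro hs_le_diff hs_le_scale hs_le_mono[OF stage_int_F_1 s(1) order_refl]) auto
    then show ?thesis
    proof (rule hs_le_subst)
      show "b 1 k - stage_map lam \<epsilon> dk (b 0) V 1 k = - defect 1 k - of_real (\<epsilon> * dk) * stage_int dk F 1 k" for k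
        unfolding stage_map_V[OF 1] by (simp add: defect_def)
      have "cm * cg * dk ^ q \<le> cm * cg * (dk ^ q + \<epsilon> * dk ^ 3)" "c6 * (\<epsilon> * dk ^ 3) \<le> c6 * (dk ^ q + \<epsilon> * dk ^ 3)"
        using cg_nonneg c6_nonneg e3 by (auto intro!: mult_left_mono)
      from add_mono[OF mult_left_mono[OF this(1) eps_dk(1)] mult_left_mono[OF this(2) eps_dk(1)]]
      have "\<epsilon> * dk * (cm * cg * dk ^ q) + \<epsilon> * dk * (c6 * (\<epsilon> * dk ^ 3))
        \<le> \<epsilon> * dk * (cm * cg * (dk ^ q + \<epsilon> * dk ^ 3)) + \<epsilon> * dk * (c6 * (dk ^ q + \<epsilon> * dk ^ 3))"
        .
      then show "\<epsilon> * dk * (cm * cg * dk ^ q) + cmod (of_real (\<epsilon> * dk)) * (c6 * (\<epsilon> * dk ^ 3))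
         \<le> \<epsilon> * dk * ((cm * cg + c6) * (dk ^ q + \<epsilon> * dk ^ 3))"
        unfolding ed distrib_right[of "cm * cg" c6] distrib_left[of "\<epsilon> * dk"] .
    qed
  qed
  have "hs_le (\<alpha> - 2 * real q) (\<lambda>k. U 1 k - b 1 k)
    ((1 + \<epsilon> * dk * (6 * cm\<^sup>2 * TC * B\<^sup>2)) * E
      + \<epsilon> * dk * (6 * cm * TC * B\<^sup>2 * ((K3 + cm * cF) * (dk ^ q + \<epsilon> * dk ^ 3)))
      + \<epsilon> * dk * ((cm * cg + c6) * (dk ^ q + \<epsilon> * dk ^ 3)))"
    by (rule step_error[where V = V and \<delta> = "\<lambda>\<tau> k. V \<tau> k - stage_map lam \<epsilon> dk (b 0) V \<tau> k"
         and \<eta> = "\<lambda>k. b 1 k - stage_map lam \<epsilon> dk (b 0) V 1 k",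
        OF q(3) s(2) U V_continuous hs_le_weaken[OF V_le B] eqU _ \<delta> _ \<eta> ab small]) simp_all
  then show ?thesis
    by (elim hs_le_weaken) (simp add: distrib_right distrib_left mult.assoc)
qed

end

end

section \<open>Global error\<close>

lemma hs_continuous_on_affine:
  assumes h: "hs_continuous_on s I h" and c: "0 < c" and sub: "\<And>\<sigma>. \<sigma> \<in> J \<Longrightarrow> t0 + \<sigma> * c \<in> I"
  shows "hs_continuous_on s J (\<lambda>\<sigma>. h (t0 + \<sigma> * c))"
  unfolding hs_continuous_on_def
proof (intro ballI allI impI)
  fix t and e :: real assume t: "t \<in> J" and e: "0 < e"
  obtain \<delta> where \<delta>: "\<delta> > 0" "\<And>t'. t' \<in> I \<Longrightarrow> \<bar>t' - (t0 + t * c)\<bar> < \<delta> \<Longrightarrow> hs_le s (\<lambda>k. h t' k - h (t0 + t * c) k) e"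
    using h sub[OF t] e unfolding hs_continuous_on_def by meson
  have "hs_le s (\<lambda>k. h (t0 + t' * c) k - h (t0 + t * c) k) e" if "t' \<in> J" "\<bar>t' - t\<bar> < \<delta> / c" for t'
  proof (rule \<delta>(2)[OF sub[OF that(1)]])
    have "t0 + t' * c - (t0 + t * c) = (t' - t) * c" by (simp add: left_diff_distrib)
    then show "\<bar>t0 + t' * c - (t0 + t * c)\<bar> < \<delta>" using that(2) c by (simp add: abs_mult pos_less_divide_eq)
  qed
  then show "\<exists>\<delta>>0. \<forall>t'\<in>J. \<bar>t' - t\<bar> < \<delta> \<longrightarrow> hs_le s (\<lambda>k. h (t0 + t' * c) k - h (t0 + t * c) k) e"
    using \<delta>(1) c by (intro exI[of _ "\<delta> / c"]) auto
qed

text \<open>The constants form a chain without a circle. \<open>Mb\<close> bounds the exact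
  solution; B bounds the stages in H^(\<alpha> - 2) as long as the error there is at most 1; B
  determines the growth rate G of the H^\<alpha>-norm, G the bound B1 for the whole time, and B1 the
  radius R. Only then is dk made small, and as \<epsilon> \<le> 1 the conditions on dk do not
  involve \<epsilon>.\<close>

locale ep_run = ep_method C A cm r
  for C A cm r +
  fixes lam \<epsilon> dk \<alpha> T Mb M R B G B1 :: real and w0 :: "real ^ 'd::finite \<Rightarrow> complex" and w :: "real \<Rightarrow> real ^ 'd \<Rightarrow> complex"
  assumes r1: "1 \<le> r" and \<alpha>2: "\<alpha> - 2 > real CARD('d) / 2"
    and \<epsilon>: "0 < \<epsilon>" "\<epsilon> \<le> 1" and dk: "0 < dk" "dk \<le> 1" and T: "0 < T"
    and sol: "nls_solution lam \<alpha> T \<epsilon> w0 w" and w0: "w0 \<in> sobolev_space \<alpha>"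
    and M: "sobolev_norm \<alpha> w0 \<le> M"
    and Mb: "\<And>\<kappa>. \<kappa> \<in> {0..T / \<epsilon>} \<Longrightarrow> sobolev_norm \<alpha> (w \<kappa>) \<le> Mb"
    and G: "G = cm * (\<bar>lam\<bar> * 3 * (2 powr \<alpha>)\<^sup>2 * (sob_const TYPE('d) (\<alpha> - 2) * B)\<^sup>2) * (2 * cm)"
    and B1: "B1 = exp (G * T) * M"
    and B: "cm * (Mb + 1) + 1 \<le> B" and R: "cm * B1 + 1 \<le> R"
    and small: "dk * (cm * (tri_const TYPE('d) lam \<alpha> * (cm * B1 + 1) ^ 3)) \<le> 1"
      "dk * (cm * (3 * tri_const TYPE('d) lam \<alpha> * R\<^sup>2)) \<le> 1 / 2"
      "dk * (cm * (\<bar>lam\<bar> * 3 * (2 powr \<alpha>)\<^sup>2 * (sob_const TYPE('d) (\<alpha> - 2) * B)\<^sup>2)) \<le> 1 / 2"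
      "dk * (cm * (3 * tri_const TYPE('d) lam (\<alpha> - 2) * B\<^sup>2)) \<le> 1 / 2"
begin

lemma \<alpha>_pos: "0 \<le> \<alpha> - 2" "0 \<le> \<alpha>" "\<alpha> > real CARD('d) / 2" "\<alpha> > real CARD('d) / 2 + 2"
  using \<alpha>2 by (auto intro: order_trans[of 0 "real CARD('d) / 2"] simp: field_simps)

lemma eps_dk_le: "0 \<le> x \<Longrightarrow> \<epsilon> * dk * x \<le> dk * x"
  using \<epsilon> dk by (intro mult_right_mono) (auto simp: mult_le_cancel_right1)

lemma eps_dk: "0 \<le> \<epsilon> * dk" using \<epsilon> dk by simp

lemma M_nonneg: "0 \<le> M" using order_trans[OF sobolev_norm_nonneg M] .

lemma G_nonneg: "0 \<le> G" by (simp add: G)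

lemma B1_nonneg: "0 \<le> B1" using M_nonneg by (simp add: B1)

lemma Mb_nonneg: "0 \<le> Mb" using order_trans[OF sobolev_norm_nonneg Mb[of 0]] T \<epsilon> by simp

lemma Mb_le_B: "Mb \<le> B"
proof -
  have "1 * Mb \<le> cm * Mb" using cm Mb_nonneg by (rule mult_right_mono)
  then show ?thesis using B cm by (simp add: distrib_left)
qed

definition \<Phi> :: "(real ^ 'd \<Rightarrow> complex) \<Rightarrow> real ^ 'd \<Rightarrow> complex" where
  "\<Phi> = ep_step C A lam \<epsilon> dk \<alpha> R"

definition u :: "nat \<Rightarrow> real ^ 'd \<Rightarrow> complex" where
  "u n = (\<Phi> ^^ n) w0"

definition v :: "nat \<Rightarrow> int ^ 'd \<Rightarrow> complex" where
  "v n = fourier_coeff (w (real n * dk))"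

text \<open>The solution is constructed in the ball of radius cm B1 + 1, while uniqueness is proved
  in the possibly larger ball of radius R. This identifies the choice made by \<open>ep_step\<close>
  up to null sets.\<close>

lemma stage_well_posed:
  assumes y: "y \<in> sobolev_space \<alpha>" and Y: "hs_le \<alpha> (fourier_coeff y) B1"
  obtains U where "unique_stage_solution C A lam \<epsilon> dk \<alpha> R y" "\<Phi> y \<in> sobolev_space \<alpha>" "fourier_coeff (\<Phi> y) = U 1"
    "hs_continuous_on \<alpha> {0..1} U" "\<And>\<tau>. \<tau> \<in> {0..1} \<Longrightarrow> hs_le \<alpha> (U \<tau>) (cm * B1 + 1)"
    "\<And>\<tau> k. \<tau> \<in> {0..1} \<Longrightarrow> U \<tau> k = stage_map lam \<epsilon> dk (fourier_coeff y) U \<tau> k"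
proof -
  have R0: "0 \<le> cm * B1 + 1" using B1_nonneg by simp
  have s1: "\<epsilon> * dk * (cm * (tri_const TYPE('d) lam \<alpha> * (cm * B1 + 1) ^ 3)) \<le> 1"
    using R0 by (intro order_trans[OF eps_dk_le small(1)]) simp
  have sR: "\<epsilon> * dk * (cm * (3 * tri_const TYPE('d) lam \<alpha> * R\<^sup>2)) \<le> 1 / 2"
    by (intro order_trans[OF eps_dk_le small(2)]) simp
  have "cm * (3 * tri_const TYPE('d) lam \<alpha> * (cm * B1 + 1)\<^sup>2) \<le> cm * (3 * tri_const TYPE('d) lam \<alpha> * R\<^sup>2)"
    by (intro mult_left_mono power_mono R R0) auto
  from order_trans[OF mult_left_mono[OF this eps_dk] sR]
  have s2: "\<epsilon> * dk * (cm * (3 * tri_const TYPE('d) lam \<alpha> * (cm * B1 + 1)\<^sup>2)) \<le> 1 / 2" .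
  have dk0: "0 \<le> \<epsilon>" "0 \<le> dk" using \<epsilon> dk by auto
  obtain U where U: "hs_continuous_on \<alpha> {0..1} U" "\<And>\<tau>. \<tau> \<in> {0..1} \<Longrightarrow> hs_le \<alpha> (U \<tau>) (cm * B1 + 1)"
    "\<And>\<tau> k. \<tau> \<in> {0..1} \<Longrightarrow> U \<tau> k = stage_map lam \<epsilon> dk (fourier_coeff y) U \<tau> k"
    by (rule stage_exists[OF \<alpha>_pos(2,3) Y dk0 refl s1 s2]) (rule that)
  have UR: "hs_le \<alpha> (U \<tau>) R" if "\<tau> \<in> {0..1}" for \<tau> by (rule hs_le_weaken[OF U(2)[OF that] R])
  have ex: "stage_solution C A lam \<epsilon> dk \<alpha> R y (\<lambda>\<tau>. fser (U \<tau>))"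
    by (rule stage_map_imp_stage_solution[OF y \<alpha>_pos(2,3) U(1) UR U(3)])
  have coeff: "fourier_coeff (V \<tau>) = U \<tau>" and ae: "ae_eq (V \<tau>) (fser (U \<tau>))"
    if V: "stage_solution C A lam \<epsilon> dk \<alpha> R y V" and \<tau>: "\<tau> \<in> {0..1}" for V \<tau>
  proof -
    note V' = stage_solution_imp_stage_map[OF V y \<alpha>_pos(2,3)]
    show eq: "fourier_coeff (V \<tau>) = U \<tau>"
      by (rule stage_unique[where U = "\<lambda>\<tau>. fourier_coeff (V \<tau>)", OF \<alpha>_pos(2,3) V'(1,2) U(1) UR V'(3) U(3) dk0 sR \<tau>])
    have "stage_map lam \<epsilon> dk (fourier_coeff y) (\<lambda>\<tau>. fourier_coeff (V \<tau>)) \<tau> = U \<tau>"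
      using V'(3)[OF \<tau>] by (simp add: eq fun_eq_iff)
    then show "ae_eq (V \<tau>) (fser (U \<tau>))" using V'(4)[OF \<tau>] by simp
  qed
  show ?thesis
  proof (rule that[OF _ _ _ U])
    have "ae_eq (V \<tau>) (W \<tau>)" if "stage_solution C A lam \<epsilon> dk \<alpha> R y V" "stage_solution C A lam \<epsilon> dk \<alpha> R y W" "\<tau> \<in> {0..1}" for V W \<tau>
      using ae[OF that(1,3)] ae[OF that(2,3)] unfolding ae_eq_def by eventually_elim simp
    then show "unique_stage_solution C A lam \<epsilon> dk \<alpha> R y"
      unfolding unique_stage_solution_def using ex by blast
    define W where "W = (SOME W. stage_solution C A lam \<epsilon> dk \<alpha> R y W)"
    have W: "stage_solution C A lam \<epsilon> dk \<alpha> R y W" unfolding W_def by (rule someI[where P = "stage_solution C A lam \<epsilon> dk \<alpha> R y", OF ex])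
    have \<Phi>: "\<Phi> y = W 1" by (simp add: \<Phi>_def ep_step_def W_def)
    show "fourier_coeff (\<Phi> y) = U 1" unfolding \<Phi> by (rule coeff[OF W]) simp
    show "\<Phi> y \<in> sobolev_space \<alpha>" unfolding \<Phi> using W by (auto simp: stage_solution_def sobolev_continuous_on_def)
  qed
qed

lemma window:
  assumes n: "real (Suc n) * dk \<le> T / \<epsilon>"
  shows "ep_window C A cm r lam \<epsilon> dk \<alpha> Mb (\<lambda>\<sigma>. fourier_coeff (w (real n * dk + \<sigma> * dk)))"
proof -
  let ?t = "\<lambda>\<sigma>. real n * dk + \<sigma> * dk"
  have sub: "?t \<sigma> \<in> {0..T / \<epsilon>}" if "\<sigma> \<in> {0..1}" for \<sigma>
  proof -
    have "\<sigma> * dk \<le> 1 * dk" using that dk by (intro mult_right_mono) auto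
    moreover have "real n * dk + 1 * dk \<le> T / \<epsilon>" using n by (simp add: distrib_right)
    moreover have "0 \<le> real n * dk + \<sigma> * dk" using that dk by simp
    ultimately show ?thesis unfolding atLeastAtMost_iff by linarith
  qed
  show ?thesis
  proof unfold_locales
    have "sobolev_continuous_on \<alpha> {0..T / \<epsilon>} w" using sol by (simp add: nls_solution_def)
    from hs_continuous_on_affine[OF sobolev_continuous_on_imp[OF this] dk(1) sub]
    show "hs_continuous_on \<alpha> {0..1} (\<lambda>\<sigma>. fourier_coeff (w (?t \<sigma>)))" .
    fix \<sigma> :: real assume \<sigma>: "\<sigma> \<in> {0..1}"
    have "w (?t \<sigma>) \<in> sobolev_space \<alpha>" using sol sub[OF \<sigma>] by (auto simp: nls_solution_def sobolev_continuous_on_def)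
    from hs_le_weaken[OF sobolev_space_hs_le[OF this] Mb[OF sub[OF \<sigma>]]]
    show "hs_le \<alpha> (fourier_coeff (w (?t \<sigma>))) Mb" .
    fix k
    let ?D = "- \<i> * of_real (freq_sq k) * fourier_coeff (w (?t \<sigma>)) k + of_real \<epsilon> * cubic lam (fourier_coeff (w (?t \<sigma>))) k"
    have "((\<lambda>t. fourier_coeff (w t) k) has_vector_derivative ?D) (at (?t \<sigma>) within {0..T / \<epsilon>})"
      by (rule nls_solution_coeff_derivative[OF sol \<alpha>_pos(4) sub[OF \<sigma>]])
    then have "((\<lambda>t. fourier_coeff (w t) k) has_vector_derivative ?D) (at (?t \<sigma>) within ?t ` {0..1})"
      by (rule has_vector_derivative_within_subset) (use sub in auto)
    moreover have "(?t has_vector_derivative dk) (at \<sigma> within {0..1})"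
      by (auto intro!: derivative_eq_intros simp: has_real_derivative_iff_has_vector_derivative[symmetric])
    ultimately have "(((\<lambda>t. fourier_coeff (w t) k) \<circ> ?t) has_vector_derivative dk *\<^sub>R ?D) (at \<sigma> within {0..1})"
      by (intro vector_diff_chain_within)
    moreover have "dk *\<^sub>R ?D = freq_arg dk k * fourier_coeff (w (?t \<sigma>)) k + of_real (\<epsilon> * dk) * cubic lam (fourier_coeff (w (?t \<sigma>))) k"
      by (simp add: freq_arg_def scaleR_conv_of_real algebra_simps)
    ultimately show "((\<lambda>\<sigma>. fourier_coeff (w (?t \<sigma>)) k) has_vector_derivative
      (freq_arg dk k * fourier_coeff (w (?t \<sigma>)) k + of_real (\<epsilon> * dk) * cubic lam (fourier_coeff (w (?t \<sigma>))) k)) (at \<sigma> within {0..1})"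
      by (simp add: o_def)
  qed (use r1 \<alpha>2 \<epsilon> dk in auto)
qed

text \<open>The one-step estimate as a predicate with the loss q as a parameter: q = 1 drives the
  bootstrap, the final q the claimed bound, with the same growth constant.\<close>

definition step_error_le :: "nat \<Rightarrow> real \<Rightarrow> real \<Rightarrow> bool" where
  "step_error_le q c1 g \<longleftrightarrow> (\<forall>b a U E. ep_window C A cm r lam \<epsilon> dk \<alpha> Mb (b :: real \<Rightarrow> int ^ 'd \<Rightarrow> complex) \<longrightarrow>
     hs_continuous_on (\<alpha> - 2) {0..1} U \<longrightarrow> (\<forall>\<tau>\<in>{0..1}. hs_le (\<alpha> - 2) (U \<tau>) B) \<longrightarrow>
     (\<forall>\<tau>\<in>{0..1}. \<forall>k. U \<tau> k = stage_map lam \<epsilon> dk a U \<tau> k) \<longrightarrow>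
     hs_le (\<alpha> - 2 * real q) (\<lambda>k. a k - b 0 k) E \<longrightarrow>
     hs_le (\<alpha> - 2 * real q) (\<lambda>k. U 1 k - b 1 k) ((1 + \<epsilon> * dk * c1) * E + \<epsilon> * dk * g))"

definition err_le :: "nat \<Rightarrow> real \<Rightarrow> real \<Rightarrow> nat \<Rightarrow> bool" where
  "err_le q c1 g n \<longleftrightarrow> hs_le (\<alpha> - 2 * real q) (\<lambda>k. fourier_coeff (u n) k - v n k)
     ((1 + \<epsilon> * dk * c1) ^ n * (real n * (\<epsilon> * dk) * g))"

text \<open>The invariant of the bootstrap: the error bound 1 in H^(\<alpha> - 2) keeps the iterate
  in the ball for which the growth rate G of the H^\<alpha>-norm is valid.\<close>

definition stable :: "nat \<Rightarrow> bool" where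
  "stable n \<longleftrightarrow> u n \<in> sobolev_space \<alpha> \<and> hs_le \<alpha> (fourier_coeff (u n)) ((1 + \<epsilon> * dk * G) ^ n * M) \<and>
     hs_le (\<alpha> - 2) (\<lambda>k. fourier_coeff (u n) k - v n k) 1"

text \<open>The number of steps times \<epsilon> dk is at most T, whatever \<epsilon> is; this makes
  the accumulated growth uniform in \<epsilon>.\<close>

lemma growth_le:
  assumes "real n * dk \<le> T / \<epsilon>" "0 \<le> c"
  shows "(1 + \<epsilon> * dk * c) ^ n \<le> exp (c * T)" "real n * (\<epsilon> * dk) \<le> T"
proof -
  show nT: "real n * (\<epsilon> * dk) \<le> T" using assms(1) \<epsilon> by (simp add: pos_le_divide_eq mult_ac)
  have "(1 + \<epsilon> * dk * c) ^ n \<le> exp (\<epsilon> * dk * c) ^ n"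
    using assms(2) eps_dk by (intro power_mono exp_ge_add_one_self) auto
  also have "\<dots> = exp (real n * (\<epsilon> * dk) * c)" by (simp add: exp_of_nat_mult[symmetric] mult_ac)
  also have "\<dots> \<le> exp (c * T)" using mult_right_mono[OF nT assms(2)] by (simp add: mult_ac)
  finally show "(1 + \<epsilon> * dk * c) ^ n \<le> exp (c * T)" .
qed

lemma err_le_final:
  assumes "err_le q c1 g n" "real n * dk \<le> T / \<epsilon>" "0 \<le> c1" "0 \<le> g"
  shows "hs_le (\<alpha> - 2 * real q) (\<lambda>k. fourier_coeff (u n) k - v n k) (exp (c1 * T) * (T * g))"
proof (rule hs_le_weaken[OF assms(1)[unfolded err_le_def]])
  show "(1 + \<epsilon> * dk * c1) ^ n * (real n * (\<epsilon> * dk) * g) \<le> exp (c1 * T) * (T * g)"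
    using growth_le[OF assms(2,3)] assms(4) eps_dk by (intro mult_mono mult_right_mono) auto
qed

lemma err_le_0: "err_le q c1 g 0"
proof -
  have t: "0 \<in> {0..T / \<epsilon>}" using T \<epsilon> by simp
  have wsp: "w 0 \<in> sobolev_space \<alpha>" using sol t by (auto simp: nls_solution_def sobolev_continuous_on_def)
  have "ae_eq (w 0) w0" using sol by (simp add: nls_solution_def)
  then have "fourier_coeff (w 0) k = fourier_coeff w0 k" for k
    by (rule ae_eq_fourier_coeff) (use sobolev_space_measurable[OF wsp] sobolev_space_measurable[OF w0] in auto)
  then show ?thesis by (simp add: err_le_def u_def v_def)
qed

lemma stable_B1: "stable n \<Longrightarrow> real n * dk \<le> T / \<epsilon> \<Longrightarrow> hs_le \<alpha> (fourier_coeff (u n)) B1"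
  unfolding stable_def B1
  by (elim conjE hs_le_weaken) (intro mult_right_mono growth_le G_nonneg M_nonneg)

text \<open>The order of the estimates avoids a circle. The error bound 1 puts the iterate below Mb
  + 1 in H^(\<alpha> - 2); the crude H^\<alpha>-bound on the stages then enters behind \<epsilon> dk
  only, so the stages stay below B in H^(\<alpha> - 2); with B the tame estimate gives the growth in
  H^\<alpha>, and the one-step error estimate applies.\<close>

lemma advance:
  assumes n: "real (Suc n) * dk \<le> T / \<epsilon>" and st: "stable n"
  shows "u (Suc n) \<in> sobolev_space \<alpha>" "hs_le \<alpha> (fourier_coeff (u (Suc n))) ((1 + \<epsilon> * dk * G) ^ Suc n * M)"
    "step_error_le q c1 g \<Longrightarrow> err_le q c1 g n \<Longrightarrow> 0 \<le> c1 \<Longrightarrow> 0 \<le> g \<Longrightarrow> err_le q c1 g (Suc n)"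
proof -
  have n': "real n * dk \<le> T / \<epsilon>" using n dk by (simp add: distrib_right)
  have sp: "u n \<in> sobolev_space \<alpha>" and tm: "hs_le \<alpha> (fourier_coeff (u n)) ((1 + \<epsilon> * dk * G) ^ n * M)"
    and er: "hs_le (\<alpha> - 2) (\<lambda>k. fourier_coeff (u n) k - v n k) 1"
    using st by (auto simp: stable_def)
  obtain U where U: "\<Phi> (u n) \<in> sobolev_space \<alpha>" "fourier_coeff (\<Phi> (u n)) = U 1"
    "hs_continuous_on \<alpha> {0..1} U" "\<And>\<tau>. \<tau> \<in> {0..1} \<Longrightarrow> hs_le \<alpha> (U \<tau>) (cm * B1 + 1)"
    "\<And>\<tau> k. \<tau> \<in> {0..1} \<Longrightarrow> U \<tau> k = stage_map lam \<epsilon> dk (fourier_coeff (u n)) U \<tau> k"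
    by (rule stage_well_posed[OF sp stable_B1[OF st n']]) (rule that)
  have Suc: "u (Suc n) = \<Phi> (u n)" by (simp add: u_def)
  show "u (Suc n) \<in> sobolev_space \<alpha>" unfolding Suc by (rule U(1))
  have dk0: "0 \<le> \<epsilon>" "0 \<le> dk" using \<epsilon> dk by auto
  interpret W: ep_window C A cm r lam \<epsilon> dk \<alpha> Mb "\<lambda>\<sigma>. fourier_coeff (w (real n * dk + \<sigma> * dk))"
    by (rule window[OF n])
  have v: "v n = fourier_coeff (w (real n * dk + 0 * dk))" "v (Suc n) = fourier_coeff (w (real n * dk + 1 * dk))"
    by (simp_all add: v_def algebra_simps)
  have uB: "hs_le (\<alpha> - 2) (fourier_coeff (u n)) (Mb + 1)"
  proof (rule hs_le_subst)
    show "hs_le (\<alpha> - 2) (\<lambda>k. v n k + (fourier_coeff (u n) k - v n k)) (Mb + 1)"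
      unfolding v(1) by (intro hs_le_add W.b_le' er[unfolded v(1)]) simp
  qed simp_all
  have UB: "hs_le (\<alpha> - 2) (U \<tau>) B" if \<tau>: "\<tau> \<in> {0..1}" for \<tau>
  proof -
    have "hs_le (\<alpha> - 2) (stage_map lam \<epsilon> dk (fourier_coeff (u n)) U \<tau>)
      (cm * (Mb + 1) + \<epsilon> * dk * (cm * (tri_const TYPE('d) lam \<alpha> * (cm * B1 + 1) ^ 3)))"
    proof (rule hs_le_stage_map[OF \<tau> uB _ _ dk0])
      show "hs_le (\<alpha> - 2) (cubic lam (U \<sigma>)) (tri_const TYPE('d) lam \<alpha> * (cm * B1 + 1) ^ 3)" if "\<sigma> \<in> {0..1}" for \<sigma>
        by (rule hs_le_mono[OF hs_le_cubic[OF \<alpha>_pos(2,3) U(4)[OF that]]]) auto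
      show "continuous_on {0..1} (\<lambda>\<sigma>. cubic lam (U \<sigma>) k)" for k
        by (rule hs_continuous_onD[OF hs_continuous_on_cubic[OF \<alpha>_pos(2,3) U(3,4)]])
    qed
    then show ?thesis
    proof (rule hs_le_subst)
      show "U \<tau> k = stage_map lam \<epsilon> dk (fourier_coeff (u n)) U \<tau> k" for k by (rule U(5)[OF \<tau>])
      have "\<epsilon> * dk * (cm * (tri_const TYPE('d) lam \<alpha> * (cm * B1 + 1) ^ 3)) \<le> 1"
        using B1_nonneg by (intro order_trans[OF eps_dk_le small(1)]) simp
      then show "cm * (Mb + 1) + \<epsilon> * dk * (cm * (tri_const TYPE('d) lam \<alpha> * (cm * B1 + 1) ^ 3)) \<le> B" using B by simp
    qed
  qed
  have Uc: "hs_continuous_on (\<alpha> - 2) {0..1} U" by (rule hs_continuous_on_mono[OF U(3)]) auto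
  have C1: "cmod (C 1 z) \<le> 1" if "Re z = 0" for z using that by (simp add: C_1)
  have s3: "\<epsilon> * dk * (cm * (\<bar>lam\<bar> * 3 * (2 powr \<alpha>)\<^sup>2 * (sob_const TYPE('d) (\<alpha> - 2) * B)\<^sup>2)) \<le> 1 / 2"
    by (intro order_trans[OF eps_dk_le small(3)]) simp
  have "hs_le \<alpha> (U 1) ((1 + \<epsilon> * dk * G) * ((1 + \<epsilon> * dk * G) ^ n * M))"
    unfolding G
    by (rule stage_tame[OF \<alpha>_pos(1) \<alpha>2 _ U(3,4) UB U(5) tm[unfolded G] dk0 refl s3 C1]) auto
  then show "hs_le \<alpha> (fourier_coeff (u (Suc n))) ((1 + \<epsilon> * dk * G) ^ Suc n * M)"
    unfolding Suc U(2) by (simp add: mult.assoc)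
  assume step: "step_error_le q c1 g" and err: "err_le q c1 g n" and c1: "0 \<le> c1" and g: "0 \<le> g"
  let ?h = "\<epsilon> * dk"
  let ?E = "(1 + ?h * c1) ^ n * (real n * ?h * g)"
  have "hs_le (\<alpha> - 2 * real q) (\<lambda>k. U 1 k - fourier_coeff (w (real n * dk + 1 * dk)) k) ((1 + ?h * c1) * ?E + ?h * g)"
    using err step[unfolded step_error_le_def, rule_format, OF W.ep_window_axioms Uc UB U(5)]
    unfolding err_le_def v(1) by blast
  then show "err_le q c1 g (Suc n)"
    unfolding err_le_def Suc U(2) v(2)
  proof (rule hs_le_weaken)
    \<comment> \<open>Discrete Gronwall: the new contribution is enlarged to carry the same power as
      the old ones, so that all Suc n contributions are equal.\<close>
    have "1 * (?h * g) \<le> (1 + ?h * c1) ^ Suc n * (?h * g)"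
      using eps_dk c1 g by (intro mult_right_mono one_le_power) auto
    then show "(1 + ?h * c1) * ?E + ?h * g \<le> (1 + ?h * c1) ^ Suc n * (real (Suc n) * ?h * g)"
      by (simp add: distrib_left distrib_right mult_ac)
  qed
qed

text \<open>The estimate with q = 1 returns an error of at most 1, by the smallness hypothesis, and
  that is the assumption on which the next step rests.\<close>

lemma stable_all:
  assumes boot: "step_error_le 1 c1 g" "0 \<le> c1" "0 \<le> g" "exp (c1 * T) * (T * g) \<le> 1"
    and n: "real n * dk \<le> T / \<epsilon>"
  shows "stable n"
proof -
  have init: "hs_le (\<alpha> - 2) (\<lambda>k. fourier_coeff (u n) k - v n k) 1"
    if "err_le 1 c1 g n" "real n * dk \<le> T / \<epsilon>" for n
    using hs_le_weaken[OF err_le_final[OF that boot(2,3)] boot(4)] by simp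
  have "stable n \<and> err_le 1 c1 g n" using n
  proof (induction n)
    case 0
    have "u 0 \<in> sobolev_space \<alpha>" "hs_le \<alpha> (fourier_coeff (u 0)) M"
      using w0 hs_le_weaken[OF sobolev_space_hs_le[OF w0] M] by (simp_all add: u_def)
    then show ?case using init[OF err_le_0] 0 err_le_0 by (simp add: stable_def)
  next
    case (Suc n)
    have n': "real n * dk \<le> T / \<epsilon>" using Suc.prems dk by (simp add: distrib_right)
    note a = advance[OF Suc.prems conjunct1[OF Suc.IH[OF n']]]
    have e: "err_le 1 c1 g (Suc n)" by (rule a(3)[OF boot(1) conjunct2[OF Suc.IH[OF n']] boot(2,3)])
    show ?case unfolding stable_def using a(1,2) init[OF e Suc.prems] e by blast
  qed
  then show ?thesis ..
qed

text \<open>Stability is already known at every step, so a second induction with the final q needs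
  no further smallness.\<close>

lemma global_error:
  assumes boot: "step_error_le 1 c1 g" "0 \<le> c1" "0 \<le> g" "exp (c1 * T) * (T * g) \<le> 1"
    and step: "step_error_le q c1 g'" "0 \<le> g'"
    and n: "real n * dk \<le> T / \<epsilon>"
  shows "u n \<in> sobolev_space \<alpha>" "unique_stage_solution C A lam \<epsilon> dk \<alpha> R (u n)"
    "sobolev_norm (\<alpha> - 2 * real q) (\<lambda>x. u n x - w (real n * dk) x) \<le> exp (c1 * T) * (T * g')"
proof -
  note st = stable_all[OF boot n]
  show sp: "u n \<in> sobolev_space \<alpha>" using st by (simp add: stable_def)
  show "unique_stage_solution C A lam \<epsilon> dk \<alpha> R (u n)"
    by (rule stage_well_posed[OF sp stable_B1[OF st n]])
  have "err_le q c1 g' n" using n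
  proof (induction n)
    case 0
    show ?case by (rule err_le_0)
  next
    case (Suc n)
    have n': "real n * dk \<le> T / \<epsilon>" using Suc.prems dk by (simp add: distrib_right)
    show ?case by (rule advance(3)[OF Suc.prems stable_all[OF boot n'] step(1) Suc.IH[OF n'] boot(2) step(2)])
  qed
  note e = err_le_final[OF this n boot(2) step(2)]
  have "w (real n * dk) \<in> sobolev_space \<alpha>"
    using sol n dk by (auto simp: nls_solution_def sobolev_continuous_on_def)
  then have "fourier_coeff (\<lambda>x. u n x - w (real n * dk) x) k = fourier_coeff (u n) k - v n k" for k
    unfolding v_def using sp by (intro fourier_coeff_diff sobolev_space_integrable)
  with e show "sobolev_norm (\<alpha> - 2 * real q) (\<lambda>x. u n x - w (real n * dk) x) \<le> exp (c1 * T) * (T * g')"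
    by (intro sobolev_norm_le) (elim hs_le_subst, auto)
qed

end

section \<open>Choice of the step size threshold and of the uniform constants\<close>

lemma ep_error_bound_mono:
  assumes "ep_error_bound C A lam \<alpha> T T0 R E s bnd w0 w" "0 < T0"
    and "\<And>\<epsilon> dk. \<epsilon> \<in> E \<Longrightarrow> 0 < dk \<Longrightarrow> bnd \<epsilon> dk \<le> bnd' \<epsilon> dk"
  shows "ep_error_bound C A lam \<alpha> T T0 R E s bnd' w0 w"
proof -
  obtain N0 :: nat where N0: "N0 > 0" "\<And>\<epsilon> N n. \<epsilon> \<in> E \<Longrightarrow> N0 \<le> N \<Longrightarrow> real n * (T0 / real N) \<le> T / \<epsilon> \<Longrightarrow>
       (ep_step C A lam \<epsilon> (T0 / real N) \<alpha> R ^^ n) w0 \<in> sobolev_space \<alpha> \<and>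
       unique_stage_solution C A lam \<epsilon> (T0 / real N) \<alpha> R ((ep_step C A lam \<epsilon> (T0 / real N) \<alpha> R ^^ n) w0) \<and>
       sobolev_norm s (\<lambda>x. (ep_step C A lam \<epsilon> (T0 / real N) \<alpha> R ^^ n) w0 x - w \<epsilon> (real n * (T0 / real N)) x) \<le> bnd \<epsilon> (T0 / real N)"
    using assms(1) unfolding ep_error_bound_def Let_def by blast
  have "bnd \<epsilon> (T0 / real N) \<le> bnd' \<epsilon> (T0 / real N)" if "\<epsilon> \<in> E" "N0 \<le> N" for \<epsilon> N
    using that N0(1) assms(2) by (intro assms(3)) auto
  then show ?thesis
    unfolding ep_error_bound_def Let_def using N0 order_trans by (intro exI[of _ N0]) blast
qed

lemma nls_family_subset: "nls_family lam \<alpha> T K E w0 w \<Longrightarrow> E' \<subseteq> E \<Longrightarrow> nls_family lam \<alpha> T K E' w0 w"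
  unfolding nls_family_def by blast

context ep_method
begin

lemma ep_error_bound_global:
  fixes w0 :: "real ^ 'd::finite \<Rightarrow> complex"
  assumes r1: "1 \<le> r" and \<alpha>2: "\<alpha> - 2 > real CARD('d) / 2" and T: "0 < T" and T0: "0 < T0" and E: "E \<subseteq> {0<..1}"
    and fam: "nls_family lam \<alpha> T K E w0 w" and M: "sobolev_norm \<alpha> w0 = M"
    and B: "cm * (K * M + 1) + 1 \<le> B"
    and G: "G = cm * (\<bar>lam\<bar> * 3 * (2 powr \<alpha>)\<^sup>2 * (sob_const TYPE('d) (\<alpha> - 2) * B)\<^sup>2) * (2 * cm)"
    and R: "cm * (exp (G * T) * M) + 1 \<le> R"
    and c1: "c1 = 6 * cm\<^sup>2 * tri_const TYPE('d) lam (\<alpha> - 2) * B\<^sup>2"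
    and g: "\<And>\<epsilon> dk. 0 \<le> \<epsilon> \<Longrightarrow> 0 \<le> dk \<Longrightarrow> 0 \<le> g \<epsilon> dk"
    and step: "\<And>\<epsilon> dk b a U e. \<epsilon> \<in> E \<Longrightarrow> ep_window C A cm r lam \<epsilon> dk \<alpha> (K * M) (b :: real \<Rightarrow> int ^ 'd \<Rightarrow> complex) \<Longrightarrow>
      hs_continuous_on (\<alpha> - 2) {0..1} U \<Longrightarrow> (\<And>\<tau>. \<tau> \<in> {0..1} \<Longrightarrow> hs_le (\<alpha> - 2) (U \<tau>) B) \<Longrightarrow>
      (\<And>\<tau> k. \<tau> \<in> {0..1} \<Longrightarrow> U \<tau> k = stage_map lam \<epsilon> dk a U \<tau> k) \<Longrightarrow>
      hs_le (\<alpha> - 2 * real q) (\<lambda>k. a k - b 0 k) e \<Longrightarrow>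
      \<epsilon> * dk * (cm * (3 * tri_const TYPE('d) lam (\<alpha> - 2) * B\<^sup>2)) \<le> 1 / 2 \<Longrightarrow>
      hs_le (\<alpha> - 2 * real q) (\<lambda>k. U 1 k - b 1 k) ((1 + \<epsilon> * dk * c1) * e + \<epsilon> * dk * g \<epsilon> dk)"
  shows "ep_error_bound C A lam \<alpha> T T0 R E (\<alpha> - 2 * real q) (\<lambda>\<epsilon> dk. exp (c1 * T) * (T * g \<epsilon> dk)) w0 w"
proof -
  have M0: "0 \<le> M" using sobolev_norm_nonneg M by metis
  define B1 where "B1 = exp (G * T) * M"
  have B1: "0 \<le> B1" using M0 by (simp add: B1_def)
  define TC where "TC = tri_const TYPE('d) lam (\<alpha> - 2)"
  define cg where "cg = const_g TYPE('d) lam \<alpha> (K * M)"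
  define c2 where "c2 = \<bar>6 * cm * TC * B\<^sup>2 * (cm * (K * M) + cm * const_G TYPE('d) lam \<alpha> (K * M) + cm * cg + cg) + cm * cg\<bar>"
  have c1_nonneg: "0 \<le> c1" by (simp add: c1)
  define x1 where "x1 = cm * (tri_const TYPE('d) lam \<alpha> * (cm * B1 + 1) ^ 3)"
  define x2 where "x2 = cm * (3 * tri_const TYPE('d) lam \<alpha> * R\<^sup>2)"
  define x3 where "x3 = cm * (\<bar>lam\<bar> * 3 * (2 powr \<alpha>)\<^sup>2 * (sob_const TYPE('d) (\<alpha> - 2) * B)\<^sup>2)"
  define x4 where "x4 = cm * (3 * TC * B\<^sup>2)"
  define x5 where "x5 = exp (c1 * T) * (T * c2)"
  have x: "0 \<le> x1" "0 \<le> x2" "0 \<le> x3" "0 \<le> x4" "0 \<le> x5"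
    using B1 T by (simp_all add: x1_def x2_def x3_def x4_def x5_def TC_def c2_def)
  \<comment> \<open>X collects everything that must be small after multiplication by dk, doubled
    where the target is 1/2; \<open>x5\<close> is doubled because dk + \<epsilon> dk^2 \<le> 2 dk.
    The single condition dk X \<le> 1 then suffices, and it does not involve \<epsilon>.\<close>
  define X where "X = 1 + x1 + 2 * x2 + 2 * x3 + 2 * x4 + 2 * x5"
  have X: "1 \<le> X" using x by (simp add: X_def)
  define N0 where "N0 = nat \<lceil>T0 * X\<rceil> + 1"
  have main: "(ep_step C A lam \<epsilon> dk \<alpha> R ^^ n) w0 \<in> sobolev_space \<alpha> \<and>
      unique_stage_solution C A lam \<epsilon> dk \<alpha> R ((ep_step C A lam \<epsilon> dk \<alpha> R ^^ n) w0) \<and>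
      sobolev_norm (\<alpha> - 2 * real q) (\<lambda>x. (ep_step C A lam \<epsilon> dk \<alpha> R ^^ n) w0 x - w \<epsilon> (real n * dk) x)
        \<le> exp (c1 * T) * (T * g \<epsilon> dk)"
    if \<epsilon>E: "\<epsilon> \<in> E" and N: "N0 \<le> N" and dk_def: "dk = T0 / real N" and n: "real n * dk \<le> T / \<epsilon>" for \<epsilon> N dk n
  proof -
    have \<epsilon>: "0 < \<epsilon>" "\<epsilon> \<le> 1" using E \<epsilon>E by auto
    have N': "0 < real N" "T0 * X \<le> real N"
    proof -
      have "T0 * X \<le> real (nat \<lceil>T0 * X\<rceil>)" by (rule real_nat_ceiling_ge)
      then show "T0 * X \<le> real N" "0 < real N" using N by (auto simp: N0_def)
    qed
    have dk: "0 < dk" using T0 N' by (simp add: dk_def)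
    have dkX: "dk * X \<le> 1" using N' by (simp add: dk_def pos_divide_le_eq)
    have part: "dk * y \<le> 1" if "y \<le> X" for y
      using mult_left_mono[OF that, of dk] dk dkX by linarith
    have half: "dk * y \<le> 1 / 2" if "2 * y \<le> X" for y
      using part[OF that] by simp
    have dk1: "dk \<le> 1" using part[OF X] by simp
    interpret ep_run C A cm r lam \<epsilon> dk \<alpha> T "K * M" M R B G B1 w0 "w \<epsilon>"
    proof unfold_locales
      show "nls_solution lam \<alpha> T \<epsilon> w0 (w \<epsilon>)" "w0 \<in> sobolev_space \<alpha>"
        using fam \<epsilon>E by (auto simp: nls_family_def)
      show "sobolev_norm \<alpha> (w \<epsilon> \<kappa>) \<le> K * M" if "\<kappa> \<in> {0..T / \<epsilon>}" for \<kappa>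
        using fam \<epsilon>E that M by (auto simp: nls_family_def)
      show "dk * (cm * (tri_const TYPE('d) lam \<alpha> * (cm * B1 + 1) ^ 3)) \<le> 1"
        unfolding x1_def[symmetric] by (rule part) (use x in \<open>simp add: X_def\<close>)
      show "dk * (cm * (3 * tri_const TYPE('d) lam \<alpha> * R\<^sup>2)) \<le> 1 / 2"
        unfolding x2_def[symmetric] by (rule half) (use x in \<open>simp add: X_def\<close>)
      show "dk * (cm * (\<bar>lam\<bar> * 3 * (2 powr \<alpha>)\<^sup>2 * (sob_const TYPE('d) (\<alpha> - 2) * B)\<^sup>2)) \<le> 1 / 2"
        unfolding x3_def[symmetric] by (rule half) (use x in \<open>simp add: X_def\<close>)
      show "dk * (cm * (3 * tri_const TYPE('d) lam (\<alpha> - 2) * B\<^sup>2)) \<le> 1 / 2"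
        unfolding x4_def[unfolded TC_def, symmetric] by (rule half) (use x in \<open>simp add: X_def\<close>)
    qed (use r1 \<alpha>2 \<epsilon> dk dk1 T M B G R in \<open>simp_all add: B1_def\<close>)
    have sm: "\<epsilon> * dk * (cm * (3 * tri_const TYPE('d) lam (\<alpha> - 2) * B\<^sup>2)) \<le> 1 / 2"
      by (intro order_trans[OF eps_dk_le small(4)]) simp
    have boot: "step_error_le 1 c1 (c2 * (dk ^ 1 + \<epsilon> * dk ^ 2))"
      unfolding step_error_le_def
    proof (intro allI impI)
      fix b :: "real \<Rightarrow> int ^ 'd \<Rightarrow> complex" and a U e
      assume win: "ep_window C A cm r lam \<epsilon> dk \<alpha> (K * M) b"
        and U: "hs_continuous_on (\<alpha> - 2) {0..1} U" "\<forall>\<tau>\<in>{0..1}. hs_le (\<alpha> - 2) (U \<tau>) B"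
          "\<forall>\<tau>\<in>{0..1}. \<forall>k. U \<tau> k = stage_map lam \<epsilon> dk a U \<tau> k"
        and ab: "hs_le (\<alpha> - 2 * real 1) (\<lambda>k. a k - b 0 k) e"
      interpret W: ep_window C A cm r lam \<epsilon> dk \<alpha> "K * M" b by (rule win)
      have e: "0 \<le> dk ^ 1 + \<epsilon> * dk ^ 2" using \<epsilon> dk by simp
      have "hs_le (\<alpha> - 2 * real 1) (\<lambda>k. U 1 k - b 1 k)
        ((1 + \<epsilon> * dk * (6 * cm\<^sup>2 * W.TC * B\<^sup>2)) * e
         + \<epsilon> * dk * ((6 * cm * W.TC * B\<^sup>2 * (cm * (K * M) + cm * W.cG + cm * W.cg + W.cg) + cm * W.cg) * (dk ^ 1 + \<epsilon> * dk ^ 2)))"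
        by (rule W.step_error_order2[OF _ _ _ U(1) _ Mb_le_B _ ab]) (use U(2,3) sm \<alpha>_pos in \<open>simp_all add: W.TC_def\<close>)
      then show "hs_le (\<alpha> - 2 * real 1) (\<lambda>k. U 1 k - b 1 k) ((1 + \<epsilon> * dk * c1) * e + \<epsilon> * dk * (c2 * (dk ^ 1 + \<epsilon> * dk ^ 2)))"
        unfolding W.TC_def W.cG_def W.cg_def TC_def[symmetric] cg_def[symmetric] c1 c2_def
        by (elim hs_le_weaken) (intro add_mono order_refl mult_left_mono mult_right_mono abs_ge_self e eps_dk)
    qed
    have "dk ^ 1 + \<epsilon> * dk ^ 2 \<le> 2 * dk"
    proof -
      have "\<epsilon> * dk * dk \<le> 1 * dk" using \<epsilon> dk dk1 by (intro mult_right_mono mult_le_one) auto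
      then show ?thesis by (simp add: power2_eq_square mult.assoc)
    qed
    then have "exp (c1 * T) * (T * (c2 * (dk ^ 1 + \<epsilon> * dk ^ 2))) \<le> exp (c1 * T) * (T * (c2 * (2 * dk)))"
      using T by (intro mult_left_mono) (auto simp: c2_def)
    also have "\<dots> = dk * (2 * x5)" by (simp add: x5_def mult_ac)
    also have "\<dots> \<le> 1" by (rule part) (use x in \<open>simp add: X_def\<close>)
    finally have small_boot: "exp (c1 * T) * (T * (c2 * (dk ^ 1 + \<epsilon> * dk ^ 2))) \<le> 1" .
    have "step_error_le q c1 (g \<epsilon> dk)"
      unfolding step_error_le_def using step[OF \<epsilon>E] sm by blast
    moreover have "0 \<le> g \<epsilon> dk" "0 \<le> c2 * (dk ^ 1 + \<epsilon> * dk ^ 2)" using \<epsilon> dk by (auto intro!: g simp: c2_def)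
    ultimately show ?thesis
      using global_error[OF boot c1_nonneg _ small_boot _ _ n] by (simp add: u_def \<Phi>_def)
  qed
  show ?thesis
    unfolding ep_error_bound_def Let_def
  proof (intro exI conjI ballI allI impI)
    show "0 < N0" by (simp add: N0_def)
  qed (use main in blast)+
qed

text \<open>The factor 2 in the hypothesis on \<open>bnd\<close> allows two terms of the same size
  to be merged; the added 1 makes the final constant positive even if \<open>c2\<close> is
  0.\<close>

lemma convergence_from_step:
  fixes bnd :: "real \<Rightarrow> real \<Rightarrow> real" and w0 :: "real ^ 'd::finite \<Rightarrow> complex"
  assumes r1: "1 \<le> r" and \<alpha>2: "\<alpha> - 2 > real CARD('d) / 2" and T: "0 < T" and T0: "0 < T0" and E: "E \<subseteq> {0<..1}"
    and fam: "nls_family lam \<alpha> T K E w0 w" and M: "sobolev_norm \<alpha> w0 = M"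
    and B: "cm * (K * M + 1) + 1 \<le> B"
    and G: "G = cm * (\<bar>lam\<bar> * 3 * (2 powr \<alpha>)\<^sup>2 * (sob_const TYPE('d) (\<alpha> - 2) * B)\<^sup>2) * (2 * cm)"
    and R: "cm * (exp (G * T) * M) + 1 \<le> R"
    and c1: "c1 = 6 * cm\<^sup>2 * tri_const TYPE('d) lam (\<alpha> - 2) * B\<^sup>2"
    and bnd: "\<And>\<epsilon> dk. \<epsilon> \<in> E \<Longrightarrow> 0 < dk \<Longrightarrow> dk ^ q + \<epsilon> * dk ^ p \<le> 2 * bnd \<epsilon> dk"
    and step: "\<And>\<epsilon> dk b a U e. \<epsilon> \<in> E \<Longrightarrow> ep_window C A cm r lam \<epsilon> dk \<alpha> (K * M) (b :: real \<Rightarrow> int ^ 'd \<Rightarrow> complex) \<Longrightarrow>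
      hs_continuous_on (\<alpha> - 2) {0..1} U \<Longrightarrow> (\<And>\<tau>. \<tau> \<in> {0..1} \<Longrightarrow> hs_le (\<alpha> - 2) (U \<tau>) B) \<Longrightarrow>
      (\<And>\<tau> k. \<tau> \<in> {0..1} \<Longrightarrow> U \<tau> k = stage_map lam \<epsilon> dk a U \<tau> k) \<Longrightarrow>
      hs_le (\<alpha> - 2 * real q) (\<lambda>k. a k - b 0 k) e \<Longrightarrow>
      \<epsilon> * dk * (cm * (3 * tri_const TYPE('d) lam (\<alpha> - 2) * B\<^sup>2)) \<le> 1 / 2 \<Longrightarrow>
      hs_le (\<alpha> - 2 * real q) (\<lambda>k. U 1 k - b 1 k) ((1 + \<epsilon> * dk * c1) * e + \<epsilon> * dk * (c2 * (dk ^ q + \<epsilon> * dk ^ p)))"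
  shows "ep_error_bound C A lam \<alpha> T T0 R E (\<alpha> - 2 * real q)
    (\<lambda>\<epsilon> dk. (exp (c1 * T) * (T * \<bar>c2\<bar>) * 2 + 1) * bnd \<epsilon> dk) w0 w"
proof -
  have "ep_error_bound C A lam \<alpha> T T0 R E (\<alpha> - 2 * real q) (\<lambda>\<epsilon> dk. exp (c1 * T) * (T * (\<bar>c2\<bar> * (dk ^ q + \<epsilon> * dk ^ p)))) w0 w"
  proof (rule ep_error_bound_global[OF r1 \<alpha>2 T T0 E fam M B G R c1])
    fix \<epsilon> dk and b :: "real \<Rightarrow> int ^ 'd \<Rightarrow> complex" and a U e
    assume \<epsilon>: "\<epsilon> \<in> E" and win: "ep_window C A cm r lam \<epsilon> dk \<alpha> (K * M) b" and U: "hs_continuous_on (\<alpha> - 2) {0..1} U"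
      "\<And>\<tau>. \<tau> \<in> {0..1} \<Longrightarrow> hs_le (\<alpha> - 2) (U \<tau>) B" "\<And>\<tau> k. \<tau> \<in> {0..1} \<Longrightarrow> U \<tau> k = stage_map lam \<epsilon> dk a U \<tau> k"
      and ab: "hs_le (\<alpha> - 2 * real q) (\<lambda>k. a k - b 0 k) e"
      and sm: "\<epsilon> * dk * (cm * (3 * tri_const TYPE('d) lam (\<alpha> - 2) * B\<^sup>2)) \<le> 1 / 2"
    interpret W: ep_window C A cm r lam \<epsilon> dk \<alpha> "K * M" b by (rule win)
    have "hs_le (\<alpha> - 2 * real q) (\<lambda>k. U 1 k - b 1 k) ((1 + \<epsilon> * dk * c1) * e + \<epsilon> * dk * (c2 * (dk ^ q + \<epsilon> * dk ^ p)))"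
      by (rule step[OF \<epsilon> win U ab sm])
    then show "hs_le (\<alpha> - 2 * real q) (\<lambda>k. U 1 k - b 1 k) ((1 + \<epsilon> * dk * c1) * e + \<epsilon> * dk * (\<bar>c2\<bar> * (dk ^ q + \<epsilon> * dk ^ p)))"
      using W.dk W.\<epsilon> by (elim hs_le_weaken) (intro add_mono order_refl mult_left_mono mult_right_mono abs_ge_self W.eps_dk, simp)
  qed (simp add: abs_ge_zero)
  then show ?thesis
  proof (rule ep_error_bound_mono[OF _ T0])
    fix \<epsilon> dk :: real assume \<epsilon>: "\<epsilon> \<in> E" and dk: "0 < dk"
    note le = bnd[OF \<epsilon> dk]
    have "0 < dk ^ q + \<epsilon> * dk ^ p" using E \<epsilon> dk by (intro add_pos_pos) auto
    with le have "0 \<le> bnd \<epsilon> dk" by simp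
    have "exp (c1 * T) * (T * (\<bar>c2\<bar> * (dk ^ q + \<epsilon> * dk ^ p))) \<le> exp (c1 * T) * (T * (\<bar>c2\<bar> * (2 * bnd \<epsilon> dk)))"
      using T le by (intro mult_left_mono) auto
    also have "\<dots> \<le> (exp (c1 * T) * (T * \<bar>c2\<bar>) * 2 + 1) * bnd \<epsilon> dk"
      using \<open>0 \<le> bnd \<epsilon> dk\<close> by (simp add: algebra_simps)
    finally show "exp (c1 * T) * (T * (\<bar>c2\<bar> * (dk ^ q + \<epsilon> * dk ^ p))) \<le> (exp (c1 * T) * (T * \<bar>c2\<bar>) * 2 + 1) * bnd \<epsilon> dk" .
  qed
qed

text \<open>The constant and the radius are fixed before w0, E, q and \<open>bnd\<close>: they
  depend on the initial value through M only, and the two norms claimed for one method can share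
  them.\<close>

lemma convergence_order2:
  assumes r1: "1 \<le> r" and \<alpha>2: "\<alpha> - 2 > real CARD('d::finite) / 2" and T: "0 < T" and T0: "0 < T0"
  shows "\<exists>c>0. \<exists>R0. \<forall>(w0 :: real ^ 'd \<Rightarrow> complex) w E q bnd R. E \<subseteq> {0<..1} \<longrightarrow> nls_family lam \<alpha> T K E w0 w \<longrightarrow>
    sobolev_norm \<alpha> w0 = M \<longrightarrow> 1 \<le> q \<longrightarrow> q \<le> Suc r \<longrightarrow> 0 \<le> \<alpha> - 2 * real q \<longrightarrow> R0 \<le> R \<longrightarrow>
    (\<forall>\<epsilon>\<in>E. \<forall>dk>0. dk ^ q + \<epsilon> * dk ^ 2 \<le> 2 * bnd \<epsilon> dk) \<longrightarrow>
    ep_error_bound C A lam \<alpha> T T0 R E (\<alpha> - 2 * real q) (\<lambda>\<epsilon> dk. c * bnd \<epsilon> dk) w0 w"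
proof -
  define Mb where "Mb = K * M"
  \<comment> \<open>The maximum gives Mb \<le> B without knowing the sign of K M.\<close>
  define B where "B = max (cm * (Mb + 1) + 1) Mb"
  define G where "G = cm * (\<bar>lam\<bar> * 3 * (2 powr \<alpha>)\<^sup>2 * (sob_const TYPE('d) (\<alpha> - 2) * B)\<^sup>2) * (2 * cm)"
  \<comment> \<open>Constants of the locale taken outside of it: they depend on parameters only, so
    they can be fixed before a solution is given.\<close>
  define TC where "TC = nls_window.TC TYPE('d) lam \<alpha>"
  define c2 where "c2 = 6 * cm * TC * B\<^sup>2 * (cm * Mb + cm * nls_window.cG TYPE('d) lam \<alpha> Mb + cm * nls_window.cg TYPE('d) lam \<alpha> Mb
     + nls_window.cg TYPE('d) lam \<alpha> Mb) + cm * nls_window.cg TYPE('d) lam \<alpha> Mb"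
  define c1 where "c1 = 6 * cm\<^sup>2 * tri_const TYPE('d) lam (\<alpha> - 2) * B\<^sup>2"
  have c: "0 < exp (c1 * T) * (T * \<bar>c2\<bar>) * 2 + 1" using T by (auto intro!: add_nonneg_pos)
  show ?thesis
  proof (rule exI, rule conjI[OF c], rule exI[of _ "cm * (exp (G * T) * M) + 1"], intro allI impI)
    fix w0 :: "real ^ 'd \<Rightarrow> complex" and w E q bnd R
    assume E: "E \<subseteq> {0<..1}" and fam: "nls_family lam \<alpha> T K E w0 w" and M: "sobolev_norm \<alpha> w0 = M"
      and q: "1 \<le> q" "q \<le> Suc r" "0 \<le> \<alpha> - 2 * real q" and R: "cm * (exp (G * T) * M) + 1 \<le> R"
      and bnd: "\<forall>\<epsilon>\<in>E. \<forall>dk>0. dk ^ q + \<epsilon> * dk ^ 2 \<le> 2 * bnd \<epsilon> dk"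
    show "ep_error_bound C A lam \<alpha> T T0 R E (\<alpha> - 2 * real q) (\<lambda>\<epsilon> dk. (exp (c1 * T) * (T * \<bar>c2\<bar>) * 2 + 1) * bnd \<epsilon> dk) w0 w"
    proof (rule convergence_from_step[OF r1 \<alpha>2 T T0 E fam M _ G_def R c1_def bnd[rule_format]])
      show "cm * (K * M + 1) + 1 \<le> B" by (simp add: B_def Mb_def)
      fix \<epsilon> dk and b :: "real \<Rightarrow> int ^ 'd \<Rightarrow> complex" and a U e
      assume win: "ep_window C A cm r lam \<epsilon> dk \<alpha> (K * M) b" and U: "hs_continuous_on (\<alpha> - 2) {0..1} U"
        "\<And>\<tau>. \<tau> \<in> {0..1} \<Longrightarrow> hs_le (\<alpha> - 2) (U \<tau>) B" "\<And>\<tau> k. \<tau> \<in> {0..1} \<Longrightarrow> U \<tau> k = stage_map lam \<epsilon> dk a U \<tau> k"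
        and ab: "hs_le (\<alpha> - 2 * real q) (\<lambda>k. a k - b 0 k) e"
        and sm: "\<epsilon> * dk * (cm * (3 * tri_const TYPE('d) lam (\<alpha> - 2) * B\<^sup>2)) \<le> 1 / 2"
      interpret W: ep_window C A cm r lam \<epsilon> dk \<alpha> Mb b using win by (simp only: Mb_def)
      have "Mb \<le> B" by (simp add: B_def)
      show "hs_le (\<alpha> - 2 * real q) (\<lambda>k. U 1 k - b 1 k) ((1 + \<epsilon> * dk * c1) * e + \<epsilon> * dk * (c2 * (dk ^ q + \<epsilon> * dk ^ 2)))"
        unfolding c1_def W.TC_def[symmetric] TC_def c2_def
        by (rule W.step_error_order2[OF q U(1,2) \<open>Mb \<le> B\<close> U(3) ab sm[folded W.TC_def]])
    qed
  qed
qed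

end

lemma (in ep_method3) convergence_order3:
  assumes r2: "2 \<le> r" and \<alpha>2: "\<alpha> - 2 > real CARD('d::finite) / 2" and \<alpha>4: "0 \<le> \<alpha> - 4" and T: "0 < T" and T0: "0 < T0"
  shows "\<exists>c>0. \<exists>R0. \<forall>(w0 :: real ^ 'd \<Rightarrow> complex) w E q bnd R. E \<subseteq> {0<..1} \<longrightarrow> nls_family lam \<alpha> T K E w0 w \<longrightarrow>
    sobolev_norm \<alpha> w0 = M \<longrightarrow> 2 \<le> q \<longrightarrow> q \<le> Suc r \<longrightarrow> 0 \<le> \<alpha> - 2 * real q \<longrightarrow> R0 \<le> R \<longrightarrow>
    (\<forall>\<epsilon>\<in>E. \<forall>dk>0. dk ^ q + \<epsilon> * dk ^ 3 \<le> 2 * bnd \<epsilon> dk) \<longrightarrow>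
    ep_error_bound C A lam \<alpha> T T0 R E (\<alpha> - 2 * real q) (\<lambda>\<epsilon> dk. c * bnd \<epsilon> dk) w0 w"
proof -
  have r1: "1 \<le> r" using r2 by simp
  define Mb where "Mb = K * M"
  define cg where "cg = nls_window.cg TYPE('d) lam \<alpha> Mb"
  \<comment> \<open>The ball must now contain the shifted curve \<open>V\<close> as well, whence the
    summand cm cg.\<close>
  define B where "B = max (cm * (Mb + 1) + 1) (Mb + cm * cg)"
  define G where "G = cm * (\<bar>lam\<bar> * 3 * (2 powr \<alpha>)\<^sup>2 * (sob_const TYPE('d) (\<alpha> - 2) * B)\<^sup>2) * (2 * cm)"
  define TC where "TC = nls_window.TC TYPE('d) lam \<alpha>"
  define c2 where "c2 = 6 * cm * TC * B\<^sup>2 * (ep_window3.K3 TYPE('d) cm lam \<alpha> Mb + cm * ep_window3.cF TYPE('d) cm lam \<alpha> Mb B)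
    + (cm * cg + ep_window3.c6 TYPE('d) cm lam \<alpha> Mb B)"
  define c1 where "c1 = 6 * cm\<^sup>2 * tri_const TYPE('d) lam (\<alpha> - 2) * B\<^sup>2"
  have c: "0 < exp (c1 * T) * (T * \<bar>c2\<bar>) * 2 + 1" using T by (auto intro!: add_nonneg_pos)
  show ?thesis
  proof (rule exI, rule conjI[OF c], rule exI[of _ "cm * (exp (G * T) * M) + 1"], intro allI impI)
    fix w0 :: "real ^ 'd \<Rightarrow> complex" and w E q bnd R
    assume E: "E \<subseteq> {0<..1}" and fam: "nls_family lam \<alpha> T K E w0 w" and M: "sobolev_norm \<alpha> w0 = M"
      and q: "2 \<le> q" "q \<le> Suc r" "0 \<le> \<alpha> - 2 * real q" and R: "cm * (exp (G * T) * M) + 1 \<le> R"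
      and bnd: "\<forall>\<epsilon>\<in>E. \<forall>dk>0. dk ^ q + \<epsilon> * dk ^ 3 \<le> 2 * bnd \<epsilon> dk"
    show "ep_error_bound C A lam \<alpha> T T0 R E (\<alpha> - 2 * real q) (\<lambda>\<epsilon> dk. (exp (c1 * T) * (T * \<bar>c2\<bar>) * 2 + 1) * bnd \<epsilon> dk) w0 w"
    proof (rule convergence_from_step[OF r1 \<alpha>2 T T0 E fam M _ G_def R c1_def bnd[rule_format]])
      show "cm * (K * M + 1) + 1 \<le> B" by (simp add: B_def Mb_def)
      fix \<epsilon> dk and b :: "real \<Rightarrow> int ^ 'd \<Rightarrow> complex" and a U e
      assume win: "ep_window C A cm r lam \<epsilon> dk \<alpha> (K * M) b" and U: "hs_continuous_on (\<alpha> - 2) {0..1} U"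
        "\<And>\<tau>. \<tau> \<in> {0..1} \<Longrightarrow> hs_le (\<alpha> - 2) (U \<tau>) B" "\<And>\<tau> k. \<tau> \<in> {0..1} \<Longrightarrow> U \<tau> k = stage_map lam \<epsilon> dk a U \<tau> k"
        and ab: "hs_le (\<alpha> - 2 * real q) (\<lambda>k. a k - b 0 k) e"
        and sm: "\<epsilon> * dk * (cm * (3 * tri_const TYPE('d) lam (\<alpha> - 2) * B\<^sup>2)) \<le> 1 / 2"
      interpret W': ep_window C A cm r lam \<epsilon> dk \<alpha> Mb b using win by (simp only: Mb_def)
      interpret W: ep_window3 C A cm r lam \<epsilon> dk \<alpha> Mb b P by unfold_locales (fact r2 \<alpha>4)+
      have "Mb + cm * cg \<le> B" by (simp add: B_def)
      then show "hs_le (\<alpha> - 2 * real q) (\<lambda>k. U 1 k - b 1 k) ((1 + \<epsilon> * dk * c1) * e + \<epsilon> * dk * (c2 * (dk ^ q + \<epsilon> * dk ^ 3)))"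
        unfolding c1_def W'.TC_def[symmetric] TC_def cg_def c2_def
        by (rule W.step_error_order3[OF _ q U ab sm[folded W'.TC_def]])
    qed
  qed
qed

theorem theorem3:
  fixes lam \<alpha> T K M T0 d :: real and E :: "real set"
  assumes d: "d = real CARD('d::finite)"
    and T: "T > 0" and K: "K > 1"
    and E: "E \<subseteq> {0<..1}"
    and T0: "is_minimal_period (free_flow :: real \<Rightarrow> 'd field \<Rightarrow> 'd field) T0"
  shows
    "(\<alpha> > max (d / 2 + 2) 4 \<longrightarrow>
       (\<exists>c>0. \<exists>R0. \<forall>(w0 :: 'd field) w.
          nls_family lam \<alpha> T K E w0 w \<and> sobolev_norm \<alpha> w0 = M \<longrightarrow>
          (\<forall>R\<ge>R0. ep_error_bound EP1_C EP1_A lam \<alpha> T T0 R E (\<alpha> - 4)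
             (\<lambda>\<epsilon> dk. c * dk ^ 2) w0 w)))
   \<and> (\<alpha> > max (d / 2 + 2) 6 \<longrightarrow>
       (\<exists>c>0. \<exists>R0. \<forall>(w0 :: 'd field) w.
          nls_family lam \<alpha> T K E w0 w \<and> sobolev_norm \<alpha> w0 = M \<longrightarrow>
          (\<forall>R\<ge>R0. ep_error_bound EP2_C EP2_A lam \<alpha> T T0 R E (\<alpha> - 6)
             (\<lambda>\<epsilon> dk. c * (\<epsilon> * dk ^ 2 + dk ^ 3)) w0 w \<and>
           ep_error_bound EP2_C EP2_A lam \<alpha> T T0 R (E \<inter> {1}) (\<alpha> - 4)
             (\<lambda>\<epsilon> dk. c * (\<epsilon> * dk ^ 2 + dk ^ 3)) w0 w)))
   \<and> (\<alpha> > max (d / 2 + 2) 8 \<longrightarrow>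
       (\<exists>c>0. \<exists>R0. \<forall>(w0 :: 'd field) w.
          nls_family lam \<alpha> T K E w0 w \<and> sobolev_norm \<alpha> w0 = M \<longrightarrow>
          (\<forall>R\<ge>R0. ep_error_bound EP3_C EP3_A lam \<alpha> T T0 R E (\<alpha> - 8)
             (\<lambda>\<epsilon> dk. c * (\<epsilon> * dk ^ 3 + dk ^ 4)) w0 w \<and>
           ep_error_bound EP3_C EP3_A lam \<alpha> T T0 R (E \<inter> {1}) (\<alpha> - 6)
             (\<lambda>\<epsilon> dk. c * (\<epsilon> * dk ^ 3 + dk ^ 4)) w0 w)))"
proof (intro conjI impI)
  have T0': "0 < T0" using T0 by (simp add: is_minimal_period_def)
  have E1: "E \<inter> {1} \<subseteq> {0<..1}" using E by auto
  have sub: "E \<inter> {1} \<subseteq> E" by auto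
  {
    assume "\<alpha> > max (d / 2 + 2) 4"
    then have \<alpha>: "\<alpha> - 2 > real CARD('d) / 2" "0 \<le> \<alpha> - 2 * real 2" by (auto simp: d)
    obtain cm0 where cm0: "\<And>cm. cm0 \<le> cm \<Longrightarrow> ep_method EP1_C EP1_A cm 1"
      unfolding EP1_nodes by (rule node_method_exists[of real 1]) auto
    obtain c R0 where c: "c > 0" and *: "\<And>(w0 :: 'd field) w E q bnd R. E \<subseteq> {0<..1} \<Longrightarrow> nls_family lam \<alpha> T K E w0 w \<Longrightarrow>
        sobolev_norm \<alpha> w0 = M \<Longrightarrow> 1 \<le> q \<Longrightarrow> q \<le> Suc 1 \<Longrightarrow> 0 \<le> \<alpha> - 2 * real q \<Longrightarrow> R0 \<le> R \<Longrightarrow>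
        (\<forall>\<epsilon>\<in>E. \<forall>dk>0. dk ^ q + \<epsilon> * dk ^ 2 \<le> 2 * bnd \<epsilon> dk) \<Longrightarrow>
        ep_error_bound EP1_C EP1_A lam \<alpha> T T0 R E (\<alpha> - 2 * real q) (\<lambda>\<epsilon> dk. c * bnd \<epsilon> dk) w0 w"
      using ep_method.convergence_order2[OF cm0[OF order_refl] order_refl \<alpha>(1) T T0'] by metis
    show "\<exists>c>0. \<exists>R0. \<forall>(w0 :: 'd field) w.
          nls_family lam \<alpha> T K E w0 w \<and> sobolev_norm \<alpha> w0 = M \<longrightarrow>
          (\<forall>R\<ge>R0. ep_error_bound EP1_C EP1_A lam \<alpha> T T0 R E (\<alpha> - 4) (\<lambda>\<epsilon> dk. c * dk ^ 2) w0 w)"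
    proof (rule exI[of _ c], rule conjI[OF c], rule exI[of _ R0], intro allI impI, elim conjE)
      fix w0 :: "'d field" and w R
      assume fam: "nls_family lam \<alpha> T K E w0 w" "sobolev_norm \<alpha> w0 = M" and R: "R0 \<le> R"
      \<comment> \<open>As \<epsilon> \<le> 1, the nonlinear term \<epsilon> dk^2 is absorbed by
        dk^2, the order reached with q = 2.\<close>
      have "\<forall>\<epsilon>\<in>E. \<forall>dk>0. dk ^ 2 + \<epsilon> * dk ^ 2 \<le> 2 * dk ^ 2" using E by (auto simp: mult_le_cancel_right1)
      from *[where bnd = "\<lambda>\<epsilon> dk. dk ^ 2", OF E fam _ _ \<alpha>(2) R this]
      show "ep_error_bound EP1_C EP1_A lam \<alpha> T T0 R E (\<alpha> - 4) (\<lambda>\<epsilon> dk. c * dk ^ 2) w0 w" by simp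
    qed
  }
  {
    assume "\<alpha> > max (d / 2 + 2) 6"
    then have \<alpha>: "\<alpha> - 2 > real CARD('d) / 2" "0 \<le> \<alpha> - 2 * real 3" "0 \<le> \<alpha> - 2 * real 2" by (auto simp: d)
    have "inj_on EP2_c {0..2}" "EP2_c 0 = 0" "EP2_c 2 = 1" by (auto simp: EP2_c_def inj_on_def)
    note nodes = this
    obtain cm0 where "\<And>cm. cm0 \<le> cm \<Longrightarrow> ep_method (node_C EP2_c 2) (node_A EP2_c 2) cm 2"
      by (rule node_method_exists[OF nodes], rule that)
    note cm0 = this[folded EP2_nodes]
    obtain c R0 where c: "c > 0" and *: "\<And>(w0 :: 'd field) w E q bnd R. E \<subseteq> {0<..1} \<Longrightarrow> nls_family lam \<alpha> T K E w0 w \<Longrightarrow>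
        sobolev_norm \<alpha> w0 = M \<Longrightarrow> 1 \<le> q \<Longrightarrow> q \<le> Suc 2 \<Longrightarrow> 0 \<le> \<alpha> - 2 * real q \<Longrightarrow> R0 \<le> R \<Longrightarrow>
        (\<forall>\<epsilon>\<in>E. \<forall>dk>0. dk ^ q + \<epsilon> * dk ^ 2 \<le> 2 * bnd \<epsilon> dk) \<Longrightarrow>
        ep_error_bound EP2_C EP2_A lam \<alpha> T T0 R E (\<alpha> - 2 * real q) (\<lambda>\<epsilon> dk. c * bnd \<epsilon> dk) w0 w"
      using ep_method.convergence_order2[OF cm0[OF order_refl] one_le_numeral \<alpha>(1) T T0'] by metis
    show "\<exists>c>0. \<exists>R0. \<forall>(w0 :: 'd field) w.
          nls_family lam \<alpha> T K E w0 w \<and> sobolev_norm \<alpha> w0 = M \<longrightarrow>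
          (\<forall>R\<ge>R0. ep_error_bound EP2_C EP2_A lam \<alpha> T T0 R E (\<alpha> - 6)
             (\<lambda>\<epsilon> dk. c * (\<epsilon> * dk ^ 2 + dk ^ 3)) w0 w \<and>
           ep_error_bound EP2_C EP2_A lam \<alpha> T T0 R (E \<inter> {1}) (\<alpha> - 4)
             (\<lambda>\<epsilon> dk. c * (\<epsilon> * dk ^ 2 + dk ^ 3)) w0 w)"
    proof (rule exI[of _ c], rule conjI[OF c], rule exI[of _ R0], intro allI impI, elim conjE)
      fix w0 :: "'d field" and w R
      assume fam: "nls_family lam \<alpha> T K E w0 w" "sobolev_norm \<alpha> w0 = M" and R: "R0 \<le> R"
      note fam1 = nls_family_subset[OF fam(1) sub] fam(2)
      let ?b = "\<lambda>\<epsilon> dk :: real. \<epsilon> * dk ^ 2 + dk ^ 3"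
      have 1: "\<forall>\<epsilon>\<in>E. \<forall>dk>0. dk ^ 3 + \<epsilon> * dk ^ 2 \<le> 2 * ?b \<epsilon> dk" using E by auto
      \<comment> \<open>For \<epsilon> = 1 the rate is dk^2 in any case, so the smaller loss q = 2
        suffices and the norm is stronger.\<close>
      have 2: "\<forall>\<epsilon>\<in>E \<inter> {1}. \<forall>dk>0. dk ^ 2 + \<epsilon> * dk ^ 2 \<le> 2 * ?b \<epsilon> dk" by auto
      show "ep_error_bound EP2_C EP2_A lam \<alpha> T T0 R E (\<alpha> - 6) (\<lambda>\<epsilon> dk. c * (\<epsilon> * dk ^ 2 + dk ^ 3)) w0 w \<and>
           ep_error_bound EP2_C EP2_A lam \<alpha> T T0 R (E \<inter> {1}) (\<alpha> - 4) (\<lambda>\<epsilon> dk. c * (\<epsilon> * dk ^ 2 + dk ^ 3)) w0 w"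
        using *[where bnd = ?b, OF E fam _ _ \<alpha>(2) R 1] *[where bnd = ?b, OF E1 fam1 _ _ \<alpha>(3) R 2] by simp
    qed
  }
  {
    assume "\<alpha> > max (d / 2 + 2) 8"
    then have \<alpha>: "\<alpha> - 2 > real CARD('d) / 2" "0 \<le> \<alpha> - 2 * real 4" "0 \<le> \<alpha> - 2 * real 3" "0 \<le> \<alpha> - 4" by (auto simp: d)
    obtain cm where cm: "ep_method3 EP3_C EP3_A cm 3 (node_P EP3_c 3)"
      unfolding EP3_nodes by (rule node_method3_exists[OF EP3_nodes_inj EP3_c_simps EP3_order])
    have r2: "2 \<le> (3::nat)" by simp
    obtain c R0 where c: "c > 0" and *: "\<And>(w0 :: 'd field) w E q bnd R. E \<subseteq> {0<..1} \<Longrightarrow> nls_family lam \<alpha> T K E w0 w \<Longrightarrow>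
        sobolev_norm \<alpha> w0 = M \<Longrightarrow> 2 \<le> q \<Longrightarrow> q \<le> Suc 3 \<Longrightarrow> 0 \<le> \<alpha> - 2 * real q \<Longrightarrow> R0 \<le> R \<Longrightarrow>
        (\<forall>\<epsilon>\<in>E. \<forall>dk>0. dk ^ q + \<epsilon> * dk ^ 3 \<le> 2 * bnd \<epsilon> dk) \<Longrightarrow>
        ep_error_bound EP3_C EP3_A lam \<alpha> T T0 R E (\<alpha> - 2 * real q) (\<lambda>\<epsilon> dk. c * bnd \<epsilon> dk) w0 w"
      using ep_method3.convergence_order3[OF cm r2 \<alpha>(1,4) T T0'] by metis
    show "\<exists>c>0. \<exists>R0. \<forall>(w0 :: 'd field) w.
          nls_family lam \<alpha> T K E w0 w \<and> sobolev_norm \<alpha> w0 = M \<longrightarrow>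
          (\<forall>R\<ge>R0. ep_error_bound EP3_C EP3_A lam \<alpha> T T0 R E (\<alpha> - 8)
             (\<lambda>\<epsilon> dk. c * (\<epsilon> * dk ^ 3 + dk ^ 4)) w0 w \<and>
           ep_error_bound EP3_C EP3_A lam \<alpha> T T0 R (E \<inter> {1}) (\<alpha> - 6)
             (\<lambda>\<epsilon> dk. c * (\<epsilon> * dk ^ 3 + dk ^ 4)) w0 w)"
    proof (rule exI[of _ c], rule conjI[OF c], rule exI[of _ R0], intro allI impI, elim conjE)
      fix w0 :: "'d field" and w R
      assume fam: "nls_family lam \<alpha> T K E w0 w" "sobolev_norm \<alpha> w0 = M" and R: "R0 \<le> R"
      note fam1 = nls_family_subset[OF fam(1) sub] fam(2)
      let ?b = "\<lambda>\<epsilon> dk :: real. \<epsilon> * dk ^ 3 + dk ^ 4"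
      have 1: "\<forall>\<epsilon>\<in>E. \<forall>dk>0. dk ^ 4 + \<epsilon> * dk ^ 3 \<le> 2 * ?b \<epsilon> dk" using E by auto
      \<comment> \<open>As for EP2: with \<epsilon> = 1 the rate dk^3 is already reached with q = 3,
        at the cost of six derivatives instead of eight.\<close>
      have 2: "\<forall>\<epsilon>\<in>E \<inter> {1}. \<forall>dk>0. dk ^ 3 + \<epsilon> * dk ^ 3 \<le> 2 * ?b \<epsilon> dk" by auto
      show "ep_error_bound EP3_C EP3_A lam \<alpha> T T0 R E (\<alpha> - 8) (\<lambda>\<epsilon> dk. c * (\<epsilon> * dk ^ 3 + dk ^ 4)) w0 w \<and>
           ep_error_bound EP3_C EP3_A lam \<alpha> T T0 R (E \<inter> {1}) (\<alpha> - 6) (\<lambda>\<epsilon> dk. c * (\<epsilon> * dk ^ 3 + dk ^ 4)) w0 w"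
        using *[where bnd = ?b, OF E fam _ _ \<alpha>(2) R 1] *[where bnd = ?b, OF E1 fam1 _ _ \<alpha>(3) R 2] by simp
    qed
  }
qed

end
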